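(* Let $(R,\mathfrak m)$ be a Noetherian local ring, or a standard graded $K$-algebra over a field $K$ with graded maximal ideal $\mathfrak m$, and let $I\subset \mathfrak m$ be an ideal, which is assumed to be a graded ideal in the case that $R$ is graded. Then for every $j\geq 1$ there exists an integer $c_j$ such that $\rho_j(I^k)=c_j$ for all $k\gg 0$. In particular, if $R$ is regular, then there exists an integer $c$ such that $\rho_j(I^k)\leq c$ for all $j\geq 1$ and all $k$.
   Context: A standard graded $K$-algebra is a commutative graded $K$-algebra $R=\bigoplus_{i\ge 0}R_i$ with $R_0=K$ that is generated over $K$ by finitely many elements of degree 1; its graded maximal ideal is $\mathfrak m=\bigoplus_{i\geq 1}R_i$. Artin--Rees number: for a finitely generated $R$-module $M$ and a submodule $N\subset M$ (in the graded case $M$ is graded and $N$ is a graded submodule), $\rho(N,M)$ denotes the smallest integer $r\ge 0$ such that $N\cap \mathfrak m^iM=\mathfrak m^{i-r}(N\cap \mathfrak m^rM)$ for all $i\geq r$ (such an $r$ exists by the Artin--Rees Lemma). For a finitely generated $R$-module $M$ (graded in the graded case), let $(\mathbb F,\varphi)$ be a minimal free $R$-resolution of $M$ (graded minimal in the graded case), with $\varphi_j: F_j\to F_{j-1}$. For $j\geq 1$ let $N_j=\operatorname{Im}(\varphi_j)\subset F_{j-1}$ be the $j$-th syzygy module and set $\rho_j(M):=\rho(N_j,F_{j-1})$. In the statement, $I^k$ is viewed as an $R$-module. *)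

theory Defs
  imports
    "HOL-Library.Extended_Nat"
    "Jordan_Normal_Form.Missing_VectorSpace"
    "HOL-Algebra.Ideal_Product"
    "HOL-Algebra.Ring_Divisibility"
    "HOL-Algebra.Subrings"
    "HOL-Algebra.Generated_Rings"
begin

section \<open>Ideals, modules and the Artin--Rees number\<close>

text \<open>The library turns the ideals of a ring into a monoid with unit \<open>carrier R\<close>, so that \<open>I\<^sup>0 = R\<close>.\<close>

definition ideal_power :: "('a, 'e) ring_scheme \<Rightarrow> 'a set \<Rightarrow> nat \<Rightarrow> 'a set"
  where "ideal_power R I k = I [^]\<^bsub>ideals_set R\<^esub> k"

text \<open>The \<open>mult\<close> and \<open>one\<close> fields of a module record are irrelevant.\<close>

definition ideal_module :: "('a, 'e) ring_scheme \<Rightarrow> 'a set \<Rightarrow> ('a, 'a) module"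
  where "ideal_module R J =
    \<lparr> carrier = J, monoid.mult = monoid.mult R, one = \<one>\<^bsub>R\<^esub>, ring.zero = \<zero>\<^bsub>R\<^esub>,
      add = add R, smult = monoid.mult R \<rparr>"

definition ideal_smult ::
    "('a, 'e) ring_scheme \<Rightarrow> ('a, 'b, 'f) module_scheme \<Rightarrow> 'a set \<Rightarrow> 'b set \<Rightarrow> 'b set"
  where "ideal_smult R M J N = module.span R M {a \<odot>\<^bsub>M\<^esub> x | a x. a \<in> J \<and> x \<in> N}"

definition artin_rees_number ::
    "('a, 'e) ring_scheme \<Rightarrow> 'a set \<Rightarrow> 'b set \<Rightarrow> ('a, 'b, 'f) module_scheme \<Rightarrow> nat"
  where "artin_rees_number R m N M =
    (LEAST r. \<forall>i\<ge>r.
       N \<inter> ideal_smult R M (ideal_power R m i) (carrier M) =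
       ideal_smult R M (ideal_power R m (i - r))
         (N \<inter> ideal_smult R M (ideal_power R m r) (carrier M)))"


section \<open>Local rings, dimension and regularity\<close>

locale noetherian_local_ring =
  cring R + noetherian_ring R + maximalideal m R for R (structure) and m +
  assumes maximal_unique: "maximalideal n R \<Longrightarrow> n = m"

definition krull_dim :: "('a, 'e) ring_scheme \<Rightarrow> enat"
  where "krull_dim R =
    Sup {enat n | n. \<exists>P :: nat \<Rightarrow> 'a set.
           (\<forall>i\<le>n. primeideal (P i) R) \<and> (\<forall>i<n. P i \<subset> P (Suc i))}"

locale regular_local_ring = noetherian_local_ring +
  assumes regular: "\<exists>X. X \<subseteq> carrier R \<and> finite X \<and> Idl X = m \<and> enat (card X) = krull_dim R"

text \<open>The fraction \<open>a/s\<close> as an equivalence class of pairs, and the ring of fractions of \<open>R\<close> with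
  respect to a multiplicatively closed set \<open>S\<close>. As usual for quotients, the operations take the
  union over all representatives, and the classes in that union coincide.\<close>

definition fraction :: "('a, 'e) ring_scheme \<Rightarrow> 'a set \<Rightarrow> 'a \<Rightarrow> 'a \<Rightarrow> ('a \<times> 'a) set"
  where "fraction R S a s =
    {(b, t). b \<in> carrier R \<and> t \<in> S \<and>
       (\<exists>u\<in>S. u \<otimes>\<^bsub>R\<^esub> (a \<otimes>\<^bsub>R\<^esub> t) = u \<otimes>\<^bsub>R\<^esub> (b \<otimes>\<^bsub>R\<^esub> s))}"

definition ring_of_fractions :: "('a, 'e) ring_scheme \<Rightarrow> 'a set \<Rightarrow> ('a \<times> 'a) set ring"
  where "ring_of_fractions R S =
    \<lparr> carrier = {fraction R S a s | a s. a \<in> carrier R \<and> s \<in> S},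
      monoid.mult = (\<lambda>X Y. \<Union>(a, s)\<in>X. \<Union>(b, t)\<in>Y. fraction R S (a \<otimes>\<^bsub>R\<^esub> b) (s \<otimes>\<^bsub>R\<^esub> t)),
      one = fraction R S \<one>\<^bsub>R\<^esub> \<one>\<^bsub>R\<^esub>,
      ring.zero = fraction R S \<zero>\<^bsub>R\<^esub> \<one>\<^bsub>R\<^esub>,
      add = (\<lambda>X Y. \<Union>(a, s)\<in>X. \<Union>(b, t)\<in>Y.
              fraction R S (a \<otimes>\<^bsub>R\<^esub> t \<oplus>\<^bsub>R\<^esub> b \<otimes>\<^bsub>R\<^esub> s) (s \<otimes>\<^bsub>R\<^esub> t)) \<rparr>"

locale regular_ring = cring R + noetherian_ring R for R (structure) +
  assumes localizations_regular:
    "primeideal p R \<Longrightarrow> \<exists>n. regular_local_ring (ring_of_fractions R (carrier R - p)) n"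


section \<open>Graded rings and modules\<close>

definition direct_sum_decomposition :: "('a, 'e) ring_scheme \<Rightarrow> ('i \<Rightarrow> 'a set) \<Rightarrow> bool"
  where "direct_sum_decomposition M G \<longleftrightarrow>
    (\<forall>i. additive_subgroup (G i) M) \<and>
    (\<forall>x\<in>carrier M. \<exists>!f. (\<forall>i. f i \<in> G i) \<and> finite {i. f i \<noteq> \<zero>\<^bsub>M\<^esub>} \<and>
                        x = finsum M f {i. f i \<noteq> \<zero>\<^bsub>M\<^esub>})"

text \<open>\<open>A i\<close> is the homogeneous component \<open>R\<^sub>i\<close>; the ground field is identified with \<open>R\<^sub>0\<close>.\<close>

locale standard_graded_algebra = cring R
  for R :: "('a, 'e) ring_scheme" (structure) and K :: "'a set" and A :: "nat \<Rightarrow> 'a set" +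
  assumes ground_field: "subfield K R"
    and degree_zero: "A 0 = K"
    and decomposition: "direct_sum_decomposition R A"
    and mult_graded: "\<lbrakk>a \<in> A i; b \<in> A j\<rbrakk> \<Longrightarrow> a \<otimes> b \<in> A (i + j)"
    and generated_in_degree_one: "\<exists>X. finite X \<and> X \<subseteq> A 1 \<and> generate_ring R (K \<union> X) = carrier R"

definition graded_maximal_ideal :: "('a, 'e) ring_scheme \<Rightarrow> (nat \<Rightarrow> 'a set) \<Rightarrow> 'a set"
  where "graded_maximal_ideal R A =
    {finsum R f D | f D. finite D \<and> D \<subseteq> {1..} \<and> (\<forall>i\<in>D. f i \<in> A i)}"

definition graded_ideal :: "('a, 'e) ring_scheme \<Rightarrow> (nat \<Rightarrow> 'a set) \<Rightarrow> 'a set \<Rightarrow> bool"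
  where "graded_ideal R A I \<longleftrightarrow>
    ideal I R \<and> direct_sum_decomposition (R\<lparr>carrier := I\<rparr>) (\<lambda>i. I \<inter> A i)"

definition graded_module ::
    "('a, 'e) ring_scheme \<Rightarrow> (nat \<Rightarrow> 'a set) \<Rightarrow> ('a, 'b, 'f) module_scheme \<Rightarrow> (int \<Rightarrow> 'b set) \<Rightarrow> bool"
  where "graded_module R A M G \<longleftrightarrow>
    module R M \<and> direct_sum_decomposition M G \<and>
    (\<forall>i d. \<forall>a\<in>A i. \<forall>x\<in>G d. a \<odot>\<^bsub>M\<^esub> x \<in> G (int i + d))"

definition ideal_grading ::
    "('a, 'e) ring_scheme \<Rightarrow> (nat \<Rightarrow> 'a set) \<Rightarrow> 'a set \<Rightarrow> int \<Rightarrow> 'a set"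
  where "ideal_grading R A J d = (if d < 0 then {\<zero>\<^bsub>R\<^esub>} else J \<inter> A (nat d))"


section \<open>Minimal free resolutions\<close>

definition module_basis ::
    "('a, 'e) ring_scheme \<Rightarrow> ('a, 'b, 'f) module_scheme \<Rightarrow> 'b set \<Rightarrow> bool"
  where "module_basis R M B \<longleftrightarrow>
    B \<subseteq> carrier M \<and> module.span R M B = carrier M \<and> \<not> module.lin_dep R M B"

text \<open>A resolution consists of \<open>\<phi> j : F j \<rightarrow> F (j - 1)\<close> for \<open>j \<ge> 1\<close> and the augmentation
  \<open>\<epsilon> : F 0 \<rightarrow> M\<close>; the value \<open>\<phi> 0\<close> is not used.\<close>

definition free_resolution ::
    "('a, 'e) ring_scheme \<Rightarrow> ('a, 'c) module \<Rightarrow>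
      (nat \<Rightarrow> ('a, 'b) module) \<Rightarrow> (nat \<Rightarrow> 'b \<Rightarrow> 'b) \<Rightarrow> ('b \<Rightarrow> 'c) \<Rightarrow> bool"
  where "free_resolution R M F \<phi> \<epsilon> \<longleftrightarrow>
    (\<forall>j. module R (F j) \<and> (\<exists>B. finite B \<and> module_basis R (F j) B)) \<and>
    mod_hom R (F 0) M \<epsilon> \<and>
    (\<forall>j\<ge>1. mod_hom R (F j) (F (j - 1)) (\<phi> j)) \<and>
    \<epsilon> ` carrier (F 0) = carrier M \<and>
    \<phi> 1 ` carrier (F 1) = a_kernel (F 0) M \<epsilon> \<and>
    (\<forall>j\<ge>1. \<phi> (j + 1) ` carrier (F (j + 1)) = a_kernel (F j) (F (j - 1)) (\<phi> j))"

definition minimal_free_resolution ::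
    "('a, 'e) ring_scheme \<Rightarrow> 'a set \<Rightarrow> ('a, 'c) module \<Rightarrow>
      (nat \<Rightarrow> ('a, 'b) module) \<Rightarrow> (nat \<Rightarrow> 'b \<Rightarrow> 'b) \<Rightarrow> ('b \<Rightarrow> 'c) \<Rightarrow> bool"
  where "minimal_free_resolution R m M F \<phi> \<epsilon> \<longleftrightarrow>
    free_resolution R M F \<phi> \<epsilon> \<and>
    (\<forall>j\<ge>1. \<phi> j ` carrier (F j) \<subseteq> ideal_smult R (F (j - 1)) m (carrier (F (j - 1))))"

text \<open>\<open>MG d\<close> and \<open>G j d\<close> are the components of degree \<open>d\<close> of \<open>M\<close> and \<open>F j\<close>. Each \<open>F j\<close> has a
  homogeneous basis, that is, it is a direct sum of shifted copies of \<open>R\<close>, and the maps have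
  degree \<open>0\<close>.\<close>

definition graded_minimal_free_resolution ::
    "('a, 'e) ring_scheme \<Rightarrow> (nat \<Rightarrow> 'a set) \<Rightarrow> ('a, 'c) module \<Rightarrow> (int \<Rightarrow> 'c set) \<Rightarrow>
      (nat \<Rightarrow> ('a, 'b) module) \<Rightarrow> (nat \<Rightarrow> int \<Rightarrow> 'b set) \<Rightarrow> (nat \<Rightarrow> 'b \<Rightarrow> 'b) \<Rightarrow> ('b \<Rightarrow> 'c) \<Rightarrow> bool"
  where "graded_minimal_free_resolution R A M MG F G \<phi> \<epsilon> \<longleftrightarrow>
    minimal_free_resolution R (graded_maximal_ideal R A) M F \<phi> \<epsilon> \<and>
    (\<forall>j. graded_module R A (F j) (G j) \<and>
         (\<exists>B. finite B \<and> B \<subseteq> (\<Union>d. G j d) \<and> module_basis R (F j) B)) \<and>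
    (\<forall>d. \<epsilon> ` G 0 d \<subseteq> MG d) \<and>
    (\<forall>j\<ge>1. \<forall>d. \<phi> j ` G j d \<subseteq> G (j - 1) d)"

text \<open>\<open>\<rho>\<^sub>j(M)\<close>, computed from a given minimal free resolution \<open>(F, \<phi>)\<close> of \<open>M\<close>, for \<open>j \<ge> 1\<close>. Minimal
  free resolutions are unique up to isomorphism, so statements about \<open>\<rho>\<^sub>j(M)\<close> are made for every
  minimal free resolution of \<open>M\<close>.\<close>

definition syzygy_artin_rees_number ::
    "('a, 'e) ring_scheme \<Rightarrow> 'a set \<Rightarrow>
      (nat \<Rightarrow> ('a, 'b) module) \<Rightarrow> (nat \<Rightarrow> 'b \<Rightarrow> 'b) \<Rightarrow> nat \<Rightarrow> nat"
  where "syzygy_artin_rees_number R m F \<phi> j =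
    artin_rees_number R m (\<phi> j ` carrier (F j)) (F (j - 1))"

end

theory Submission
  imports Defs "HOL-Library.Product_Plus" "HOL-Library.Multiset"
begin

text \<open>The modules \<open>I\<^sup>k\<close> are the homogeneous components of the Rees algebra of \<open>I\<close>, which is finitely
  generated over \<open>T = R[X\<^sub>0, \<dots>, X\<^sub>n\<^sub>-\<^sub>1]\<close>. The components of a graded free resolution of it over \<open>T\<close> are free
  resolutions over \<open>R\<close> of all \<open>I\<^sup>k\<close> at once, in general not minimal. If \<open>N\<^sub>k \<subseteq> F\<^sub>k\<close> are the components of
  one of its syzygy modules, then \<open>W(i, k) = N\<^sub>k \<inter> m\<^sup>i F\<^sub>k\<close> is a bigraded module, finitely generated over the Rees
  algebra of \<open>m\<close> with coefficients in \<open>T\<close>. Hence there is \<open>r\<close> with \<open>W(i + 1, k) = m W(i, k)\<close> for all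
  \<open>i \<ge> r\<close> and all \<open>k\<close>, and \<open>W(i, k + 1) = X W(i, k)\<close> for large \<open>k\<close>. So the sets of defects
  \<open>{i. W(i + 1, k) \<noteq> m W(i, k)}\<close> are contained in \<open>{0, \<dots>, r - 1}\<close> and decrease for large \<open>k\<close>; they are
  eventually constant, and they determine the Artin--Rees numbers. Two free resolutions of the same module
  are homotopy equivalent and therefore have the same defects, so minimality is irrelevant here.

  In the regular case it suffices that minimal resolutions have length at most \<open>d = dim R\<close>. Up to
  denominators, \<open>m\<close> is generated by \<open>x\<^sub>0, \<dots>, x\<^sub>d\<^sub>-\<^sub>1\<close>. A chain of \<open>d + 1\<close> primes makes the length of
  \<open>R / m\<^sup>s\<^sup>N\<close> at least \<open>N choose d\<close>, whereas a zero divisor \<open>x\<^sub>t\<close> modulo \<open>(x\<^sub>0, \<dots>, x\<^sub>t\<^sub>-\<^sub>1)\<close> yields a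
  relation between monomials, in fact for a weighted order a leading monomial all of whose multiples are
  redundant, so that the length would be \<open>O(N\<^sup>d\<^sup>-\<^sup>1)\<close>. Hence the \<open>x\<^sub>i\<close> form a regular sequence locally at \<open>m\<close>,
  \<open>Tor\<^sub>j(R / m, -)\<close> vanishes for \<open>j > d\<close>, and \<open>F\<^sub>j = 0\<close> for \<open>j > d\<close> in a minimal resolution.\<close>

section \<open>Hilbert's basis theorem for graded families\<close>

context abelian_group
begin

text \<open>For a single \<open>k\<close> the Artin--Rees lemma bounds the defects, but it compares
  nothing between different \<open>k\<close>. Every chain condition is therefore stated for whole
  families, with one stabilisation index valid in all degrees at once. The defects are kept as sets
  because the homotopy argument works for one exponent \<open>i\<close> at a time, and because a
  decreasing sequence of finite sets must stop. In the regular case the dimension enters twice, as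
  the number of generators and as the length of a chain of primes, and the two resulting growth
  rates of \<open>R / m^n\<close> collide. To count lengths by monomials, each weight must belong to
  at most one monomial of size below \<open>N\<close>; base \<open>N\<close> digits achieve this.
  The variables \<open>x i\<close> with \<open>i < t\<close> have to be heavier than every possible
  leading monomial, so that elements of \<open>I t\<close> contribute only terms of larger weight.
  The count takes place modulo \<open>m^N\<close>: the \<open>x i\<close> generate \<open>m\<close>
  up to multipliers outside \<open>m\<close>, and modulo a power of \<open>m\<close> such
  multipliers are invertible.\<close>

definition add_sub :: "'a set \<Rightarrow> bool"
  where "add_sub H \<longleftrightarrow> H \<subseteq> carrier G \<and> \<zero> \<in> H \<and> (\<forall>x\<in>H. \<forall>y\<in>H. x \<ominus> y \<in> H)"

definition endo :: "('a \<Rightarrow> 'a) \<Rightarrow> bool"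
  where "endo f \<longleftrightarrow> f \<in> carrier G \<rightarrow> carrier G \<and>
    (\<forall>x\<in>carrier G. \<forall>y\<in>carrier G. f (x \<oplus> y) = f x \<oplus> f y)"

text \<open>\<open>\<Omega>\<close> consists of endomorphisms \<open>f\<close> tagged with a degree \<open>\<delta>\<close>. With the scalars in degree \<open>0\<close> and the
  variables in their degrees, a family is a graded submodule over a polynomial ring whose components are
  all subgroups of the same group.\<close>

definition family :: "('g::cancel_comm_monoid_add \<times> ('a \<Rightarrow> 'a)) set \<Rightarrow> ('g \<Rightarrow> 'a set) \<Rightarrow> bool"
  where "family \<Omega> N \<longleftrightarrow> (\<forall>g. add_sub (N g)) \<and>
    (\<forall>\<delta> f g x. (\<delta>, f) \<in> \<Omega> \<longrightarrow> x \<in> N g \<longrightarrow> f x \<in> N (g + \<delta>))"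

text \<open>The ascending chain condition for subfamilies of \<open>M\<close>. Stabilisation is an
  equality of functions, so a single index serves all degrees; all later uniformity in
  \<open>i\<close> and \<open>k\<close> comes from this.\<close>

definition noeth :: "('g::cancel_comm_monoid_add \<times> ('a \<Rightarrow> 'a)) set \<Rightarrow> ('g \<Rightarrow> 'a set) \<Rightarrow> bool"
  where "noeth \<Omega> M \<longleftrightarrow> (\<forall>N::nat \<Rightarrow> 'g \<Rightarrow> 'a set.
    (\<forall>p. family \<Omega> (N p) \<and> N p \<le> M \<and> N p \<le> N (Suc p)) \<longrightarrow> (\<exists>p0. \<forall>p\<ge>p0. N p = N p0))"

lemma add_subD:
  assumes "add_sub H"
  shows "x \<in> H \<Longrightarrow> x \<in> carrier G" "\<zero> \<in> H" "x \<in> H \<Longrightarrow> y \<in> H \<Longrightarrow> x \<ominus> y \<in> H"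
    "x \<in> H \<Longrightarrow> \<ominus> x \<in> H" "x \<in> H \<Longrightarrow> y \<in> H \<Longrightarrow> x \<oplus> y \<in> H"
proof -
  show 1: "x \<in> H \<Longrightarrow> x \<in> carrier G" "\<zero> \<in> H" "x \<in> H \<Longrightarrow> y \<in> H \<Longrightarrow> x \<ominus> y \<in> H" for x y
    using assms by (auto simp: add_sub_def)
  show 2: "x \<in> H \<Longrightarrow> \<ominus> x \<in> H" for x
    using 1(3)[OF 1(2), of x] 1(1)[of x] by (simp add: a_minus_def)
  show "x \<in> H \<Longrightarrow> y \<in> H \<Longrightarrow> x \<oplus> y \<in> H"
    using 1(3)[of x "\<ominus> y"] 2[of y] 1(1)[of x] 1(1)[of y] by (simp add: a_minus_def)
qed

lemma add_subI:
  assumes "H \<subseteq> carrier G" "\<zero> \<in> H" "\<And>x y. x \<in> H \<Longrightarrow> y \<in> H \<Longrightarrow> x \<oplus> y \<in> H"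
    "\<And>x. x \<in> H \<Longrightarrow> \<ominus> x \<in> H"
  shows "add_sub H"
  using assms by (auto simp: add_sub_def a_minus_def)

lemma add_sub_Int: "add_sub H \<Longrightarrow> add_sub K \<Longrightarrow> add_sub (H \<inter> K)"
  by (auto simp: add_sub_def)

lemma endoD:
  assumes "endo f"
  shows "x \<in> carrier G \<Longrightarrow> f x \<in> carrier G"
    "x \<in> carrier G \<Longrightarrow> y \<in> carrier G \<Longrightarrow> f (x \<oplus> y) = f x \<oplus> f y"
    "f \<zero> = \<zero>" "x \<in> carrier G \<Longrightarrow> f (\<ominus> x) = \<ominus> f x"
    "x \<in> carrier G \<Longrightarrow> y \<in> carrier G \<Longrightarrow> f (x \<ominus> y) = f x \<ominus> f y"
proof -
  show c: "x \<in> carrier G \<Longrightarrow> f x \<in> carrier G" for x using assms by (auto simp: endo_def)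
  show a: "x \<in> carrier G \<Longrightarrow> y \<in> carrier G \<Longrightarrow> f (x \<oplus> y) = f x \<oplus> f y" for x y
    using assms by (auto simp: endo_def)
  show z: "f \<zero> = \<zero>" using a[of \<zero> \<zero>] c[of \<zero>] by (simp add: add.l_cancel_one')
  show n: "x \<in> carrier G \<Longrightarrow> f (\<ominus> x) = \<ominus> f x" for x
    using a[of "\<ominus> x" x] z c[of x] c[of "\<ominus> x"] by (simp add: l_neg minus_equality)
  show "x \<in> carrier G \<Longrightarrow> y \<in> carrier G \<Longrightarrow> f (x \<ominus> y) = f x \<ominus> f y"
    using a[of x "\<ominus> y"] n[of y] by (simp add: a_minus_def)
qed

lemma familyD:
  assumes "family \<Omega> N"
  shows "add_sub (N g)" "(\<delta>, f) \<in> \<Omega> \<Longrightarrow> x \<in> N g \<Longrightarrow> f x \<in> N (g + \<delta>)"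
  using assms by (auto simp: family_def)

lemma chain_mono:
  fixes N :: "nat \<Rightarrow> 'g \<Rightarrow> 'c set"
  assumes "\<And>p. N p \<le> N (Suc p)" "p \<le> q"
  shows "N p \<le> N q"
  using lift_Suc_mono_le[of N] assms by blast

text \<open>The coefficients allowed at \<open>X ^^ l\<close> in total degree \<open>g\<close>, that
  is \<open>M (g - l * \<xi>)\<close>. The degrees form only a cancellative monoid, so the
  difference is replaced by a union over all \<open>h\<close> with \<open>h + l * \<xi> = g\<close>;
  cancellation leaves at most one such \<open>h\<close>, and without one only \<open>\<zero>\<close>
  remains. The sum over \<open>i < l\<close> stands for the multiple
  \<open>l * \<xi>\<close>.\<close>

definition base :: "('g::cancel_comm_monoid_add \<Rightarrow> 'a set) \<Rightarrow> 'g \<Rightarrow> nat \<Rightarrow> 'g \<Rightarrow> 'a set"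
  where "base M \<xi> l g = {\<zero>} \<union> (\<Union>h\<in>{h. h + (\<Sum>i<l. \<xi>) = g}. M h)"

text \<open>The values of the polynomials in \<open>X\<close> of degree less than \<open>l\<close> with coefficients in \<open>M\<close>, of total degree \<open>g\<close>.\<close>

primrec lev :: "('g::cancel_comm_monoid_add \<Rightarrow> 'a set) \<Rightarrow> 'g \<Rightarrow> ('a \<Rightarrow> 'a) \<Rightarrow> nat \<Rightarrow> 'g \<Rightarrow> 'a set" where
  "lev M \<xi> X 0 g = {\<zero>}"
| "lev M \<xi> X (Suc l) g = {u \<oplus> (X ^^ l) a | u a. u \<in> lev M \<xi> X l g \<and> a \<in> base M \<xi> l g}"

definition extend :: "('g::cancel_comm_monoid_add \<Rightarrow> 'a set) \<Rightarrow> 'g \<Rightarrow> ('a \<Rightarrow> 'a) \<Rightarrow> 'g \<Rightarrow> 'a set"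
  where "extend M \<xi> X g = (\<Union>l. lev M \<xi> X l g)"

text \<open>The leading coefficients of Hilbert's proof. Elements are values and not formal
  polynomials, so one element can have several expressions; every coefficient \<open>a\<close> that
  occurs at \<open>X ^^ l\<close> in some expression counts.\<close>

definition lead :: "('g::cancel_comm_monoid_add \<Rightarrow> 'a set) \<Rightarrow> 'g \<Rightarrow> ('a \<Rightarrow> 'a) \<Rightarrow> ('g \<Rightarrow> 'a set) \<Rightarrow> nat \<Rightarrow> 'g \<Rightarrow> 'a set"
  where "lead M \<xi> X N l h = {a \<in> M h. \<exists>u\<in>lev M \<xi> X l (h + (\<Sum>i<l. \<xi>)). u \<oplus> (X ^^ l) a \<in> N (h + (\<Sum>i<l. \<xi>))}"

lemma endo_funpow: "endo f \<Longrightarrow> endo (f ^^ l)"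
  by (induction l) (auto simp: endo_def Pi_def)

end

locale hilbert_step = abelian_group G for G (structure) +
  fixes \<Omega> :: "('g::cancel_comm_monoid_add \<times> ('a \<Rightarrow> 'a)) set" and M :: "'g \<Rightarrow> 'a set"
    and \<xi> :: 'g and X :: "'a \<Rightarrow> 'a"
  assumes M: "family \<Omega> M" and X: "endo X" and endo: "\<And>\<delta> f. (\<delta>, f) \<in> \<Omega> \<Longrightarrow> endo f"
    and comm: "\<And>\<delta> f x. (\<delta>, f) \<in> \<Omega> \<Longrightarrow> x \<in> carrier G \<Longrightarrow> f (X x) = X (f x)"
begin

abbreviation "L l g \<equiv> lev M \<xi> X l g"

lemma Mc: "a \<in> M h \<Longrightarrow> a \<in> carrier G"
  using add_subD(1)[OF familyD(1)[OF M]] .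

lemma Xl: "endo (X ^^ l)"
  by (rule endo_funpow[OF X])

lemma Xlc: "x \<in> carrier G \<Longrightarrow> (X ^^ l) x \<in> carrier G"
  by (rule endoD(1)[OF Xl])

lemma comm_funpow:
  assumes "(\<delta>, f) \<in> \<Omega>" "x \<in> carrier G"
  shows "f ((X ^^ l) x) = (X ^^ l) (f x)"
proof (induction l)
  case (Suc l)
  thus ?case using comm[OF assms(1), of "(X ^^ l) x"] endoD(1)[OF Xl assms(2)] by simp
qed simp

lemma base_add_sub: "add_sub (base M \<xi> l g)"
proof (cases "\<exists>h. h + (\<Sum>i<l. \<xi>) = g")
  case True
  then obtain h where h: "h + (\<Sum>i<l. \<xi>) = g" by blast
  hence "{h. h + (\<Sum>i<l. \<xi>) = g} = {h}" by (auto dest: add_right_imp_eq)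
  hence "base M \<xi> l g = M h"
    using add_subD(2)[OF familyD(1)[OF M, of h]] by (auto simp: base_def)
  thus ?thesis using familyD(1)[OF M] by simp
next
  case False
  hence "base M \<xi> l g = {\<zero>}" by (auto simp: base_def)
  thus ?thesis by (simp add: add_sub_def a_minus_def)
qed

lemma base_eq: "base M \<xi> l (h + (\<Sum>i<l. \<xi>)) = M h"
  using add_subD(2)[OF familyD(1)[OF M, of h]] by (auto simp: base_def)

lemma baseE:
  assumes "a \<in> base M \<xi> l g"
  obtains "a = \<zero>" | h where "a \<in> M h" "g = h + (\<Sum>i<l. \<xi>)"
  using assms by (auto simp: base_def)

lemma base_carrier: "a \<in> base M \<xi> l g \<Longrightarrow> a \<in> carrier G"
  using add_subD(1)[OF base_add_sub] .

lemma lev_SucI: "u \<in> L l g \<Longrightarrow> a \<in> base M \<xi> l g \<Longrightarrow> x = u \<oplus> (X ^^ l) a \<Longrightarrow> x \<in> L (Suc l) g"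
  by auto

lemma lev_add_sub: "add_sub (L l g)"
proof (induction l)
  case 0
  show ?case by (simp add: add_sub_def a_minus_def)
next
  case (Suc l)
  note IH = add_subD[OF Suc]
  note B = add_subD[OF base_add_sub[of l g]]
  show ?case
  proof (rule add_subI)
    show "L (Suc l) g \<subseteq> carrier G" using IH(1) B(1) Xlc by auto
  next
    have "\<zero> = \<zero> \<oplus> (X ^^ l) \<zero>" using endoD(3)[OF Xl] by simp
    thus "\<zero> \<in> L (Suc l) g" by (rule lev_SucI[OF IH(2) B(2)])
  next
    fix x y assume "x \<in> L (Suc l) g" "y \<in> L (Suc l) g"
    then obtain u a v b where 1: "x = u \<oplus> (X ^^ l) a" "u \<in> L l g" "a \<in> base M \<xi> l g"
      "y = v \<oplus> (X ^^ l) b" "v \<in> L l g" "b \<in> base M \<xi> l g" by auto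
    have "x \<oplus> y = (u \<oplus> v) \<oplus> (X ^^ l) (a \<oplus> b)"
      using 1 IH(1) B(1) Xlc endoD(2)[OF Xl] by (simp add: a_ac)
    thus "x \<oplus> y \<in> L (Suc l) g" using lev_SucI[OF IH(5) B(5)] 1 by blast
  next
    fix x assume "x \<in> L (Suc l) g"
    then obtain u a where 1: "x = u \<oplus> (X ^^ l) a" "u \<in> L l g" "a \<in> base M \<xi> l g" by auto
    have "\<ominus> x = \<ominus> u \<oplus> (X ^^ l) (\<ominus> a)"
      using 1 IH(1) B(1) Xlc endoD(4)[OF Xl] by (simp add: minus_add)
    thus "\<ominus> x \<in> L (Suc l) g" using lev_SucI[OF IH(4) B(4)] 1 by blast
  qed
qed

lemma lev_carrier: "x \<in> L l g \<Longrightarrow> x \<in> carrier G"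
  by (rule add_subD(1)[OF lev_add_sub])

lemma lev_Suc: "L l g \<subseteq> L (Suc l) g"
proof
  fix x assume x: "x \<in> L l g"
  hence "x = x \<oplus> (X ^^ l) \<zero>" using lev_carrier endoD(3)[OF Xl] by simp
  thus "x \<in> L (Suc l) g" using lev_SucI[OF x add_subD(2)[OF base_add_sub]] by blast
qed

lemma lev_mono: "l \<le> k \<Longrightarrow> L l g \<subseteq> L k g"
  using lift_Suc_mono_le[of "\<lambda>l. L l g"] lev_Suc by blast

lemma lev_X: "x \<in> L l g \<Longrightarrow> X x \<in> L (Suc l) (g + \<xi>)"
proof (induction l arbitrary: x)
  case 0
  thus ?case using endoD(3)[OF X] lev_mono[of 0 "Suc 0" "g + \<xi>"] by auto
next
  case (Suc l)
  then obtain u a where 1: "x = u \<oplus> (X ^^ l) a" "u \<in> L l g" "a \<in> base M \<xi> l g" by auto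
  have "a \<in> base M \<xi> (Suc l) (g + \<xi>)"
    using 1(3) by (cases rule: baseE) (auto simp: base_def add_ac)
  moreover have "X x = X u \<oplus> (X ^^ Suc l) a"
    using 1 endoD(2)[OF X lev_carrier[OF 1(2)] Xlc[OF base_carrier[OF 1(3)]]] by simp
  ultimately show ?case using lev_SucI[OF Suc.IH[OF 1(2)]] by blast
qed

lemma base_op:
  assumes "(\<delta>, f) \<in> \<Omega>" "a \<in> base M \<xi> l g"
  shows "f a \<in> base M \<xi> l (g + \<delta>)"
  using assms(2)
proof (cases rule: baseE)
  case 1
  thus ?thesis using endoD(3)[OF endo[OF assms(1)]] by (simp add: base_def)
next
  case (2 h)
  hence "f a \<in> M (h + \<delta>)" using familyD(2)[OF M assms(1)] by simp
  moreover have "(h + \<delta>) + (\<Sum>i<l. \<xi>) = g + \<delta>" using 2 by (simp add: add_ac)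
  ultimately show ?thesis by (auto simp: base_def)
qed

lemma lev_op:
  assumes "(\<delta>, f) \<in> \<Omega>"
  shows "x \<in> L l g \<Longrightarrow> f x \<in> L l (g + \<delta>)"
proof (induction l arbitrary: x)
  case 0
  thus ?case using endoD(3)[OF endo[OF assms]] by simp
next
  case (Suc l)
  then obtain u a where 1: "x = u \<oplus> (X ^^ l) a" "u \<in> L l g" "a \<in> base M \<xi> l g" by auto
  have "f x = f u \<oplus> (X ^^ l) (f a)"
    using 1 endoD(2)[OF endo[OF assms]] lev_carrier Xlc base_carrier comm_funpow[OF assms] by simp
  thus ?case by (rule lev_SucI[OF Suc.IH[OF 1(2)] base_op[OF assms 1(3)]])
qed

lemma extend_family: "family (insert (\<xi>, X) \<Omega>) (extend M \<xi> X)"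
  unfolding family_def
proof (intro conjI allI impI)
  fix g
  show "add_sub (extend M \<xi> X g)"
    unfolding extend_def add_sub_def
  proof (intro conjI ballI)
    show "(\<Union>l. L l g) \<subseteq> carrier G" using lev_carrier by blast
    show "\<zero> \<in> (\<Union>l. L l g)" using add_subD(2)[OF lev_add_sub] by blast
    fix x y assume "x \<in> (\<Union>l. L l g)" "y \<in> (\<Union>l. L l g)"
    then obtain l k where "x \<in> L l g" "y \<in> L k g" by blast
    hence "x \<in> L (max l k) g" "y \<in> L (max l k) g"
      using lev_mono[of l "max l k" g] lev_mono[of k "max l k" g] by auto
    thus "x \<ominus> y \<in> (\<Union>l. L l g)" using add_subD(3)[OF lev_add_sub] by blast
  qed
next
  fix \<delta> f g x assume f: "(\<delta>, f) \<in> insert (\<xi>, X) \<Omega>" and "x \<in> extend M \<xi> X g"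
  then obtain l where l: "x \<in> L l g" by (auto simp: extend_def)
  have "f x \<in> L (Suc l) (g + \<delta>)"
  proof (cases "(\<delta>, f) = (\<xi>, X)")
    case True
    thus ?thesis using lev_X[OF l] by simp
  next
    case False
    hence "(\<delta>, f) \<in> \<Omega>" using f by auto
    from lev_op[OF this l] show ?thesis using lev_Suc[of l "g + \<delta>"] by blast
  qed
  thus "f x \<in> extend M \<xi> X (g + \<delta>)" unfolding extend_def by (rule UN_I[OF UNIV_I])
qed

lemma extend_ge: "M \<le> extend M \<xi> X"
proof (rule le_funI, rule subsetI)
  fix g x assume "x \<in> M g"
  moreover from this have "x = \<zero> \<oplus> (X ^^ 0) x" using Mc by simp
  moreover have "base M \<xi> 0 g = M g" using base_eq[of 0 g] by simp
  ultimately have "x \<in> L (Suc 0) g" by (intro lev_SucI[of \<zero> 0 g x]) simp_all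
  thus "x \<in> extend M \<xi> X g" unfolding extend_def by blast
qed

abbreviation "\<Lambda> N l h \<equiv> lead M \<xi> X N l h"

lemma lead_family:
  assumes N: "family \<Omega> N"
  shows "family \<Omega> (\<Lambda> N l)"
  unfolding family_def
proof (intro conjI allI impI)
  fix h
  note M' = add_subD[OF familyD(1)[OF M, of h]]
  note N' = add_subD[OF familyD(1)[OF N, of "h + (\<Sum>i<l. \<xi>)"]]
  note L' = add_subD[OF lev_add_sub[of l "h + (\<Sum>i<l. \<xi>)"]]
  show "add_sub (\<Lambda> N l h)"
  proof (rule add_subI)
    show "\<Lambda> N l h \<subseteq> carrier G" using M'(1) by (auto simp: lead_def)
    have "\<zero> \<oplus> (X ^^ l) \<zero> = \<zero>" using endoD(3)[OF Xl] by simp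
    thus "\<zero> \<in> \<Lambda> N l h" using M'(2) L'(2) N'(2) unfolding lead_def by force
  next
    fix a b assume "a \<in> \<Lambda> N l h" "b \<in> \<Lambda> N l h"
    then obtain u v where 1: "a \<in> M h" "u \<in> L l (h + (\<Sum>i<l. \<xi>))" "u \<oplus> (X ^^ l) a \<in> N (h + (\<Sum>i<l. \<xi>))"
      "b \<in> M h" "v \<in> L l (h + (\<Sum>i<l. \<xi>))" "v \<oplus> (X ^^ l) b \<in> N (h + (\<Sum>i<l. \<xi>))"
      by (auto simp: lead_def)
    have "(u \<oplus> v) \<oplus> (X ^^ l) (a \<oplus> b) = (u \<oplus> (X ^^ l) a) \<oplus> (v \<oplus> (X ^^ l) b)"
      using 1 L'(1) Mc Xlc endoD(2)[OF Xl] by (simp add: a_ac)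
    hence "(u \<oplus> v) \<oplus> (X ^^ l) (a \<oplus> b) \<in> N (h + (\<Sum>i<l. \<xi>))" using N'(5)[OF 1(3,6)] by simp
    thus "a \<oplus> b \<in> \<Lambda> N l h" using M'(5)[OF 1(1,4)] L'(5)[OF 1(2,5)] unfolding lead_def by blast
  next
    fix a assume "a \<in> \<Lambda> N l h"
    then obtain u where 1: "a \<in> M h" "u \<in> L l (h + (\<Sum>i<l. \<xi>))" "u \<oplus> (X ^^ l) a \<in> N (h + (\<Sum>i<l. \<xi>))"
      by (auto simp: lead_def)
    have "\<ominus> u \<oplus> (X ^^ l) (\<ominus> a) = \<ominus> (u \<oplus> (X ^^ l) a)"
      using 1 L'(1) Mc Xlc endoD(4)[OF Xl] by (simp add: minus_add)
    hence "\<ominus> u \<oplus> (X ^^ l) (\<ominus> a) \<in> N (h + (\<Sum>i<l. \<xi>))" using N'(4)[OF 1(3)] by simp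
    thus "\<ominus> a \<in> \<Lambda> N l h" using M'(4)[OF 1(1)] L'(4)[OF 1(2)] unfolding lead_def by blast
  qed
next
  fix \<delta> f h a assume f: "(\<delta>, f) \<in> \<Omega>" and "a \<in> \<Lambda> N l h"
  then obtain u where 1: "a \<in> M h" "u \<in> L l (h + (\<Sum>i<l. \<xi>))" "u \<oplus> (X ^^ l) a \<in> N (h + (\<Sum>i<l. \<xi>))"
    by (auto simp: lead_def)
  have e: "h + (\<Sum>i<l. \<xi>) + \<delta> = (h + \<delta>) + (\<Sum>i<l. \<xi>)" by (simp add: add_ac)
  have "f (u \<oplus> (X ^^ l) a) = f u \<oplus> (X ^^ l) (f a)"
    using 1 endoD(2)[OF endo[OF f]] lev_carrier Xlc Mc comm_funpow[OF f] by simp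
  hence "f u \<oplus> (X ^^ l) (f a) \<in> N ((h + \<delta>) + (\<Sum>i<l. \<xi>))"
    using familyD(2)[OF N f 1(3)] e by simp
  moreover have "f u \<in> L l ((h + \<delta>) + (\<Sum>i<l. \<xi>))" using lev_op[OF f 1(2)] e by simp
  ultimately show "f a \<in> \<Lambda> N l (h + \<delta>)" using familyD(2)[OF M f 1(1)] unfolding lead_def by blast
qed

text \<open>Multiplication by \<open>X\<close> keeps the leading coefficient and raises the degree
  by one.\<close>

lemma lead_Suc:
  assumes N: "family (insert (\<xi>, X) \<Omega>) N"
  shows "\<Lambda> N l \<le> \<Lambda> N (Suc l)"
proof (rule le_funI, rule subsetI)
  fix h a assume "a \<in> \<Lambda> N l h"
  then obtain u where 1: "a \<in> M h" "u \<in> L l (h + (\<Sum>i<l. \<xi>))" "u \<oplus> (X ^^ l) a \<in> N (h + (\<Sum>i<l. \<xi>))"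
    by (auto simp: lead_def)
  have e: "h + (\<Sum>i<l. \<xi>) + \<xi> = h + (\<Sum>i<Suc l. \<xi>)" by (simp add: add_ac)
  have "X (u \<oplus> (X ^^ l) a) = X u \<oplus> (X ^^ Suc l) a"
    using endoD(2)[OF X lev_carrier[OF 1(2)] Xlc[OF Mc[OF 1(1)]]] by simp
  hence "X u \<oplus> (X ^^ Suc l) a \<in> N (h + (\<Sum>i<Suc l. \<xi>))"
    using familyD(2)[OF N insertI1 1(3)] e by simp
  moreover have "X u \<in> L (Suc l) (h + (\<Sum>i<Suc l. \<xi>))" using lev_X[OF 1(2)] e by simp
  ultimately show "a \<in> \<Lambda> N (Suc l) h" using 1(1) unfolding lead_def by blast
qed

lemma lead_mono: "N \<le> N' \<Longrightarrow> \<Lambda> N l \<le> \<Lambda> N' l"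
  by (auto simp: lead_def le_fun_def)

text \<open>Induction on the degree bound \<open>l\<close>: an element of \<open>N'\<close> shares
  its leading coefficient with an element of \<open>N\<close>, and the difference of the two has a
  smaller bound.\<close>

lemma lead_eq_imp_eq:
  assumes N: "family \<Omega> N" and N': "family \<Omega> N'" and le: "N \<le> N'" "N' \<le> extend M \<xi> X"
    and eq: "\<And>l. \<Lambda> N' l = \<Lambda> N l"
  shows "N' = N"
proof (rule antisym[OF _ le(1)], rule le_funI)
  fix g
  have "x \<in> L l g \<Longrightarrow> x \<in> N' g \<Longrightarrow> x \<in> N g" for l x
  proof (induction l arbitrary: x)
    case 0
    thus ?case using add_subD(2)[OF familyD(1)[OF N]] by simp
  next
    case (Suc l)
    then obtain u a where 1: "x = u \<oplus> (X ^^ l) a" "u \<in> L l g" "a \<in> base M \<xi> l g" by auto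
    note c = lev_carrier[OF 1(2)] base_carrier[OF 1(3)]
    from 1(3) show ?case
    proof (cases rule: baseE)
      case 1
      hence "x = u" using \<open>x = u \<oplus> (X ^^ l) a\<close> c endoD(3)[OF Xl] by simp
      thus ?thesis using Suc \<open>u \<in> L l g\<close> by simp
    next
      case (2 h)
      hence "a \<in> \<Lambda> N' l h" using 1 Suc.prems unfolding lead_def by blast
      hence "a \<in> \<Lambda> N l h" using eq by simp
      then obtain v where v: "v \<in> L l g" "v \<oplus> (X ^^ l) a \<in> N g"
        using 2 unfolding lead_def by auto
      have "x \<ominus> (v \<oplus> (X ^^ l) a) = u \<ominus> v"
        using 1 c lev_carrier[OF v(1)] Xlc[OF c(2), of l]
        by (simp add: a_minus_def minus_add a_ac r_neg r_neg1 r_neg2)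
      moreover have "x \<ominus> (v \<oplus> (X ^^ l) a) \<in> N' g"
        using add_subD(3)[OF familyD(1)[OF N'] Suc.prems(2)] v(2) le(1) by (auto simp: le_fun_def)
      moreover have "u \<ominus> v \<in> L l g" using add_subD(3)[OF lev_add_sub] 1(2) v(1) .
      ultimately have "x \<ominus> (v \<oplus> (X ^^ l) a) \<in> N g" using Suc.IH by simp
      hence "(x \<ominus> (v \<oplus> (X ^^ l) a)) \<oplus> (v \<oplus> (X ^^ l) a) \<in> N g"
        using add_subD(5)[OF familyD(1)[OF N]] v(2) by blast
      moreover have "(x \<ominus> (v \<oplus> (X ^^ l) a)) \<oplus> (v \<oplus> (X ^^ l) a) = x"
        using lev_carrier[OF Suc.prems(1)] add_subD(1)[OF familyD(1)[OF N] v(2)]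
        by (simp add: a_minus_def a_assoc l_neg)
      ultimately show ?thesis by simp
    qed
  qed
  thus "N' g \<subseteq> N g" using le(2) unfolding extend_def le_fun_def by blast
qed

text \<open>The families \<open>\<Lambda> (N p) l\<close> increase both with \<open>l\<close> and
  with \<open>p\<close>. So the diagonal \<open>l = p\<close> stabilises and controls every
  \<open>l\<close> from its stabilisation index on; finitely many \<open>l\<close> remain, each with
  a chain of its own.\<close>

lemma noeth_extend:
  assumes "noeth \<Omega> M"
  shows "noeth (insert (\<xi>, X) \<Omega>) (extend M \<xi> X)"
  unfolding noeth_def
proof (intro allI impI)
  fix N assume N: "\<forall>p::nat. family (insert (\<xi>, X) \<Omega>) (N p) \<and> N p \<le> extend M \<xi> X \<and> N p \<le> N (Suc p)"
  have f: "family \<Omega> (N p)" for p using N by (auto simp: family_def)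
  have le: "N p \<le> N q" if "p \<le> q" for p q using chain_mono[of N] N that by blast
  have M': "\<Lambda> (N p) l \<le> M" for p l by (auto simp: lead_def le_fun_def)
  have inl: "\<Lambda> (N p) l \<le> \<Lambda> (N p) k" if "l \<le> k" for p l k
    using chain_mono[of "\<lambda>l. \<Lambda> (N p) l"] lead_Suc N that by blast
  have inp: "\<Lambda> (N p) l \<le> \<Lambda> (N q) l" if "p \<le> q" for p q l by (rule lead_mono[OF le[OF that]])
  have "\<exists>p0. \<forall>p\<ge>p0. \<Lambda> (N p) p = \<Lambda> (N p0) p0"
  proof (rule assms[unfolded noeth_def, rule_format], intro conjI)
    fix p
    show "\<Lambda> (N p) p \<le> \<Lambda> (N (Suc p)) (Suc p)"
      using order_trans[OF inl[of p "Suc p" p] inp[of p "Suc p" "Suc p"]] by simp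
  qed (use lead_family[OF f] M' in auto)
  then obtain p0 where p0: "\<And>p. p \<ge> p0 \<Longrightarrow> \<Lambda> (N p) p = \<Lambda> (N p0) p0" by blast
  have "\<exists>p1. \<forall>p\<ge>p1. \<Lambda> (N p) l = \<Lambda> (N p1) l" for l
    using assms[unfolded noeth_def, rule_format, of "\<lambda>p. \<Lambda> (N p) l"] lead_family[OF f] M' inp by auto
  then obtain p1 where p1: "\<And>p l. p \<ge> p1 l \<Longrightarrow> \<Lambda> (N p) l = \<Lambda> (N (p1 l)) l" by metis
  define q where "q = Max (insert p0 (p1 ` {..<p0}))"
  have q: "p0 \<le> q" "\<And>l. l < p0 \<Longrightarrow> p1 l \<le> q" by (auto simp: q_def)
  have "N p = N q" if "p \<ge> q" for p
  proof (rule lead_eq_imp_eq[OF f f le[OF that]])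
    show "N p \<le> extend M \<xi> X" using N by blast
    fix l
    show "\<Lambda> (N p) l = \<Lambda> (N q) l"
    proof (cases "l < p0")
      case True
      hence "p1 l \<le> q" using q by blast
      thus ?thesis using p1[of l p] p1[of l q] that by (metis order_trans)
    next
      case False
      \<comment> \<open>This family is squeezed between the diagonal at \<open>p0\<close> and the
        diagonal at \<open>max l r\<close>, which agree.\<close>
      have "\<Lambda> (N r) l = \<Lambda> (N p0) p0" if "p0 \<le> r" for r
      proof (rule antisym)
        have "\<Lambda> (N r) l \<le> \<Lambda> (N (max l r)) (max l r)" using order_trans[OF inl inp] by simp
        thus "\<Lambda> (N r) l \<le> \<Lambda> (N p0) p0" using p0[of "max l r"] that by simp
        show "\<Lambda> (N p0) p0 \<le> \<Lambda> (N r) l" using order_trans[OF inl inp] False that by simp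
      qed
      thus ?thesis using q that by simp
    qed
  qed
  thus "\<exists>p0. \<forall>p\<ge>p0. N p = N p0" by blast
qed

end

section \<open>Finitely many commuting variables\<close>

context abelian_group
begin

text \<open>Iterates \<open>hilbert_step\<close>, one operation at a time. Operations already
  adjoined join \<open>\<Omega>\<close>, so each new one has to commute with all of them.\<close>

lemma noeth_finite_ops:
  assumes "finite Os" "noeth \<Omega> M" "family \<Omega> M"
    and "\<And>\<delta> f. (\<delta>, f) \<in> Os \<union> \<Omega> \<Longrightarrow> endo f"
    and "\<And>\<delta> f \<delta>' f' x. (\<delta>, f) \<in> Os \<union> \<Omega> \<Longrightarrow> (\<delta>', f') \<in> Os \<Longrightarrow> x \<in> carrier G \<Longrightarrow> f (f' x) = f' (f x)"
  shows "\<exists>M'. family (Os \<union> \<Omega>) M' \<and> M \<le> M' \<and> noeth (Os \<union> \<Omega>) M'"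
  using assms(1,4,5)
proof (induction Os rule: finite_induct)
  case empty
  thus ?case using assms(2,3) by auto
next
  case (insert o' Os)
  obtain \<xi> X where o': "o' = (\<xi>, X)" by (cases o')
  have "\<exists>M'. family (Os \<union> \<Omega>) M' \<and> M \<le> M' \<and> noeth (Os \<union> \<Omega>) M'"
    by (rule insert.IH) (use insert.prems in blast)+
  then obtain M' where M': "family (Os \<union> \<Omega>) M'" "M \<le> M'" "noeth (Os \<union> \<Omega>) M'" by blast
  interpret hilbert_step G "Os \<union> \<Omega>" M' \<xi> X
  proof
    show "endo X" using insert.prems(1)[of \<xi> X] o' by simp
    show "endo f" if "(\<delta>, f) \<in> Os \<union> \<Omega>" for \<delta> f using insert.prems(1)[of \<delta> f] that by simp
    show "f (X x) = X (f x)" if "(\<delta>, f) \<in> Os \<union> \<Omega>" "x \<in> carrier G" for \<delta> f x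
      using insert.prems(2)[of \<delta> f \<xi> X x] that o' by simp
  qed (rule M')
  have "family (insert (\<xi>, X) (Os \<union> \<Omega>)) (extend M' \<xi> X)" by (rule extend_family)
  moreover have "M \<le> extend M' \<xi> X" using M'(2) extend_ge by (rule order_trans)
  moreover have "noeth (insert (\<xi>, X) (Os \<union> \<Omega>)) (extend M' \<xi> X)" using noeth_extend M'(3) .
  ultimately show ?case unfolding o' by auto
qed

lemma family_zero:
  assumes "\<And>\<delta> f. (\<delta>, f) \<in> \<Omega> \<Longrightarrow> endo f"
  shows "family \<Omega> (\<lambda>_. {\<zero>})"
  using assms endoD(3) by (auto simp: family_def add_sub_def a_minus_def)

lemma noeth_zero: "noeth \<Omega> (\<lambda>_. {\<zero>})"
  unfolding noeth_def
proof (intro allI impI)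
  fix N assume N: "\<forall>p::nat. family \<Omega> (N p) \<and> N p \<le> (\<lambda>_. {\<zero>}) \<and> N p \<le> N (Suc p)"
  hence "N p g = {\<zero>}" for p g
    using add_subD(2)[OF familyD(1), of \<Omega> "N p" g] by (auto simp: le_fun_def)
  hence "N p = N 0" for p by auto
  thus "\<exists>p0. \<forall>p\<ge>p0. N p = N p0" by metis
qed

end

lemma (in noetherian_ring) ideal_acc:
  fixes J :: "nat \<Rightarrow> 'a set"
  assumes "\<And>p. ideal (J p) R" "\<And>p. J p \<subseteq> J (Suc p)"
  shows "\<exists>p0. \<forall>p\<ge>p0. J p = J p0"
proof -
  have le: "J p \<subseteq> J q" if "p \<le> q" for p q using lift_Suc_mono_le[of J] assms(2) that by blast
  have "\<Union> (range J) \<in> range J"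
  proof (rule ideal_chain_is_trivial)
    show "subset.chain {I. ideal I R} (range J)"
      unfolding subset_chain_def
    proof (intro conjI ballI)
      show "range J \<subseteq> {I. ideal I R}" using assms(1) by auto
      fix x y assume "x \<in> range J" "y \<in> range J"
      then obtain p q where "x = J p" "y = J q" by blast
      thus "x \<subseteq> y \<or> y \<subseteq> x" using le nat_le_linear[of p q] by metis
    qed
  qed simp
  then obtain p0 where "\<Union> (range J) = J p0" by blast
  hence "J p = J p0" if "p \<ge> p0" for p using le[OF that] by blast
  thus ?thesis by blast
qed

section \<open>Submodules and Artin--Rees numbers\<close>

context module
begin

lemma submodule_iff:
  "submodule R N M \<longleftrightarrow> M.add_sub N \<and> (\<forall>r\<in>carrier R. \<forall>x\<in>N. r \<odot>\<^bsub>M\<^esub> x \<in> N)"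
proof
  assume N: "submodule R N M"
  note sub = submodule.subset[OF N] and sm = submodule.smult_closed[OF N]
  have "\<ominus>\<^bsub>M\<^esub> x \<in> N" if "x \<in> N" for x
    using sm[OF R.a_inv_closed[OF R.one_closed] that] that sub smult_l_minus[of \<one> x] by auto
  thus "M.add_sub N \<and> (\<forall>r\<in>carrier R. \<forall>x\<in>N. r \<odot>\<^bsub>M\<^esub> x \<in> N)"
    using sub sm submodule.m_closed[OF N] submodule.zero_closed[OF N] by (auto intro!: M.add_subI)
next
  assume a: "M.add_sub N \<and> (\<forall>r\<in>carrier R. \<forall>x\<in>N. r \<odot>\<^bsub>M\<^esub> x \<in> N)"
  note b = M.add_subD[OF conjunct1[OF a]]
  show "submodule R N M"
    by (rule submodule.intro) (use a b module_axioms in auto)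
qed

definition scalars :: "('g::zero \<times> ('c \<Rightarrow> 'c)) set"
  where "scalars = (\<lambda>r. (0, (\<odot>\<^bsub>M\<^esub>) r)) ` carrier R"

lemma scalars_endo: "(\<delta>, f) \<in> scalars \<Longrightarrow> M.endo f"
  by (auto simp: scalars_def M.endo_def smult_r_distr)

lemma family_scalars: "M.family scalars N \<longleftrightarrow> (\<forall>g. submodule R (N g) M)"
proof
  assume N: "M.family scalars N"
  have "r \<odot>\<^bsub>M\<^esub> x \<in> N g" if "r \<in> carrier R" "x \<in> N g" for r x g
    using M.familyD(2)[OF N, of 0 "(\<odot>\<^bsub>M\<^esub>) r" x g] that by (auto simp: scalars_def)
  thus "\<forall>g. submodule R (N g) M" using M.familyD(1)[OF N] by (simp add: submodule_iff)
next
  assume "\<forall>g. submodule R (N g) M"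
  thus "M.family scalars N" by (auto simp: M.family_def scalars_def submodule_iff)
qed

text \<open>The chain condition for an extension: a chain below \<open>F' = F + R e\<close> is
  governed by its intersection with \<open>F\<close> and by the ideals \<open>J p\<close> of
  coefficients that \<open>e\<close> takes in it; the latter stabilise since \<open>R\<close> is
  noetherian.\<close>

lemma noeth_add_generator:
  fixes F :: "'g::cancel_comm_monoid_add \<Rightarrow> 'c set"
  assumes R: "noetherian_ring R" and F: "M.family scalars F" "M.noeth scalars F" and e: "e \<in> carrier M"
  shows "\<exists>F'. M.family scalars F' \<and> F \<le> F' \<and> e \<in> F' d \<and> M.noeth scalars F'"
proof -
  interpret noetherian_ring R by fact
  define F' where "F' g = (if g = d then {u \<oplus>\<^bsub>M\<^esub> r \<odot>\<^bsub>M\<^esub> e | u r. u \<in> F d \<and> r \<in> carrier R} else F g)" for g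
  note S = M.add_subD[OF M.familyD(1)[OF F(1)]]
  have Sm: "r \<odot>\<^bsub>M\<^esub> x \<in> F g" if "r \<in> carrier R" "x \<in> F g" for r x g
    using F(1) that by (auto simp: family_scalars submodule_iff)
  have F'I: "x \<in> F' d" if "u \<in> F d" "r \<in> carrier R" "x = u \<oplus>\<^bsub>M\<^esub> r \<odot>\<^bsub>M\<^esub> e" for x u r
    using that by (auto simp: F'_def)
  have F'E: "\<exists>u r. u \<in> F d \<and> r \<in> carrier R \<and> x = u \<oplus>\<^bsub>M\<^esub> r \<odot>\<^bsub>M\<^esub> e" if "x \<in> F' d" for x
    using that by (auto simp: F'_def)
  have sub: "submodule R (F' g) M" for g
  proof (cases "g = d")
    case [simp]: True
    show ?thesis unfolding submodule_iff True
    proof (intro conjI ballI M.add_subI)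
      show "F' d \<subseteq> carrier M" using S(1) e by (auto simp: F'_def)
      show "\<zero>\<^bsub>M\<^esub> \<in> F' d" using F'I[OF S(2)[of d] R.zero_closed] e by simp
      fix x assume "x \<in> F' d"
      then obtain u r where x: "u \<in> F d" "r \<in> carrier R" "x = u \<oplus>\<^bsub>M\<^esub> r \<odot>\<^bsub>M\<^esub> e" using F'E by blast
      show "\<ominus>\<^bsub>M\<^esub> x \<in> F' d"
        by (rule F'I[OF S(4)[OF x(1)] R.a_inv_closed[OF x(2)]])
          (use x S(1) e in \<open>simp add: smult_l_minus M.minus_add\<close>)
      {
        fix y assume "y \<in> F' d"
        then obtain v s where y: "v \<in> F d" "s \<in> carrier R" "y = v \<oplus>\<^bsub>M\<^esub> s \<odot>\<^bsub>M\<^esub> e" using F'E by blast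
        show "x \<oplus>\<^bsub>M\<^esub> y \<in> F' d"
          by (rule F'I[OF S(5)[OF x(1) y(1)] R.a_closed[OF x(2) y(2)]])
            (use x y S(1) e in \<open>simp add: smult_l_distr M.a_ac\<close>)
      }
      fix t assume t: "t \<in> carrier R"
      show "t \<odot>\<^bsub>M\<^esub> x \<in> F' d"
        by (rule F'I[OF Sm[OF t x(1)] R.m_closed[OF t x(2)]])
          (use x S(1) e t in \<open>simp add: smult_r_distr smult_assoc1\<close>)
    qed
  next
    case False
    thus ?thesis using F(1) by (simp add: F'_def family_scalars)
  qed
  have "F \<le> F'"
  proof (intro le_funI subsetI)
    fix g x assume "x \<in> F g"
    thus "x \<in> F' g" using F'I[of x \<zero> x] S(1)[of x] e by (cases "g = d") (auto simp: F'_def)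
  qed
  moreover have "e \<in> F' d" using F'I[OF S(2) R.one_closed, of e] e by simp
  moreover have "M.noeth scalars F'"
    unfolding M.noeth_def
  proof (intro allI impI)
    fix N :: "nat \<Rightarrow> 'g \<Rightarrow> 'c set"
    assume N: "\<forall>p. M.family scalars (N p) \<and> N p \<le> F' \<and> N p \<le> N (Suc p)"
    have sN: "submodule R (N p g) M" for p g using N by (auto simp: family_scalars)
    note T = M.add_subD[OF conjunct1[OF sN[unfolded submodule_iff]]]
    have Tm: "r \<odot>\<^bsub>M\<^esub> x \<in> N p g" if "r \<in> carrier R" "x \<in> N p g" for r x p g
      using sN that by (auto simp: submodule_iff)
    have le: "N p g \<subseteq> N q g" if "p \<le> q" for p q g
      using M.chain_mono[of N p q] N that by (auto simp: le_fun_def)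
    define J where "J p = {r \<in> carrier R. \<exists>u\<in>F d. u \<oplus>\<^bsub>M\<^esub> r \<odot>\<^bsub>M\<^esub> e \<in> N p d}" for p
    have J: "ideal (J p) R" for p
    proof (rule idealI[OF R.ring_axioms])
      show "subgroup (J p) (add_monoid R)"
      proof (rule R.add.subgroupI)
        show "J p \<subseteq> carrier R" by (auto simp: J_def)
        have "\<zero>\<^bsub>M\<^esub> \<oplus>\<^bsub>M\<^esub> \<zero> \<odot>\<^bsub>M\<^esub> e \<in> N p d" using e T(2) by simp
        thus "J p \<noteq> {}" using S(2)[of d] R.zero_closed unfolding J_def by blast
        fix r assume "r \<in> J p"
        then obtain u where u: "r \<in> carrier R" "u \<in> F d" "u \<oplus>\<^bsub>M\<^esub> r \<odot>\<^bsub>M\<^esub> e \<in> N p d" by (auto simp: J_def)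
        have "\<ominus>\<^bsub>M\<^esub> u \<oplus>\<^bsub>M\<^esub> (\<ominus> r) \<odot>\<^bsub>M\<^esub> e \<in> N p d"
          using T(4)[OF u(3)] u S(1) e by (simp add: smult_l_minus M.minus_add)
        thus "\<ominus> r \<in> J p" using S(4)[OF u(2)] R.a_inv_closed[OF u(1)] unfolding J_def by blast
        fix s assume "s \<in> J p"
        then obtain v where v: "s \<in> carrier R" "v \<in> F d" "v \<oplus>\<^bsub>M\<^esub> s \<odot>\<^bsub>M\<^esub> e \<in> N p d" by (auto simp: J_def)
        have "(u \<oplus>\<^bsub>M\<^esub> v) \<oplus>\<^bsub>M\<^esub> (r \<oplus> s) \<odot>\<^bsub>M\<^esub> e = (u \<oplus>\<^bsub>M\<^esub> r \<odot>\<^bsub>M\<^esub> e) \<oplus>\<^bsub>M\<^esub> (v \<oplus>\<^bsub>M\<^esub> s \<odot>\<^bsub>M\<^esub> e)"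
          using u v S(1) e by (simp add: smult_l_distr M.a_ac)
        hence "(u \<oplus>\<^bsub>M\<^esub> v) \<oplus>\<^bsub>M\<^esub> (r \<oplus> s) \<odot>\<^bsub>M\<^esub> e \<in> N p d" using T(5)[OF u(3) v(3)] by simp
        thus "r \<oplus> s \<in> J p" using S(5)[OF u(2) v(2)] R.a_closed[OF u(1) v(1)] unfolding J_def by blast
      qed
      fix r t assume "r \<in> J p" and t: "t \<in> carrier R"
      then obtain u where u: "r \<in> carrier R" "u \<in> F d" "u \<oplus>\<^bsub>M\<^esub> r \<odot>\<^bsub>M\<^esub> e \<in> N p d" by (auto simp: J_def)
      have "t \<odot>\<^bsub>M\<^esub> u \<oplus>\<^bsub>M\<^esub> (t \<otimes> r) \<odot>\<^bsub>M\<^esub> e \<in> N p d"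
        using Tm[OF t u(3)] u t S(1) e by (simp add: smult_r_distr smult_assoc1)
      thus "t \<otimes> r \<in> J p" using Sm[OF t u(2)] R.m_closed[OF t u(1)] unfolding J_def by blast
      thus "r \<otimes> t \<in> J p" using t u(1) by (simp add: R.m_comm)
    qed
    have "\<exists>p0. \<forall>p\<ge>p0. J p = J p0"
    proof (rule ideal_acc[OF J])
      show "J p \<subseteq> J (Suc p)" for p using le[of p "Suc p" d] by (auto simp: J_def)
    qed
    then obtain p0 where p0: "\<And>p. p \<ge> p0 \<Longrightarrow> J p = J p0" by blast
    have "\<exists>p1. \<forall>p\<ge>p1. (\<lambda>g. N p g \<inter> F g) = (\<lambda>g. N p1 g \<inter> F g)"
    proof (rule F(2)[unfolded M.noeth_def, rule_format, of "\<lambda>p g. N p g \<inter> F g"], intro conjI)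
      fix p
      show "M.family scalars (\<lambda>g. N p g \<inter> F g)"
        using sN F(1) by (auto simp: family_scalars submodule_iff M.add_sub_Int)
      show "(\<lambda>g. N p g \<inter> F g) \<le> F" by (auto simp: le_fun_def)
      show "(\<lambda>g. N p g \<inter> F g) \<le> (\<lambda>g. N (Suc p) g \<inter> F g)" using le[of p "Suc p"] by (auto simp: le_fun_def)
    qed
    then obtain p1 where p1: "\<And>p. p \<ge> p1 \<Longrightarrow> (\<lambda>g. N p g \<inter> F g) = (\<lambda>g. N p1 g \<inter> F g)" by blast
    define q where "q = max p0 p1"
    have "N p g = N q g" if p: "p \<ge> q" for p g
    proof (rule antisym[OF _ le[OF p]], rule subsetI)
      fix x assume x: "x \<in> N p g"
      have eq: "N p g \<inter> F g = N q g \<inter> F g" using fun_cong[OF p1[of p], of g] fun_cong[OF p1[of q], of g] p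
        by (simp add: q_def)
      have xF: "x \<in> F' g" using N x by (auto simp: le_fun_def)
      show "x \<in> N q g"
      proof (cases "g = d")
        case False
        hence "x \<in> F g" using xF by (simp add: F'_def)
        thus ?thesis using x eq by blast
      next
        case [simp]: True
        obtain u r where u: "u \<in> F d" "r \<in> carrier R" "x = u \<oplus>\<^bsub>M\<^esub> r \<odot>\<^bsub>M\<^esub> e" using F'E[of x] xF True by blast
        hence "r \<in> J p" using x unfolding J_def by auto
        hence "r \<in> J q" using p0[of p] p0[of q] p by (simp add: q_def)
        then obtain v where v: "v \<in> F d" "v \<oplus>\<^bsub>M\<^esub> r \<odot>\<^bsub>M\<^esub> e \<in> N q d" by (auto simp: J_def)
        \<comment> \<open>Two elements with the same coefficient at \<open>e\<close> differ by an
          element of \<open>F d\<close>, where the chain is already stable.\<close>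
        have "x \<ominus>\<^bsub>M\<^esub> (v \<oplus>\<^bsub>M\<^esub> r \<odot>\<^bsub>M\<^esub> e) = u \<ominus>\<^bsub>M\<^esub> v"
          using u v(1) S(1) e
          by (simp add: a_minus_def M.minus_add M.a_ac M.r_neg M.r_neg1 M.r_neg2)
        moreover have "x \<ominus>\<^bsub>M\<^esub> (v \<oplus>\<^bsub>M\<^esub> r \<odot>\<^bsub>M\<^esub> e) \<in> N p d"
          using T(3)[of x p d] x le[OF p, of d] v(2) by auto
        moreover have "u \<ominus>\<^bsub>M\<^esub> v \<in> F d" using S(3) u(1) v(1) .
        ultimately have "x \<ominus>\<^bsub>M\<^esub> (v \<oplus>\<^bsub>M\<^esub> r \<odot>\<^bsub>M\<^esub> e) \<in> N q d" using eq by auto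
        hence "(x \<ominus>\<^bsub>M\<^esub> (v \<oplus>\<^bsub>M\<^esub> r \<odot>\<^bsub>M\<^esub> e)) \<oplus>\<^bsub>M\<^esub> (v \<oplus>\<^bsub>M\<^esub> r \<odot>\<^bsub>M\<^esub> e) \<in> N q d" using T(5) v(2) by blast
        moreover have "(x \<ominus>\<^bsub>M\<^esub> (v \<oplus>\<^bsub>M\<^esub> r \<odot>\<^bsub>M\<^esub> e)) \<oplus>\<^bsub>M\<^esub> (v \<oplus>\<^bsub>M\<^esub> r \<odot>\<^bsub>M\<^esub> e) = x"
          using T(1)[OF x] T(1)[OF v(2)] by (simp add: a_minus_def M.a_assoc M.l_neg)
        ultimately show ?thesis by simp
      qed
    qed
    hence "N p = N q" if "p \<ge> q" for p using that by blast
    thus "\<exists>p0. \<forall>p\<ge>p0. N p = N p0" by blast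
  qed
  ultimately show ?thesis using sub by (auto simp: family_scalars)
qed

lemma noeth_finitely_generated:
  fixes E :: "('g::cancel_comm_monoid_add \<times> 'c) set"
  assumes R: "noetherian_ring R" and E: "finite E" "E \<subseteq> UNIV \<times> carrier M"
  shows "\<exists>F. M.family scalars F \<and> (\<forall>(d, e)\<in>E. e \<in> F d) \<and> M.noeth scalars F"
  using E
proof (induction E rule: finite_induct)
  case empty
  have "M.family scalars (\<lambda>_::'g. {\<zero>\<^bsub>M\<^esub>})" by (rule M.family_zero) (rule scalars_endo)
  thus ?case using M.noeth_zero by blast
next
  case (insert x E)
  obtain d e where x: "x = (d, e)" by (cases x)
  from insert obtain F where F: "M.family scalars F" "\<forall>(d, e)\<in>E. e \<in> F d" "M.noeth scalars F" by auto
  have "e \<in> carrier M" using insert.prems x by auto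
  from noeth_add_generator[OF R F(1,3) this, of d] obtain F' where
    F': "M.family scalars F'" "F \<le> F'" "e \<in> F' d" "M.noeth scalars F'" by blast
  have "\<forall>(d, e)\<in>insert x E. e \<in> F' d"
  proof (clarify)
    fix d' e' assume a: "(d', e') \<in> insert x E"
    show "e' \<in> F' d'"
    proof (cases "(d', e') = x")
      case True
      thus ?thesis using x F'(3) by simp
    next
      case False
      hence "e' \<in> F d'" using a F(2) by auto
      thus ?thesis using F'(2) by (auto simp: le_fun_def)
    qed
  qed
  thus ?case using F' by blast
qed

end

section \<open>Powers of ideals, and ideals as modules\<close>

context cring
begin

lemma ideal_power_0: "ideal_power R I 0 = carrier R"
  by (simp add: ideal_power_def ideals_set_def)

lemma ideal_power_Suc: "ideal_power R I (Suc k) = ideal_power R I k \<cdot> I"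
  by (simp add: ideal_power_def ideals_set_def)

lemma ideal_power_ideal: "ideal I R \<Longrightarrow> ideal (ideal_power R I k) R"
  by (induction k) (auto simp: ideal_power_0 ideal_power_Suc oneideal ideal_prod_is_ideal)

lemma ideal_power_Suc': "ideal I R \<Longrightarrow> ideal_power R I (Suc k) = I \<cdot> ideal_power R I k"
  using ideal_power_Suc ideal_prod_commute ideal_power_ideal by metis

lemma ideal_power_1: "ideal I R \<Longrightarrow> ideal_power R I (Suc 0) = I"
  using ideal_power_Suc'[of I 0] ideal_power_0 ideal_prod_one by simp

lemma ideal_power_add:
  assumes "ideal I R"
  shows "ideal_power R I (i + j) = ideal_power R I i \<cdot> ideal_power R I j"
proof (induction j)
  case 0
  show ?case using ideal_prod_one[OF ideal_power_ideal[OF assms]] by (simp add: ideal_power_0)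
next
  case (Suc j)
  show ?case using Suc ideal_prod_assoc[OF ideal_power_ideal[OF assms] ideal_power_ideal[OF assms] assms]
    by (simp add: ideal_power_Suc)
qed

lemma ideal_prod_mono_right: "J \<subseteq> J' \<Longrightarrow> I \<cdot> J \<subseteq> I \<cdot> J'"
proof
  fix x assume J: "J \<subseteq> J'" and "x \<in> I \<cdot> J"
  from this(2) show "x \<in> I \<cdot> J'"
    by (induction rule: ideal_prod.induct) (use J in \<open>auto intro: ideal_prod.intros\<close>)
qed

lemma ideal_power_decreasing:
  assumes "ideal I R" "i \<le> j"
  shows "ideal_power R I j \<subseteq> ideal_power R I i"
proof -
  have "ideal_power R I (i + (j - i)) \<subseteq> ideal_power R I i"
    using ideal_prod_inter[OF ideal_power_ideal ideal_power_ideal, OF assms(1) assms(1)]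
    unfolding ideal_power_add[OF assms(1)] by blast
  thus ?thesis using assms(2) by simp
qed

lemma ideal_iff_submodule:
  "ideal J R \<longleftrightarrow> add_sub J \<and> (\<forall>r\<in>carrier R. \<forall>x\<in>J. r \<otimes> x \<in> J)"
proof
  assume J: "ideal J R"
  interpret ideal J R by fact
  show "add_sub J \<and> (\<forall>r\<in>carrier R. \<forall>x\<in>J. r \<otimes> x \<in> J)"
    using I_l_closed a_subset by (auto intro!: add_subI)
next
  assume J: "add_sub J \<and> (\<forall>r\<in>carrier R. \<forall>x\<in>J. r \<otimes> x \<in> J)"
  note a = add_subD[OF conjunct1[OF J]]
  show "ideal J R"
  proof (rule idealI[OF ring_axioms])
    show "subgroup J (add_monoid R)"
      by (rule add.subgroupI) (use a in auto)
    fix a x assume a': "a \<in> J" "x \<in> carrier R"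
    show "x \<otimes> a \<in> J" using a' J by blast
    thus "a \<otimes> x \<in> J" using a' a m_comm[of x a] by auto
  qed
qed

lemma module_ideal:
  assumes "ideal J R"
  shows "module R (ideal_module R J)"
proof -
  interpret ideal J R by fact
  have "abelian_group (ideal_module R J)"
  proof (rule abelian_groupI)
    fix x assume "x \<in> carrier (ideal_module R J)"
    thus "\<exists>y\<in>carrier (ideal_module R J). y \<oplus>\<^bsub>ideal_module R J\<^esub> x = \<zero>\<^bsub>ideal_module R J\<^esub>"
      using a_inv_closed[of x] by (auto simp: ideal_module_def l_neg intro!: bexI[of _ "\<ominus> x"])
  qed (auto simp: ideal_module_def a_ac)
  thus ?thesis
    by (intro moduleI is_cring) (auto simp: ideal_module_def I_l_closed l_distr r_distr m_assoc)
qed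

end

section \<open>Products of ideals and submodules\<close>

context module
begin

lemma submoduleD:
  assumes "submodule R N M"
  shows "x \<in> N \<Longrightarrow> x \<in> carrier M" "\<zero>\<^bsub>M\<^esub> \<in> N" "x \<in> N \<Longrightarrow> y \<in> N \<Longrightarrow> x \<oplus>\<^bsub>M\<^esub> y \<in> N"
    "x \<in> N \<Longrightarrow> \<ominus>\<^bsub>M\<^esub> x \<in> N" "x \<in> N \<Longrightarrow> y \<in> N \<Longrightarrow> x \<ominus>\<^bsub>M\<^esub> y \<in> N"
    "r \<in> carrier R \<Longrightarrow> x \<in> N \<Longrightarrow> r \<odot>\<^bsub>M\<^esub> x \<in> N"
  using M.add_subD[of N] assms by (auto simp: submodule_iff)

lemma submodule_subset: "submodule R N M \<Longrightarrow> N \<subseteq> carrier M"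
  using submoduleD(1) by blast

lemma submodule_Int: "submodule R N M \<Longrightarrow> submodule R P M \<Longrightarrow> submodule R (N \<inter> P) M"
  by (auto simp: submodule_iff M.add_sub_Int)

lemma submodule_carrier: "submodule R (carrier M) M"
  by (auto simp: submodule_iff M.add_sub_def)

lemma submodule_zero: "submodule R {\<zero>\<^bsub>M\<^esub>} M"
  by (auto simp: submodule_iff M.add_sub_def a_minus_def)

lemma smult_gens_subset: "J \<subseteq> carrier R \<Longrightarrow> N \<subseteq> carrier M \<Longrightarrow> {a \<odot>\<^bsub>M\<^esub> x | a x. a \<in> J \<and> x \<in> N} \<subseteq> carrier M"
  by auto

lemma ideal_smult_submodule:
  "J \<subseteq> carrier R \<Longrightarrow> N \<subseteq> carrier M \<Longrightarrow> submodule R (ideal_smult R M J N) M"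
  unfolding ideal_smult_def by (intro span_is_submodule smult_gens_subset)

lemma ideal_smultI:
  assumes "J \<subseteq> carrier R" "N \<subseteq> carrier M" "a \<in> J" "x \<in> N"
  shows "a \<odot>\<^bsub>M\<^esub> x \<in> ideal_smult R M J N"
proof -
  have "a \<odot>\<^bsub>M\<^esub> x \<in> {a \<odot>\<^bsub>M\<^esub> x | a x. a \<in> J \<and> x \<in> N}" using assms(3,4) by blast
  thus ?thesis unfolding ideal_smult_def using in_own_span[OF smult_gens_subset[OF assms(1,2)]] by blast
qed

lemma ideal_smult_least:
  assumes "submodule R P M" "\<And>a x. a \<in> J \<Longrightarrow> x \<in> N \<Longrightarrow> a \<odot>\<^bsub>M\<^esub> x \<in> P"
  shows "ideal_smult R M J N \<subseteq> P"
  unfolding ideal_smult_def by (rule span_is_subset[OF _ assms(1)]) (use assms(2) in auto)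

lemma ideal_smult_mono:
  assumes "J \<subseteq> J'" "J' \<subseteq> carrier R" "N \<subseteq> N'" "N' \<subseteq> carrier M"
  shows "ideal_smult R M J N \<subseteq> ideal_smult R M J' N'"
  by (rule ideal_smult_least) (use assms in \<open>auto intro!: ideal_smult_submodule ideal_smultI\<close>)

lemma ideal_smult_subset:
  "J \<subseteq> carrier R \<Longrightarrow> submodule R N M \<Longrightarrow> ideal_smult R M J N \<subseteq> N"
  by (rule ideal_smult_least) (auto intro: submoduleD)

lemma ideal_smult_carrier:
  assumes "submodule R N M"
  shows "ideal_smult R M (carrier R) N = N"
proof (rule antisym[OF ideal_smult_subset[OF subset_refl assms]], rule subsetI)
  fix x assume "x \<in> N"
  thus "x \<in> ideal_smult R M (carrier R) N"
    using ideal_smultI[of "carrier R" N \<one> x] submodule_subset[OF assms] by auto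
qed

lemma ideal_annihilating:
  assumes "submodule R P M" "x \<in> carrier M"
  shows "ideal {a \<in> carrier R. a \<odot>\<^bsub>M\<^esub> x \<in> P} R"
  unfolding R.ideal_iff_submodule
  by (intro conjI R.add_subI) (use assms submoduleD[OF assms(1)] in
    \<open>auto simp: smult_l_distr smult_l_minus smult_assoc1\<close>)

lemma ideal_smult_Idl:
  assumes "submodule R P M" "N \<subseteq> carrier M" "Y \<subseteq> carrier R"
    and "\<And>y x. y \<in> Y \<Longrightarrow> x \<in> N \<Longrightarrow> y \<odot>\<^bsub>M\<^esub> x \<in> P"
  shows "ideal_smult R M (Idl Y) N \<subseteq> P"
proof (rule ideal_smult_least[OF assms(1)])
  fix a x assume a: "a \<in> Idl Y" and x: "x \<in> N"
  have "Idl Y \<subseteq> {a \<in> carrier R. a \<odot>\<^bsub>M\<^esub> x \<in> P}"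
    by (rule R.genideal_minimal[OF ideal_annihilating]) (use assms x in auto)
  thus "a \<odot>\<^bsub>M\<^esub> x \<in> P" using a by blast
qed

lemma submodule_preimage_smult:
  assumes "submodule R P M" "a \<in> carrier R"
  shows "submodule R {x \<in> carrier M. a \<odot>\<^bsub>M\<^esub> x \<in> P} M"
proof -
  have "a \<odot>\<^bsub>M\<^esub> (r \<odot>\<^bsub>M\<^esub> x) \<in> P" if "r \<in> carrier R" "x \<in> carrier M" "a \<odot>\<^bsub>M\<^esub> x \<in> P" for r x
    using submoduleD(6)[OF assms(1) that(1,3)] that assms(2) by (simp flip: smult_assoc1 add: R.m_comm)
  thus ?thesis unfolding submodule_iff using assms submoduleD[OF assms(1)]
    by (auto intro!: M.add_subI simp: smult_r_distr smult_r_minus)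
qed

lemma ideal_smult_prod:
  assumes "ideal I R" "ideal J R" "submodule R N M"
  shows "ideal_smult R M (I \<cdot> J) N = ideal_smult R M I (ideal_smult R M J N)"
proof (rule antisym)
  interpret I: ideal I R by fact
  interpret J: ideal J R by fact
  interpret IJ: ideal "I \<cdot> J" R using R.ideal_prod_is_ideal assms by blast
  note N = submodule_subset[OF assms(3)]
  have sJ: "submodule R (ideal_smult R M J N) M" by (rule ideal_smult_submodule[OF J.a_subset N])
  have sI: "submodule R (ideal_smult R M I (ideal_smult R M J N)) M"
    by (rule ideal_smult_submodule[OF I.a_subset submodule_subset[OF sJ]])
  have sIJ: "submodule R (ideal_smult R M (I \<cdot> J) N) M"
    by (rule ideal_smult_submodule[OF IJ.a_subset N])
  show "ideal_smult R M (I \<cdot> J) N \<subseteq> ideal_smult R M I (ideal_smult R M J N)"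
  proof (rule ideal_smult_least[OF sI])
    fix a x assume a: "a \<in> I \<cdot> J" and x: "x \<in> N"
    from a show "a \<odot>\<^bsub>M\<^esub> x \<in> ideal_smult R M I (ideal_smult R M J N)"
    proof (induction rule: ideal_prod.induct)
      case (prod i j)
      have "i \<odot>\<^bsub>M\<^esub> (j \<odot>\<^bsub>M\<^esub> x) \<in> ideal_smult R M I (ideal_smult R M J N)"
        using ideal_smultI[OF J.a_subset N prod(2) x] ideal_smultI[OF I.a_subset submodule_subset[OF sJ] prod(1)]
        by blast
      thus ?case using prod x N smult_assoc1[of i j x] by auto
    next
      case (sum s t)
      hence "s \<in> carrier R" "t \<in> carrier R" using IJ.a_subset by auto
      thus ?case using sum submoduleD(3)[OF sI] x N smult_l_distr[of s t x] by auto
    qed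
  qed
  show "ideal_smult R M I (ideal_smult R M J N) \<subseteq> ideal_smult R M (I \<cdot> J) N"
  proof (rule ideal_smult_least[OF sIJ])
    fix i y assume i: "i \<in> I" and y: "y \<in> ideal_smult R M J N"
    have "ideal_smult R M J N \<subseteq> {x \<in> carrier M. i \<odot>\<^bsub>M\<^esub> x \<in> ideal_smult R M (I \<cdot> J) N}"
    proof (rule ideal_smult_least[OF submodule_preimage_smult[OF sIJ]])
      show "i \<in> carrier R" using i by simp
      fix j x assume j: "j \<in> J" and x: "x \<in> N"
      have "(i \<otimes> j) \<odot>\<^bsub>M\<^esub> x \<in> ideal_smult R M (I \<cdot> J) N"
        by (rule ideal_smultI[OF IJ.a_subset N ideal_prod.prod[OF i j] x])
      thus "j \<odot>\<^bsub>M\<^esub> x \<in> {x \<in> carrier M. i \<odot>\<^bsub>M\<^esub> x \<in> ideal_smult R M (I \<cdot> J) N}"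
        using i j x N smult_assoc1[of i j x] by auto
    qed
    thus "i \<odot>\<^bsub>M\<^esub> y \<in> ideal_smult R M (I \<cdot> J) N" using y by blast
  qed
qed

lemma ideal_smult_hom:
  assumes f: "mod_hom R M N f" and "J \<subseteq> carrier R" "P \<subseteq> carrier M" "x \<in> ideal_smult R M J P"
    and Q: "submodule R Q N" "\<And>a y. a \<in> J \<Longrightarrow> y \<in> P \<Longrightarrow> a \<odot>\<^bsub>N\<^esub> f y \<in> Q"
  shows "f x \<in> Q"
proof -
  interpret f: mod_hom R M N f by fact
  note q = f.N.submoduleD[OF Q(1)]
  have "submodule R {x \<in> carrier M. f x \<in> Q} M"
    unfolding submodule_iff using q by (auto intro!: M.add_subI)
  hence "ideal_smult R M J P \<subseteq> {x \<in> carrier M. f x \<in> Q}"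
  proof (rule ideal_smult_least)
    fix a y assume a: "a \<in> J" "y \<in> P"
    hence "a \<in> carrier R" "y \<in> carrier M" using assms(2,3) by auto
    hence "f (a \<odot>\<^bsub>M\<^esub> y) = a \<odot>\<^bsub>N\<^esub> f y" by simp
    thus "a \<odot>\<^bsub>M\<^esub> y \<in> {x \<in> carrier M. f x \<in> Q}" using Q(2)[OF a] a assms(2,3) by auto
  qed
  thus ?thesis using assms(4) by blast
qed

text \<open>Turns an equality over all exponents into a condition on consecutive ones. One inclusion
  always holds, by \<open>ge\<close>, so only \<open>W (Suc i) \<subseteq> m W i\<close> carries
  information, and iterating it from \<open>r\<close> on recovers all exponents. This is what makes
  it possible to speak of a single failing exponent.\<close>

lemma artin_rees_iff:
  assumes m: "ideal m R" and N: "submodule R N M"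
  defines "W i \<equiv> N \<inter> ideal_smult R M (ideal_power R m i) (carrier M)"
  shows "(\<forall>i\<ge>r. W i = ideal_smult R M (ideal_power R m (i - r)) (W r)) \<longleftrightarrow>
    (\<forall>i\<ge>r. W (Suc i) \<subseteq> ideal_smult R M m (W i))"
proof -
  have mi: "ideal (ideal_power R m i) R" for i by (rule R.ideal_power_ideal[OF m])
  have mc: "ideal_power R m i \<subseteq> carrier R" for i using ideal.axioms(1)[OF mi] by (rule additive_subgroup.a_subset)
  have W: "submodule R (W i) M" for i
    unfolding W_def by (intro submodule_Int N ideal_smult_submodule mc subset_refl)
  have pSuc: "ideal_smult R M (ideal_power R m (Suc k)) P = ideal_smult R M m (ideal_smult R M (ideal_power R m k) P)"
    if "submodule R P M" for P k
    unfolding R.ideal_power_Suc'[OF m] by (rule ideal_smult_prod[OF m mi that])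
  have ge: "ideal_smult R M (ideal_power R m k) (W r) \<subseteq> W (k + r)" for k r
  proof -
    have "ideal_smult R M (ideal_power R m k) (W r) \<subseteq> N"
      using ideal_smult_subset[OF mc W] by (auto simp: W_def)
    moreover have "ideal_smult R M (ideal_power R m k) (W r)
      \<subseteq> ideal_smult R M (ideal_power R m k) (ideal_smult R M (ideal_power R m r) (carrier M))"
      by (rule ideal_smult_mono[OF subset_refl mc _ submodule_subset[OF ideal_smult_submodule[OF mc subset_refl]]])
        (simp add: W_def)
    moreover have "\<dots> = ideal_smult R M (ideal_power R m (k + r)) (carrier M)"
      unfolding R.ideal_power_add[OF m] by (rule ideal_smult_prod[OF mi mi submodule_carrier, symmetric])
    ultimately show ?thesis unfolding W_def by simp
  qed
  show ?thesis
  proof (intro iffI allI impI)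
    fix i assume a: "\<forall>i\<ge>r. W i = ideal_smult R M (ideal_power R m (i - r)) (W r)" and i: "i \<ge> r"
    have "W (Suc i) = ideal_smult R M (ideal_power R m (Suc (i - r))) (W r)"
      unfolding Suc_diff_le[OF i, symmetric] by (rule a[rule_format]) (use i in simp)
    also have "\<dots> = ideal_smult R M m (W i)"
      unfolding pSuc[OF W] by (rule arg_cong[OF a[rule_format, OF i, symmetric]])
    finally show "W (Suc i) \<subseteq> ideal_smult R M m (W i)" by simp
  next
    fix i assume a: "\<forall>i\<ge>r. W (Suc i) \<subseteq> ideal_smult R M m (W i)" and i: "i \<ge> r"
    have "W (k + r) \<subseteq> ideal_smult R M (ideal_power R m k) (W r)" for k
    proof (induction k)
      case 0
      show ?case by (simp add: R.ideal_power_0 ideal_smult_carrier[OF W])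
    next
      case (Suc k)
      have "W (Suc k + r) \<subseteq> ideal_smult R M m (W (k + r))" using a by simp
      also have "\<dots> \<subseteq> ideal_smult R M m (ideal_smult R M (ideal_power R m k) (W r))"
        using mc[of "Suc 0"] submodule_subset[OF ideal_smult_submodule[OF mc submodule_subset[OF W]]]
        by (intro ideal_smult_mono[OF subset_refl _ Suc]) (simp_all only: R.ideal_power_1[OF m])
      finally show ?case by (simp add: pSuc[OF W])
    qed
    from this[of "i - r"] ge[of "i - r" r] i
    show "W i = ideal_smult R M (ideal_power R m (i - r)) (W r)" by simp
  qed
qed

lemma artin_rees_number_eq:
  assumes m: "ideal m R" and N: "submodule R N M"
  shows "artin_rees_number R m N M = (LEAST r. \<forall>i\<ge>r.
    N \<inter> ideal_smult R M (ideal_power R m (Suc i)) (carrier M) \<subseteq>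
    ideal_smult R M m (N \<inter> ideal_smult R M (ideal_power R m i) (carrier M)))"
  unfolding artin_rees_number_def artin_rees_iff[OF assms] ..

end

section \<open>Bigraded modules over Rees algebras\<close>

text \<open>\<open>F\<close> is a graded module over \<open>R[X\<^sub>0, \<dots>, X\<^sub>n\<^sub>-\<^sub>1]\<close>, generated by the elements \<open>e\<close> in degree \<open>d\<close> for
  \<open>(d, e) \<in> E\<close>.\<close>

locale polynomial_module = module R M for R :: "('a, 'm) ring_scheme" (structure) and M :: "('a, 'c, 'd) module_scheme" (structure) +
  fixes n :: nat and X :: "nat \<Rightarrow> 'c \<Rightarrow> 'c" and F :: "nat \<Rightarrow> 'c set" and E :: "(nat \<times> 'c) set"
  assumes noeth_R: "noetherian_ring R"
    and X_endo: "l < n \<Longrightarrow> M.endo (X l)"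
    and X_smult: "\<lbrakk>l < n; r \<in> carrier R; x \<in> carrier M\<rbrakk> \<Longrightarrow> X l (r \<odot>\<^bsub>M\<^esub> x) = r \<odot>\<^bsub>M\<^esub> X l x"
    and X_comm: "\<lbrakk>l < n; l' < n; x \<in> carrier M\<rbrakk> \<Longrightarrow> X l (X l' x) = X l' (X l x)"
    and F_sub: "submodule R (F k) M"
    and F_X: "\<lbrakk>l < n; x \<in> F k\<rbrakk> \<Longrightarrow> X l x \<in> F (Suc k)"
    and E: "finite E" "E \<subseteq> UNIV \<times> carrier M"
    and F_least: "\<lbrakk>\<And>k. submodule R (P k) M; \<And>l k x. \<lbrakk>l < n; x \<in> P k\<rbrakk> \<Longrightarrow> X l x \<in> P (Suc k);
      \<And>d e. (d, e) \<in> E \<Longrightarrow> e \<in> P d\<rbrakk> \<Longrightarrow> F k \<subseteq> P k"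
begin

text \<open>These are the graded submodules over the polynomial ring.\<close>

definition closed :: "(nat \<Rightarrow> 'c set) \<Rightarrow> bool"
  where "closed N \<longleftrightarrow> (\<forall>k. submodule R (N k) M) \<and> (\<forall>l<n. \<forall>k. \<forall>x\<in>N k. X l x \<in> N (Suc k))"

lemma closedD:
  assumes "closed N"
  shows "submodule R (N k) M" "\<lbrakk>l < n; x \<in> N k\<rbrakk> \<Longrightarrow> X l x \<in> N (Suc k)"
  using assms by (auto simp: closed_def)

text \<open>Adjoining the \<open>X l\<close> as operations of degree one to the submodules spanned
  by the generators gives a noetherian family \<open>M'\<close>, and \<open>F_least\<close> places
  \<open>F\<close> inside it.\<close>

lemma closed_acc:
  assumes N: "\<And>p. closed (N p)" "\<And>p k. N p k \<subseteq> F k" "\<And>p k. N p k \<subseteq> N (Suc p) k"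
  shows "\<exists>p0. \<forall>p\<ge>p0. N p = N p0"
proof -
  define Os where "Os = (\<lambda>l. (Suc 0, X l)) ` {..<n}"
  obtain F0 where F0: "M.family scalars F0" "\<forall>(d, e)\<in>E. e \<in> F0 d" "M.noeth scalars F0"
    using noeth_finitely_generated[OF noeth_R E] by blast
  have "\<exists>M'. M.family (Os \<union> scalars) M' \<and> F0 \<le> M' \<and> M.noeth (Os \<union> scalars) M'"
  proof (rule M.noeth_finite_ops[OF _ F0(3,1)])
    show "finite Os" by (simp add: Os_def)
    show "M.endo f" if "(\<delta>, f) \<in> Os \<union> scalars" for \<delta> f
      using that scalars_endo X_endo by (auto simp: Os_def)
    show "f (f' x) = f' (f x)" if "(\<delta>, f) \<in> Os \<union> scalars" "(\<delta>', f') \<in> Os" "x \<in> carrier M" for \<delta> f \<delta>' f' x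
      using that X_comm X_smult by (auto simp: Os_def scalars_def)
  qed
  then obtain M' where M': "M.family (Os \<union> scalars) M'" "F0 \<le> M'" "M.noeth (Os \<union> scalars) M'" by blast
  have "M.family scalars M'" using M'(1) by (simp add: M.family_def)
  hence s: "submodule R (M' k) M" for k unfolding family_scalars by (rule spec)
  have "F k \<subseteq> M' k" for k
  proof (rule F_least[OF s])
    show "X l x \<in> M' (Suc k)" if "l < n" "x \<in> M' k" for l k x
      using M.familyD(2)[OF M'(1), of "Suc 0" "X l" x k] that by (auto simp: Os_def)
    show "e \<in> M' d" if "(d, e) \<in> E" for d e
      using that F0(2) M'(2) by (fastforce simp: le_fun_def)
  qed
  hence le: "N p \<le> M'" for p using N(2) by (fastforce simp: le_fun_def)
  show ?thesis
  proof (rule M'(3)[unfolded M.noeth_def, rule_format, of N], intro conjI le)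
    fix p
    have "M.family scalars (N p)" using closedD(1)[OF N(1)] by (simp add: family_scalars)
    thus "M.family (Os \<union> scalars) (N p)"
      using closedD(2)[OF N(1)] by (auto simp: M.family_def Os_def)
    show "N p \<le> N (Suc p)" using N(3) by (simp add: le_fun_def)
  qed
qed

definition gen :: "(nat \<times> 'c) set \<Rightarrow> nat \<Rightarrow> 'c set"
  where "gen S k = {x \<in> carrier M. \<forall>P. closed P \<longrightarrow> (\<forall>(d, e)\<in>S. e \<in> P d) \<longrightarrow> x \<in> P k}"

lemma gen_least: "closed P \<Longrightarrow> (\<And>d e. (d, e) \<in> S \<Longrightarrow> e \<in> P d) \<Longrightarrow> gen S k \<subseteq> P k"
  by (auto simp: gen_def)

lemma gen_self: "(d, e) \<in> S \<Longrightarrow> e \<in> carrier M \<Longrightarrow> e \<in> gen S d"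
  by (auto simp: gen_def)

lemma gen_mono:
  assumes "S \<subseteq> S'"
  shows "gen S k \<subseteq> gen S' k"
proof
  fix x assume x: "x \<in> gen S k"
  have "x \<in> P k" if P: "closed P" "\<forall>(d, e)\<in>S'. e \<in> P d" for P
  proof -
    have "\<forall>(d, e)\<in>S. e \<in> P d" using P(2) assms by (meson subsetD)
    thus ?thesis using x P(1) by (simp add: gen_def)
  qed
  thus "x \<in> gen S' k" using x by (simp add: gen_def)
qed

lemma closed_gen: "closed (gen S)"
  unfolding closed_def submodule_iff
proof (intro conjI allI impI ballI M.add_subI)
  fix k
  show "gen S k \<subseteq> carrier M" by (auto simp: gen_def)
  show "\<zero>\<^bsub>M\<^esub> \<in> gen S k" using submoduleD(2)[OF closedD(1)] by (auto simp: gen_def)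
  show "x \<oplus>\<^bsub>M\<^esub> y \<in> gen S k" if "x \<in> gen S k" "y \<in> gen S k" for x y
    using that submoduleD(3)[OF closedD(1)] by (auto simp: gen_def)
  show "\<ominus>\<^bsub>M\<^esub> x \<in> gen S k" if "x \<in> gen S k" for x
    using that submoduleD(4)[OF closedD(1)] by (auto simp: gen_def)
  show "r \<odot>\<^bsub>M\<^esub> x \<in> gen S k" if "r \<in> carrier R" "x \<in> gen S k" for r x
    using that submoduleD(6)[OF closedD(1)] by (auto simp: gen_def)
  show "X l x \<in> gen S (Suc k)" if "l < n" "x \<in> gen S k" for l x
    using that closedD(2) M.endoD(1)[OF X_endo] by (auto simp: gen_def)
qed

text \<open>Otherwise generators could be added forever, each one strictly enlarging
  \<open>gen\<close>, against \<open>closed_acc\<close>.\<close>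

lemma closed_finitely_generated:
  assumes N: "closed N" "\<And>k. N k \<subseteq> F k"
  shows "\<exists>S. finite S \<and> (\<forall>(d, e)\<in>S. e \<in> N d) \<and> (\<forall>k. N k = gen S k)"
proof (rule ccontr)
  let ?ok = "\<lambda>S. finite S \<and> (\<forall>(d, e)\<in>S. e \<in> N d)"
  assume a: "\<not> ?thesis"
  have sub: "gen S k \<subseteq> N k" if "?ok S" for S k using gen_least[OF N(1)] that by blast
  have step: "\<exists>S'. ?ok S' \<and> S \<subseteq> S' \<and> gen S \<noteq> gen S'" if S: "?ok S" for S
  proof -
    obtain k where "N k \<noteq> gen S k" using a S by blast
    then obtain x where x: "x \<in> N k" "x \<notin> gen S k" using sub[OF S] by blast
    have "x \<in> gen (insert (k, x) S) k" using gen_self[of k x] x submodule_subset[OF closedD(1)[OF N(1)]] by auto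
    hence "gen S \<noteq> gen (insert (k, x) S)" using x(2) by metis
    moreover have "?ok (insert (k, x) S)" using S x(1) by auto
    ultimately show ?thesis by blast
  qed
  have "\<exists>f. \<forall>p::nat. ?ok (f p) \<and> (f p \<subseteq> f (Suc p) \<and> gen (f p) \<noteq> gen (f (Suc p)))"
    by (rule dependent_nat_choice) (use step in \<open>blast+\<close>)
  then obtain f where f: "\<And>p::nat. ?ok (f p)" "\<And>p. f p \<subseteq> f (Suc p)" "\<And>p. gen (f p) \<noteq> gen (f (Suc p))"
    by blast
  have "\<exists>p0. \<forall>p\<ge>p0. gen (f p) = gen (f p0)"
  proof (rule closed_acc[OF closed_gen])
    show "gen (f p) k \<subseteq> F k" for p k using sub[OF f(1)] N(2) by blast
    show "gen (f p) k \<subseteq> gen (f (Suc p)) k" for p k by (rule gen_mono[OF f(2)])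
  qed
  then obtain p0 where p0: "\<forall>p\<ge>p0. gen (f p) = gen (f p0)" by blast
  have "gen (f p0) = gen (f (Suc p0))" using p0[rule_format, of "Suc p0"] by simp
  thus False using f(3)[of p0] by contradiction
qed

text \<open>The product of \<open>N\<close> with the degree one part of the polynomial ring.\<close>

definition Xsum :: "'c set \<Rightarrow> 'c set"
  where "Xsum N = span (\<Union>l<n. X l ` N)"

lemma Xsum_submodule: "N \<subseteq> carrier M \<Longrightarrow> submodule R (Xsum N) M"
  unfolding Xsum_def by (rule span_is_submodule) (use M.endoD(1)[OF X_endo] in auto)

lemma Xsum_least: "submodule R P M \<Longrightarrow> (\<And>l x. l < n \<Longrightarrow> x \<in> N \<Longrightarrow> X l x \<in> P) \<Longrightarrow> Xsum N \<subseteq> P"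
  unfolding Xsum_def by (rule span_is_subset) auto

lemma XsumI: "N \<subseteq> carrier M \<Longrightarrow> l < n \<Longrightarrow> x \<in> N \<Longrightarrow> X l x \<in> Xsum N"
  unfolding Xsum_def by (rule subsetD[OF in_own_span]) (use M.endoD(1)[OF X_endo] in auto)

lemma Xsum_mono: "N \<subseteq> N' \<Longrightarrow> N' \<subseteq> carrier M \<Longrightarrow> Xsum N \<subseteq> Xsum N'"
  by (rule Xsum_least) (auto intro: Xsum_submodule XsumI)

lemma submodule_preimage_X:
  assumes "submodule R P M" "l < n"
  shows "submodule R {x \<in> carrier M. X l x \<in> P} M"
  unfolding submodule_iff using submoduleD[OF assms(1)] M.endoD[OF X_endo[OF assms(2)]] X_smult[OF assms(2)]
  by (auto intro!: M.add_subI)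

lemma ideal_smult_X:
  assumes "l < n" "J \<subseteq> carrier R" "N \<subseteq> carrier M" "submodule R P M" "\<And>x. x \<in> N \<Longrightarrow> X l x \<in> P"
    and "x \<in> ideal_smult R M J N"
  shows "X l x \<in> ideal_smult R M J P"
proof -
  note P = submodule_subset[OF assms(4)]
  have "ideal_smult R M J N \<subseteq> {x \<in> carrier M. X l x \<in> ideal_smult R M J P}"
  proof (rule ideal_smult_least[OF submodule_preimage_X[OF ideal_smult_submodule[OF assms(2) P] assms(1)]])
    fix a x assume a: "a \<in> J" "x \<in> N"
    hence "X l (a \<odot>\<^bsub>M\<^esub> x) = a \<odot>\<^bsub>M\<^esub> X l x" using X_smult[OF assms(1)] assms(2,3) by auto
    thus "a \<odot>\<^bsub>M\<^esub> x \<in> {x \<in> carrier M. X l x \<in> ideal_smult R M J P}"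
      using a assms(2,3) ideal_smultI[OF assms(2) P a(1) assms(5)[OF a(2)]] by auto
  qed
  thus ?thesis using assms(6) by blast
qed

lemma Xsum_smult:
  assumes "a \<in> carrier R" "N \<subseteq> carrier M" "submodule R P M" "\<And>x. x \<in> N \<Longrightarrow> a \<odot>\<^bsub>M\<^esub> x \<in> P" "x \<in> Xsum N"
  shows "a \<odot>\<^bsub>M\<^esub> x \<in> Xsum P"
proof -
  note P = submodule_subset[OF assms(3)]
  have "Xsum N \<subseteq> {x \<in> carrier M. a \<odot>\<^bsub>M\<^esub> x \<in> Xsum P}"
  proof (rule Xsum_least[OF submodule_preimage_smult[OF Xsum_submodule[OF P] assms(1)]])
    fix l x assume l: "l < n" and x: "x \<in> N"
    have "a \<odot>\<^bsub>M\<^esub> X l x = X l (a \<odot>\<^bsub>M\<^esub> x)" using X_smult[OF l assms(1)] x assms(2) by auto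
    thus "X l x \<in> {x \<in> carrier M. a \<odot>\<^bsub>M\<^esub> x \<in> Xsum P}"
      using XsumI[OF P l assms(4)[OF x]] M.endoD(1)[OF X_endo[OF l]] x assms(2) by auto
  qed
  thus ?thesis using assms(5) by blast
qed

lemma closed_Xsum: "closed N \<Longrightarrow> Xsum (N k) \<subseteq> N (Suc k)"
  by (rule Xsum_least) (use closedD in auto)

context
  fixes m :: "'a set" assumes m: "ideal m R"
begin

lemma mc: "ideal_power R m i \<subseteq> carrier R"
  by (rule additive_subgroup.a_subset[OF ideal.axioms(1)[OF R.ideal_power_ideal[OF m]]])

lemma mc1: "m \<subseteq> carrier R"
  by (rule additive_subgroup.a_subset[OF ideal.axioms(1)[OF m]])

lemmas mi = R.ideal_power_ideal[OF m]

text \<open>Bigraded submodules of the sum of all \<open>m^i F k\<close> over the Rees algebra of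
  \<open>m\<close> with polynomial coefficients: \<open>a \<in> m\<close> acts in degree
  \<open>(1, 0)\<close> and \<open>X l\<close> in degree \<open>(0, 1)\<close>.\<close>

definition biclosed :: "(nat \<Rightarrow> nat \<Rightarrow> 'c set) \<Rightarrow> bool"
  where "biclosed W \<longleftrightarrow> (\<forall>i. closed (W i)) \<and> (\<forall>a\<in>m. \<forall>i k. \<forall>x\<in>W i k. a \<odot>\<^bsub>M\<^esub> x \<in> W (Suc i) k) \<and>
    (\<forall>i k. W i k \<subseteq> ideal_smult R M (ideal_power R m i) (F k))"

lemma biclosedD:
  assumes "biclosed W"
  shows "closed (W i)" "a \<in> m \<Longrightarrow> x \<in> W i k \<Longrightarrow> a \<odot>\<^bsub>M\<^esub> x \<in> W (Suc i) k"
    "W i k \<subseteq> ideal_smult R M (ideal_power R m i) (F k)" "submodule R (W i k) M"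
    "l < n \<Longrightarrow> x \<in> W i k \<Longrightarrow> X l x \<in> W i (Suc k)"
  using assms closedD by (auto simp: biclosed_def)

text \<open>The Rees algebra of \<open>m\<close> is a quotient of a polynomial ring with one
  variable of degree \<open>(1, 0)\<close> for each of finitely many generators of \<open>m\<close>.
  Such a variable acts on the ambient \<open>M\<close> as multiplication by its generator, so
  Hilbert's theorem applies to the enlarged list of operations.\<close>

lemma biclosed_acc:
  assumes W: "\<And>p. biclosed (W p)" "\<And>p i k. W p i k \<subseteq> W (Suc p) i k"
  shows "\<exists>p0. \<forall>p\<ge>p0. W p = W p0"
proof -
  obtain Y where Y: "Y \<subseteq> carrier R" "finite Y" "m = Idl Y"
    using noetherian_ring.finetely_gen[OF noeth_R m] by blast
  define Os :: "((nat \<times> nat) \<times> ('c \<Rightarrow> 'c)) set"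
    where "Os = (\<lambda>l. ((0, 1), X l)) ` {..<n} \<union> (\<lambda>y. ((1, 0), (\<odot>\<^bsub>M\<^esub>) y)) ` Y"
  have OsE: "(\<exists>l<n. \<delta> = (0, 1) \<and> f = X l) \<or> (\<exists>y\<in>Y. \<delta> = (1, 0) \<and> f = (\<odot>\<^bsub>M\<^esub>) y)"
    if "(\<delta>, f) \<in> Os" for \<delta> f using that by (auto simp: Os_def)
  define E' where "E' = (\<lambda>(d, e). ((0::nat, d), e)) ` E"
  have E': "finite E'" "E' \<subseteq> UNIV \<times> carrier M" using E by (auto simp: E'_def)
  obtain F0 where F0: "M.family scalars F0" "\<forall>(d, e)\<in>E'. e \<in> F0 d" "M.noeth scalars F0"
    using noeth_finitely_generated[OF noeth_R E'] by blast
  have "\<exists>M'. M.family (Os \<union> scalars) M' \<and> F0 \<le> M' \<and> M.noeth (Os \<union> scalars) M'"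
  proof (rule M.noeth_finite_ops[OF _ F0(3,1)])
    show "finite Os" using Y by (simp add: Os_def)
    show "M.endo f" if "(\<delta>, f) \<in> Os \<union> scalars" for \<delta> f
    proof (cases "(\<delta>, f) \<in> Os")
      case True
      thus ?thesis using OsE[OF True] X_endo Y(1) smult_r_distr by (auto simp: M.endo_def)
    next
      case False
      thus ?thesis using that scalars_endo by auto
    qed
    have smult_comm: "r \<odot>\<^bsub>M\<^esub> (s \<odot>\<^bsub>M\<^esub> x) = s \<odot>\<^bsub>M\<^esub> (r \<odot>\<^bsub>M\<^esub> x)"
      if "r \<in> carrier R" "s \<in> carrier R" "x \<in> carrier M" for r s x
      using that by (simp flip: smult_assoc1 add: R.m_comm)
    have lin: "f (r \<odot>\<^bsub>M\<^esub> x) = r \<odot>\<^bsub>M\<^esub> f x" if "(\<delta>, f) \<in> Os" "r \<in> carrier R" "x \<in> carrier M" for \<delta> f r x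
      using OsE[OF that(1)] that(2,3) X_smult smult_comm Y(1) by auto
    show "f (f' x) = f' (f x)" if f: "(\<delta>, f) \<in> Os \<union> scalars" and f': "(\<delta>', f') \<in> Os" and x: "x \<in> carrier M"
      for \<delta> f \<delta>' f' x
    proof (cases "\<exists>r\<in>carrier R. f = (\<odot>\<^bsub>M\<^esub>) r")
      case True
      thus ?thesis using lin[OF f' _ x] by auto
    next
      case False
      hence "(\<delta>, f) \<in> Os" using f by (auto simp: scalars_def)
      from OsE[OF this] False Y(1) obtain l where l: "l < n" "f = X l" by auto
      from OsE[OF f'] show ?thesis using X_comm[OF l(1) _ x] X_smult[OF l(1) _ x] Y(1) l(2) by auto
    qed
  qed
  then obtain M' where M': "M.family (Os \<union> scalars) M'" "F0 \<le> M'" "M.noeth (Os \<union> scalars) M'" by blast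
  have "M.family scalars M'" using M'(1) by (simp add: M.family_def)
  hence s: "submodule R (M' k) M" for k unfolding family_scalars by (rule spec)
  have "F k \<subseteq> M' (0, k)" for k
  proof (rule F_least[OF s])
    show "X l x \<in> M' (0, Suc k)" if "l < n" "x \<in> M' (0, k)" for l k x
      using M.familyD(2)[OF M'(1), of "(0, 1)" "X l" x "(0, k)"] that by (auto simp: Os_def)
    show "e \<in> M' (0, d)" if "(d, e) \<in> E" for d e
    proof -
      have "((0, d), e) \<in> E'" using that by (auto simp: E'_def)
      hence "e \<in> F0 (0, d)" using F0(2) by auto
      thus ?thesis using M'(2) by (auto simp: le_fun_def)
    qed
  qed
  \<comment> \<open>The bigraded family \<open>M'\<close>, which contains the generators in degrees
    \<open>(0, d)\<close>, contains \<open>m^i F k\<close> in degree \<open>(i, k)\<close>; thus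
    every biclosed \<open>W\<close> is a subfamily of it.\<close>
  have mF: "ideal_smult R M (ideal_power R m i) (F k) \<subseteq> M' (i, k)" for i k
  proof (induction i)
    case 0
    show ?case using \<open>F k \<subseteq> M' (0, k)\<close> by (simp add: R.ideal_power_0 ideal_smult_carrier[OF F_sub])
  next
    case (Suc i)
    have "ideal_smult R M (ideal_power R m (Suc i)) (F k)
      = ideal_smult R M (Idl Y) (ideal_smult R M (ideal_power R m i) (F k))"
      unfolding R.ideal_power_Suc'[OF m] using ideal_smult_prod[OF m mi F_sub] Y(3) by simp
    also have "\<dots> \<subseteq> M' (Suc i, k)"
    proof (rule ideal_smult_Idl[OF s _ Y(1)])
      show "ideal_smult R M (ideal_power R m i) (F k) \<subseteq> carrier M"
        by (rule submodule_subset[OF ideal_smult_submodule[OF mc submodule_subset[OF F_sub]]])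
      fix y x assume "y \<in> Y" "x \<in> ideal_smult R M (ideal_power R m i) (F k)"
      thus "y \<odot>\<^bsub>M\<^esub> x \<in> M' (Suc i, k)"
        using M.familyD(2)[OF M'(1), of "(1, 0)" "(\<odot>\<^bsub>M\<^esub>) y" x "(i, k)"] Suc by (auto simp: Os_def)
    qed
    finally show ?case .
  qed
  have "\<exists>p0. \<forall>p\<ge>p0. (\<lambda>(i, k). W p i k) = (\<lambda>(i, k). W p0 i k)"
  proof (rule M'(3)[unfolded M.noeth_def, rule_format, of "\<lambda>p (i, k). W p i k"], intro conjI)
    fix p
    have fs: "M.family scalars (\<lambda>(i, k). W p i k)"
      using biclosedD(4)[OF W(1)] by (auto simp: family_scalars)
    have op: "f x \<in> (case g + \<delta> of (i, k) \<Rightarrow> W p i k)" if "(\<delta>, f) \<in> Os" "x \<in> (case g of (i, k) \<Rightarrow> W p i k)" for \<delta> f g x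
    proof (cases g)
      case (Pair i k)
      have "y \<in> m" if "y \<in> Y" for y using R.genideal_self[OF Y(1)] Y(3) that by blast
      thus ?thesis using OsE[OF that(1)] that(2) Pair biclosedD(2,5)[OF W(1)] by auto
    qed
    show "M.family (Os \<union> scalars) (\<lambda>(i, k). W p i k)"
      unfolding M.family_def
    proof (intro conjI allI impI)
      show "M.add_sub (case g of (i, k) \<Rightarrow> W p i k)" for g by (rule M.familyD(1)[OF fs])
      show "f x \<in> (case g + \<delta> of (i, k) \<Rightarrow> W p i k)"
        if "(\<delta>, f) \<in> Os \<union> scalars" "x \<in> (case g of (i, k) \<Rightarrow> W p i k)" for \<delta> f g x
      proof (cases "(\<delta>, f) \<in> Os")
        case True
        show ?thesis by (rule op[OF True that(2)])
      next
        case False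
        hence "(\<delta>, f) \<in> scalars" using that(1) by simp
        thus ?thesis by (rule M.familyD(2)[OF fs _ that(2)])
      qed
    qed
    show "(\<lambda>(i, k). W p i k) \<le> M'" using biclosedD(3)[OF W(1)] mF by (fastforce simp: le_fun_def)
    show "(\<lambda>(i, k). W p i k) \<le> (\<lambda>(i, k). W (Suc p) i k)" using W(2) by (auto simp: le_fun_def)
  qed
  then obtain p0 where p0: "\<And>p. p \<ge> p0 \<Longrightarrow> (\<lambda>(i, k). W p i k) = (\<lambda>(i, k). W p0 i k)" by blast
  have "W p = W p0" if "p \<ge> p0" for p
  proof (intro ext)
    fix i k show "W p i k = W p0 i k" using fun_cong[OF p0[OF that], of "(i, k)"] by simp
  qed
  thus ?thesis by blast
qed

text \<open>\<open>V p\<close> is the bigraded submodule generated by the rows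
  \<open>i \<le> p\<close> of \<open>W\<close>. It increases with \<open>p\<close>, so it
  stabilises, and from then on each row of \<open>W\<close> is generated by its predecessor.\<close>

theorem biclosed_artin_rees:
  assumes W: "biclosed W"
  shows "\<exists>r. \<forall>i\<ge>r. \<forall>k. W (Suc i) k \<subseteq> ideal_smult R M m (W i k)"
proof -
  define V where "V p i k = (if i \<le> p then W i k else ideal_smult R M (ideal_power R m (i - p)) (W p k))" for p i k
  note sub = biclosedD(4)[OF W]
  note subc = submodule_subset[OF sub]
  have FM: "ideal_smult R M (ideal_power R m p) (F k) \<subseteq> carrier M" for p k
    by (rule submodule_subset[OF ideal_smult_submodule[OF mc submodule_subset[OF F_sub]]])
  have m1: "ideal_smult R M (ideal_power R m (Suc 0)) P = ideal_smult R M m P" for P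
    unfolding R.ideal_power_1[OF m] ..
  have mSuc: "ideal_smult R M (ideal_power R m (Suc j)) (W p k)
    = ideal_smult R M m (ideal_smult R M (ideal_power R m j) (W p k))" for j p k
    unfolding R.ideal_power_Suc'[OF m] by (rule ideal_smult_prod[OF m mi sub])
  have mSuc': "ideal_smult R M (ideal_power R m (Suc j)) (W p k)
    = ideal_smult R M (ideal_power R m j) (ideal_smult R M m (W p k))" for j p k
    unfolding R.ideal_power_Suc by (rule ideal_smult_prod[OF mi m sub])
  have mW: "ideal_smult R M m (W p k) \<subseteq> W (Suc p) k" for p k
    by (rule ideal_smult_least[OF sub]) (rule biclosedD(2)[OF W])
  have "biclosed (V p)" for p
    unfolding biclosed_def closed_def
  proof (intro conjI allI ballI impI)
    fix i k
    show "submodule R (V p i k) M" unfolding V_def using sub ideal_smult_submodule[OF mc subc] by simp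
    show "X l x \<in> V p i (Suc k)" if "l < n" "x \<in> V p i k" for l x
      using that biclosedD(5)[OF W that(1)]
        ideal_smult_X[OF that(1) mc subc[of p k] sub[of p "Suc k"] biclosedD(5)[OF W that(1)], of x]
      by (simp add: V_def split: if_splits)
    show "V p i k \<subseteq> ideal_smult R M (ideal_power R m i) (F k)"
    proof (cases "i \<le> p")
      case True
      thus ?thesis using biclosedD(3)[OF W] by (simp add: V_def)
    next
      case False
      have "ideal_smult R M (ideal_power R m (i - p)) (W p k)
        \<subseteq> ideal_smult R M (ideal_power R m (i - p)) (ideal_smult R M (ideal_power R m p) (F k))"
        by (rule ideal_smult_mono[OF subset_refl mc biclosedD(3)[OF W] FM])
      also have "\<dots> = ideal_smult R M (ideal_power R m (i - p + p)) (F k)"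
        unfolding R.ideal_power_add[OF m] by (rule ideal_smult_prod[OF mi mi F_sub, symmetric])
      finally show ?thesis using False by (simp add: V_def)
    qed
    fix a x assume a: "a \<in> m" and x: "x \<in> V p i k"
    show "a \<odot>\<^bsub>M\<^esub> x \<in> V p (Suc i) k"
    proof (cases "Suc i \<le> p")
      case True
      thus ?thesis using x biclosedD(2)[OF W a] by (simp add: V_def)
    next
      case False
      have "x \<in> ideal_smult R M (ideal_power R m (i - p)) (W p k)"
      proof (cases "i = p")
        case True
        thus ?thesis using x by (simp add: V_def R.ideal_power_0 ideal_smult_carrier[OF sub])
      qed (use x False in \<open>simp add: V_def\<close>)
      hence "a \<odot>\<^bsub>M\<^esub> x \<in> ideal_smult R M (ideal_power R m (Suc (i - p))) (W p k)"
        unfolding mSuc by (rule ideal_smultI[OF mc1 submodule_subset[OF ideal_smult_submodule[OF mc subc]] a])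
      thus ?thesis using False by (simp add: V_def Suc_diff_le)
    qed
  qed
  moreover have "V p i k \<subseteq> V (Suc p) i k" for p i k
  proof -
    consider "i \<le> p" | "i = Suc p" | j where "i = Suc (Suc p + j)" by (metis less_imp_Suc_add not_less_iff_gr_or_eq le_less_Suc_eq not_le)
    thus ?thesis
    proof cases
      case 2
      thus ?thesis using mW by (simp add: V_def m1)
    next
      case 3
      have "ideal_smult R M (ideal_power R m (Suc (Suc j))) (W p k)
        \<subseteq> ideal_smult R M (ideal_power R m (Suc j)) (W (Suc p) k)"
        unfolding mSuc'[of "Suc j"] by (rule ideal_smult_mono[OF subset_refl mc mW subc])
      thus ?thesis using 3 by (simp add: V_def)
    qed (simp add: V_def)
  qed
  ultimately obtain p0 where p0: "\<And>p. p \<ge> p0 \<Longrightarrow> V p = V p0" using biclosed_acc[of V] by blast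
  have "W (Suc i) k \<subseteq> ideal_smult R M m (W i k)" if "i \<ge> p0" for i k
  proof -
    have "V (Suc i) (Suc i) k = V i (Suc i) k" using p0[of "Suc i"] p0[of i] that by simp
    thus ?thesis by (simp add: V_def m1)
  qed
  thus ?thesis by blast
qed

text \<open>The same truncation as for \<open>biclosed_artin_rees\<close>, now in the direction of
  \<open>k\<close>, with the variables in place of \<open>m\<close>.\<close>

theorem biclosed_X_generation:
  assumes W: "biclosed W"
  shows "\<exists>K. \<forall>k\<ge>K. \<forall>i. W i (Suc k) \<subseteq> Xsum (W i k)"
proof -
  define V where "V p i k = (if k \<le> p then W i k else (Xsum ^^ (k - p)) (W i p))" for p i k
  note sub = biclosedD(4)[OF W]
  have subX: "submodule R ((Xsum ^^ j) (W i k)) M" for j i k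
    by (induction j) (auto simp: sub Xsum_submodule[OF submodule_subset])
  note subXc = submodule_subset[OF subX]
  have le: "(Xsum ^^ j) (W i k) \<subseteq> W i (k + j)" for j i k
  proof (induction j)
    case (Suc j)
    thus ?case using Xsum_mono[OF Suc submodule_subset[OF sub]] closed_Xsum[OF biclosedD(1)[OF W], of i "k + j"] by simp
  qed simp
  have le': "(Xsum ^^ Suc j) (W i p) \<subseteq> (Xsum ^^ j) (W i (Suc p))" for j i p
  proof (induction j)
    case 0
    show ?case using closed_Xsum[OF biclosedD(1)[OF W]] by simp
  next
    case (Suc j)
    show ?case using Xsum_mono[OF Suc subXc] by simp
  qed
  have mX: "a \<odot>\<^bsub>M\<^esub> x \<in> (Xsum ^^ j) (W (Suc i) k)" if "a \<in> m" "x \<in> (Xsum ^^ j) (W i k)" for a x j i k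
    using that(2)
  proof (induction j arbitrary: x)
    case 0
    thus ?case using biclosedD(2)[OF W that(1)] by simp
  next
    case (Suc j)
    have "a \<odot>\<^bsub>M\<^esub> x \<in> Xsum ((Xsum ^^ j) (W (Suc i) k))"
      by (rule Xsum_smult[OF _ subXc subX Suc.IH]) (use Suc.prems that(1) mc1 in auto)
    thus ?case by simp
  qed
  have "biclosed (V p)" for p
    unfolding biclosed_def closed_def
  proof (intro conjI allI ballI impI)
    fix i k
    show "submodule R (V p i k) M" using sub subX[of "k - p" i p] by (simp add: V_def)
    show "X l x \<in> V p i (Suc k)" if l: "l < n" and x: "x \<in> V p i k" for l x
    proof (cases "Suc k \<le> p")
      case True
      thus ?thesis using x biclosedD(5)[OF W l] by (simp add: V_def)
    next
      case False
      have "x \<in> (Xsum ^^ (k - p)) (W i p)"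
        using x False by (cases "k = p") (simp_all add: V_def)
      hence "X l x \<in> (Xsum ^^ Suc (k - p)) (W i p)" using XsumI[OF subXc l] by simp
      thus ?thesis using False by (simp add: V_def Suc_diff_le)
    qed
    show "V p i k \<subseteq> ideal_smult R M (ideal_power R m i) (F k)"
      using biclosedD(3)[OF W, of i k] order_trans[OF le[of "k - p" i p]] by (simp add: V_def)
    show "a \<odot>\<^bsub>M\<^esub> x \<in> V p (Suc i) k" if "a \<in> m" "x \<in> V p i k" for a x
      using that biclosedD(2)[OF W that(1)] mX[OF that(1), of x "k - p" i p] by (simp add: V_def split: if_splits)
  qed
  moreover have "V p i k \<subseteq> V (Suc p) i k" for p i k
  proof -
    consider "k \<le> p" | "k = Suc p" | j where "k = Suc (Suc p + j)" by (metis less_imp_Suc_add not_less_iff_gr_or_eq le_less_Suc_eq not_le)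
    thus ?thesis
    proof cases
      case 2
      thus ?thesis using le[of 1 i p] by (simp add: V_def)
    next
      case 3
      thus ?thesis using le'[of "Suc j" i p] by (simp add: V_def del: funpow.simps)
    qed (simp add: V_def)
  qed
  ultimately obtain p0 where p0: "\<And>p. p \<ge> p0 \<Longrightarrow> V p = V p0" using biclosed_acc[of V] by blast
  have "W i (Suc k) \<subseteq> Xsum (W i k)" if "k \<ge> p0" for i k
  proof -
    have "V (Suc k) i (Suc k) = V k i (Suc k)" using p0[of "Suc k"] p0[of k] that by simp
    thus ?thesis by (simp add: V_def)
  qed
  thus ?thesis by blast
qed

lemma biclosed_defects_eventually_constant:
  assumes W: "biclosed W"
  shows "\<exists>B K. \<forall>k\<ge>K. {i. \<not> W (Suc i) k \<subseteq> ideal_smult R M m (W i k)} = B"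
proof -
  define bad where "bad k = {i. \<not> W (Suc i) k \<subseteq> ideal_smult R M m (W i k)}" for k
  note sub = biclosedD(4)[OF W]
  obtain r where r: "\<And>i k. i \<ge> r \<Longrightarrow> W (Suc i) k \<subseteq> ideal_smult R M m (W i k)"
    using biclosed_artin_rees[OF W] by blast
  obtain K where K: "\<And>i k. k \<ge> K \<Longrightarrow> W i (Suc k) \<subseteq> Xsum (W i k)"
    using biclosed_X_generation[OF W] by blast
  have "bad k \<subseteq> {..<r}" for k using r not_less by (auto simp: bad_def)
  hence fin: "finite (bad k)" for k using finite_subset by blast
  \<comment> \<open>An exponent that is no defect at \<open>k\<close> is none at
    \<open>k + 1\<close>: writing \<open>X\<close> for \<open>Xsum\<close>, one has \<open>W (i+1)
    (k+1) \<subseteq> X W (i+1) k \<subseteq> X m W i k \<subseteq> m W i (k+1)\<close>.\<close>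
  have step: "bad (Suc k) \<subseteq> bad k" if "k \<ge> K" for k
  proof (rule subsetI, rule ccontr)
    fix i assume i: "i \<in> bad (Suc k)" "i \<notin> bad k"
    have s: "submodule R (ideal_smult R M m (W i (Suc k))) M"
      by (rule ideal_smult_submodule[OF mc1 submodule_subset[OF sub]])
    have "W (Suc i) (Suc k) \<subseteq> Xsum (W (Suc i) k)" using K[OF that] .
    also have "\<dots> \<subseteq> Xsum (ideal_smult R M m (W i k))"
      by (rule Xsum_mono) (use i(2) submodule_subset[OF ideal_smult_submodule[OF mc1 submodule_subset[OF sub]]] in
        \<open>auto simp: bad_def\<close>)
    also have "\<dots> \<subseteq> ideal_smult R M m (W i (Suc k))"
    proof (rule Xsum_least[OF s])
      fix l x assume l: "l < n" and x: "x \<in> ideal_smult R M m (W i k)"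
      show "X l x \<in> ideal_smult R M m (W i (Suc k))"
        by (rule ideal_smult_X[OF l mc1 submodule_subset[OF sub] sub biclosedD(5)[OF W l] x])
    qed
    finally show False using i(1) by (simp add: bad_def)
  qed
  have anti: "bad k \<subseteq> bad j" if "K \<le> j" "j \<le> k" for j k
    using that(2)
  proof (induction k rule: dec_induct)
    case (step k)
    thus ?case using \<open>\<And>k. K \<le> k \<Longrightarrow> bad (Suc k) \<subseteq> bad k\<close>[of k] that(1) by simp
  qed simp
  \<comment> \<open>In a decreasing sequence of finite sets, one of least cardinality is followed
    only by itself.\<close>
  define k0 where "k0 = arg_min (\<lambda>k. card (bad k)) (\<lambda>k. k \<ge> K)"
  have k0: "k0 \<ge> K" "\<And>k. k \<ge> K \<Longrightarrow> card (bad k0) \<le> card (bad k)"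
    using arg_min_natI[of "\<lambda>k. k \<ge> K" K "\<lambda>k. card (bad k)"] arg_min_nat_le[of "\<lambda>k. k \<ge> K" _ "\<lambda>k. card (bad k)"]
    by (auto simp: k0_def)
  have "bad k = bad k0" if "k \<ge> k0" for k
    by (rule card_seteq[OF fin anti[OF k0(1) that] k0(2)]) (use that k0(1) in simp)
  thus ?thesis unfolding bad_def by blast
qed

end

end

section \<open>Submodules of ideals and the classical Artin--Rees lemma\<close>

context cring
begin

lemma submodule_ideal_module:
  assumes "ideal J R"
  shows "submodule R P (ideal_module R J) \<longleftrightarrow> ideal P R \<and> P \<subseteq> J"
proof -
  interpret J: ideal J R by fact
  interpret M: module R "ideal_module R J" by (rule module_ideal[OF assms])
  have inv: "\<ominus>\<^bsub>ideal_module R J\<^esub> x = \<ominus> x" if "x \<in> J" for x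
    by (rule M.M.minus_equality) (use that J.a_inv_closed in \<open>auto simp: ideal_module_def l_neg\<close>)
  have eq: "M.M.add_sub P \<longleftrightarrow> add_sub P \<and> P \<subseteq> J"
  proof
    assume "M.M.add_sub P"
    note a = M.M.add_subD[OF this]
    have "\<ominus> x \<in> P" if "x \<in> P" for x using a(4)[OF that] inv[of x] a(1)[OF that] by (simp add: ideal_module_def)
    thus "add_sub P \<and> P \<subseteq> J" using a by (auto intro!: add_subI simp: ideal_module_def)
  next
    assume P: "add_sub P \<and> P \<subseteq> J"
    note a = add_subD[OF conjunct1[OF P]]
    have "\<ominus>\<^bsub>ideal_module R J\<^esub> x \<in> P" if "x \<in> P" for x using a(4)[OF that] inv[of x] that P by auto
    thus "M.M.add_sub P" using a P by (intro M.M.add_subI) (auto simp: ideal_module_def)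
  qed
  have ms: "r \<odot>\<^bsub>ideal_module R J\<^esub> x = r \<otimes> x" for r x by (simp add: ideal_module_def)
  show ?thesis unfolding M.submodule_iff ideal_iff_submodule eq ms by blast
qed

lemma ideal_smult_ideal_module:
  assumes J: "ideal J R" and I: "ideal I R" and P: "ideal P R" "P \<subseteq> J"
  shows "ideal_smult R (ideal_module R J) I P = I \<cdot> P"
proof (rule antisym)
  interpret M: module R "ideal_module R J" by (rule module_ideal[OF J])
  interpret I: ideal I R by fact
  have P': "submodule R P (ideal_module R J)" using P submodule_ideal_module[OF J] by simp
  note Pc = M.submodule_subset[OF P']
  have "I \<cdot> P \<subseteq> J" using ideal_prod_inter[OF I P(1)] P(2) by blast
  hence "submodule R (I \<cdot> P) (ideal_module R J)"
    using submodule_ideal_module[OF J] ideal_prod_is_ideal[OF I P(1)] by simp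
  thus "ideal_smult R (ideal_module R J) I P \<subseteq> I \<cdot> P"
    by (rule M.ideal_smult_least) (auto simp: ideal_module_def intro: ideal_prod.prod)
  have s: "submodule R (ideal_smult R (ideal_module R J) I P) (ideal_module R J)"
    by (rule M.ideal_smult_submodule[OF I.a_subset Pc])
  show "I \<cdot> P \<subseteq> ideal_smult R (ideal_module R J) I P"
  proof
    fix x assume "x \<in> I \<cdot> P"
    thus "x \<in> ideal_smult R (ideal_module R J) I P"
    proof (induction rule: ideal_prod.induct)
      case (prod i j)
      thus ?case using M.ideal_smultI[OF I.a_subset Pc] by (force simp: ideal_module_def)
    next
      case (sum s t)
      thus ?case using M.submoduleD(3)[OF s] by (force simp: ideal_module_def)
    qed
  qed
qed

end

text \<open>The free module of rank one. A single variable acting as the identity makes every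
  component \<open>F k\<close> equal to \<open>R\<close>, so that \<open>W\<close> does not depend
  on \<open>k\<close>, and the statement about rows becomes the classical lemma in its weak form,
  with \<open>m^j N\<close> on the right.\<close>

theorem (in cring) artin_rees_ideal:
  assumes R: "noetherian_ring R" and m: "ideal m R" and N: "ideal N R"
  shows "\<exists>r. \<forall>j. N \<inter> ideal_power R m (j + r) \<subseteq> ideal_power R m j \<cdot> N"
proof -
  let ?M = "ideal_module R (carrier R)"
  have c: "carrier ?M = carrier R" by (simp add: ideal_module_def)
  note sm = submodule_ideal_module[OF oneideal]
  note mpow = ideal_power_ideal[OF m]
  interpret M: module R ?M by (rule module_ideal[OF oneideal])
  interpret polynomial_module R ?M 1 "\<lambda>_ x. x" "\<lambda>_. carrier R" "{(0, \<one>)}"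
  proof (intro polynomial_module.intro polynomial_module_axioms.intro module_ideal[OF oneideal])
    fix P k assume P: "\<And>k. submodule R (P k) ?M"
      "\<And>l k x. \<lbrakk>l < (1::nat); x \<in> P k\<rbrakk> \<Longrightarrow> x \<in> P (Suc k)" "\<And>d e. (d, e) \<in> {(0, \<one>)} \<Longrightarrow> e \<in> P d"
    have "\<one> \<in> P k" by (induction k) (use P(2)[of 0] P(3) in auto)
    thus "carrier R \<subseteq> P k" using ideal.one_imp_carrier[of "P k" R] P(1)[of k] sm by simp
  qed (use R sm oneideal c in \<open>auto simp: M.M.endo_def\<close>)
  define W where "W i k = N \<inter> ideal_power R m i" for i :: nat and k :: nat
  have Wi: "ideal (W i k) R" for i k unfolding W_def by (rule i_intersect[OF N mpow])
  have cF: "ideal_smult R ?M (ideal_power R m i) (carrier R) = ideal_power R m i" for i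
    by (simp add: ideal_smult_ideal_module[OF oneideal mpow oneideal] ideal_prod_one[OF mpow])
  have "biclosed m W"
    unfolding biclosed_def[OF m] closed_def
  proof (intro conjI allI ballI impI)
    show "submodule R (W i k) ?M" for i k
      using Wi additive_subgroup.a_subset[OF ideal.axioms(1)[OF Wi]] sm by simp
    show "W i k \<subseteq> ideal_smult R ?M (ideal_power R m i) (carrier R)" for i k
      unfolding cF by (simp add: W_def)
    show "a \<odot>\<^bsub>?M\<^esub> x \<in> W (Suc i) k" if "a \<in> m" "x \<in> W i k" for a x i k
      using that ideal_prod.prod[of a m x] ideal.I_l_closed[OF N, of x a] ideal.Icarr[OF m]
      by (auto simp: W_def ideal_module_def ideal_power_Suc'[OF m])
  qed (simp add: W_def)
  from biclosed_artin_rees[OF m this] obtain r where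
    r: "\<And>i k. i \<ge> r \<Longrightarrow> W (Suc i) k \<subseteq> ideal_smult R ?M m (W i k)" by blast
  have e: "ideal_smult R ?M m (W i k) = m \<cdot> W i k" for i k
    by (rule ideal_smult_ideal_module[OF oneideal m Wi additive_subgroup.a_subset[OF ideal.axioms(1)[OF Wi]]])
  have "N \<inter> ideal_power R m (j + r) \<subseteq> ideal_power R m j \<cdot> N" for j
  proof (induction j)
    case 0
    show ?case using ideal_prod_one[OF N] ideal_prod_commute[OF N oneideal] by (simp add: ideal_power_0)
  next
    case (Suc j)
    have "N \<inter> ideal_power R m (Suc j + r) \<subseteq> m \<cdot> W (j + r) 0"
      using r[of "j + r" 0] unfolding e by (simp add: W_def)
    also have "\<dots> \<subseteq> m \<cdot> (ideal_power R m j \<cdot> N)" unfolding W_def by (rule ideal_prod_mono_right[OF Suc])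
    also have "\<dots> = ideal_power R m (Suc j) \<cdot> N"
      unfolding ideal_power_Suc'[OF m] by (rule ideal_prod_assoc[OF m mpow N, symmetric])
    finally show ?case .
  qed
  thus ?thesis by blast
qed

lemma mod_homD:
  assumes "mod_hom R M N f"
  shows "x \<in> carrier M \<Longrightarrow> f x \<in> carrier N"
    "x \<in> carrier M \<Longrightarrow> y \<in> carrier M \<Longrightarrow> f (x \<oplus>\<^bsub>M\<^esub> y) = f x \<oplus>\<^bsub>N\<^esub> f y"
    "r \<in> carrier R \<Longrightarrow> x \<in> carrier M \<Longrightarrow> f (r \<odot>\<^bsub>M\<^esub> x) = r \<odot>\<^bsub>N\<^esub> f x"
    "f \<zero>\<^bsub>M\<^esub> = \<zero>\<^bsub>N\<^esub>"
    "x \<in> carrier M \<Longrightarrow> y \<in> carrier M \<Longrightarrow> f (x \<ominus>\<^bsub>M\<^esub> y) = f x \<ominus>\<^bsub>N\<^esub> f y"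
    "module R M" "module R N"
proof -
  interpret mod_hom R M N f by fact
  show "x \<in> carrier M \<Longrightarrow> f x \<in> carrier N"
    "x \<in> carrier M \<Longrightarrow> y \<in> carrier M \<Longrightarrow> f (x \<oplus>\<^bsub>M\<^esub> y) = f x \<oplus>\<^bsub>N\<^esub> f y"
    "r \<in> carrier R \<Longrightarrow> x \<in> carrier M \<Longrightarrow> f (r \<odot>\<^bsub>M\<^esub> x) = r \<odot>\<^bsub>N\<^esub> f x"
    "f \<zero>\<^bsub>M\<^esub> = \<zero>\<^bsub>N\<^esub>"
    "x \<in> carrier M \<Longrightarrow> y \<in> carrier M \<Longrightarrow> f (x \<ominus>\<^bsub>M\<^esub> y) = f x \<ominus>\<^bsub>N\<^esub> f y" by auto
  show "module R M" "module R N" by unfold_locales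
qed

section \<open>Free modules: coordinates and lifting\<close>

context module
begin

abbreviation Rmod :: "('a, 'a) module"
  where "Rmod \<equiv> ideal_module R (carrier R)"

lemma Rmod_simps [simp]:
  "carrier Rmod = carrier R" "add Rmod = add R" "zero Rmod = zero R" "smult Rmod = monoid.mult R"
  by (simp_all add: ideal_module_def)

lemma module_Rmod: "module R Rmod"
  by (rule R.module_ideal[OF R.oneideal])

lemma lincomb_inj_on_basis:
  assumes B: "finite B" "module_basis R M B"
    and a: "a \<in> B \<rightarrow> carrier R" "a' \<in> B \<rightarrow> carrier R" and eq: "lincomb a B = lincomb a' B"
    and b: "b \<in> B"
  shows "a b = a' b"
proof (rule ccontr)
  assume ne: "a b \<noteq> a' b"
  have Bc: "B \<subseteq> carrier M" and li: "\<not> lin_dep B" using B(2) by (auto simp: module_basis_def)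
  have "lincomb (\<lambda>v. a v \<ominus> a' v) B = lincomb a B \<ominus>\<^bsub>M\<^esub> lincomb a' B"
    by (rule lincomb_diff[OF B(1) Bc a])
  also have "\<dots> = \<zero>\<^bsub>M\<^esub>" using eq lincomb_closed[OF Bc a(2)] by (simp add: a_minus_def M.r_neg)
  finally have 0: "lincomb (\<lambda>v. a v \<ominus> a' v) B = \<zero>\<^bsub>M\<^esub>" .
  have "a b \<in> carrier R" "a' b \<in> carrier R" using a b by auto
  hence nz: "a b \<ominus> a' b \<noteq> \<zero>" using ne by simp
  have "lin_dep B"
    by (rule lin_dep_crit[OF B(1) subset_refl _ b _ 0]) (use a nz in auto)
  thus False using li by contradiction
qed

text \<open>Uniqueness of coefficients makes any choice of coordinates linear.\<close>

lemma basis_coordinates: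
  assumes B: "finite B" "module_basis R M B"
  obtains \<pi> where "\<And>b. b \<in> B \<Longrightarrow> mod_hom R M Rmod (\<pi> b)"
    "\<And>x. x \<in> carrier M \<Longrightarrow> lincomb (\<lambda>b. \<pi> b x) B = x"
    "\<And>b b'. b \<in> B \<Longrightarrow> b' \<in> B \<Longrightarrow> \<pi> b b' = (if b = b' then \<one> else \<zero>)"
proof -
  have Bc: "B \<subseteq> carrier M" and span: "span B = carrier M" using B(2) by (auto simp: module_basis_def)
  have "\<exists>a. x \<in> carrier M \<longrightarrow> a \<in> B \<rightarrow> carrier R \<and> lincomb a B = x" for x
    using finite_in_span[OF B(1) Bc, of x] span by auto
  then obtain c where c: "\<And>x. x \<in> carrier M \<Longrightarrow> c x \<in> B \<rightarrow> carrier R"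
    "\<And>x. x \<in> carrier M \<Longrightarrow> lincomb (c x) B = x" by metis
  have uniq: "c x b = a b" if "x \<in> carrier M" "a \<in> B \<rightarrow> carrier R" "lincomb a B = x" "b \<in> B" for x a b
    by (rule lincomb_inj_on_basis[OF B c(1) that(2) _ that(4)]) (use that c(2) in auto)
  show ?thesis
  proof (rule that[of "\<lambda>b x. c x b"])
    fix b assume b: "b \<in> B"
    have "c (x \<oplus>\<^bsub>M\<^esub> y) b = c x b \<oplus> c y b" if "x \<in> carrier M" "y \<in> carrier M" for x y
    proof (rule uniq[OF _ _ _ b])
      show "lincomb (\<lambda>v. c x v \<oplus> c y v) B = x \<oplus>\<^bsub>M\<^esub> y"
        using lincomb_sum[OF B(1) Bc c(1)[OF that(1)] c(1)[OF that(2)]] c(2) that by simp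
    qed (use that c(1)[OF that(1)] c(1)[OF that(2)] in auto)
    moreover have "c (r \<odot>\<^bsub>M\<^esub> x) b = r \<otimes> c x b" if "r \<in> carrier R" "x \<in> carrier M" for r x
    proof (rule uniq[OF _ _ _ b])
      show "lincomb (\<lambda>v. r \<otimes> c x v) B = r \<odot>\<^bsub>M\<^esub> x"
        using lincomb_smult[OF Bc c(1)[OF that(2)] that(1)] c(2) that by simp
    qed (use that c(1)[OF that(2)] in auto)
    moreover have "c x b \<in> carrier R" if "x \<in> carrier M" for x using c(1)[OF that] b by auto
    ultimately show "mod_hom R M Rmod (\<lambda>x. c x b)"
      by (intro mod_hom.intro module_axioms module_Rmod mod_hom_axioms.intro)
        (auto simp: module_hom_def)
  next
    fix x assume "x \<in> carrier M" thus "lincomb (\<lambda>b. c x b) B = x" using c(2) by simp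
  next
    fix b b' assume b: "b \<in> B" "b' \<in> B"
    show "c b' b = (if b = b' then \<one> else \<zero>)"
    proof (rule uniq[OF _ _ _ b(1)])
      have "lincomb (\<lambda>v. if v = b' then \<one> else \<zero>) B
        = (if b' = b' then \<one> else \<zero>) \<odot>\<^bsub>M\<^esub> b' \<oplus>\<^bsub>M\<^esub> lincomb (\<lambda>v. if v = b' then \<one> else \<zero>) (B - {b'})"
        by (rule lincomb_del2[OF B(1) Bc _ b(2)]) auto
      also have "lincomb (\<lambda>v. if v = b' then \<one> else \<zero>) (B - {b'}) = lincomb (\<lambda>v. \<zero>) (B - {b'})"
        by (rule lincomb_cong) (use Bc in auto)
      also have "lincomb (\<lambda>v. \<zero>) (B - {b'}) = \<zero>\<^bsub>M\<^esub>"
        unfolding lincomb_def by (rule M.finsum_all0) (use Bc in auto)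
      finally show "lincomb (\<lambda>v. if v = b' then \<one> else \<zero>) B = b'" using b Bc by auto
    qed (use b Bc in auto)
  qed
qed

lemma mod_homI:
  assumes "module R N" "\<And>x. x \<in> carrier M \<Longrightarrow> f x \<in> carrier N"
    "\<And>x y. x \<in> carrier M \<Longrightarrow> y \<in> carrier M \<Longrightarrow> f (x \<oplus>\<^bsub>M\<^esub> y) = f x \<oplus>\<^bsub>N\<^esub> f y"
    "\<And>r x. r \<in> carrier R \<Longrightarrow> x \<in> carrier M \<Longrightarrow> f (r \<odot>\<^bsub>M\<^esub> x) = r \<odot>\<^bsub>N\<^esub> f x"
  shows "mod_hom R M N f"
  by (intro mod_hom.intro module_axioms assms(1) mod_hom_axioms.intro)
    (use assms in \<open>auto simp: module_hom_def\<close>)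

lemma hom_eq_on_basis:
  assumes B: "module_basis R M B" and f: "mod_hom R M N f" and g: "mod_hom R M N g"
    and eq: "\<And>b. b \<in> B \<Longrightarrow> f b = g b" and x: "x \<in> carrier M"
  shows "f x = g x"
proof -
  interpret f: mod_hom R M N f by fact
  interpret g: mod_hom R M N g by fact
  have "submodule R {x \<in> carrier M. f x = g x} M"
    unfolding submodule_iff by (intro conjI M.add_subI) auto
  moreover have "B \<subseteq> {x \<in> carrier M. f x = g x}" using B eq by (auto simp: module_basis_def)
  ultimately have "span B \<subseteq> {x \<in> carrier M. f x = g x}" by (intro span_is_subset)
  thus ?thesis using x B by (auto simp: module_basis_def)
qed

lemma basis_hom:
  assumes B: "finite B" "module_basis R M B" and N: "module R N" and g: "\<And>b. b \<in> B \<Longrightarrow> g b \<in> carrier N"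
  shows "\<exists>h. mod_hom R M N h \<and> (\<forall>b\<in>B. h b = g b)"
proof -
  interpret N: module R N by fact
  obtain \<pi> where \<pi>: "\<And>b. b \<in> B \<Longrightarrow> mod_hom R M Rmod (\<pi> b)"
    "\<And>b b'. b \<in> B \<Longrightarrow> b' \<in> B \<Longrightarrow> \<pi> b b' = (if b = b' then \<one> else \<zero>)"
    using basis_coordinates[OF B] by metis
  have c: "\<pi> b x \<in> carrier R" if "b \<in> B" "x \<in> carrier M" for b x
    using mod_homD(1)[OF \<pi>(1)[OF that(1)] that(2)] by simp
  have a: "\<pi> b (x \<oplus>\<^bsub>M\<^esub> y) = \<pi> b x \<oplus> \<pi> b y" if "b \<in> B" "x \<in> carrier M" "y \<in> carrier M" for b x y
    using mod_homD(2)[OF \<pi>(1)[OF that(1)] that(2,3)] by simp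
  have s: "\<pi> b (r \<odot>\<^bsub>M\<^esub> x) = r \<otimes> \<pi> b x" if "b \<in> B" "r \<in> carrier R" "x \<in> carrier M" for b r x
    using mod_homD(3)[OF \<pi>(1)[OF that(1)] that(2,3)] by simp
  define h where "h x = (\<Oplus>\<^bsub>N\<^esub>b\<in>B. \<pi> b x \<odot>\<^bsub>N\<^esub> g b)" for x
  have "mod_hom R M N h"
  proof (rule mod_homI[OF N])
    show "h x \<in> carrier N" if "x \<in> carrier M" for x
      unfolding h_def by (rule N.M.finsum_closed) (use c g that in auto)
    fix x assume x: "x \<in> carrier M"
    show "h (x \<oplus>\<^bsub>M\<^esub> y) = h x \<oplus>\<^bsub>N\<^esub> h y" if y: "y \<in> carrier M" for y
    proof -
      have "h (x \<oplus>\<^bsub>M\<^esub> y) = (\<Oplus>\<^bsub>N\<^esub>b\<in>B. \<pi> b x \<odot>\<^bsub>N\<^esub> g b \<oplus>\<^bsub>N\<^esub> \<pi> b y \<odot>\<^bsub>N\<^esub> g b)"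
        unfolding h_def by (rule N.M.finsum_cong') (use c g a x y in \<open>auto simp: N.smult_l_distr\<close>)
      thus ?thesis unfolding h_def using c g x y by (subst (asm) N.M.finsum_addf) auto
    qed
    show "h (r \<odot>\<^bsub>M\<^esub> x) = r \<odot>\<^bsub>N\<^esub> h x" if r: "r \<in> carrier R" for r
    proof -
      have "h (r \<odot>\<^bsub>M\<^esub> x) = (\<Oplus>\<^bsub>N\<^esub>b\<in>B. r \<odot>\<^bsub>N\<^esub> (\<pi> b x \<odot>\<^bsub>N\<^esub> g b))"
        unfolding h_def by (rule N.M.finsum_cong') (use c g s x r in \<open>auto simp: N.smult_assoc1\<close>)
      also have "\<dots> = r \<odot>\<^bsub>N\<^esub> h x"
        unfolding h_def by (rule N.finsum_smult[symmetric]) (use c g x r in auto)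
      finally show ?thesis .
    qed
  qed
  moreover have "h b' = g b'" if b': "b' \<in> B" for b'
  proof -
    have "h b' = (\<Oplus>\<^bsub>N\<^esub>b\<in>B. if b = b' then g b else \<zero>\<^bsub>N\<^esub>)"
      unfolding h_def by (rule N.M.finsum_cong') (use \<pi>(2) b' g in auto)
    also have "\<dots> = g b'" by (rule N.M.add.finprod_singleton_swap[OF b' B(1)]) (use g in auto)
    finally show ?thesis .
  qed
  ultimately show ?thesis by blast
qed

text \<open>Free modules are projective: preimages are chosen for the images of the basis
  elements.\<close>

lemma free_lift:
  assumes B: "finite B" "module_basis R M B" and f: "mod_hom R M C f" and g: "mod_hom R A C g"
    and im: "\<And>x. x \<in> carrier M \<Longrightarrow> f x \<in> g ` carrier A"
  shows "\<exists>h. mod_hom R M A h \<and> (\<forall>x\<in>carrier M. g (h x) = f x)"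
proof -
  interpret f: mod_hom R M C f by fact
  interpret g: mod_hom R A C g by fact
  have Bc: "B \<subseteq> carrier M" using B(2) by (auto simp: module_basis_def)
  have "\<forall>b\<in>B. \<exists>a. a \<in> carrier A \<and> g a = f b" using im Bc by (metis imageE subsetD)
  then obtain k where k: "\<And>b. b \<in> B \<Longrightarrow> k b \<in> carrier A" "\<And>b. b \<in> B \<Longrightarrow> g (k b) = f b" by metis
  obtain h where h: "mod_hom R M A h" "\<And>b. b \<in> B \<Longrightarrow> h b = k b"
    using basis_hom[OF B g.M.module_axioms, of k] k(1) by blast
  interpret h: mod_hom R M A h by fact
  have gh: "mod_hom R M C (\<lambda>x. g (h x))" by (rule mod_homI[OF f.N.module_axioms]) auto
  have "g (h x) = f x" if "x \<in> carrier M" for x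
    using hom_eq_on_basis[OF B(2) gh f _ that] h(2) k(2) by simp
  thus ?thesis using h(1) by blast
qed

end

section \<open>Comparison of free resolutions\<close>

lemma free_resolutionD:
  assumes "free_resolution R M F \<phi> \<epsilon>"
  shows "module R (F j)" "\<exists>B. finite B \<and> module_basis R (F j) B" "mod_hom R (F 0) M \<epsilon>"
    "mod_hom R (F (Suc j)) (F j) (\<phi> (Suc j))" "\<epsilon> ` carrier (F 0) = carrier M"
    "\<phi> (Suc 0) ` carrier (F (Suc 0)) = {x \<in> carrier (F 0). \<epsilon> x = \<zero>\<^bsub>M\<^esub>}"
    "\<phi> (Suc (Suc j)) ` carrier (F (Suc (Suc j))) = {x \<in> carrier (F (Suc j)). \<phi> (Suc j) x = \<zero>\<^bsub>F j\<^esub>}"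
  using assms unfolding free_resolution_def a_kernel_def kernel_def
  by (simp_all, fastforce+)

lemma mod_hom_comp:
  assumes "mod_hom R A B f" "mod_hom R B C g"
  shows "mod_hom R A C (\<lambda>x. g (f x))"
  by (rule module.mod_homI[OF mod_homD(6)[OF assms(1)] mod_homD(7)[OF assms(2)]])
    (simp_all add: mod_homD(1-3)[OF assms(1)] mod_homD(1-3)[OF assms(2)])

lemma mod_hom_diff:
  assumes "mod_hom R A B f" "mod_hom R A B g"
  shows "mod_hom R A B (\<lambda>x. f x \<ominus>\<^bsub>B\<^esub> g x)"
proof -
  interpret B: module R B by (rule mod_homD(7)[OF assms(1)])
  note f = mod_homD(1-3)[OF assms(1)] and g = mod_homD(1-3)[OF assms(2)]
  show ?thesis
  proof (rule module.mod_homI[OF mod_homD(6)[OF assms(1)] B.module_axioms])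
    fix x assume x: "x \<in> carrier A"
    show "f x \<ominus>\<^bsub>B\<^esub> g x \<in> carrier B" using f(1)[OF x] g(1)[OF x] by simp
    show "f (x \<oplus>\<^bsub>A\<^esub> y) \<ominus>\<^bsub>B\<^esub> g (x \<oplus>\<^bsub>A\<^esub> y) = f x \<ominus>\<^bsub>B\<^esub> g x \<oplus>\<^bsub>B\<^esub> (f y \<ominus>\<^bsub>B\<^esub> g y)"
      if y: "y \<in> carrier A" for y
      unfolding f(2)[OF x y] g(2)[OF x y] a_minus_def
      using f(1)[OF x] g(1)[OF x] f(1)[OF y] g(1)[OF y] by (simp add: B.M.minus_add B.M.a_ac)
    show "f (r \<odot>\<^bsub>A\<^esub> x) \<ominus>\<^bsub>B\<^esub> g (r \<odot>\<^bsub>A\<^esub> x) = r \<odot>\<^bsub>B\<^esub> (f x \<ominus>\<^bsub>B\<^esub> g x)" if r: "r \<in> carrier R" for r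
      unfolding f(3)[OF r x] g(3)[OF r x] a_minus_def
      using f(1)[OF x] g(1)[OF x] r by (simp add: B.smult_r_distr B.smult_r_minus)
  qed
qed

lemma mod_hom_id: "module R M \<Longrightarrow> mod_hom R M M (\<lambda>x. x)"
  by (rule module.mod_homI) auto

lemma free_resolution_lift:
  assumes "free_resolution R M F \<phi> \<epsilon>" "mod_hom R (F j) C f" "mod_hom R A C g"
    and "\<And>x. x \<in> carrier (F j) \<Longrightarrow> f x \<in> g ` carrier A"
  shows "\<exists>h. mod_hom R (F j) A h \<and> (\<forall>x\<in>carrier (F j). g (h x) = f x)"
proof -
  obtain B where "finite B" "module_basis R (F j) B" using free_resolutionD(2)[OF assms(1)] by blast
  thus ?thesis using module.free_lift[OF free_resolutionD(1)[OF assms(1)] _ _ assms(2-4)] by blast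
qed

text \<open>Lifting along free modules, degree by degree. The choice in degree \<open>j\<close> must
  already guarantee that degree \<open>j + 1\<close> can be lifted; this is the second clause of
  \<open>P\<close>, and exactness of \<open>F'\<close> provides it.\<close>

lemma resolution_chain_map:
  assumes F: "free_resolution R M F \<phi> \<epsilon>" and F': "free_resolution R M F' \<phi>' \<epsilon>'"
  obtains \<alpha> where "\<And>j. mod_hom R (F j) (F' j) (\<alpha> j)"
    "\<And>x. x \<in> carrier (F 0) \<Longrightarrow> \<epsilon>' (\<alpha> 0 x) = \<epsilon> x"
    "\<And>j x. x \<in> carrier (F (Suc j)) \<Longrightarrow> \<phi>' (Suc j) (\<alpha> (Suc j) x) = \<alpha> j (\<phi> (Suc j) x)"
proof -
  note D = free_resolutionD[OF F] and D' = free_resolutionD[OF F']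
  define P where "P j a \<longleftrightarrow> mod_hom R (F j) (F' j) a \<and>
    (\<forall>x\<in>carrier (F (Suc j)). a (\<phi> (Suc j) x) \<in> \<phi>' (Suc j) ` carrier (F' (Suc j))) \<and>
    (j = 0 \<longrightarrow> (\<forall>x\<in>carrier (F 0). \<epsilon>' (a x) = \<epsilon> x))" for j a
  define Q where "Q j a a' \<longleftrightarrow> (\<forall>x\<in>carrier (F (Suc j)). \<phi>' (Suc j) (a' x) = a (\<phi> (Suc j) x))" for j a a'
  have "\<exists>\<alpha>. \<forall>j. P j (\<alpha> j) \<and> Q j (\<alpha> j) (\<alpha> (Suc j))"
  proof (rule dependent_nat_choice)
    obtain a where a: "mod_hom R (F 0) (F' 0) a" "\<And>x. x \<in> carrier (F 0) \<Longrightarrow> \<epsilon>' (a x) = \<epsilon> x"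
      using free_resolution_lift[OF F D(3) D'(3)] mod_homD(1)[OF D(3)] D'(5) by blast
    have "a (\<phi> (Suc 0) x) \<in> \<phi>' (Suc 0) ` carrier (F' (Suc 0))" if x: "x \<in> carrier (F (Suc 0))" for x
    proof -
      have p: "\<phi> (Suc 0) x \<in> carrier (F 0)" "\<epsilon> (\<phi> (Suc 0) x) = \<zero>\<^bsub>M\<^esub>" using D(6) x by blast+
      thus ?thesis unfolding D'(6) using mod_homD(1)[OF a(1) p(1)] a(2)[OF p(1)] by simp
    qed
    thus "\<exists>a. P 0 a" unfolding P_def using a by blast
  next
    fix a j assume a: "P j a"
    have ah: "mod_hom R (F j) (F' j) a" using a by (simp add: P_def)
    obtain b where b: "mod_hom R (F (Suc j)) (F' (Suc j)) b"
      "\<And>x. x \<in> carrier (F (Suc j)) \<Longrightarrow> \<phi>' (Suc j) (b x) = a (\<phi> (Suc j) x)"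
      using free_resolution_lift[OF F mod_hom_comp[OF D(4) ah] D'(4)] a unfolding P_def by blast
    have "b (\<phi> (Suc (Suc j)) x) \<in> \<phi>' (Suc (Suc j)) ` carrier (F' (Suc (Suc j)))"
      if x: "x \<in> carrier (F (Suc (Suc j)))" for x
    proof -
      have p: "\<phi> (Suc (Suc j)) x \<in> carrier (F (Suc j))" "\<phi> (Suc j) (\<phi> (Suc (Suc j)) x) = \<zero>\<^bsub>F j\<^esub>"
        using D(7)[of j] x by blast+
      thus ?thesis unfolding D'(7) using mod_homD(1)[OF b(1) p(1)] b(2)[OF p(1)] mod_homD(4)[OF ah] by simp
    qed
    thus "\<exists>b. P (Suc j) b \<and> Q j a b" unfolding P_def Q_def using b by blast
  qed
  then obtain \<alpha> where \<alpha>: "\<And>j. P j (\<alpha> j)" "\<And>j. Q j (\<alpha> j) (\<alpha> (Suc j))" by blast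
  show ?thesis
    by (rule that[of \<alpha>]) (use \<alpha> in \<open>auto simp: P_def Q_def\<close>)
qed

text \<open>A chain endomorphism lifting \<open>0\<close> is null-homotopic; only the consequence on cycles is recorded.\<close>

lemma resolution_null_homotopy:
  assumes F: "free_resolution R M F \<phi> \<epsilon>"
    and \<gamma>: "\<And>j. mod_hom R (F j) (F j) (\<gamma> j)"
      "\<And>x. x \<in> carrier (F 0) \<Longrightarrow> \<epsilon> (\<gamma> 0 x) = \<zero>\<^bsub>M\<^esub>"
      "\<And>j x. x \<in> carrier (F (Suc j)) \<Longrightarrow> \<phi> (Suc j) (\<gamma> (Suc j) x) = \<gamma> j (\<phi> (Suc j) x)"
  shows "\<exists>h. mod_hom R (F j) (F (Suc j)) h \<and>
    (\<forall>y\<in>carrier (F (Suc j)). \<phi> (Suc j) (h (\<phi> (Suc j) y)) = \<gamma> j (\<phi> (Suc j) y))"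
proof -
  note D = free_resolutionD[OF F]
  have "\<exists>h. mod_hom R (F j) (F (Suc j)) h \<and>
    (\<forall>y\<in>carrier (F (Suc j)). \<phi> (Suc j) (h (\<phi> (Suc j) y)) = \<gamma> j (\<phi> (Suc j) y))" for j
  proof (induction j)
    case 0
    have "\<gamma> 0 x \<in> \<phi> (Suc 0) ` carrier (F (Suc 0))" if "x \<in> carrier (F 0)" for x
      unfolding D(6) using \<gamma>(2)[OF that] mod_homD(1)[OF \<gamma>(1) that] by simp
    then obtain h where "mod_hom R (F 0) (F (Suc 0)) h" "\<forall>x\<in>carrier (F 0). \<phi> (Suc 0) (h x) = \<gamma> 0 x"
      using free_resolution_lift[OF F \<gamma>(1) D(4)] by blast
    thus ?case using mod_homD(1)[OF D(4)] by blast
  next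
    case (Suc j)
    then obtain h where h: "mod_hom R (F j) (F (Suc j)) h"
      "\<And>y. y \<in> carrier (F (Suc j)) \<Longrightarrow> \<phi> (Suc j) (h (\<phi> (Suc j) y)) = \<gamma> j (\<phi> (Suc j) y)" by blast
    interpret FS: module R "F (Suc j)" by (rule D(1))
    interpret Fj: module R "F j" by (rule D(1))
    \<comment> \<open>\<open>\<gamma> - h \<phi>\<close> takes values in the cycles, by the relation
      known for \<open>h\<close> on boundaries, so it lifts to the next homotopy.\<close>
    let ?f = "\<lambda>x. \<gamma> (Suc j) x \<ominus>\<^bsub>F (Suc j)\<^esub> h (\<phi> (Suc j) x)"
    have f: "mod_hom R (F (Suc j)) (F (Suc j)) ?f"
      by (rule mod_hom_diff[OF \<gamma>(1) mod_hom_comp[OF D(4) h(1)]])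
    have "?f x \<in> \<phi> (Suc (Suc j)) ` carrier (F (Suc (Suc j)))" if x: "x \<in> carrier (F (Suc j))" for x
    proof -
      have p: "\<phi> (Suc j) x \<in> carrier (F j)" by (rule mod_homD(1)[OF D(4) x])
      have c: "\<gamma> (Suc j) x \<in> carrier (F (Suc j))" "h (\<phi> (Suc j) x) \<in> carrier (F (Suc j))"
        using mod_homD(1)[OF \<gamma>(1) x] mod_homD(1)[OF h(1) p] by auto
      have "\<phi> (Suc j) (?f x) = \<gamma> j (\<phi> (Suc j) x) \<ominus>\<^bsub>F j\<^esub> \<gamma> j (\<phi> (Suc j) x)"
        using mod_homD(5)[OF D(4) c] \<gamma>(3)[OF x] h(2)[OF x] by simp
      also have "\<dots> = \<zero>\<^bsub>F j\<^esub>" using mod_homD(1)[OF \<gamma>(1) p] by (simp add: a_minus_def Fj.M.r_neg)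
      finally show ?thesis unfolding D(7) using c by simp
    qed
    then obtain k where k: "mod_hom R (F (Suc j)) (F (Suc (Suc j))) k"
      "\<And>x. x \<in> carrier (F (Suc j)) \<Longrightarrow> \<phi> (Suc (Suc j)) (k x) = ?f x"
      using free_resolution_lift[OF F f D(4)] by blast
    have "\<phi> (Suc (Suc j)) (k (\<phi> (Suc (Suc j)) y)) = \<gamma> (Suc j) (\<phi> (Suc (Suc j)) y)"
      if "y \<in> carrier (F (Suc (Suc j)))" for y
    proof -
      have p: "\<phi> (Suc (Suc j)) y \<in> carrier (F (Suc j))" "\<phi> (Suc j) (\<phi> (Suc (Suc j)) y) = \<zero>\<^bsub>F j\<^esub>"
        using D(7)[of j] that by blast+
      have c: "\<gamma> (Suc j) (\<phi> (Suc (Suc j)) y) \<in> carrier (F (Suc j))" by (rule mod_homD(1)[OF \<gamma>(1) p(1)])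
      show ?thesis using k(2)[OF p(1)] p(2) mod_homD(4)[OF h(1)] c by (simp add: a_minus_def)
    qed
    thus ?case using k(1) by blast
  qed
  thus ?thesis .
qed

text \<open>The exponents at which the condition on consecutive powers fails. The Artin--Rees number
  is the least \<open>r\<close> exceeding all of them, but it is this set, exponent by exponent,
  that turns out to be independent of the resolution.\<close>

definition defects :: "('a, 'e) ring_scheme \<Rightarrow> 'a set \<Rightarrow> 'b set \<Rightarrow> ('a, 'b, 'f) module_scheme \<Rightarrow> nat set"
  where "defects R m N M = {i. \<not> N \<inter> ideal_smult R M (ideal_power R m (Suc i)) (carrier M)
    \<subseteq> ideal_smult R M m (N \<inter> ideal_smult R M (ideal_power R m i) (carrier M))}"

lemma (in module) artin_rees_number_defects:
  assumes "ideal m R" "submodule R N M"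
  shows "artin_rees_number R m N M = (LEAST r. \<forall>i\<ge>r. i \<notin> defects R m N M)"
  unfolding artin_rees_number_eq[OF assms] defects_def by simp

lemma submodule_image:
  assumes f: "mod_hom R M N f"
  shows "submodule R (f ` carrier M) N"
proof -
  interpret mod_hom R M N f by fact
  show ?thesis using im_is_submodule by (simp add: im_def)
qed

lemma ideal_smult_hom_mono:
  assumes f: "mod_hom R M N f" and J: "J \<subseteq> carrier R" and x: "x \<in> ideal_smult R M J P" and P: "P \<subseteq> carrier M"
    and Q: "Q \<subseteq> carrier N" "\<And>y. y \<in> P \<Longrightarrow> f y \<in> Q"
  shows "f x \<in> ideal_smult R N J Q"
proof -
  interpret M: module R M by (rule mod_homD(6)[OF f])
  interpret N: module R N by (rule mod_homD(7)[OF f])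
  show ?thesis
    by (rule M.ideal_smult_hom[OF f J P x N.ideal_smult_submodule[OF J Q(1)]])
      (rule N.ideal_smultI[OF J Q(1) _ Q(2)])
qed

text \<open>With the homotopy \<open>h\<close>, an element \<open>x\<close> of the syzygy module
  \<open>N'\<close> of \<open>F'\<close> is \<open>\<alpha> (\<beta> x) + \<phi>' (h x)\<close>. For
  \<open>x\<close> in \<open>m^(i+1) F'\<close> the first term inherits membership in
  \<open>m (N' \<inter> m^i F')\<close> from \<open>F\<close>, where \<open>i\<close> is no defect.
  The second term always has it: \<open>h x\<close> lies in \<open>m m^i\<close> times the next free
  module, and \<open>\<phi>'\<close> maps that module into \<open>N'\<close>.\<close>

lemma defects_resolution_subset:
  assumes F: "free_resolution R M F \<phi> \<epsilon>" and F': "free_resolution R M F' \<phi>' \<epsilon>'" and m: "ideal m R"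
  shows "defects R m (\<phi>' (Suc j) ` carrier (F' (Suc j))) (F' j)
    \<subseteq> defects R m (\<phi> (Suc j) ` carrier (F (Suc j))) (F j)"
proof -
  note D = free_resolutionD[OF F] and D' = free_resolutionD[OF F']
  obtain \<beta> where \<beta>: "\<And>j. mod_hom R (F' j) (F j) (\<beta> j)"
    "\<And>x. x \<in> carrier (F' 0) \<Longrightarrow> \<epsilon> (\<beta> 0 x) = \<epsilon>' x"
    "\<And>j x. x \<in> carrier (F' (Suc j)) \<Longrightarrow> \<phi> (Suc j) (\<beta> (Suc j) x) = \<beta> j (\<phi>' (Suc j) x)"
    using resolution_chain_map[OF F' F] by metis
  obtain \<alpha> where \<alpha>: "\<And>j. mod_hom R (F j) (F' j) (\<alpha> j)"
    "\<And>x. x \<in> carrier (F 0) \<Longrightarrow> \<epsilon>' (\<alpha> 0 x) = \<epsilon> x"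
    "\<And>j x. x \<in> carrier (F (Suc j)) \<Longrightarrow> \<phi>' (Suc j) (\<alpha> (Suc j) x) = \<alpha> j (\<phi> (Suc j) x)"
    using resolution_chain_map[OF F F'] by metis
  interpret Mm: module R M by (rule mod_homD(7)[OF D(3)])
  interpret Fj: module R "F j" by (rule D(1))
  interpret F'j: module R "F' j" by (rule D'(1))
  interpret F'S: module R "F' (Suc j)" by (rule D'(1))
  have m_c: "ideal_power R m i \<subseteq> carrier R" for i
    by (rule additive_subgroup.a_subset[OF ideal.axioms(1)[OF Mm.R.ideal_power_ideal[OF m]]])
  have m_c1: "m \<subseteq> carrier R" by (rule additive_subgroup.a_subset[OF ideal.axioms(1)[OF m]])
  define \<gamma> where "\<gamma> j x = x \<ominus>\<^bsub>F' j\<^esub> \<alpha> j (\<beta> j x)" for j x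
  have \<gamma>h: "mod_hom R (F' j) (F' j) (\<gamma> j)" for j
    unfolding \<gamma>_def by (rule mod_hom_diff[OF mod_hom_id[OF D'(1)] mod_hom_comp[OF \<beta>(1) \<alpha>(1)]])
  have "\<exists>h. mod_hom R (F' j) (F' (Suc j)) h \<and>
    (\<forall>y\<in>carrier (F' (Suc j)). \<phi>' (Suc j) (h (\<phi>' (Suc j) y)) = \<gamma> j (\<phi>' (Suc j) y))"
  proof (rule resolution_null_homotopy[OF F' \<gamma>h])
    fix x assume x: "x \<in> carrier (F' 0)"
    have b: "\<beta> 0 x \<in> carrier (F 0)" by (rule mod_homD(1)[OF \<beta>(1) x])
    have "\<epsilon>' (\<gamma> 0 x) = \<epsilon>' x \<ominus>\<^bsub>M\<^esub> \<epsilon>' x"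
      unfolding \<gamma>_def using mod_homD(5)[OF D'(3) x mod_homD(1)[OF \<alpha>(1) b]] \<alpha>(2)[OF b] \<beta>(2)[OF x] by simp
    thus "\<epsilon>' (\<gamma> 0 x) = \<zero>\<^bsub>M\<^esub>" using mod_homD(1)[OF D'(3) x] by (simp add: a_minus_def Mm.M.r_neg)
  next
    fix j x assume x: "x \<in> carrier (F' (Suc j))"
    have b: "\<beta> (Suc j) x \<in> carrier (F (Suc j))" by (rule mod_homD(1)[OF \<beta>(1) x])
    show "\<phi>' (Suc j) (\<gamma> (Suc j) x) = \<gamma> j (\<phi>' (Suc j) x)"
      unfolding \<gamma>_def using mod_homD(5)[OF D'(4) x mod_homD(1)[OF \<alpha>(1) b]] \<alpha>(3)[OF b] \<beta>(3)[OF x] by simp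
  qed
  then obtain h where h: "mod_hom R (F' j) (F' (Suc j)) h"
    "\<And>y. y \<in> carrier (F' (Suc j)) \<Longrightarrow> \<phi>' (Suc j) (h (\<phi>' (Suc j) y)) = \<gamma> j (\<phi>' (Suc j) y)" by blast
  let ?N = "\<phi> (Suc j) ` carrier (F (Suc j))" and ?N' = "\<phi>' (Suc j) ` carrier (F' (Suc j))"
  let ?m = "\<lambda>C i. ideal_smult R C (ideal_power R m i) (carrier C)"
  have N'c: "?N' \<subseteq> carrier (F' j)" and Nc: "?N \<subseteq> carrier (F j)"
    using mod_homD(1)[OF D'(4)] mod_homD(1)[OF D(4)] by auto
  have sQ: "submodule R (ideal_smult R (F' j) m (?N' \<inter> ?m (F' j) i)) (F' j)" for i
    by (rule F'j.ideal_smult_submodule[OF m_c1]) (use N'c in blast)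
  have "?N' \<inter> ?m (F' j) (Suc i) \<subseteq> ideal_smult R (F' j) m (?N' \<inter> ?m (F' j) i)"
    if i: "?N \<inter> ?m (F j) (Suc i) \<subseteq> ideal_smult R (F j) m (?N \<inter> ?m (F j) i)" for i
  proof
    fix x assume x: "x \<in> ?N' \<inter> ?m (F' j) (Suc i)"
    then obtain y where y: "y \<in> carrier (F' (Suc j))" "x = \<phi>' (Suc j) y" by blast
    have xc: "x \<in> carrier (F' j)" using x N'c by blast
    have \<beta>m: "\<beta> j z \<in> ?m (F j) k" if "z \<in> ?m (F' j) k" for z k
      by (rule ideal_smult_hom_mono[OF \<beta>(1) m_c that]) (use mod_homD(1)[OF \<beta>(1)] in auto)
    have \<alpha>m: "\<alpha> j z \<in> ?m (F' j) k" if "z \<in> ?m (F j) k" for z k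
      by (rule ideal_smult_hom_mono[OF \<alpha>(1) m_c that]) (use mod_homD(1)[OF \<alpha>(1)] in auto)
    have "\<beta> j x \<in> ?N" unfolding y(2) \<beta>(3)[OF y(1), symmetric] using mod_homD(1)[OF \<beta>(1) y(1)] by blast
    hence "\<beta> j x \<in> ideal_smult R (F j) m (?N \<inter> ?m (F j) i)" using i \<beta>m x by blast
    hence ab: "\<alpha> j (\<beta> j x) \<in> ideal_smult R (F' j) m (?N' \<inter> ?m (F' j) i)"
    proof (rule ideal_smult_hom_mono[OF \<alpha>(1) m_c1])
      fix z assume z: "z \<in> ?N \<inter> ?m (F j) i"
      then obtain w where w: "w \<in> carrier (F (Suc j))" "z = \<phi> (Suc j) w" by blast
      have "\<alpha> j z \<in> ?N'" unfolding w(2) \<alpha>(3)[OF w(1), symmetric] using mod_homD(1)[OF \<alpha>(1) w(1)] by blast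
      thus "\<alpha> j z \<in> ?N' \<inter> ?m (F' j) i" using \<alpha>m z by blast
    qed (use N'c Nc in blast)+
    have "h x \<in> ?m (F' (Suc j)) (Suc i)"
      by (rule ideal_smult_hom_mono[OF h(1) m_c IntD2[OF x]]) (use mod_homD(1)[OF h(1)] in auto)
    hence "h x \<in> ideal_smult R (F' (Suc j)) m (?m (F' (Suc j)) i)"
      unfolding Mm.R.ideal_power_Suc'[OF m]
      using F'S.ideal_smult_prod[OF m Mm.R.ideal_power_ideal[OF m] F'S.submodule_carrier] by simp
    hence "\<phi>' (Suc j) (h x) \<in> ideal_smult R (F' j) m (?N' \<inter> ?m (F' j) i)"
    proof (rule ideal_smult_hom_mono[OF D'(4) m_c1])
      have c: "?m (F' (Suc j)) i \<subseteq> carrier (F' (Suc j))"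
        by (rule F'S.submodule_subset[OF F'S.ideal_smult_submodule[OF m_c subset_refl]])
      show "?m (F' (Suc j)) i \<subseteq> carrier (F' (Suc j))" by (rule c)
      fix z assume z: "z \<in> ?m (F' (Suc j)) i"
      have "\<phi>' (Suc j) z \<in> ?m (F' j) i"
        by (rule ideal_smult_hom_mono[OF D'(4) m_c z]) (use mod_homD(1)[OF D'(4)] in auto)
      thus "\<phi>' (Suc j) z \<in> ?N' \<inter> ?m (F' j) i" using z c by blast
    qed (use N'c in blast)
    hence "\<gamma> j x \<in> ideal_smult R (F' j) m (?N' \<inter> ?m (F' j) i)" using h(2)[OF y(1)] y(2) by simp
    hence "\<gamma> j x \<oplus>\<^bsub>F' j\<^esub> \<alpha> j (\<beta> j x) \<in> ideal_smult R (F' j) m (?N' \<inter> ?m (F' j) i)"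
      using F'j.submoduleD(3)[OF sQ] ab by blast
    moreover have "\<gamma> j x \<oplus>\<^bsub>F' j\<^esub> \<alpha> j (\<beta> j x) = x"
      unfolding \<gamma>_def using xc mod_homD(1)[OF \<alpha>(1) mod_homD(1)[OF \<beta>(1) xc]]
      by (simp add: a_minus_def F'j.M.a_assoc F'j.M.l_neg)
    ultimately show "x \<in> ideal_smult R (F' j) m (?N' \<inter> ?m (F' j) i)" by simp
  qed
  thus ?thesis unfolding defects_def by blast
qed

lemma syzygy_artin_rees_number_comparison:
  assumes F: "free_resolution R M F \<phi> \<epsilon>" and F': "free_resolution R M F' \<phi>' \<epsilon>'" and m: "ideal m R"
    and j: "j \<ge> 1"
  shows "syzygy_artin_rees_number R m F \<phi> j =
    (LEAST r. \<forall>i\<ge>r. i \<notin> defects R m (\<phi>' j ` carrier (F' j)) (F' (j - 1)))"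
proof -
  obtain k where k: "j = Suc k" using j by (cases j) auto
  note D = free_resolutionD[OF F]
  have "defects R m (\<phi> j ` carrier (F j)) (F (j - 1)) = defects R m (\<phi>' j ` carrier (F' j)) (F' (j - 1))"
    using defects_resolution_subset[OF F F' m, of k] defects_resolution_subset[OF F' F m, of k] k by simp
  thus ?thesis unfolding syzygy_artin_rees_number_def
    using module.artin_rees_number_defects[OF D(1) m submodule_image[OF D(4)], of k] k by simp
qed

section \<open>Free resolutions of Rees algebras\<close>

text \<open>For finite \<open>S\<close> this is the free module with basis \<open>S\<close>. All of
  them are submodules of the one with \<open>S = UNIV\<close>, so free modules of all degrees share
  one ambient group, as the graded families require.\<close>

definition fun_module :: "('a, 'e) ring_scheme \<Rightarrow> 'x set \<Rightarrow> ('a, 'x \<Rightarrow> 'a) module"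
  where "fun_module R S =
    \<lparr> carrier = {u. (\<forall>x. u x \<in> carrier R) \<and> (\<forall>x. x \<notin> S \<longrightarrow> u x = \<zero>\<^bsub>R\<^esub>)},
      monoid.mult = (\<lambda>u v x. u x \<otimes>\<^bsub>R\<^esub> v x), one = (\<lambda>x. \<one>\<^bsub>R\<^esub>), ring.zero = (\<lambda>x. \<zero>\<^bsub>R\<^esub>),
      add = (\<lambda>u v x. u x \<oplus>\<^bsub>R\<^esub> v x), smult = (\<lambda>r u x. r \<otimes>\<^bsub>R\<^esub> u x) \<rparr>"

lemma fun_module_simps [simp]:
  "u \<in> carrier (fun_module R S) \<longleftrightarrow> (\<forall>x. u x \<in> carrier R) \<and> (\<forall>x. x \<notin> S \<longrightarrow> u x = \<zero>\<^bsub>R\<^esub>)"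
  "ring.zero (fun_module R S) = (\<lambda>x. \<zero>\<^bsub>R\<^esub>)"
  "add (fun_module R S) = (\<lambda>u v x. u x \<oplus>\<^bsub>R\<^esub> v x)"
  "smult (fun_module R S) = (\<lambda>r u x. r \<otimes>\<^bsub>R\<^esub> u x)"
  by (simp_all add: fun_module_def)

lemma fun_module_restrict:
  "(fun_module R UNIV)\<lparr>carrier := carrier (fun_module R S)\<rparr> = fun_module R S"
  by (simp add: fun_module_def)

definition unit_fun :: "('a, 'e) ring_scheme \<Rightarrow> 'x \<Rightarrow> 'x \<Rightarrow> 'a"
  where "unit_fun R x y = (if y = x then \<one>\<^bsub>R\<^esub> else \<zero>\<^bsub>R\<^esub>)"

context cring
begin

lemma module_fun_module: "module R (fun_module R S)"
proof (rule moduleI[OF is_cring])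
  show "abelian_group (fun_module R S)"
  proof (rule abelian_groupI)
    fix u assume u: "u \<in> carrier (fun_module R S)"
    show "\<exists>v\<in>carrier (fun_module R S). v \<oplus>\<^bsub>fun_module R S\<^esub> u = \<zero>\<^bsub>fun_module R S\<^esub>"
      by (rule bexI[of _ "\<lambda>x. \<ominus> u x"]) (use u in \<open>auto simp: l_neg\<close>)
  qed (auto simp: a_ac)
qed (auto simp: l_distr r_distr m_assoc)

lemma unit_fun_carrier: "x \<in> S \<Longrightarrow> unit_fun R x \<in> carrier (fun_module R S)"
  by (auto simp: unit_fun_def)

lemma fun_module_mono: "S \<subseteq> T \<Longrightarrow> carrier (fun_module R S) \<subseteq> carrier (fun_module R T)"
  by (auto simp: fun_module_def)

lemma fun_module_submodule: "submodule R (carrier (fun_module R S)) (fun_module R UNIV)"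
proof (rule submodule.intro[OF module_fun_module])
  show "carrier (fun_module R S) \<subseteq> carrier (fun_module R UNIV)" by (rule fun_module_mono) simp
qed auto

lemma fun_module_least:
  assumes S: "finite S" and P: "submodule R P (fun_module R UNIV)"
    and unit: "\<And>x. x \<in> S \<Longrightarrow> unit_fun R x \<in> P"
  shows "carrier (fun_module R S) \<subseteq> P"
proof -
  have "u \<in> P" if "T \<subseteq> S" "u \<in> carrier (fun_module R T)" for T u
    using finite_subset[OF that(1) S] that
  proof (induction T arbitrary: u rule: finite_induct)
    case empty
    hence "u = \<zero>\<^bsub>fun_module R UNIV\<^esub>" by auto
    thus ?case using submodule.zero_closed[OF P] by simp
  next
    case (insert x T)
    let ?v = "u(x := \<zero>)"
    have v: "?v \<in> P" by (rule insert.IH) (use insert.prems in auto)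
    have "u x \<odot>\<^bsub>fun_module R UNIV\<^esub> unit_fun R x \<in> P"
      using submodule.smult_closed[OF P _ unit] insert.prems by auto
    hence "?v \<oplus>\<^bsub>fun_module R UNIV\<^esub> u x \<odot>\<^bsub>fun_module R UNIV\<^esub> unit_fun R x \<in> P"
      using submodule.m_closed[OF P v] by blast
    also have "?v \<oplus>\<^bsub>fun_module R UNIV\<^esub> u x \<odot>\<^bsub>fun_module R UNIV\<^esub> unit_fun R x = u"
      using insert.prems(2) by (auto simp: unit_fun_def)
    finally show ?case .
  qed
  thus ?thesis by blast
qed

lemma fun_module_basis:
  fixes S :: "'x set"
  assumes S: "finite S"
  shows "finite (unit_fun R ` S)" "module_basis R (fun_module R S) (unit_fun R ` S)"
proof -
  let ?M = "fun_module R S" and ?B = "unit_fun R ` S"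
  interpret M: module R ?M by (rule module_fun_module)
  show "finite ?B" by (rule finite_imageI[OF S])
  have Bc: "?B \<subseteq> carrier ?M" by (rule image_subsetI[OF unit_fun_carrier])
  have sp: "submodule R (M.span ?B) (fun_module R UNIV)"
  proof -
    interpret U: module R "fun_module R UNIV :: ('a, 'x \<Rightarrow> 'a) module" by (rule module_fun_module)
    have "M.span ?B = U.span ?B"
      using U.span_li_not_depend(1)[OF Bc fun_module_submodule] by (simp add: fun_module_restrict)
    thus ?thesis using U.span_is_submodule[OF order_trans[OF Bc fun_module_mono[OF subset_UNIV]]] by simp
  qed
  have "carrier ?M \<subseteq> M.span ?B"
    by (rule fun_module_least[OF S sp subsetD[OF M.in_own_span[OF Bc] imageI]])
  moreover have "M.span ?B \<subseteq> carrier ?M" by (rule M.span_is_subset2[OF Bc])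
  moreover have "\<not> M.lin_dep ?B"
  proof
    assume "M.lin_dep ?B"
    then obtain A a v where A: "finite A" "A \<subseteq> ?B" "a \<in> A \<rightarrow> carrier R" "M.lincomb a A = \<zero>\<^bsub>?M\<^esub>"
      "v \<in> A" "a v \<noteq> \<zero>" unfolding M.lin_dep_def by blast
    obtain y where y: "y \<in> S" "v = unit_fun R y" using A by blast
    \<comment> \<open>Evaluation at \<open>y\<close> is linear and sends a linear combination of
      unit functions to its coefficient at \<open>unit_fun R y\<close>.\<close>
    interpret ev: mod_hom R ?M "ideal_module R (carrier R)" "\<lambda>u. u y"
      by (rule M.mod_homI[OF M.module_Rmod]) auto
    have Ac: "A \<subseteq> carrier ?M" using A(2) Bc by blast
    have "(M.lincomb a A) y = (\<Oplus>\<^bsub>ideal_module R (carrier R)\<^esub>w\<in>A. (a w \<odot>\<^bsub>?M\<^esub> w) y)"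
      unfolding M.lincomb_def
      by (rule ev.hom_sum[OF Ac]) (intro Pi_I M.smult_closed funcset_mem[OF A(3)] subsetD[OF Ac])
    also have "\<dots> = (\<Oplus>\<^bsub>ideal_module R (carrier R)\<^esub>w\<in>A. if v = w then a w else \<zero>\<^bsub>ideal_module R (carrier R)\<^esub>)"
    proof (rule ev.N.M.finsum_cong')
      fix w assume w: "w \<in> A"
      then obtain z where z: "w = unit_fun R z" using A(2) by blast
      have "a w \<in> carrier R" using A(3) w by auto
      thus "(a w \<odot>\<^bsub>?M\<^esub> w) y = (if v = w then a w else \<zero>\<^bsub>ideal_module R (carrier R)\<^esub>)"
        using y z by (cases "v = w") (auto simp: unit_fun_def[of R y y] unit_fun_def[of R z y])
    qed (use A(3) in auto)
    also have "\<dots> = a v"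
      by (rule ev.N.M.add.finprod_singleton[OF A(5,1)]) (use A(3) in simp)
    finally have "(M.lincomb a A) y = a v" .
    thus False using A(4,6) by (simp del: fun_module_simps(1))
  qed
  ultimately show "module_basis R ?M ?B" unfolding module_basis_def using Bc by blast
qed

lemma fun_module_lift:
  assumes S: "finite S" and N: "module R N" and w: "\<And>x. x \<in> S \<Longrightarrow> w x \<in> carrier N"
  defines "h \<equiv> (\<lambda>u. \<Oplus>\<^bsub>N\<^esub>x\<in>S. u x \<odot>\<^bsub>N\<^esub> w x)"
  shows "mod_hom R (fun_module R S) N h" "x \<in> S \<Longrightarrow> h (unit_fun R x) = w x"
proof -
  interpret N: module R N by fact
  interpret M: module R "fun_module R S" by (rule module_fun_module)
  show "mod_hom R (fun_module R S) N h"
  proof (rule M.mod_homI[OF N])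
    fix u assume u: "u \<in> carrier (fun_module R S)"
    show "h u \<in> carrier N" unfolding h_def by (rule N.M.finsum_closed) (use u w in auto)
    show "h (u \<oplus>\<^bsub>fun_module R S\<^esub> v) = h u \<oplus>\<^bsub>N\<^esub> h v" if v: "v \<in> carrier (fun_module R S)" for v
    proof -
      have "h (u \<oplus>\<^bsub>fun_module R S\<^esub> v) = (\<Oplus>\<^bsub>N\<^esub>x\<in>S. u x \<odot>\<^bsub>N\<^esub> w x \<oplus>\<^bsub>N\<^esub> v x \<odot>\<^bsub>N\<^esub> w x)"
        unfolding h_def by (rule N.M.finsum_cong') (use u v w in \<open>auto simp: N.smult_l_distr\<close>)
      thus ?thesis unfolding h_def using u v w by (subst (asm) N.M.finsum_addf) auto
    qed
    show "h (r \<odot>\<^bsub>fun_module R S\<^esub> u) = r \<odot>\<^bsub>N\<^esub> h u" if r: "r \<in> carrier R" for r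
    proof -
      have "h (r \<odot>\<^bsub>fun_module R S\<^esub> u) = (\<Oplus>\<^bsub>N\<^esub>x\<in>S. r \<odot>\<^bsub>N\<^esub> (u x \<odot>\<^bsub>N\<^esub> w x))"
        unfolding h_def by (rule N.M.finsum_cong') (use u w r in \<open>auto simp: N.smult_assoc1\<close>)
      also have "\<dots> = r \<odot>\<^bsub>N\<^esub> h u"
        unfolding h_def by (rule N.finsum_smult[symmetric]) (use u w r in auto)
      finally show ?thesis .
    qed
  qed
  show "h (unit_fun R x) = w x" if x: "x \<in> S"
  proof -
    have "h (unit_fun R x) = (\<Oplus>\<^bsub>N\<^esub>y\<in>S. if x = y then w y else \<zero>\<^bsub>N\<^esub>)"
      unfolding h_def by (rule N.M.finsum_cong') (use w in \<open>auto simp: unit_fun_def\<close>)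
    also have "\<dots> = w x" by (rule N.M.add.finprod_singleton[OF x S]) (use w in auto)
    finally show ?thesis .
  qed
qed

section \<open>Monomials in given ring elements\<close>

definition monom :: "nat \<Rightarrow> (nat \<Rightarrow> 'a) \<Rightarrow> nat multiset \<Rightarrow> 'a"
  where "monom n f \<mu> = (\<Otimes>i\<in>{..<n}. f i [^] count \<mu> i)"

lemma monom_closed: "(\<And>i. i < n \<Longrightarrow> f i \<in> carrier R) \<Longrightarrow> monom n f \<mu> \<in> carrier R"
  unfolding monom_def by (rule finprod_closed) auto

lemma monom_empty: "monom n f {#} = \<one>"
  unfolding monom_def by (rule finprod_one_eqI) auto

lemma monom_union:
  assumes "\<And>i. i < n \<Longrightarrow> f i \<in> carrier R"
  shows "monom n f (\<mu> + \<nu>) = monom n f \<mu> \<otimes> monom n f \<nu>"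
proof -
  have "monom n f (\<mu> + \<nu>) = (\<Otimes>i\<in>{..<n}. f i [^] count \<mu> i \<otimes> f i [^] count \<nu> i)"
    unfolding monom_def by (rule finprod_cong') (use assms in \<open>auto simp: nat_pow_mult\<close>)
  also have "\<dots> = monom n f \<mu> \<otimes> monom n f \<nu>"
    unfolding monom_def by (rule finprod_multf) (use assms in auto)
  finally show ?thesis .
qed

lemma monom_single:
  assumes "\<And>i. i < n \<Longrightarrow> f i \<in> carrier R" "l < n"
  shows "monom n f {#l#} = f l"
proof -
  have "monom n f {#l#} = (\<Otimes>i\<in>{..<n}. if l = i then f i else \<one>)"
    unfolding monom_def by (rule finprod_cong') (use assms in auto)
  also have "\<dots> = f l" by (rule finprod_singleton) (use assms in auto)
  finally show ?thesis .
qed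

lemma monom_add_mset:
  assumes "\<And>i. i < n \<Longrightarrow> f i \<in> carrier R" "l < n"
  shows "monom n f (add_mset l \<mu>) = f l \<otimes> monom n f \<mu>"
  using monom_union[OF assms(1), where \<mu> = "{#l#}" and \<nu> = \<mu>] monom_single[OF assms] by simp

end

lemma finite_multisets_of_size: "finite {\<mu> :: nat multiset. set_mset \<mu> \<subseteq> {..<n} \<and> size \<mu> = s}"
proof (induction s)
  case (Suc s)
  have "{\<mu>. set_mset \<mu> \<subseteq> {..<n} \<and> size \<mu> = Suc s} \<subseteq>
    (\<lambda>(i, \<mu>). add_mset i \<mu>) ` ({..<n} \<times> {\<mu>. set_mset \<mu> \<subseteq> {..<n} \<and> size \<mu> = s})"
  proof
    fix \<mu> :: "nat multiset" assume \<mu>: "\<mu> \<in> {\<mu>. set_mset \<mu> \<subseteq> {..<n} \<and> size \<mu> = Suc s}"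
    have "size \<mu> = Suc s" using \<mu> by simp
    from size_eq_Suc_imp_eq_union[OF this] obtain i \<nu> where "\<mu> = add_mset i \<nu>" by auto
    thus "\<mu> \<in> (\<lambda>(i, \<mu>). add_mset i \<mu>) ` ({..<n} \<times> {\<mu>. set_mset \<mu> \<subseteq> {..<n} \<and> size \<mu> = s})"
      using \<mu> by (intro image_eqI[of _ _ "(i, \<nu>)"]) auto
  qed
  thus ?case by (rule finite_subset) (intro finite_imageI finite_cartesian_product finite_lessThan Suc)
qed simp

text \<open>The value at \<open>(g, \<mu>)\<close> is the coefficient of the monomial \<open>\<mu>\<close> times the \<open>g\<close>-th basis element of a free
  module over a polynomial ring, and \<open>shift\<close> is multiplication by a monomial. In \<open>degset\<close>, the \<open>g\<close>-th basis
  element has degree \<open>ds ! g\<close>.\<close>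

type_synonym 'a poly_fun = "nat \<times> nat multiset \<Rightarrow> 'a"

definition shift :: "('a, 'e) ring_scheme \<Rightarrow> nat multiset \<Rightarrow> 'a poly_fun \<Rightarrow> 'a poly_fun"
  where "shift R \<mu> u = (\<lambda>(g, \<nu>). if \<mu> \<subseteq># \<nu> then u (g, \<nu> - \<mu>) else \<zero>\<^bsub>R\<^esub>)"

definition degset :: "nat \<Rightarrow> nat list \<Rightarrow> nat \<Rightarrow> (nat \<times> nat multiset) set"
  where "degset n ds k = {(g, \<mu>). g < length ds \<and> set_mset \<mu> \<subseteq> {..<n} \<and> ds ! g + size \<mu> = k}"

lemma finite_degset: "finite (degset n ds k)"
proof (rule finite_subset)
  show "degset n ds k \<subseteq> {..<length ds} \<times> (\<Union>s\<in>{..k}. {\<mu>. set_mset \<mu> \<subseteq> {..<n} \<and> size \<mu> = s})"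
    by (auto simp: degset_def)
  show "finite ({..<length ds} \<times> (\<Union>s\<in>{..k}. {\<mu>. set_mset \<mu> \<subseteq> {..<n} \<and> size \<mu> = s}))"
    using finite_multisets_of_size by blast
qed

lemma shift_shift: "shift R \<mu> (shift R \<nu> u) = shift R (\<mu> + \<nu>) u"
proof (rule ext, clarify)
  fix g \<kappa>
  have "\<mu> + \<nu> \<subseteq># \<kappa> \<longleftrightarrow> \<mu> \<subseteq># \<kappa> \<and> \<nu> \<subseteq># \<kappa> - \<mu>"
    by (metis add.commute mset_subset_eq_add_left subset_eq_diff_conv subset_mset.order_trans
        subset_mset.le_diff_conv2)
  thus "shift R \<mu> (shift R \<nu> u) (g, \<kappa>) = shift R (\<mu> + \<nu>) u (g, \<kappa>)" by (auto simp: shift_def)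
qed

lemma shift_unit_fun: "shift R \<mu> (unit_fun R (g, \<nu>)) = unit_fun R (g, \<mu> + \<nu>)"
  by (auto simp: shift_def unit_fun_def fun_eq_iff dest: subset_mset.diff_add)

lemma shift_empty: "shift R {#} u = u"
  by (auto simp: shift_def)

section \<open>Graded free modules over the polynomial ring\<close>

locale noetherian_cring = cring R + noetherian_ring R for R (structure)
begin

abbreviation U :: "('a, 'a poly_fun) module" where "U \<equiv> fun_module R UNIV"

abbreviation free_strand :: "nat \<Rightarrow> nat list \<Rightarrow> nat \<Rightarrow> ('a, 'a poly_fun) module"
  where "free_strand n ds k \<equiv> fun_module R (degset n ds k)"

lemma U_module: "module R U"
  by (rule module_fun_module)

lemma shift_hom: "mod_hom R U U (shift R \<mu>)"
  by (rule module.mod_homI[OF U_module U_module]) (auto simp: shift_def fun_eq_iff)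

lemma shift_strand:
  assumes "l < n" "u \<in> carrier (free_strand n ds k)"
  shows "shift R {#l#} u \<in> carrier (free_strand n ds (Suc k))"
proof -
  have "u (g, \<nu> - {#l#}) = \<zero>" if l\<nu>: "l \<in># \<nu>" and d: "(g, \<nu>) \<notin> degset n ds (Suc k)" for g \<nu>
  proof -
    obtain \<kappa> where \<kappa>: "\<nu> = add_mset l \<kappa>" using mset_add[OF l\<nu>] by blast
    hence "(g, \<kappa>) \<notin> degset n ds k" using d assms(1) by (auto simp: degset_def)
    thus ?thesis using assms(2) \<kappa> by simp
  qed
  thus ?thesis using assms(2) by (auto simp: shift_def)
qed

lemma shift_strand_hom:
  assumes "l < n"
  shows "mod_hom R (free_strand n ds k) (free_strand n ds (Suc k)) (shift R {#l#})"
  by (rule module.mod_homI[OF module_fun_module module_fun_module shift_strand[OF assms]])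
    (auto simp: shift_def fun_eq_iff)

text \<open>The basis of the free module over the polynomial ring sits at the empty monomial.
  Applying variables reaches every other monomial, which gives the minimality required of the
  strands.\<close>

lemma polynomial_module_free:
  "polynomial_module R U n (\<lambda>l. shift R {#l#}) (\<lambda>k. carrier (free_strand n ds k))
    ((\<lambda>g. (ds ! g, unit_fun R (g, {#}))) ` {..<length ds})"
proof (intro polynomial_module.intro polynomial_module_axioms.intro U_module noetherian_ring_axioms)
  interpret U: module R U by (rule U_module)
  show "U.M.endo (shift R {#l#})" for l
    using mod_homD(1,2)[OF shift_hom] unfolding U.M.endo_def by blast
  show "shift R {#l#} (r \<odot>\<^bsub>U\<^esub> x) = r \<odot>\<^bsub>U\<^esub> shift R {#l#} x" if "r \<in> carrier R" "x \<in> carrier U" for l r x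
    using mod_homD(3)[OF shift_hom that] .
  show "shift R {#l#} (shift R {#l'#} x) = shift R {#l'#} (shift R {#l#} x)" for l l' and x :: "'a poly_fun"
    by (simp add: shift_shift add_mset_commute)
  show "submodule R (carrier (free_strand n ds k)) U" for k by (rule fun_module_submodule)
  show "shift R {#l#} x \<in> carrier (free_strand n ds (Suc k))"
    if "l < n" "x \<in> carrier (free_strand n ds k)" for l x k by (rule shift_strand[OF that])
  show "finite ((\<lambda>g. (ds ! g, unit_fun R (g, {#}))) ` {..<length ds})" by simp
  show "(\<lambda>g. (ds ! g, unit_fun R (g, {#}))) ` {..<length ds} \<subseteq> UNIV \<times> carrier U"
    by (auto simp: unit_fun_def)
  fix P k assume P: "\<And>k. submodule R (P k) U" "\<And>l k x. l < n \<Longrightarrow> x \<in> P k \<Longrightarrow> shift R {#l#} x \<in> P (Suc k)"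
    "\<And>d e. (d, e) \<in> (\<lambda>g. (ds ! g, unit_fun R (g, {#}))) ` {..<length ds} \<Longrightarrow> e \<in> P d"
  have "unit_fun R (g, \<mu>) \<in> P (ds ! g + size \<mu>)" if g: "g < length ds" and "set_mset \<mu> \<subseteq> {..<n}" for g \<mu>
    using that(2)
  proof (induction \<mu>)
    case empty
    thus ?case using P(3)[of "ds ! g" "unit_fun R (g, {#})"] g by auto
  next
    case (add l \<mu>)
    thus ?case using P(2)[of l "unit_fun R (g, \<mu>)" "ds ! g + size \<mu>"] by (simp add: shift_unit_fun)
  qed
  hence "unit_fun R x \<in> P k" if "x \<in> degset n ds k" for x using that by (auto simp: degset_def)
  thus "carrier (free_strand n ds k) \<subseteq> P k" by (rule fun_module_least[OF finite_degset P(1)])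
qed

text \<open>Linear maps that agree on a basis agree, so compatibility with the variables is a matter
  of monomials.\<close>

lemma shift_commute:
  assumes f: "mod_hom R (free_strand n ds k) A f" and g: "mod_hom R (free_strand n ds (Suc k)) B g"
    and \<theta>: "mod_hom R A B \<theta>" and l: "l < n" and u: "u \<in> carrier (free_strand n ds k)"
    and eq: "\<And>a \<mu>. (a, \<mu>) \<in> degset n ds k \<Longrightarrow> g (unit_fun R (a, add_mset l \<mu>)) = \<theta> (f (unit_fun R (a, \<mu>)))"
  shows "g (shift R {#l#} u) = \<theta> (f u)"
proof -
  interpret M: module R "free_strand n ds k" by (rule module_fun_module)
  show ?thesis
    by (rule M.hom_eq_on_basis[OF fun_module_basis(2)[OF finite_degset] mod_hom_comp[OF shift_strand_hom[OF l] g]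
        mod_hom_comp[OF f \<theta>] _ u]) (auto simp: shift_unit_fun eq)
qed

definition shift_closed :: "nat \<Rightarrow> (nat \<Rightarrow> 'a poly_fun set) \<Rightarrow> bool"
  where "shift_closed n K \<longleftrightarrow> (\<forall>k. submodule R (K k) U) \<and> (\<forall>l<n. \<forall>k. \<forall>x\<in>K k. shift R {#l#} x \<in> K (Suc k))"

lemma submodule_of_strand:
  assumes "submodule R P (fun_module R S)"
  shows "submodule R P (fun_module R UNIV)"
proof (rule submodule.intro[OF module_fun_module])
  show "P \<subseteq> carrier (fun_module R UNIV)"
    using submodule.subset[OF assms] fun_module_mono[of S UNIV] by blast
qed (use submodule.m_closed[OF assms] submodule.zero_closed[OF assms] submodule.smult_closed[OF assms] in auto)

lemma kernel_shift_closed: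
  assumes f: "\<And>k. mod_hom R (free_strand n ds k) (A k) (f k)"
    and \<theta>: "\<And>l k. l < n \<Longrightarrow> mod_hom R (A k) (A (Suc k)) (\<theta> l)"
    and comm: "\<And>l k u. l < n \<Longrightarrow> u \<in> carrier (free_strand n ds k) \<Longrightarrow> f (Suc k) (shift R {#l#} u) = \<theta> l (f k u)"
  shows "shift_closed n (\<lambda>k. {u \<in> carrier (free_strand n ds k). f k u = \<zero>\<^bsub>A k\<^esub>})"
  unfolding shift_closed_def
proof (intro conjI allI impI ballI)
  fix k
  interpret f: mod_hom R "free_strand n ds k" "A k" "f k" by (rule f)
  show "submodule R {u \<in> carrier (free_strand n ds k). f k u = \<zero>\<^bsub>A k\<^esub>} U"
    using submodule_of_strand[OF f.ker_is_submodule] by (simp add: f.ker_def)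
  show "shift R {#l#} u \<in> {u \<in> carrier (free_strand n ds (Suc k)). f (Suc k) u = \<zero>\<^bsub>A (Suc k)\<^esub>}"
    if "l < n" "u \<in> {u \<in> carrier (free_strand n ds k). f k u = \<zero>\<^bsub>A k\<^esub>}" for l u
    using that comm[of l u k] shift_strand[of l n u ds k] mod_homD(4)[OF \<theta>[of l k]] by simp
qed

text \<open>One step of a graded free resolution over the polynomial ring: \<open>K\<close> is
  finitely generated, a generator of degree \<open>d\<close> yields a basis element of degree
  \<open>d\<close>, and the kernel is again a graded submodule, ready for the next step. One list
  \<open>ds'\<close> serves all \<open>k\<close>, so that all powers are resolved
  simultaneously.\<close>

lemma resolution_step:
  assumes K: "shift_closed n K" "\<And>k. K k \<subseteq> carrier (free_strand n ds k)"
  shows "\<exists>ds' \<Phi>. (\<forall>k. mod_hom R (free_strand n ds' k) (free_strand n ds k) (\<Phi> k) \<and>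
      \<Phi> k ` carrier (free_strand n ds' k) = K k) \<and>
    shift_closed n (\<lambda>k. {u \<in> carrier (free_strand n ds' k). \<Phi> k u = \<zero>\<^bsub>free_strand n ds k\<^esub>})"
proof -
  interpret P: polynomial_module R U n "\<lambda>l. shift R {#l#}" "\<lambda>k. carrier (free_strand n ds k)"
    "(\<lambda>g. (ds ! g, unit_fun R (g, {#}))) ` {..<length ds}" by (rule polynomial_module_free)
  have Kc: "P.closed K" using K(1) by (simp add: P.closed_def shift_closed_def)
  obtain G where G: "finite G" "\<forall>(d, e)\<in>G. e \<in> K d" "\<And>k. K k = P.gen G k"
    using P.closed_finitely_generated[OF Kc K(2)] by blast
  obtain gs where gs: "set gs = G" using finite_list[OF G(1)] by blast
  define ds' where "ds' = map fst gs"
  \<comment> \<open>The monomial \<open>\<mu>\<close> times the \<open>g\<close>-th basis element is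
    sent to \<open>\<mu>\<close> times the \<open>g\<close>-th generator.\<close>
  define w where "w = (\<lambda>(g, \<mu>). shift R \<mu> (snd (gs ! g)))"
  have shK: "shift R \<mu> x \<in> K (k + size \<mu>)" if "x \<in> K k" "set_mset \<mu> \<subseteq> {..<n}" for \<mu> x k
    using that(2)
  proof (induction \<mu>)
    case empty
    thus ?case using that(1) by (simp add: shift_empty)
  next
    case (add l \<mu>)
    have "shift R {#l#} (shift R \<mu> x) \<in> K (Suc (k + size \<mu>))"
      using add K(1) by (simp add: shift_closed_def)
    thus ?case by (simp add: shift_shift)
  qed
  have wK: "w x \<in> K k" if xk: "x \<in> degset n ds' k" for x k
  proof -
    obtain g \<mu> where x: "x = (g, \<mu>)" "g < length gs" "set_mset \<mu> \<subseteq> {..<n}" "ds' ! g + size \<mu> = k"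
      using xk by (auto simp: degset_def ds'_def)
    obtain d e where de: "gs ! g = (d, e)" by (cases "gs ! g")
    hence "(d, e) \<in> G" using nth_mem[OF x(2)] gs by simp
    hence "e \<in> K d" using G(2) by auto
    thus ?thesis using shK[of e d \<mu>] x de by (simp add: w_def ds'_def)
  qed
  have wc: "w x \<in> carrier (free_strand n ds k)" if "x \<in> degset n ds' k" for x k
    by (rule subsetD[OF K(2) wK[OF that]])
  define \<Phi> where "\<Phi> k u = (\<Oplus>\<^bsub>free_strand n ds k\<^esub>x\<in>degset n ds' k. u x \<odot>\<^bsub>free_strand n ds k\<^esub> w x)" for k u
  have \<Phi>: "mod_hom R (free_strand n ds' k) (free_strand n ds k) (\<Phi> k)" for k
    unfolding \<Phi>_def by (rule fun_module_lift(1)[OF finite_degset module_fun_module wc])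
  have \<Phi>u: "\<Phi> k (unit_fun R x) = w x" if "x \<in> degset n ds' k" for k x
    unfolding \<Phi>_def by (rule fun_module_lift(2)[OF finite_degset module_fun_module wc that])
  have comm: "\<Phi> (Suc k) (shift R {#l#} u) = shift R {#l#} (\<Phi> k u)"
    if l: "l < n" and u: "u \<in> carrier (free_strand n ds' k)" for l k u
  proof (rule shift_commute[OF \<Phi> \<Phi> shift_strand_hom[OF l] l u])
    fix a \<mu> assume a: "(a, \<mu>) \<in> degset n ds' k"
    hence "(a, add_mset l \<mu>) \<in> degset n ds' (Suc k)" using l by (auto simp: degset_def)
    thus "\<Phi> (Suc k) (unit_fun R (a, add_mset l \<mu>)) = shift R {#l#} (\<Phi> k (unit_fun R (a, \<mu>)))"
      using \<Phi>u a by (simp add: w_def shift_shift)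
  qed
  have im: "\<Phi> k ` carrier (free_strand n ds' k) = K k" for k
  proof (rule antisym)
    have sK: "submodule R (K k) U" using K(1) by (simp add: shift_closed_def)
    show "\<Phi> k ` carrier (free_strand n ds' k) \<subseteq> K k"
    proof -
      have "submodule R {u \<in> carrier (free_strand n ds' k). \<Phi> k u \<in> K k} (free_strand n ds' k)"
      proof (rule submodule.intro[OF module_fun_module])
        show "\<zero>\<^bsub>free_strand n ds' k\<^esub> \<in> {u \<in> carrier (free_strand n ds' k). \<Phi> k u \<in> K k}"
          using mod_homD(4)[OF \<Phi>[of k]] submodule.zero_closed[OF sK] by simp
        fix v x assume v: "v \<in> {u \<in> carrier (free_strand n ds' k). \<Phi> k u \<in> K k}"
        { assume x: "x \<in> {u \<in> carrier (free_strand n ds' k). \<Phi> k u \<in> K k}"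
          show "v \<oplus>\<^bsub>free_strand n ds' k\<^esub> x \<in> {u \<in> carrier (free_strand n ds' k). \<Phi> k u \<in> K k}"
            using mod_homD(2)[OF \<Phi>[of k], of v x] submodule.m_closed[OF sK, of "\<Phi> k v" "\<Phi> k x"] v x by auto }
        fix c assume c: "c \<in> carrier R"
        show "c \<odot>\<^bsub>free_strand n ds' k\<^esub> v \<in> {u \<in> carrier (free_strand n ds' k). \<Phi> k u \<in> K k}"
          using mod_homD(3)[OF \<Phi>[of k] c, of v] submodule.smult_closed[OF sK c, of "\<Phi> k v"] v c by auto
      qed auto
      hence "carrier (free_strand n ds' k) \<subseteq> {u \<in> carrier (free_strand n ds' k). \<Phi> k u \<in> K k}"
      proof (rule fun_module_least[OF finite_degset submodule_of_strand])
        fix x assume x: "x \<in> degset n ds' k"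
        have "\<Phi> k (unit_fun R x) \<in> K k" unfolding \<Phi>u[OF x] by (rule wK[OF x])
        thus "unit_fun R x \<in> {u \<in> carrier (free_strand n ds' k). \<Phi> k u \<in> K k}"
          using unit_fun_carrier[OF x] by blast
      qed
      thus ?thesis by blast
    qed
    have "P.closed (\<lambda>k. \<Phi> k ` carrier (free_strand n ds' k))"
      unfolding P.closed_def
    proof (intro conjI allI impI ballI)
      show "submodule R (\<Phi> k ` carrier (free_strand n ds' k)) U" for k
        by (rule submodule_of_strand[OF submodule_image[OF \<Phi>]])
      fix l k x assume l: "l < n" and "x \<in> \<Phi> k ` carrier (free_strand n ds' k)"
      then obtain u where u: "u \<in> carrier (free_strand n ds' k)" "x = \<Phi> k u" by blast
      show "shift R {#l#} x \<in> \<Phi> (Suc k) ` carrier (free_strand n ds' (Suc k))"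
        unfolding u(2) comm[OF l u(1), symmetric] by (rule imageI[OF shift_strand[OF l u(1)]])
    qed
    moreover have "e \<in> \<Phi> d ` carrier (free_strand n ds' d)" if de: "(d, e) \<in> G" for d e
    proof -
      obtain g where g: "g < length gs" "gs ! g = (d, e)" using de gs by (metis in_set_conv_nth)
      hence x: "(g, {#}) \<in> degset n ds' d" by (simp add: degset_def ds'_def)
      have "\<Phi> d (unit_fun R (g, {#})) = e" using \<Phi>u[OF x] g by (simp add: w_def shift_empty)
      thus ?thesis using unit_fun_carrier[OF x] by blast
    qed
    ultimately show "K k \<subseteq> \<Phi> k ` carrier (free_strand n ds' k)" unfolding G(3) by (rule P.gen_least)
  qed
  show ?thesis
    by (intro exI[of _ ds'] exI[of _ \<Phi>] conjI allI \<Phi> im kernel_shift_closed[OF \<Phi> shift_strand_hom comm])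
qed

text \<open>The map from the polynomial ring onto the Rees algebra of \<open>I\<close>, sending the
  \<open>i\<close>-th variable to the generator \<open>f i\<close> in degree one. The list
  \<open>[0]\<close> stands for a single basis element of degree \<open>0\<close>.\<close>

lemma ideal_power_cover:
  assumes I: "ideal I R"
  shows "\<exists>n \<epsilon>. (\<forall>k. mod_hom R (free_strand n [0] k) (ideal_module R (ideal_power R I k)) (\<epsilon> k) \<and>
      \<epsilon> k ` carrier (free_strand n [0] k) = ideal_power R I k) \<and>
    shift_closed n (\<lambda>k. {u \<in> carrier (free_strand n [0] k). \<epsilon> k u = \<zero>})"
proof -
  obtain A where A: "A \<subseteq> carrier R" "finite A" "I = Idl A" using finetely_gen[OF I] by blast
  obtain fs where fs: "set fs = A" using finite_list[OF A(2)] by blast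
  define n where "n = length fs"
  define f where "f i = fs ! i" for i
  have fA: "f ` {..<n} = A" unfolding fs[symmetric] n_def f_def by (auto simp: set_conv_nth)
  have fc: "f i \<in> carrier R" if "i < n" for i using fA A(1) that by blast
  have fI: "f i \<in> I" if "i < n" for i using fA genideal_self[OF A(1)] A(3) that by blast
  let ?I = "ideal_power R I"
  note Ik = ideal_power_ideal[OF I]
  have mon: "monom n f \<mu> \<in> ?I (size \<mu>)" if "set_mset \<mu> \<subseteq> {..<n}" for \<mu>
    using that
  proof (induction \<mu>)
    case empty
    show ?case by (simp add: monom_empty ideal_power_0)
  next
    case (add l \<mu>)
    thus ?case using ideal_prod.prod[OF fI[of l], of "monom n f \<mu>" "?I (size \<mu>)" R] fc
      by (simp add: monom_add_mset ideal_power_Suc'[OF I])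
  qed
  define \<epsilon> where "\<epsilon> k u = (\<Oplus>\<^bsub>ideal_module R (?I k)\<^esub>x\<in>degset n [0] k. u x \<odot>\<^bsub>ideal_module R (?I k)\<^esub> monom n f (snd x))" for k u
  have w: "monom n f (snd x) \<in> carrier (ideal_module R (?I k))" if "x \<in> degset n [0] k" for x k
    using that mon by (auto simp: degset_def ideal_module_def)
  have \<epsilon>: "mod_hom R (free_strand n [0] k) (ideal_module R (?I k)) (\<epsilon> k)" for k
    unfolding \<epsilon>_def by (rule fun_module_lift(1)[OF finite_degset module_ideal[OF Ik] w])
  have \<epsilon>u: "\<epsilon> k (unit_fun R x) = monom n f (snd x)" if "x \<in> degset n [0] k" for k x
    unfolding \<epsilon>_def by (rule fun_module_lift(2)[OF finite_degset module_ideal[OF Ik] w that])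
  have \<theta>: "mod_hom R (ideal_module R (?I k)) (ideal_module R (?I (Suc k))) (\<lambda>x. f l \<otimes> x)" if l: "l < n" for k l
  proof (rule module.mod_homI[OF module_ideal[OF Ik] module_ideal[OF Ik]])
    fix x assume x: "x \<in> carrier (ideal_module R (?I k))"
    hence xc: "x \<in> carrier R" using ideal.Icarr[OF Ik] by (simp add: ideal_module_def)
    show "f l \<otimes> x \<in> carrier (ideal_module R (?I (Suc k)))"
      using ideal_prod.prod[OF fI[OF l], of x "?I k" R] x by (simp add: ideal_module_def ideal_power_Suc'[OF I])
    show "f l \<otimes> (x \<oplus>\<^bsub>ideal_module R (?I k)\<^esub> y) = f l \<otimes> x \<oplus>\<^bsub>ideal_module R (?I (Suc k))\<^esub> f l \<otimes> y"
      if "y \<in> carrier (ideal_module R (?I k))" for y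
      using xc ideal.Icarr[OF Ik] that fc[OF l] by (simp add: ideal_module_def r_distr)
    show "f l \<otimes> (r \<odot>\<^bsub>ideal_module R (?I k)\<^esub> x) = r \<odot>\<^bsub>ideal_module R (?I (Suc k))\<^esub> (f l \<otimes> x)"
      if "r \<in> carrier R" for r
      using xc that fc[OF l] by (simp add: ideal_module_def m_lcomm)
  qed
  have comm: "\<epsilon> (Suc k) (shift R {#l#} u) = f l \<otimes> \<epsilon> k u"
    if l: "l < n" and u: "u \<in> carrier (free_strand n [0] k)" for l k u
  proof (rule shift_commute[OF \<epsilon> \<epsilon> \<theta>[OF l] l u])
    fix a \<mu> assume a: "(a, \<mu>) \<in> degset n [0] k"
    hence "(a, add_mset l \<mu>) \<in> degset n [0] (Suc k)" using l by (auto simp: degset_def)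
    thus "\<epsilon> (Suc k) (unit_fun R (a, add_mset l \<mu>)) = f l \<otimes> \<epsilon> k (unit_fun R (a, \<mu>))"
      using \<epsilon>u a l fc by (simp add: monom_add_mset)
  qed
  let ?im = "\<lambda>k. \<epsilon> k ` carrier (free_strand n [0] k)"
  have im_ideal: "ideal (?im k) R" "?im k \<subseteq> ?I k" for k
    using submodule_image[OF \<epsilon>[of k]] submodule_ideal_module[OF Ik] by auto
  have "?I k \<subseteq> ?im k" for k
  proof (induction k)
    case 0
    have x: "(0, {#}) \<in> degset n [0] 0" by (simp add: degset_def)
    have e: "\<epsilon> 0 (unit_fun R (0, {#})) = \<one>" using \<epsilon>u[OF x] by (simp add: monom_empty)
    have "\<epsilon> 0 (unit_fun R (0, {#})) \<in> ?im 0" by (rule imageI[OF unit_fun_carrier[OF x]])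
    hence "?im 0 = carrier R" unfolding e by (rule ideal.one_imp_carrier[OF im_ideal(1)])
    thus ?case unfolding ideal_power_0 by (rule equalityD2)
  next
    case (Suc k)
    have gen: "f l \<otimes> x \<in> ?im (Suc k)" if l: "l < n" and x: "x \<in> ?I k" for l x
    proof -
      obtain u where u: "u \<in> carrier (free_strand n [0] k)" "x = \<epsilon> k u" using Suc x by blast
      show ?thesis unfolding u(2) comm[OF l u(1), symmetric]
        by (rule imageI[OF shift_strand[OF l u(1)]])
    qed
    have "ideal_smult R (ideal_module R (carrier R)) (Idl A) (?I k) \<subseteq> ?im (Suc k)"
    proof (rule module.ideal_smult_Idl[OF module_ideal[OF oneideal] _ _ A(1)])
      show "submodule R (?im (Suc k)) (ideal_module R (carrier R))"
        unfolding submodule_ideal_module[OF oneideal]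
        using im_ideal(1) ideal.Icarr[OF im_ideal(1)] by (intro conjI subsetI)
      show "?I k \<subseteq> carrier (ideal_module R (carrier R))"
        using ideal.Icarr[OF Ik] by (auto simp: ideal_module_def)
      show "y \<odot>\<^bsub>ideal_module R (carrier R)\<^esub> x \<in> ?im (Suc k)" if y: "y \<in> A" and x: "x \<in> ?I k" for x y
      proof -
        obtain l where l: "l < n" "y = f l" using y fA by blast
        show ?thesis using gen[OF l(1) x] l(2) by (simp only: ideal_module_def module.simps)
      qed
    qed
    moreover have "ideal_smult R (ideal_module R (carrier R)) (Idl A) (?I k) = ?I (Suc k)"
      unfolding A(3)[symmetric] ideal_power_Suc'[OF I]
      by (rule ideal_smult_ideal_module[OF oneideal I Ik]) (use ideal.Icarr[OF Ik] in blast)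
    ultimately show ?case by simp
  qed
  hence im: "?im k = ?I k" for k using im_ideal(2) by blast
  have "shift_closed n (\<lambda>k. {u \<in> carrier (free_strand n [0] k). \<epsilon> k u = \<zero>\<^bsub>ideal_module R (?I k)\<^esub>})"
    by (rule kernel_shift_closed[OF \<epsilon> \<theta> comm])
  hence "shift_closed n (\<lambda>k. {u \<in> carrier (free_strand n [0] k). \<epsilon> k u = \<zero>})"
    by (simp add: ideal_module_def)
  thus ?thesis by (intro exI[of _ n] exI[of _ \<epsilon>] conjI allI \<epsilon> im)
qed

lemma ideal_smult_strand:
  assumes "J \<subseteq> carrier R" "N \<subseteq> carrier (free_strand n ds k)"
  shows "ideal_smult R (free_strand n ds k) J N = ideal_smult R U J N"
proof -
  interpret U: module R U by (rule U_module)
  have "{a \<odot>\<^bsub>U\<^esub> x | a x. a \<in> J \<and> x \<in> N} \<subseteq> carrier (free_strand n ds k)"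
    using assms module.smult_gens_subset[OF module_fun_module assms] by auto
  from U.span_li_not_depend(1)[OF this fun_module_submodule] show ?thesis
    unfolding ideal_smult_def by (simp add: fun_module_restrict)
qed

text \<open>Intersecting a graded submodule with the powers of \<open>m\<close> times the strands
  gives a biclosed family.\<close>

lemma strand_defects_eventually_constant:
  assumes K: "shift_closed n K" "\<And>k. K k \<subseteq> carrier (free_strand n ds k)" and m: "ideal m R"
  shows "\<exists>B k0. \<forall>k\<ge>k0. defects R m (K k) (free_strand n ds k) = B"
proof -
  interpret P: polynomial_module R U n "\<lambda>l. shift R {#l#}" "\<lambda>k. carrier (free_strand n ds k)"
    "(\<lambda>g. (ds ! g, unit_fun R (g, {#}))) ` {..<length ds}" by (rule polynomial_module_free)
  have Kc: "P.closed K" using K(1) by (simp add: P.closed_def shift_closed_def)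
  let ?m = "\<lambda>i k. ideal_smult R U (ideal_power R m i) (carrier (free_strand n ds k))"
  define W where "W i k = K k \<inter> ?m i k" for i k
  note mi = ideal_power_ideal[OF m]
  have mc: "ideal_power R m i \<subseteq> carrier R" for i using ideal.Icarr[OF mi] by blast
  have mc1: "m \<subseteq> carrier R" using ideal.Icarr[OF m] by blast
  have Fc: "carrier (free_strand n ds k) \<subseteq> carrier U" for k by auto
  have "P.biclosed m W"
    unfolding P.biclosed_def[OF m] P.closed_def
  proof (intro conjI allI ballI impI)
    fix i k
    show "submodule R (W i k) U"
      unfolding W_def by (intro P.submodule_Int P.closedD(1)[OF Kc] P.ideal_smult_submodule mc Fc)
    show "shift R {#l#} x \<in> W i (Suc k)" if "l < n" "x \<in> W i k" for l x
    proof -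
      have "shift R {#l#} x \<in> ?m i (Suc k)"
        by (rule P.ideal_smult_X[OF that(1) mc Fc fun_module_submodule shift_strand[OF that(1)]
              IntD2[OF that(2)[unfolded W_def]]])
      thus ?thesis using P.closedD(2)[OF Kc that(1)] that(2) by (simp add: W_def)
    qed
    show "W i k \<subseteq> ?m i k" by (simp add: W_def)
    fix a x assume a: "a \<in> m" and x: "x \<in> W i k"
    have "a \<odot>\<^bsub>U\<^esub> x \<in> ideal_smult R U m (?m i k)"
      by (rule P.ideal_smultI[OF mc1 _ a])
        (use x P.submodule_subset[OF P.ideal_smult_submodule[OF mc Fc]] in \<open>auto simp only: W_def\<close>)
    hence "a \<odot>\<^bsub>U\<^esub> x \<in> ?m (Suc i) k"
      unfolding ideal_power_Suc'[OF m] P.ideal_smult_prod[OF m mi fun_module_submodule] .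
    moreover have "a \<odot>\<^bsub>U\<^esub> x \<in> K k"
      by (rule P.submoduleD(6)[OF P.closedD(1)[OF Kc]]) (use a mc1 x in \<open>auto simp only: W_def\<close>)
    ultimately show "a \<odot>\<^bsub>U\<^esub> x \<in> W (Suc i) k" by (simp only: W_def Int_iff)
  qed
  from P.biclosed_defects_eventually_constant[OF m this] obtain B k0
    where B: "\<And>k. k \<ge> k0 \<Longrightarrow> {i. \<not> W (Suc i) k \<subseteq> ideal_smult R U m (W i k)} = B" by blast
  have eq: "defects R m (K k) (free_strand n ds k) = {i. \<not> W (Suc i) k \<subseteq> ideal_smult R U m (W i k)}" for k
  proof -
    have "ideal_smult R (free_strand n ds k) m (W i k) = ideal_smult R U m (W i k)" for i
      by (rule ideal_smult_strand[OF mc1]) (use K(2) in \<open>auto simp only: W_def\<close>)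
    thus ?thesis unfolding defects_def ideal_smult_strand[OF mc subset_refl] W_def by simp
  qed
  show ?thesis by (intro exI[of _ B] exI[of _ k0] allI impI) (rule trans[OF eq B])
qed

text \<open>Dependent choice over triples \<open>(ds, K, \<Phi>)\<close>: the degrees of a basis,
  the kernel of the outgoing map, and that map. The kernel is stored because it is what the next
  free module has to cover.\<close>

theorem ideal_powers_resolution:
  assumes I: "ideal I R"
  obtains F :: "nat \<Rightarrow> nat \<Rightarrow> ('a, 'a poly_fun) module" and \<phi> \<epsilon>
  where "\<And>k. free_resolution R (ideal_module R (ideal_power R I k)) (F k) (\<phi> k) (\<epsilon> k)"
    "\<And>m j. ideal m R \<Longrightarrow> \<exists>B k0. \<forall>k\<ge>k0. defects R m (\<phi> k (Suc j) ` carrier (F k (Suc j))) (F k j) = B"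
proof -
  let ?I = "ideal_power R I"
  obtain n \<epsilon> where \<epsilon>: "\<And>k. mod_hom R (free_strand n [0] k) (ideal_module R (?I k)) (\<epsilon> k)"
    "\<And>k. \<epsilon> k ` carrier (free_strand n [0] k) = ?I k"
    "shift_closed n (\<lambda>k. {u \<in> carrier (free_strand n [0] k). \<epsilon> k u = \<zero>})"
    using ideal_power_cover[OF I] by blast
  define ok where "ok = (\<lambda>(ds, K, \<Phi> :: nat \<Rightarrow> 'a poly_fun \<Rightarrow> 'a poly_fun).
    shift_closed n K \<and> (\<forall>k. K k \<subseteq> carrier (free_strand n ds k)))"
  define nxt where "nxt = (\<lambda>(ds, K, \<Phi>' :: nat \<Rightarrow> 'a poly_fun \<Rightarrow> 'a poly_fun) (ds', K', \<Phi> :: nat \<Rightarrow> 'a poly_fun \<Rightarrow> 'a poly_fun).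
    \<forall>k. mod_hom R (free_strand n ds' k) (free_strand n ds k) (\<Phi> k) \<and>
      \<Phi> k ` carrier (free_strand n ds' k) = K k \<and>
      K' k = {u \<in> carrier (free_strand n ds' k). \<Phi> k u = \<zero>\<^bsub>free_strand n ds k\<^esub>})"
  \<comment> \<open>At stage \<open>0\<close> the outgoing map is the augmentation, whose target has
    another type; the third entry is a placeholder, and the kernel is that of
    \<open>\<epsilon>\<close>.\<close>
  define init where "init = ([0::nat], \<lambda>k. {u \<in> carrier (free_strand n [0] k). \<epsilon> k u = \<zero>},
    (\<lambda>k u. u) :: nat \<Rightarrow> 'a poly_fun \<Rightarrow> 'a poly_fun)"
  have "\<exists>s. \<forall>j. (ok (s j) \<and> (j = 0 \<longrightarrow> s j = init)) \<and> nxt (s j) (s (Suc j))"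
  proof (rule dependent_nat_choice)
    show "\<exists>s. ok s \<and> (0 = (0::nat) \<longrightarrow> s = init)" using \<epsilon>(3) by (auto simp: ok_def init_def)
    fix s :: "nat list \<times> (nat \<Rightarrow> 'a poly_fun set) \<times> (nat \<Rightarrow> 'a poly_fun \<Rightarrow> 'a poly_fun)" and j :: nat
    assume s: "ok s \<and> (j = 0 \<longrightarrow> s = init)"
    obtain ds K \<Phi>' where s': "s = (ds, K, \<Phi>')" by (cases s)
    have K: "shift_closed n K" "\<And>k. K k \<subseteq> carrier (free_strand n ds k)" using s s' by (auto simp: ok_def)
    obtain ds' \<Phi> where \<Phi>: "\<And>k. mod_hom R (free_strand n ds' k) (free_strand n ds k) (\<Phi> k)"
      "\<And>k. \<Phi> k ` carrier (free_strand n ds' k) = K k"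
      "shift_closed n (\<lambda>k. {u \<in> carrier (free_strand n ds' k). \<Phi> k u = \<zero>\<^bsub>free_strand n ds k\<^esub>})"
      using resolution_step[OF K] by blast
    let ?t = "(ds', \<lambda>k. {u \<in> carrier (free_strand n ds' k). \<Phi> k u = \<zero>\<^bsub>free_strand n ds k\<^esub>}, \<Phi>)"
    have "ok ?t" unfolding ok_def prod.case by (intro conjI allI \<Phi>(3)) (rule Collect_restrict)
    moreover have "nxt s ?t" unfolding nxt_def s' prod.case by (intro allI conjI \<Phi>(1,2) refl)
    ultimately show "\<exists>t. (ok t \<and> (Suc j = 0 \<longrightarrow> t = init)) \<and> nxt s t" by (intro exI[of _ ?t]) simp
  qed
  then obtain s where s: "\<And>j. ok (s j)" "s 0 = init" "\<And>j. nxt (s j) (s (Suc j))" by blast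
  define ds where "ds j = fst (s j)" for j
  define K where "K j = fst (snd (s j))" for j
  define \<Phi> where "\<Phi> j = snd (snd (s j))" for j
  have s': "s j = (ds j, K j, \<Phi> j)" for j by (simp add: ds_def K_def \<Phi>_def)
  have ds0: "ds 0 = [0]" "K 0 k = {u \<in> carrier (free_strand n [0] k). \<epsilon> k u = \<zero>}" for k
    using s(2) by (auto simp: ds_def K_def init_def)
  have ok: "shift_closed n (K j)" "K j k \<subseteq> carrier (free_strand n (ds j) k)" for j k
    using s(1)[of j] unfolding s' ok_def prod.case by auto
  have nxt: "mod_hom R (free_strand n (ds (Suc j)) k) (free_strand n (ds j) k) (\<Phi> (Suc j) k)"
    "\<Phi> (Suc j) k ` carrier (free_strand n (ds (Suc j)) k) = K j k"
    "K (Suc j) k = {u \<in> carrier (free_strand n (ds (Suc j)) k). \<Phi> (Suc j) k u = \<zero>\<^bsub>free_strand n (ds j) k\<^esub>}" for j k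
    using s(3)[of j] unfolding s' nxt_def prod.case by auto
  show ?thesis
  proof (rule that[of "\<lambda>k j. free_strand n (ds j) k" "\<lambda>k j. \<Phi> j k" \<epsilon>])
    fix k
    show "free_resolution R (ideal_module R (?I k)) (\<lambda>j. free_strand n (ds j) k) (\<lambda>j. \<Phi> j k) (\<epsilon> k)"
      unfolding free_resolution_def a_kernel_def kernel_def
    proof (intro conjI allI impI)
      show "module R (free_strand n (ds j) k)" for j by (rule module_fun_module)
      show "\<exists>B. finite B \<and> module_basis R (free_strand n (ds j) k) B" for j
        using fun_module_basis[OF finite_degset] by blast
      show "mod_hom R (free_strand n (ds 0) k) (ideal_module R (?I k)) (\<epsilon> k)" unfolding ds0(1) by (rule \<epsilon>(1))
      show "\<epsilon> k ` carrier (free_strand n (ds 0) k) = carrier (ideal_module R (?I k))"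
        unfolding ds0(1) \<epsilon>(2) by (simp add: ideal_module_def)
      show "\<Phi> 1 k ` carrier (free_strand n (ds 1) k)
        = {x \<in> carrier (add_monoid (free_strand n (ds 0) k)). \<epsilon> k x = \<one>\<^bsub>add_monoid (ideal_module R (?I k))\<^esub>}"
        using nxt(2)[of 0 k] ds0 by (simp add: ideal_module_def)
      fix j :: nat assume "1 \<le> j"
      then obtain i where i: "j = Suc i" by (cases j) auto
      show "mod_hom R (free_strand n (ds j) k) (free_strand n (ds (j - 1)) k) (\<Phi> j k)"
        using nxt(1)[of i k] i by simp
      show "\<Phi> (j + 1) k ` carrier (free_strand n (ds (j + 1)) k)
        = {x \<in> carrier (add_monoid (free_strand n (ds j) k)). \<Phi> j k x = \<one>\<^bsub>add_monoid (free_strand n (ds (j - 1)) k)\<^esub>}"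
        using nxt(2)[of j k] nxt(3)[of i k] i by simp
    qed
  next
    fix m j assume m: "ideal m R"
    show "\<exists>B k0. \<forall>k\<ge>k0. defects R m (\<Phi> (Suc j) k ` carrier (free_strand n (ds (Suc j)) k)) (free_strand n (ds j) k) = B"
      unfolding nxt(2) by (rule strand_defects_eventually_constant[OF ok m])
  qed
qed

text \<open>\<open>\<rho> j k\<close> is read off from the constructed resolution. By the comparison
  of resolutions every other free resolution of the \<open>k\<close>-th power gives the same number,
  also when its elements have another type.\<close>

theorem syzygy_artin_rees_numbers_of_powers:
  assumes I: "ideal I R" and m: "ideal m R"
  obtains \<rho> :: "nat \<Rightarrow> nat \<Rightarrow> nat" where "\<And>j. \<exists>c k0. \<forall>k\<ge>k0. \<rho> j k = c"
    "\<And>j k (F :: nat \<Rightarrow> ('a, 'c) module) \<phi> \<epsilon>. j \<ge> 1 \<Longrightarrow> free_resolution R (ideal_module R (ideal_power R I k)) F \<phi> \<epsilon> \<Longrightarrow>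
      syzygy_artin_rees_number R m F \<phi> j = \<rho> j k"
proof -
  obtain F :: "nat \<Rightarrow> nat \<Rightarrow> ('a, 'a poly_fun) module" and \<phi> \<epsilon>
    where F: "\<And>k. free_resolution R (ideal_module R (ideal_power R I k)) (F k) (\<phi> k) (\<epsilon> k)"
    "\<And>m j. ideal m R \<Longrightarrow> \<exists>B k0. \<forall>k\<ge>k0. defects R m (\<phi> k (Suc j) ` carrier (F k (Suc j))) (F k j) = B"
    using ideal_powers_resolution[OF I] by metis
  \<comment> \<open>\<open>Suc (j - 1)\<close> is \<open>j\<close> for \<open>j \<ge> 1\<close>, in
    the form in which the constructed resolution states its property.\<close>
  define \<rho> where "\<rho> j k = (LEAST r. \<forall>i\<ge>r. i \<notin> defects R m (\<phi> k (Suc (j - 1)) ` carrier (F k (Suc (j - 1)))) (F k (j - 1)))" for j k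
  show ?thesis
  proof (rule that[of \<rho>])
    fix j
    obtain B k0 where "\<And>k. k \<ge> k0 \<Longrightarrow> defects R m (\<phi> k (Suc (j - 1)) ` carrier (F k (Suc (j - 1)))) (F k (j - 1)) = B"
      using F(2)[OF m, of "j - 1"] by blast
    hence "\<forall>k\<ge>k0. \<rho> j k = (LEAST r. \<forall>i\<ge>r. i \<notin> B)" by (simp add: \<rho>_def)
    thus "\<exists>c k0. \<forall>k\<ge>k0. \<rho> j k = c" by blast
  next
    fix j k :: nat and F' :: "nat \<Rightarrow> ('a, 'c) module" and \<phi>' \<epsilon>'
    assume "j \<ge> 1" "free_resolution R (ideal_module R (ideal_power R I k)) F' \<phi>' \<epsilon>'"
    thus "syzygy_artin_rees_number R m F' \<phi>' j = \<rho> j k"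
      using syzygy_artin_rees_number_comparison[OF _ F(1) m] by (simp add: \<rho>_def)
  qed
qed

end

section \<open>Lengths of chains of ideals\<close>

context cring
begin

lemma mem_set_add: "x \<in> I <+>\<^bsub>R\<^esub> J \<longleftrightarrow> (\<exists>a\<in>I. \<exists>b\<in>J. x = a \<oplus> b)"
  by (auto simp: set_add_def')

lemma idealD:
  assumes "ideal J R"
  shows "x \<in> J \<Longrightarrow> x \<in> carrier R" "\<zero> \<in> J" "x \<in> J \<Longrightarrow> y \<in> J \<Longrightarrow> x \<oplus> y \<in> J" "x \<in> J \<Longrightarrow> \<ominus> x \<in> J"
    "x \<in> J \<Longrightarrow> y \<in> J \<Longrightarrow> x \<ominus> y \<in> J" "r \<in> carrier R \<Longrightarrow> x \<in> J \<Longrightarrow> r \<otimes> x \<in> J"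
    "r \<in> carrier R \<Longrightarrow> x \<in> J \<Longrightarrow> x \<otimes> r \<in> J"
  using assms ideal_iff_submodule[of J] add_subD[of J] ideal.I_r_closed[OF assms] by auto

lemma idealI':
  assumes "J \<subseteq> carrier R" "\<zero> \<in> J" "\<And>x y. x \<in> J \<Longrightarrow> y \<in> J \<Longrightarrow> x \<oplus> y \<in> J"
    "\<And>r x. r \<in> carrier R \<Longrightarrow> x \<in> J \<Longrightarrow> r \<otimes> x \<in> J"
  shows "ideal J R"
proof -
  have "\<ominus> x \<in> J" if "x \<in> J" for x using assms(1) assms(4)[of "\<ominus> \<one>" x] that by (auto simp: l_minus)
  thus ?thesis unfolding ideal_iff_submodule using assms by (intro conjI add_subI ballI) auto
qed

lemma ideal_subset: "ideal J R \<Longrightarrow> J \<subseteq> carrier R"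
  using idealD(1) by blast

lemma set_add_mono: "I \<subseteq> I' \<Longrightarrow> J \<subseteq> J' \<Longrightarrow> I <+>\<^bsub>R\<^esub> J \<subseteq> I' <+>\<^bsub>R\<^esub> J'"
  unfolding mem_set_add subset_iff by blast

lemma set_add_ge1: "ideal I R \<Longrightarrow> ideal J R \<Longrightarrow> I \<subseteq> I <+>\<^bsub>R\<^esub> J"
proof
  fix x assume "ideal I R" "ideal J R" "x \<in> I"
  thus "x \<in> I <+>\<^bsub>R\<^esub> J" unfolding mem_set_add
    using idealD(1)[of I x] idealD(2)[of J] by (intro bexI[of _ x] bexI[of _ \<zero>]) auto
qed

lemma set_add_ge2: "ideal I R \<Longrightarrow> ideal J R \<Longrightarrow> J \<subseteq> I <+>\<^bsub>R\<^esub> J"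
proof
  fix x assume "ideal I R" "ideal J R" "x \<in> J"
  thus "x \<in> I <+>\<^bsub>R\<^esub> J" unfolding mem_set_add
    using idealD(1)[of J x] idealD(2)[of I] by (intro bexI[of _ x] bexI[of _ \<zero>]) auto
qed

lemma set_add_least: "ideal P R \<Longrightarrow> I \<subseteq> P \<Longrightarrow> J \<subseteq> P \<Longrightarrow> I <+>\<^bsub>R\<^esub> J \<subseteq> P"
proof
  fix x assume P: "ideal P R" "I \<subseteq> P" "J \<subseteq> P" and "x \<in> I <+>\<^bsub>R\<^esub> J"
  then obtain a b where "a \<in> I" "b \<in> J" "x = a \<oplus> b" unfolding mem_set_add by blast
  thus "x \<in> P" using P idealD(3)[OF P(1), of a b] by blast
qed

lemma ideal_colon:
  assumes P: "ideal P R" and a: "a \<in> carrier R"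
  shows "ideal {b \<in> carrier R. a \<otimes> b \<in> P} R"
proof (rule idealI')
  fix x y assume "x \<in> {b \<in> carrier R. a \<otimes> b \<in> P}" "y \<in> {b \<in> carrier R. a \<otimes> b \<in> P}"
  thus "x \<oplus> y \<in> {b \<in> carrier R. a \<otimes> b \<in> P}" using idealD(3)[OF P] a by (auto simp: r_distr)
next
  fix r x assume "r \<in> carrier R" "x \<in> {b \<in> carrier R. a \<otimes> b \<in> P}"
  thus "r \<otimes> x \<in> {b \<in> carrier R. a \<otimes> b \<in> P}" using idealD(6)[OF P] a m_lcomm[of a r x] by auto
qed (use idealD(2)[OF P] a in auto)

lemma genideal_colon:
  assumes "ideal P R" "a \<in> carrier R" "Y \<subseteq> carrier R" "\<And>y. y \<in> Y \<Longrightarrow> a \<otimes> y \<in> P" "b \<in> Idl Y"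
  shows "a \<otimes> b \<in> P"
  using genideal_minimal[OF ideal_colon[OF assms(1,2)], of Y] assms(3-5) by blast

lemma maximal_inverse:
  assumes m: "maximalideal m R" and u: "u \<in> carrier R" "u \<notin> m"
  obtains w where "w \<in> carrier R" "\<one> \<ominus> w \<otimes> u \<in> m"
proof -
  interpret maximalideal m R by fact
  have mi: "ideal m R" by (rule is_ideal)
  have J: "ideal (m <+>\<^bsub>R\<^esub> PIdl u) R" by (rule add_ideals[OF mi cgenideal_ideal[OF u(1)]])
  have "u \<in> m <+>\<^bsub>R\<^esub> PIdl u"
    using set_add_ge2[OF mi cgenideal_ideal[OF u(1)]] cgenideal_self[OF u(1)] by blast
  hence "m <+>\<^bsub>R\<^esub> PIdl u = carrier R"
    using I_maximal[OF J set_add_ge1[OF mi cgenideal_ideal[OF u(1)]] ideal_subset[OF J]] u(2) by blast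
  hence "\<one> \<in> m <+>\<^bsub>R\<^esub> PIdl u" by simp
  then obtain y z where y: "y \<in> m" "z \<in> PIdl u" "\<one> = y \<oplus> z" unfolding mem_set_add by blast
  then obtain w where w: "w \<in> carrier R" "z = w \<otimes> u" unfolding cgenideal_def by blast
  have "\<one> \<ominus> w \<otimes> u = y"
    using y w u(1) idealD(1)[OF mi, of y] by (simp add: a_minus_def a_assoc r_neg)
  thus ?thesis using that[OF w(1)] y(1) by simp
qed

text \<open>This says that \<open>R / J\<close> has length at least \<open>n\<close>. Chains of
  ideals express it without quotient modules and without assuming the length to be finite.\<close>

definition has_chain :: "'a set \<Rightarrow> nat \<Rightarrow> bool"
  where "has_chain J n \<longleftrightarrow> (\<exists>C. (\<forall>i\<le>n. ideal (C i) R \<and> J \<subseteq> C i) \<and> (\<forall>i<n. C i \<subset> C (Suc i)))"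

lemma has_chain_mono:
  assumes "has_chain J n" "J' \<subseteq> J" "n' \<le> n"
  shows "has_chain J' n'"
proof -
  obtain C where C: "\<And>i. i \<le> n \<Longrightarrow> ideal (C i) R \<and> J \<subseteq> C i" "\<And>i. i < n \<Longrightarrow> C i \<subset> C (Suc i)"
    using assms(1) unfolding has_chain_def by blast
  have "(\<forall>i\<le>n'. ideal (C i) R \<and> J' \<subseteq> C i) \<and> (\<forall>i<n'. C i \<subset> C (Suc i))"
    using C assms(2,3) by (meson order_trans le_less_trans less_le_trans)
  thus ?thesis unfolding has_chain_def by (rule exI[of _ C])
qed

lemma has_chain_append:
  assumes "has_chain J v" "\<And>i. i \<le> u \<Longrightarrow> ideal (E i) R \<and> J' \<subseteq> E i" "\<And>i. i < u \<Longrightarrow> E i \<subset> E (Suc i)"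
    and "E u \<subseteq> J" "J' \<subseteq> J"
  shows "has_chain J' (u + v)"
proof -
  obtain C where C: "\<And>i. i \<le> v \<Longrightarrow> ideal (C i) R \<and> J \<subseteq> C i" "\<And>i. i < v \<Longrightarrow> C i \<subset> C (Suc i)"
    using assms(1) unfolding has_chain_def by blast
  \<comment> \<open>\<open>C 0\<close> is left out:
    \<open>E u \<subseteq> J \<subseteq> C 0 \<subset> C 1\<close> is still strict at the seam, and
    \<open>u + v\<close> strict steps result.\<close>
  define D where "D i = (if i \<le> u then E i else C (i - u))" for i
  have "ideal (D i) R \<and> J' \<subseteq> D i" if "i \<le> u + v" for i
  proof (cases "i \<le> u")
    case False
    hence "ideal (C (i - u)) R \<and> J \<subseteq> C (i - u)" using C(1) that by simp
    thus ?thesis using False assms(5) by (auto simp: D_def)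
  qed (use assms(2) in \<open>simp add: D_def\<close>)
  moreover have "D i \<subset> D (Suc i)" if i: "i < u + v" for i
  proof -
    consider "i < u" | "i = u" | "i > u" by linarith
    thus ?thesis
    proof cases
      case 2
      hence "C 0 \<subset> C 1" "J \<subseteq> C 0" using C(1)[of 0] C(2)[of 0] i by auto
      thus ?thesis using 2 assms(4) by (auto simp: D_def)
    next
      case 3
      thus ?thesis using C(2)[of "i - u"] i by (simp add: D_def Suc_diff_le)
    qed (use assms(3) in \<open>simp add: D_def\<close>)
  qed
  ultimately show ?thesis unfolding has_chain_def by (intro exI[of _ D]) simp
qed

text \<open>Multiplication by \<open>a\<close> embeds \<open>R / (T : a)\<close> into \<open>R / T\<close>.\<close>

lemma has_chain_colon:
  assumes T: "ideal T R" and a: "a \<in> carrier R" and Q: "ideal Q R" "T \<subseteq> Q" "a \<in> Q"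
    and J: "\<And>b. b \<in> carrier R \<Longrightarrow> a \<otimes> b \<in> T \<Longrightarrow> b \<in> J" and u: "has_chain J u" and v: "has_chain Q v"
  shows "has_chain T (u + v)"
proof -
  obtain C where C: "\<And>i. i \<le> u \<Longrightarrow> ideal (C i) R \<and> J \<subseteq> C i" "\<And>i. i < u \<Longrightarrow> C i \<subset> C (Suc i)"
    using u unfolding has_chain_def by blast
  \<comment> \<open>The preimage in \<open>R\<close> of \<open>a\<close> times \<open>C i\<close> in
    \<open>R / T\<close>.\<close>
  define E where "E i = {x. \<exists>c\<in>C i. \<exists>t\<in>T. x = a \<otimes> c \<oplus> t}" for i
  note Td = idealD[OF T]
  have E: "ideal (E i) R" if i: "i \<le> u" for i
  proof (rule idealI')
    note Cd = idealD[OF conjunct1[OF C(1)[OF i]]]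
    show "E i \<subseteq> carrier R" using Cd(1) Td(1) a by (auto simp: E_def)
    have "\<zero> = a \<otimes> \<zero> \<oplus> \<zero>" using a by simp
    thus "\<zero> \<in> E i" unfolding E_def using Cd(2) Td(2) by blast
    fix x assume "x \<in> E i"
    then obtain c t where x: "c \<in> C i" "t \<in> T" "x = a \<otimes> c \<oplus> t" unfolding E_def by blast
    { fix y assume "y \<in> E i"
      then obtain c' t' where y: "c' \<in> C i" "t' \<in> T" "y = a \<otimes> c' \<oplus> t'" unfolding E_def by blast
      have "x \<oplus> y = a \<otimes> (c \<oplus> c') \<oplus> (t \<oplus> t')" using x y Cd(1) Td(1) a by (simp add: r_distr a_ac)
      thus "x \<oplus> y \<in> E i" unfolding E_def using Cd(3)[OF x(1) y(1)] Td(3)[OF x(2) y(2)] by blast }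
    fix r assume r: "r \<in> carrier R"
    have "r \<otimes> x = a \<otimes> (r \<otimes> c) \<oplus> r \<otimes> t" using x r Cd(1) Td(1) a by (simp add: r_distr m_lcomm)
    thus "r \<otimes> x \<in> E i" unfolding E_def using Cd(6)[OF r x(1)] Td(6)[OF r x(2)] by blast
  qed
  show ?thesis
  proof (rule has_chain_append[OF v, of u E])
    fix i assume i: "i \<le> u"
    note Cd = idealD[OF conjunct1[OF C(1)[OF i]]]
    have "t \<in> E i" if "t \<in> T" for t
    proof -
      have "t = a \<otimes> \<zero> \<oplus> t" using a Td(1)[OF that] by simp
      thus ?thesis unfolding E_def using Cd(2) that by blast
    qed
    thus "ideal (E i) R \<and> T \<subseteq> E i" using E[OF i] by blast
  next
    fix i assume i: "i < u"
    have i1: "ideal (C i) R" "J \<subseteq> C i" and i2: "ideal (C (Suc i)) R" using C(1)[of i] C(1)[of "Suc i"] i by auto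
    note Cd = idealD[OF i1(1)] and Cd' = idealD[OF i2]
    have "E i \<subseteq> E (Suc i)" unfolding E_def using C(2)[OF i] by blast
    moreover obtain c where c: "c \<in> C (Suc i)" "c \<notin> C i" using C(2)[OF i] by blast
    have cc: "c \<in> carrier R" by (rule Cd'(1)[OF c(1)])
    have "a \<otimes> c = a \<otimes> c \<oplus> \<zero>" using cc a by simp
    hence "a \<otimes> c \<in> E (Suc i)" unfolding E_def using c(1) Td(2) by blast
    moreover have "a \<otimes> c \<notin> E i"
    proof
      assume "a \<otimes> c \<in> E i"
      then obtain c' t where c': "c' \<in> C i" "t \<in> T" "a \<otimes> c = a \<otimes> c' \<oplus> t" unfolding E_def by blast
      have "a \<otimes> (c \<ominus> c') = t"
        using c' cc Cd(1)[OF c'(1)] Td(1)[OF c'(2)] a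
        by (simp add: a_minus_def r_distr r_minus a_ac r_neg r_neg1)
      hence "c \<ominus> c' \<in> J" using J[of "c \<ominus> c'"] c'(2) cc Cd(1)[OF c'(1)] by simp
      hence "(c \<ominus> c') \<oplus> c' \<in> C i" using i1(2) Cd(3)[OF _ c'(1)] by blast
      thus False using c(2) cc Cd(1)[OF c'(1)] by (simp add: a_minus_def a_assoc l_neg)
    qed
    ultimately show "E i \<subset> E (Suc i)" by blast
  next
    show "E u \<subseteq> Q"
    proof
      fix x assume "x \<in> E u"
      then obtain c t where x: "c \<in> C u" "t \<in> T" "x = a \<otimes> c \<oplus> t" unfolding E_def by blast
      have "c \<in> carrier R" using C(1)[of u] idealD(1)[of "C u" c] x(1) by simp
      hence "a \<otimes> c \<in> Q" by (rule idealD(7)[OF Q(1) _ Q(3)])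
      thus "x \<in> Q" using x(2,3) Q(2) idealD(3)[OF Q(1)] by blast
    qed
  qed (rule Q(2))
qed

end

section \<open>Growth of lengths along a chain of primes\<close>

context noetherian_cring
begin

text \<open>Artin--Rees for the ideal \<open>(a) + p\<close>: if \<open>a b = s + t\<close> with
  \<open>s\<close> in \<open>p\<close> and \<open>t\<close> in \<open>m^N\<close>, then
  \<open>t\<close> lies in \<open>m^(N-r)\<close> times that ideal, so \<open>a (b - c)\<close> lies
  in \<open>p\<close> for some \<open>c\<close> in \<open>m^(N-r)\<close>, and \<open>a\<close> can
  be cancelled. The loss \<open>r\<close> does not depend on \<open>N\<close>.\<close>

lemma artin_rees_colon:
  assumes m: "ideal m R" and p: "ideal p R" and a: "a \<in> carrier R"
    and nzd: "\<And>b. b \<in> carrier R \<Longrightarrow> a \<otimes> b \<in> p \<Longrightarrow> b \<in> p"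
  obtains r where "\<And>N b. b \<in> carrier R \<Longrightarrow> a \<otimes> b \<in> p <+>\<^bsub>R\<^esub> ideal_power R m N \<Longrightarrow> b \<in> p <+>\<^bsub>R\<^esub> ideal_power R m (N - r)"
proof -
  note mi = ideal_power_ideal[OF m]
  have n: "ideal (PIdl a <+>\<^bsub>R\<^esub> p) R" by (rule add_ideals[OF cgenideal_ideal[OF a] p])
  obtain r where r: "\<And>j. (PIdl a <+>\<^bsub>R\<^esub> p) \<inter> ideal_power R m (j + r) \<subseteq> ideal_power R m j \<cdot> (PIdl a <+>\<^bsub>R\<^esub> p)"
    using artin_rees_ideal[OF noetherian_ring_axioms m n] by blast
  have prod: "\<exists>c\<in>ideal_power R m j. \<exists>s\<in>p. x = a \<otimes> c \<oplus> s" if "x \<in> ideal_power R m j \<cdot> (PIdl a <+>\<^bsub>R\<^esub> p)" for x j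
    using that
  proof (induction rule: ideal_prod.induct)
    case (prod i z)
    then obtain y s where "y \<in> PIdl a" "s \<in> p" "z = y \<oplus> s" unfolding mem_set_add by blast
    moreover then obtain t where "t \<in> carrier R" "y = t \<otimes> a" unfolding cgenideal_def by blast
    ultimately have z: "z = t \<otimes> a \<oplus> s" "t \<in> carrier R" "s \<in> p" by auto
    have ic: "i \<in> carrier R" by (rule idealD(1)[OF mi prod(1)])
    have "i \<otimes> z = a \<otimes> (i \<otimes> t) \<oplus> i \<otimes> s"
      using z ic a idealD(1)[OF p z(3)] by (simp add: r_distr m_lcomm m_comm)
    thus ?case using idealD(7)[OF mi z(2) prod(1)] idealD(6)[OF p ic z(3)] by blast
  next
    case (sum x y)
    then obtain c s c' s' where h: "c \<in> ideal_power R m j" "s \<in> p" "x = a \<otimes> c \<oplus> s"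
      "c' \<in> ideal_power R m j" "s' \<in> p" "y = a \<otimes> c' \<oplus> s'" by blast
    have "x \<oplus> y = a \<otimes> (c \<oplus> c') \<oplus> (s \<oplus> s')"
      using h idealD(1)[OF mi] idealD(1)[OF p] a by (simp add: r_distr a_ac)
    thus ?case using idealD(3)[OF mi h(1,4)] idealD(3)[OF p h(2,5)] by blast
  qed
  show ?thesis
  proof (rule that[of r])
    fix N b assume b: "b \<in> carrier R" and ab: "a \<otimes> b \<in> p <+>\<^bsub>R\<^esub> ideal_power R m N"
    show "b \<in> p <+>\<^bsub>R\<^esub> ideal_power R m (N - r)"
    proof (cases "N < r")
      case True
      thus ?thesis using set_add_ge2[OF p oneideal] b by (auto simp: ideal_power_0)
    next
      case False
      obtain s t where st: "s \<in> p" "t \<in> ideal_power R m N" "a \<otimes> b = s \<oplus> t" using ab unfolding mem_set_add by blast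
      have c: "s \<in> carrier R" "t \<in> carrier R" using idealD(1)[OF p st(1)] idealD(1)[OF mi st(2)] by auto
      have "b \<otimes> a = t \<oplus> s" using st(3) m_comm[OF b a] a_comm[OF c] by simp
      hence t: "t = b \<otimes> a \<oplus> \<ominus> s" using c by (simp add: a_assoc r_neg)
      have "b \<otimes> a \<in> PIdl a" unfolding cgenideal_def using b by blast
      hence "t \<in> PIdl a <+>\<^bsub>R\<^esub> p" unfolding t mem_set_add using idealD(4)[OF p st(1)] by blast
      hence "t \<in> ideal_power R m (N - r) \<cdot> (PIdl a <+>\<^bsub>R\<^esub> p)" using r[of "N - r"] st(2) False by auto
      then obtain c' s' where cs: "c' \<in> ideal_power R m (N - r)" "s' \<in> p" "t = a \<otimes> c' \<oplus> s'" using prod by blast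
      have c'c: "c' \<in> carrier R" "s' \<in> carrier R" using idealD(1)[OF mi cs(1)] idealD(1)[OF p cs(2)] by auto
      have "a \<otimes> (b \<ominus> c') = (s \<oplus> t) \<ominus> a \<otimes> c'" using a b c'c st(3) by (simp add: a_minus_def r_distr r_minus)
      also have "\<dots> = s \<oplus> s'" unfolding cs(3) using a c c'c by (simp add: a_minus_def a_ac r_neg r_neg1 r_neg2)
      finally have "b \<ominus> c' \<in> p" using nzd[of "b \<ominus> c'"] idealD(3)[OF p st(1) cs(2)] b c'c by simp
      moreover have "b = (b \<ominus> c') \<oplus> c'" using b c'c by (simp add: a_minus_def a_assoc l_neg)
      ultimately show ?thesis unfolding mem_set_add using cs(1) by blast
    qed
  qed
qed

text \<open>A lower bound for the Hilbert--Samuel function by Pascal's rule. For \<open>a\<close> in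
  \<open>P 1\<close> but not in \<open>P 0\<close>, multiplication by \<open>a\<close> embeds a
  quotient by nearly the same ideal, worth \<open>N choose Suc d\<close>, and the shorter chain
  starting at \<open>P 1\<close> contributes at least \<open>N choose d\<close>. The factor
  \<open>s\<close> absorbs the losses in the exponent.\<close>

lemma prime_chain_growth:
  assumes m: "ideal m R" "\<one> \<notin> m"
    and P: "\<And>i. i \<le> d \<Longrightarrow> primeideal (P i) R" "\<And>i. i < d \<Longrightarrow> P i \<subset> P (Suc i)" "P d \<subseteq> m"
  shows "\<exists>s\<ge>1. \<forall>N\<ge>1. has_chain (P 0 <+>\<^bsub>R\<^esub> ideal_power R m (s * N)) (N choose d)"
  using P
proof (induction d arbitrary: P)
  case 0
  note mi = ideal_power_ideal[OF m(1)]
  have p: "ideal (P 0) R" using 0(1)[of 0] primeideal.axioms(1) by blast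
  have "has_chain (P 0 <+>\<^bsub>R\<^esub> ideal_power R m N) 1" if "N \<ge> 1" for N
  proof -
    have "P 0 <+>\<^bsub>R\<^esub> ideal_power R m N \<subseteq> m"
      using ideal_power_decreasing[OF m(1) that] ideal_power_1[OF m(1)] 0(3)
      by (intro set_add_least[OF m(1)]) auto
    hence "P 0 <+>\<^bsub>R\<^esub> ideal_power R m N \<noteq> carrier R" using m(2) by auto
    thus ?thesis unfolding has_chain_def
      using add_ideals[OF p mi[of N]] ideal_subset[OF add_ideals[OF p mi[of N]]] oneideal
      by (intro exI[of _ "\<lambda>i. if i = 0 then P 0 <+>\<^bsub>R\<^esub> ideal_power R m N else carrier R"]) auto
  qed
  thus ?case by (intro exI[of _ 1]) simp
next
  case (Suc d)
  note mi = ideal_power_ideal[OF m(1)]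
  have "\<exists>s\<ge>1. \<forall>N\<ge>1. has_chain (P (Suc 0) <+>\<^bsub>R\<^esub> ideal_power R m (s * N)) (N choose d)"
    using Suc.IH[of "\<lambda>i. P (Suc i)"] Suc.prems by simp
  then obtain s where s: "s \<ge> 1" "\<And>N. N \<ge> 1 \<Longrightarrow> has_chain (P (Suc 0) <+>\<^bsub>R\<^esub> ideal_power R m (s * N)) (N choose d)" by blast
  interpret P0: primeideal "P 0" R using Suc.prems(1) by simp
  interpret P1: primeideal "P (Suc 0)" R using Suc.prems(1) by simp
  have p0: "ideal (P 0) R" and p1: "ideal (P (Suc 0)) R" by (rule P0.is_ideal, rule P1.is_ideal)
  have P01: "P 0 \<subset> P (Suc 0)" using Suc.prems(2) by simp
  then obtain a where a: "a \<in> P (Suc 0)" "a \<notin> P 0" by blast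
  have ac: "a \<in> carrier R" using a by simp
  have nzd: "b \<in> P 0" if "b \<in> carrier R" "a \<otimes> b \<in> P 0" for b using P0.I_prime[OF ac that] a(2) by blast
  obtain r where r: "\<And>N b. b \<in> carrier R \<Longrightarrow> a \<otimes> b \<in> P 0 <+>\<^bsub>R\<^esub> ideal_power R m N \<Longrightarrow> b \<in> P 0 <+>\<^bsub>R\<^esub> ideal_power R m (N - r)"
    using artin_rees_colon[OF m(1) p0 ac nzd] by blast
  \<comment> \<open>\<open>s' \<ge> r\<close> lets one step in \<open>N\<close> pay for the
    Artin--Rees loss: \<open>s' * Suc N - r \<ge> s' * N\<close>.\<close>
  define s' where "s' = max s r"
  have s': "s' \<ge> 1" "s' \<ge> s" "s' \<ge> r" using s(1) by (auto simp: s'_def)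
  have dec: "Q <+>\<^bsub>R\<^esub> ideal_power R m j \<subseteq> Q <+>\<^bsub>R\<^esub> ideal_power R m i" if "i \<le> j" for Q i j
    by (rule set_add_mono[OF subset_refl ideal_power_decreasing[OF m(1) that]])
  have h1: "has_chain (P (Suc 0) <+>\<^bsub>R\<^esub> ideal_power R m (s' * N)) (N choose d)" if "N \<ge> 1" for N
    by (rule has_chain_mono[OF s(2)[OF that] dec]) (use s' in simp_all)
  have "has_chain (P 0 <+>\<^bsub>R\<^esub> ideal_power R m (s' * N)) (N choose Suc d)" if "N \<ge> 1" for N
    using that
  proof (induction N rule: dec_induct)
    case base
    have "1 choose Suc d \<le> 1 choose d" by (cases d) auto
    moreover have "P 0 <+>\<^bsub>R\<^esub> ideal_power R m (s' * 1) \<subseteq> P (Suc 0) <+>\<^bsub>R\<^esub> ideal_power R m (s' * 1)"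
      by (rule set_add_mono) (use P01 in auto)
    ultimately show ?case using has_chain_mono[OF h1[of 1]] by simp
  next
    case (step N)
    have "has_chain (P 0 <+>\<^bsub>R\<^esub> ideal_power R m (s' * Suc N)) ((N choose Suc d) + (Suc N choose d))"
    proof (rule has_chain_colon[OF add_ideals[OF p0 mi] ac add_ideals[OF p1 mi]])
      show "P 0 <+>\<^bsub>R\<^esub> ideal_power R m (s' * Suc N) \<subseteq> P (Suc 0) <+>\<^bsub>R\<^esub> ideal_power R m (s' * Suc N)"
        by (rule set_add_mono) (use P01 in auto)
      show "a \<in> P (Suc 0) <+>\<^bsub>R\<^esub> ideal_power R m (s' * Suc N)" using set_add_ge1[OF p1 mi] a(1) by blast
      show "b \<in> P 0 <+>\<^bsub>R\<^esub> ideal_power R m (s' * Suc N - r)"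
        if "b \<in> carrier R" "a \<otimes> b \<in> P 0 <+>\<^bsub>R\<^esub> ideal_power R m (s' * Suc N)" for b by (rule r[OF that])
      show "has_chain (P 0 <+>\<^bsub>R\<^esub> ideal_power R m (s' * Suc N - r)) (N choose Suc d)"
        by (rule has_chain_mono[OF step.IH dec]) (use s' in auto)
      show "has_chain (P (Suc 0) <+>\<^bsub>R\<^esub> ideal_power R m (s' * Suc N)) (Suc N choose d)" by (rule h1) simp
    qed
    moreover have "N choose d \<le> Suc N choose d" by (rule binomial_right_mono) simp
    ultimately show ?case using has_chain_mono[OF _ subset_refl] by simp
  qed
  thus ?case using s'(1) by blast
qed

text \<open>For a maximal ideal \<open>m\<close>, the quotients \<open>L v / L (v + 1)\<close> are at most one-dimensional over \<open>R / m\<close>.\<close>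

lemma has_chain_card_bound:
  assumes m: "maximalideal m R" and J: "ideal J R" and n: "has_chain J n"
    and L: "\<And>v. ideal (L v) R" "\<And>v. L (Suc v) \<subseteq> L v" "L 0 = carrier R" "L V \<subseteq> J"
    and g: "\<And>v. g v \<in> L v" "\<And>v b. b \<in> L v \<Longrightarrow> \<exists>u\<in>carrier R. b \<ominus> u \<otimes> g v \<in> L (Suc v)"
    and mL: "\<And>v y b. y \<in> m \<Longrightarrow> b \<in> L v \<Longrightarrow> y \<otimes> b \<in> L (Suc v)"
    and B: "finite B" "\<And>v. v \<notin> B \<Longrightarrow> L v \<subseteq> L (Suc v)"
  shows "n \<le> card B"
proof -
  obtain C where C: "\<And>i. i \<le> n \<Longrightarrow> ideal (C i) R \<and> J \<subseteq> C i" "\<And>i. i < n \<Longrightarrow> C i \<subset> C (Suc i)"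
    using n unfolding has_chain_def by blast
  \<comment> \<open>The indices \<open>v\<close> for which \<open>I\<close> meets \<open>L v\<close>
    outside \<open>L (Suc v)\<close>; they count the steps of the filtration that \<open>I\<close>
    fills.\<close>
  define D where "D I = {v. \<exists>c\<in>I. c \<in> L v \<and> c \<notin> L (Suc v)}" for I
  have DB: "D I \<subseteq> B" for I using B(2) unfolding D_def by blast
  have fin: "finite (D I)" for I by (rule finite_subset[OF DB B(1)])
  note Ld = idealD[OF L(1)]
  have gc: "g v \<in> carrier R" for v by (rule Ld(1)[OF g(1)])
  \<comment> \<open>Nested ideals with the same indices are equal: subtracting elements of the
    smaller one moves an element of the larger one deeper into the filtration, until it reaches
    \<open>L V \<subseteq> J\<close>.\<close>
  have eq: "I' \<subseteq> I" if I: "ideal I R" "J \<subseteq> I" and I': "ideal I' R" "I \<subseteq> I'" and D: "D I' \<subseteq> D I" for I I'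
  proof -
    note Id = idealD[OF I(1)] and Id' = idealD[OF I'(1)]
    have "x \<in> I' \<Longrightarrow> x \<in> L (V - k) \<Longrightarrow> x \<in> I" for k x
    proof (induction k arbitrary: x)
      case 0
      thus ?case using L(4) I(2) by auto
    next
      case (Suc k)
      show ?case
      proof (cases "x \<in> L (V - k)")
        case False
        hence V: "V - k = Suc (V - Suc k)" using Suc.prems(2) by (cases "k < V") (auto simp: Suc_diff_Suc)
        let ?v = "V - Suc k"
        have "?v \<in> D I'" using Suc.prems False V unfolding D_def by auto
        then obtain c where c: "c \<in> I" "c \<in> L ?v" "c \<notin> L (Suc ?v)" using D unfolding D_def by blast
        obtain u where u: "u \<in> carrier R" "x \<ominus> u \<otimes> g ?v \<in> L (Suc ?v)" using g(2)[OF Suc.prems(2)] by blast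
        obtain u' where u': "u' \<in> carrier R" "c \<ominus> u' \<otimes> g ?v \<in> L (Suc ?v)" using g(2)[OF c(2)] by blast
        have cc: "c \<in> carrier R" "x \<in> carrier R" using Id(1)[OF c(1)] Id'(1)[OF Suc.prems(1)] by auto
        have "u' \<notin> m"
        proof
          assume "u' \<in> m"
          hence "(c \<ominus> u' \<otimes> g ?v) \<oplus> u' \<otimes> g ?v \<in> L (Suc ?v)" using Ld(3)[OF u'(2) mL[OF _ g(1)]] by blast
          thus False using c(3) cc u'(1) gc by (simp add: a_minus_def a_assoc l_neg)
        qed
        then obtain w where w: "w \<in> carrier R" "\<one> \<ominus> w \<otimes> u' \<in> m" using maximal_inverse[OF m u'(1)] by blast
        \<comment> \<open>Modulo \<open>L (Suc ?v)\<close> both \<open>x\<close> and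
          \<open>c\<close> are multiples of \<open>g ?v\<close>, by \<open>u\<close> and
          \<open>u'\<close>. As \<open>w\<close> inverts \<open>u'\<close> modulo \<open>m\<close>,
          and \<open>m\<close> kills the step, this multiple of \<open>c\<close> cancels
          \<open>x\<close>.\<close>
        define z where "z = u \<otimes> w \<otimes> c"
        have zI: "z \<in> I" unfolding z_def using Id(6)[OF _ c(1)] u(1) w(1) by simp
        have "x \<ominus> z = (x \<ominus> u \<otimes> g ?v) \<oplus> (u \<otimes> ((\<one> \<ominus> w \<otimes> u') \<otimes> g ?v) \<oplus> \<ominus> ((u \<otimes> w) \<otimes> (c \<ominus> u' \<otimes> g ?v)))"
          unfolding z_def using cc u(1) u'(1) w(1) gc[of ?v] by algebra
        moreover have "u \<otimes> ((\<one> \<ominus> w \<otimes> u') \<otimes> g ?v) \<in> L (Suc ?v)"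
          by (rule Ld(6)[OF u(1) mL[OF w(2) g(1)]])
        moreover have "\<ominus> ((u \<otimes> w) \<otimes> (c \<ominus> u' \<otimes> g ?v)) \<in> L (Suc ?v)"
          by (rule Ld(4)[OF Ld(6)[OF _ u'(2)]]) (use u(1) w(1) in simp)
        ultimately have "x \<ominus> z \<in> L (Suc ?v)" using u(2) Ld(3) by simp
        moreover have "x \<ominus> z \<in> I'" using Id'(5)[OF Suc.prems(1)] zI I'(2) by blast
        ultimately have "x \<ominus> z \<in> I" using Suc.IH V by simp
        hence "(x \<ominus> z) \<oplus> z \<in> I" using Id(3) zI by blast
        thus ?thesis using cc Id(1)[OF zI] by (simp add: a_minus_def a_assoc l_neg)
      qed (use Suc in blast)
    qed
    from this[of _ V] show ?thesis using L(3) Id'(1) by auto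
  qed
  have "i \<le> n \<Longrightarrow> i \<le> card (D (C i))" for i
  proof (induction i)
    case (Suc i)
    have i: "ideal (C i) R" "J \<subseteq> C i" "ideal (C (Suc i)) R" using C(1)[of i] C(1)[of "Suc i"] Suc.prems by auto
    have ss: "C i \<subset> C (Suc i)" using C(2) Suc.prems by simp
    have "D (C i) \<subseteq> D (C (Suc i))" using ss unfolding D_def by blast
    moreover have "D (C i) \<noteq> D (C (Suc i))" using eq[OF i(1,2,3)] ss by blast
    ultimately have "card (D (C i)) < card (D (C (Suc i)))" by (intro psubset_card_mono[OF fin]) blast
    thus ?case using Suc by simp
  qed simp
  hence "n \<le> card (D (C n))" by blast
  also have "\<dots> \<le> card B" by (rule card_mono[OF B(1) DB])
  finally show ?thesis .
qed

end

section \<open>Counting monomials\<close>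

lemma digits_unique:
  fixes a b :: "nat \<Rightarrow> nat"
  assumes "(\<Sum>i<K. a i * B ^ i) = (\<Sum>i<K. b i * B ^ i)" "\<And>i. i < K \<Longrightarrow> a i < B" "\<And>i. i < K \<Longrightarrow> b i < B" "i < K"
  shows "a i = b i"
  using assms
proof (induction K arbitrary: a b i)
  case (Suc K)
  have e: "(\<Sum>i<Suc K. c i * B ^ i) = c 0 + B * (\<Sum>i<K. c (Suc i) * B ^ i)" for c :: "nat \<Rightarrow> nat"
    by (simp add: sum.lessThan_Suc_shift sum_distrib_left mult_ac del: sum.lessThan_Suc)
  have B: "a 0 < B" "b 0 < B" using Suc.prems(2,3) by auto
  have eq: "a 0 + B * (\<Sum>i<K. a (Suc i) * B ^ i) = b 0 + B * (\<Sum>i<K. b (Suc i) * B ^ i)"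
    using Suc.prems(1) unfolding e .
  have 0: "a 0 = b 0" using arg_cong[OF eq, of "\<lambda>x. x mod B"] B by simp
  hence "(\<Sum>i<K. a (Suc i) * B ^ i) = (\<Sum>i<K. b (Suc i) * B ^ i)" using eq B by simp
  hence "a (Suc j) = b (Suc j)" if "j < K" for j
    by (rule Suc.IH[of "\<lambda>i. a (Suc i)" "\<lambda>i. b (Suc i)"]) (use Suc.prems(2,3) that in auto)
  thus ?case using 0 Suc.prems(4) by (cases i) auto
qed simp

text \<open>The exponent at \<open>i\<close> has at most \<open>c\<close> values and each of the
  other \<open>d - 1\<close> exponents at most \<open>N\<close>.\<close>

lemma card_bounded_multisets:
  assumes i: "i < d"
  shows "card {\<mu> :: nat multiset. set_mset \<mu> \<subseteq> {..<d} \<and> size \<mu> < N \<and> count \<mu> i < c} \<le> c * N ^ (d - 1)"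
    (is "card ?S \<le> _")
proof -
  let ?T = "\<lambda>j. if j = i then {..<c} else {..<N}"
  have "inj_on (\<lambda>\<mu>. restrict (count \<mu>) {..<d}) ?S"
  proof (rule inj_onI)
    fix \<mu> \<nu> assume \<mu>: "\<mu> \<in> ?S" and \<nu>: "\<nu> \<in> ?S" and e: "restrict (count \<mu>) {..<d} = restrict (count \<nu>) {..<d}"
    show "\<mu> = \<nu>"
    proof (rule multiset_eqI)
      fix j
      show "count \<mu> j = count \<nu> j"
      proof (cases "j < d")
        case True
        thus ?thesis using fun_cong[OF e, of j] by simp
      next
        case False
        hence "j \<notin># \<mu>" "j \<notin># \<nu>" using \<mu> \<nu> by auto
        thus ?thesis by (simp add: not_in_iff)
      qed
    qed
  qed
  moreover have "(\<lambda>\<mu>. restrict (count \<mu>) {..<d}) ` ?S \<subseteq> PiE {..<d} ?T"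
  proof (rule image_subsetI, rule PiE_I)
    fix \<mu> j assume \<mu>: "\<mu> \<in> ?S" and j: "j \<in> {..<d}"
    show "restrict (count \<mu>) {..<d} j \<in> ?T j"
      using \<mu> j le_less_trans[OF count_le_size[of \<mu> j], of N] by simp
  qed simp
  ultimately have "card ?S \<le> card (PiE {..<d} ?T)"
    by (rule card_inj_on_le) (auto intro!: finite_PiE)
  also have "\<dots> = (\<Prod>j\<in>{..<d}. card (?T j))" by (rule card_PiE) simp
  also have "\<dots> = c * (\<Prod>j\<in>{..<d} - {i}. N)" using i by (simp add: prod.remove[of "{..<d}" i])
  also have "\<dots> = c * N ^ (d - 1)" using i by simp
  finally show ?thesis .
qed

context cring
begin

text \<open>This set is \<open>P\<close> plus the multiples of \<open>g\<close>. Together with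
  \<open>genideal_minimal\<close> it shows that a step of a filtration is generated by one
  element.\<close>

lemma ideal_modulo:
  assumes P: "ideal P R" and g: "g \<in> carrier R"
  shows "ideal {b \<in> carrier R. \<exists>u\<in>carrier R. b \<ominus> u \<otimes> g \<in> P} R" (is "ideal ?J R")
proof (rule idealI')
  have "\<zero> \<ominus> \<zero> \<otimes> g \<in> P" using g idealD(2)[OF P] by (simp add: a_minus_def)
  thus "\<zero> \<in> ?J" by blast
  fix a assume "a \<in> ?J"
  then obtain u where a: "a \<in> carrier R" "u \<in> carrier R" "a \<ominus> u \<otimes> g \<in> P" by blast
  { fix b assume "b \<in> ?J"
    then obtain v where b: "b \<in> carrier R" "v \<in> carrier R" "b \<ominus> v \<otimes> g \<in> P" by blast
    have "(a \<oplus> b) \<ominus> (u \<oplus> v) \<otimes> g = (a \<ominus> u \<otimes> g) \<oplus> (b \<ominus> v \<otimes> g)" using a b g by algebra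
    hence "(a \<oplus> b) \<ominus> (u \<oplus> v) \<otimes> g \<in> P" using idealD(3)[OF P a(3) b(3)] by simp
    thus "a \<oplus> b \<in> ?J" using a b by blast }
  fix r assume r: "r \<in> carrier R"
  have "r \<otimes> a \<ominus> (r \<otimes> u) \<otimes> g = r \<otimes> (a \<ominus> u \<otimes> g)" using a r g by algebra
  hence "r \<otimes> a \<ominus> (r \<otimes> u) \<otimes> g \<in> P" using idealD(6)[OF P r a(3)] by simp
  thus "r \<otimes> a \<in> ?J" using a r by blast
qed auto

end

section \<open>Regular sequences from chains of primes\<close>

text \<open>\<open>x 0, \<dots>, x (d - 1)\<close> generate the maximal ideal of the localization of \<open>R\<close> at \<open>m\<close>. Denominators are
  cleared throughout, which treats local and graded rings uniformly without passing to fractions.\<close>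

locale local_generators = noetherian_cring R for R (structure) +
  fixes m :: "'a set" and x :: "nat \<Rightarrow> 'a" and d :: nat
  assumes maximal: "maximalideal m R" and x_m: "i < d \<Longrightarrow> x i \<in> m"
    and generate: "a \<in> m \<Longrightarrow> \<exists>s\<in>carrier R. s \<notin> m \<and> s \<otimes> a \<in> Idl (x ` {..<d})"
begin

lemma m_ideal: "ideal m R"
  using maximal maximalideal.axioms(1) by blast

lemmas m_power = ideal_power_ideal[OF m_ideal]

lemma one_not_m: "\<one> \<notin> m"
  using maximal ideal.one_imp_carrier[OF m_ideal] unfolding maximalideal_def maximalideal_axioms_def by auto

lemma m_prime: "primeideal m R"
  by (rule maximalideal_prime[OF maximal])

lemma xc: "i < d \<Longrightarrow> x i \<in> carrier R"
  using x_m idealD(1)[OF m_ideal] by blast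

abbreviation I :: "nat \<Rightarrow> 'a set" where "I t \<equiv> Idl (x ` {..<t})"

lemma I_ideal: "t \<le> d \<Longrightarrow> ideal (I t) R"
  by (rule genideal_ideal) (use xc in auto)

lemma I_mem: "i < t \<Longrightarrow> t \<le> d \<Longrightarrow> x i \<in> I t"
  by (rule subsetD[OF genideal_self]) (use xc in auto)

text \<open>The multiplier \<open>s\<close> has an inverse \<open>w\<close> modulo \<open>m\<close>,
  and \<open>a = w (s a) + (1 - w s) a\<close>.\<close>

lemma m_subset_square: "m \<subseteq> I d <+>\<^bsub>R\<^esub> m \<cdot> m"
proof
  fix a assume a: "a \<in> m"
  obtain s where s: "s \<in> carrier R" "s \<notin> m" "s \<otimes> a \<in> I d" using generate[OF a] by blast
  obtain w where w: "w \<in> carrier R" "\<one> \<ominus> w \<otimes> s \<in> m" using maximal_inverse[OF maximal s(1,2)] by blast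
  have ac: "a \<in> carrier R" by (rule idealD(1)[OF m_ideal a])
  have "a = w \<otimes> (s \<otimes> a) \<oplus> (\<one> \<ominus> w \<otimes> s) \<otimes> a" using ac s(1) w(1) by algebra
  thus "a \<in> I d <+>\<^bsub>R\<^esub> m \<cdot> m"
    unfolding mem_set_add using idealD(6)[OF I_ideal[OF order_refl] w(1) s(3)] ideal_prod.prod[OF w(2) a] by blast
qed

text \<open>The inclusion for one power is substituted into a factor of
  \<open>m \<cdot> m\<close>.\<close>

lemma m_subset_power: "m \<subseteq> I d <+>\<^bsub>R\<^esub> ideal_power R m (Suc N)"
proof (induction N)
  case 0
  show ?case using set_add_ge2[OF I_ideal[OF order_refl] m_ideal] by (simp add: ideal_power_1[OF m_ideal])
next
  case (Suc N)
  let ?P = "I d <+>\<^bsub>R\<^esub> ideal_power R m (Suc (Suc N))"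
  have P: "ideal ?P R" by (rule add_ideals[OF I_ideal[OF order_refl] m_power])
  have "m \<cdot> m \<subseteq> ?P"
  proof
    fix a assume "a \<in> m \<cdot> m"
    thus "a \<in> ?P"
    proof (induction rule: ideal_prod.induct)
      case (prod y z)
      obtain u v where uv: "u \<in> I d" "v \<in> ideal_power R m (Suc N)" "y = u \<oplus> v"
        using subsetD[OF Suc prod(1)] unfolding mem_set_add by blast
      have c: "z \<in> carrier R" "u \<in> carrier R" "v \<in> carrier R"
        using idealD(1)[OF m_ideal prod(2)] idealD(1)[OF I_ideal[OF order_refl] uv(1)] idealD(1)[OF m_power uv(2)] by auto
      have "y \<otimes> z = u \<otimes> z \<oplus> v \<otimes> z" unfolding uv(3) using c by (simp add: l_distr)
      moreover have "v \<otimes> z \<in> ideal_power R m (Suc (Suc N))"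
        unfolding ideal_power_Suc[of m "Suc N"] by (rule ideal_prod.prod[OF uv(2) prod(2)])
      ultimately show ?case
        unfolding mem_set_add using idealD(7)[OF I_ideal[OF order_refl] c(1) uv(1)] by blast
    next
      case (sum a b)
      thus ?case using idealD(3)[OF P] by blast
    qed
  qed
  hence "I d <+>\<^bsub>R\<^esub> m \<cdot> m \<subseteq> ?P"
    by (rule set_add_least[OF P set_add_ge1[OF I_ideal[OF order_refl] m_power]])
  thus ?case using m_subset_square by blast
qed

abbreviation mon :: "nat multiset \<Rightarrow> 'a" where "mon \<mu> \<equiv> monom d x \<mu>"

lemma mon_closed: "mon \<mu> \<in> carrier R"
  by (rule monom_closed[OF xc])

lemma mon_add: "mon (\<mu> + \<nu>) = mon \<mu> \<otimes> mon \<nu>"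
  by (rule monom_union[OF xc])

lemma mon_power: "set_mset \<mu> \<subseteq> {..<d} \<Longrightarrow> mon \<mu> \<in> ideal_power R m (size \<mu>)"
proof (induction \<mu>)
  case empty
  show ?case by (simp add: monom_empty ideal_power_0)
next
  case (add i \<mu>)
  thus ?case using ideal_prod.prod[OF x_m[of i], of "mon \<mu>" "ideal_power R m (size \<mu>)" R]
    by (simp add: monom_add_mset[OF xc] ideal_power_Suc'[OF m_ideal])
qed

text \<open>Modulo the next power the \<open>x i\<close> are honest generators of \<open>m\<close>,
  so products of \<open>n\<close> elements expand into monomials. The induction multiplies
  \<open>m \<subseteq> I d + m \<cdot> m\<close> by the inclusion for \<open>n\<close>.\<close>

lemma power_subset_monomials:
  "ideal_power R m n \<subseteq> Idl {mon \<mu> | \<mu>. set_mset \<mu> \<subseteq> {..<d} \<and> size \<mu> = n} <+>\<^bsub>R\<^esub> ideal_power R m (Suc n)"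
proof (induction n)
  case 0
  let ?S = "{mon \<mu> | \<mu>. set_mset \<mu> \<subseteq> {..<d} \<and> size \<mu> = 0}"
  have Sc: "?S \<subseteq> carrier R" using mon_closed by auto
  have "\<one> \<in> ?S" using monom_empty by force
  hence "Idl ?S = carrier R"
    using genideal_self[OF Sc] by (intro ideal.one_imp_carrier[OF genideal_ideal[OF Sc]]) blast
  thus ?case using set_add_ge1[OF oneideal m_power] by (simp add: ideal_power_0)
next
  case (Suc n)
  let ?S = "\<lambda>n. {mon \<mu> | \<mu>. set_mset \<mu> \<subseteq> {..<d} \<and> size \<mu> = n}"
  let ?P = "Idl (?S (Suc n)) <+>\<^bsub>R\<^esub> ideal_power R m (Suc (Suc n))"
  have Sc: "?S n \<subseteq> carrier R" for n using mon_closed by auto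
  note Si = genideal_ideal[OF Sc]
  have P: "ideal ?P R" by (rule add_ideals[OF Si m_power])
  have P1: "Idl (?S (Suc n)) \<subseteq> ?P" and P2: "ideal_power R m (Suc (Suc n)) \<subseteq> ?P"
    by (rule set_add_ge1[OF Si m_power], rule set_add_ge2[OF Si m_power])
  have xS: "x i \<otimes> c \<in> Idl (?S (Suc n))" if i: "i < d" and c: "c \<in> Idl (?S n)" for i c
  proof (rule genideal_colon[OF Si xc[OF i] Sc _ c])
    fix y assume "y \<in> ?S n"
    then obtain \<mu> where \<mu>: "set_mset \<mu> \<subseteq> {..<d}" "size \<mu> = n" "y = mon \<mu>" by blast
    have "x i \<otimes> y = mon (add_mset i \<mu>)" unfolding \<mu>(3) by (rule monom_add_mset[OF xc i, symmetric])
    thus "x i \<otimes> y \<in> Idl (?S (Suc n))" using genideal_self[OF Sc[of "Suc n"]] \<mu> i by force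
  qed
  have IS: "c \<otimes> u \<in> Idl (?S (Suc n))" if u: "u \<in> I d" and c: "c \<in> Idl (?S n)" for u c
  proof (rule genideal_colon[OF Si idealD(1)[OF Si c] _ _ u])
    fix y assume "y \<in> x ` {..<d}"
    then obtain i where i: "i < d" "y = x i" by blast
    show "c \<otimes> y \<in> Idl (?S (Suc n))"
      unfolding i(2) m_comm[OF idealD(1)[OF Si c] xc[OF i(1)]] by (rule xS[OF i(1) c])
  qed (use xc in auto)
  show ?case
  proof
    fix a assume "a \<in> ideal_power R m (Suc n)"
    hence "a \<in> m \<cdot> ideal_power R m n" by (simp add: ideal_power_Suc'[OF m_ideal])
    thus "a \<in> ?P"
    proof (induction rule: ideal_prod.induct)
      case (prod y z)
      obtain u v where uv: "u \<in> I d" "v \<in> m \<cdot> m" "y = u \<oplus> v"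
        using subsetD[OF m_subset_square prod(1)] unfolding mem_set_add by blast
      obtain c h where ch: "c \<in> Idl (?S n)" "h \<in> ideal_power R m (Suc n)" "z = c \<oplus> h"
        using subsetD[OF Suc prod(2)] unfolding mem_set_add by blast
      have mm: "m \<cdot> m = ideal_power R m (Suc (Suc 0))"
        by (simp add: ideal_power_Suc ideal_power_1[OF m_ideal, unfolded ideal_power_Suc])
      have cc: "u \<in> carrier R" "v \<in> carrier R" "c \<in> carrier R" "h \<in> carrier R" "z \<in> carrier R"
        using idealD(1)[OF I_ideal[OF order_refl] uv(1)] idealD(1)[OF m_power, of v] uv(2) mm
          idealD(1)[OF Si ch(1)] idealD(1)[OF m_power ch(2)] idealD(1)[OF m_power prod(2)] by auto
      have "u \<in> m" using genideal_minimal[OF m_ideal, of "x ` {..<d}"] x_m uv(1) by auto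
      hence uh: "u \<otimes> h \<in> ideal_power R m (Suc (Suc n))"
        unfolding ideal_power_Suc'[OF m_ideal, of "Suc n"] by (rule ideal_prod.prod[OF _ ch(2)])
      have "v \<otimes> z \<in> ideal_power R m (Suc (Suc 0) + n)"
        unfolding ideal_power_add[OF m_ideal] mm[symmetric] by (rule ideal_prod.prod[OF uv(2) prod(2)])
      hence vz: "v \<otimes> z \<in> ideal_power R m (Suc (Suc n))" by simp
      have uc: "u \<otimes> c \<in> ?P" using IS[OF uv(1) ch(1)] P1 cc m_comm[of u c] by auto
      have yz: "y \<otimes> z = u \<otimes> c \<oplus> (u \<otimes> h \<oplus> v \<otimes> z)"
      proof -
        have "y \<otimes> z = u \<otimes> z \<oplus> v \<otimes> z" unfolding uv(3) using cc by (simp add: l_distr)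
        also have "u \<otimes> z = u \<otimes> c \<oplus> u \<otimes> h" unfolding ch(3) using cc by (simp add: r_distr)
        finally show ?thesis using cc by (simp add: a_assoc)
      qed
      show ?case unfolding yz by (rule idealD(3)[OF P uc idealD(3)[OF P subsetD[OF P2 uh] subsetD[OF P2 vz]]])
    next
      case (sum a b)
      thus ?case using idealD(3)[OF P] by blast
    qed
  qed
qed

end

section \<open>A filtration by monomial weights\<close>

locale weighted_generators = local_generators R m x d for R (structure) and m x d +
  fixes w :: "nat \<Rightarrow> nat" and W N :: nat
  assumes W: "W \<ge> 1" and w: "i < d \<Longrightarrow> W \<le> w i" and N: "N \<ge> 1"
begin

definition wt :: "nat multiset \<Rightarrow> nat"
  where "wt \<mu> = sum_mset (image_mset w \<mu>)"

lemma wt_simps [simp]: "wt {#} = 0" "wt (add_mset i \<mu>) = w i + wt \<mu>" "wt (\<mu> + \<nu>) = wt \<mu> + wt \<nu>"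
  by (simp_all add: wt_def)

text \<open>\<open>m^N\<close> is included for two reasons: modulo it \<open>m\<close> is generated
  by the \<open>x i\<close>, so that multiplication by \<open>m\<close> raises the weight by at
  least \<open>W\<close>, and the filtration ends at \<open>m^N\<close> after finitely many
  steps.\<close>

definition Lgen :: "nat \<Rightarrow> 'a set"
  where "Lgen v = {mon \<mu> | \<mu>. set_mset \<mu> \<subseteq> {..<d} \<and> v \<le> wt \<mu>} \<union> ideal_power R m N"

definition L :: "nat \<Rightarrow> 'a set"
  where "L v = Idl (Lgen v)"

lemma Lgen_carrier: "Lgen v \<subseteq> carrier R"
  unfolding Lgen_def using mon_closed ideal_subset[OF m_power] by auto

lemma L_ideal: "ideal (L v) R"
  unfolding L_def by (rule genideal_ideal[OF Lgen_carrier])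

lemma L_mon: "set_mset \<mu> \<subseteq> {..<d} \<Longrightarrow> v \<le> wt \<mu> \<Longrightarrow> mon \<mu> \<in> L v"
  unfolding L_def by (rule subsetD[OF genideal_self[OF Lgen_carrier]]) (auto simp: Lgen_def)

lemma L_pow: "ideal_power R m N \<subseteq> L v"
  unfolding L_def by (rule order_trans[OF _ genideal_self[OF Lgen_carrier]]) (auto simp: Lgen_def)

lemma L_antimono: "v \<le> v' \<Longrightarrow> L v' \<subseteq> L v"
  unfolding L_def[of v']
proof (rule genideal_minimal[OF L_ideal])
  assume "v \<le> v'"
  thus "Lgen v' \<subseteq> L v" unfolding Lgen_def using L_mon L_pow by auto
qed

lemma L_mon_mult:
  assumes \<nu>: "set_mset \<nu> \<subseteq> {..<d}" and b: "b \<in> L v"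
  shows "mon \<nu> \<otimes> b \<in> L (v + wt \<nu>)"
proof (rule genideal_colon[OF L_ideal mon_closed Lgen_carrier _ b[unfolded L_def]])
  fix y assume "y \<in> Lgen v"
  then consider \<mu> where "y = mon \<mu>" "set_mset \<mu> \<subseteq> {..<d}" "v \<le> wt \<mu>" | "y \<in> ideal_power R m N"
    unfolding Lgen_def by blast
  thus "mon \<nu> \<otimes> y \<in> L (v + wt \<nu>)"
  proof cases
    case 1
    thus ?thesis unfolding 1(1) mon_add[symmetric] using \<nu> by (intro L_mon) auto
  next
    case 2
    show ?thesis using L_pow idealD(6)[OF m_power mon_closed 2] by blast
  qed
qed

lemma L_m_mult:
  assumes y: "y \<in> m" and b: "b \<in> L v"
  shows "y \<otimes> b \<in> L (v + W)"
proof -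
  have bc: "b \<in> carrier R" by (rule idealD(1)[OF L_ideal b])
  obtain u z where uz: "u \<in> I d" "z \<in> ideal_power R m N" "y = u \<oplus> z"
    using subsetD[OF m_subset_power[of "N - 1"] y] N unfolding mem_set_add by auto
  have c: "u \<in> carrier R" "z \<in> carrier R"
    using idealD(1)[OF I_ideal[OF order_refl] uz(1)] idealD(1)[OF m_power uz(2)] by auto
  have "b \<otimes> u \<in> L (v + W)"
  proof (rule genideal_colon[OF L_ideal bc _ _ uz(1)])
    fix y assume "y \<in> x ` {..<d}"
    then obtain i where i: "i < d" "y = x i" by blast
    have "mon {#i#} \<otimes> b \<in> L (v + wt {#i#})" by (rule L_mon_mult[OF _ b]) (use i in simp)
    hence "x i \<otimes> b \<in> L (v + w i)" using i by (simp add: monom_single[OF xc])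
    hence "x i \<otimes> b \<in> L (v + W)" using L_antimono[of "v + W" "v + w i"] w[OF i(1)] by auto
    thus "b \<otimes> y \<in> L (v + W)" unfolding i(2) by (simp add: m_comm[OF bc xc[OF i(1)]])
  qed (use xc in auto)
  moreover have "z \<otimes> b \<in> L (v + W)" using L_pow idealD(7)[OF m_power bc uz(2)] by blast
  moreover have "y \<otimes> b = b \<otimes> u \<oplus> z \<otimes> b" unfolding uz(3) using c bc by (simp add: l_distr m_comm[of b u])
  ultimately show ?thesis using idealD(3)[OF L_ideal] by simp
qed

lemma L_power_mult:
  assumes "y \<in> ideal_power R m j" "b \<in> L v"
  shows "y \<otimes> b \<in> L (v + j * W)"
  using assms
proof (induction j arbitrary: y)
  case 0
  thus ?case using idealD(6)[OF L_ideal, of y b v] by (simp add: ideal_power_0)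
next
  case (Suc j)
  have bc: "b \<in> carrier R" by (rule idealD(1)[OF L_ideal Suc.prems(2)])
  have "y \<in> m \<cdot> ideal_power R m j" using Suc.prems(1) by (simp add: ideal_power_Suc'[OF m_ideal])
  thus ?case
  proof (induction rule: ideal_prod.induct)
    case (prod i z)
    have "i \<otimes> (z \<otimes> b) \<in> L (v + j * W + W)" by (rule L_m_mult[OF prod(1) Suc.IH[OF prod(2) Suc.prems(2)]])
    thus ?case using idealD(1)[OF m_ideal prod(1)] idealD(1)[OF m_power prod(2)] bc by (simp add: m_assoc add_ac)
  next
    case (sum s t)
    have "m \<cdot> ideal_power R m j \<subseteq> carrier R" by (rule ideal_subset[OF ideal_prod_is_ideal[OF m_ideal m_power]])
    hence "s \<in> carrier R" "t \<in> carrier R" using sum(1,2) by auto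
    thus ?case using idealD(3)[OF L_ideal sum(3,4)] bc by (simp add: l_distr)
  qed
qed

lemma L_0: "L 0 = carrier R"
  using L_mon[of "{#}" 0] by (intro ideal.one_imp_carrier[OF L_ideal]) (simp add: monom_empty)

text \<open>A monomial of size \<open>s\<close> has weight at most
  \<open>s * Suc (\<Sum>i<d. w i)\<close>, so a weight this large forces size at least
  \<open>N\<close>.\<close>

lemma L_eventually: "L (N * Suc (\<Sum>i<d. w i)) \<subseteq> ideal_power R m N"
  unfolding L_def
proof (rule genideal_minimal[OF m_power])
  have wt_le: "wt \<mu> \<le> size \<mu> * Suc (\<Sum>i<d. w i)" if "set_mset \<mu> \<subseteq> {..<d}" for \<mu>
    using that
  proof (induction \<mu>)
    case (add i \<mu>)
    have "w i \<le> (\<Sum>i<d. w i)" using add.prems by (intro member_le_sum) auto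
    thus ?case using add by simp
  qed simp
  show "Lgen (N * Suc (\<Sum>i<d. w i)) \<subseteq> ideal_power R m N"
  proof
    fix y assume "y \<in> Lgen (N * Suc (\<Sum>i<d. w i))"
    then consider \<mu> where "y = mon \<mu>" "set_mset \<mu> \<subseteq> {..<d}" "N * Suc (\<Sum>i<d. w i) \<le> wt \<mu>" | "y \<in> ideal_power R m N"
      unfolding Lgen_def by blast
    thus "y \<in> ideal_power R m N"
    proof cases
      case 1
      have "N * Suc (\<Sum>i<d. w i) \<le> size \<mu> * Suc (\<Sum>i<d. w i)" using 1(3) wt_le[OF 1(2)] by linarith
      hence "N \<le> size \<mu>" by (simp only: Suc_mult_le_cancel1 mult.commute[of _ "Suc _"])
      thus ?thesis using mon_power[OF 1(2)] ideal_power_decreasing[OF m_ideal, of N "size \<mu>"] 1(1) by blast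
    qed
  qed
qed

text \<open>Each step of \<open>L\<close> is generated by the monomial of that weight, and it is
  trivial if this monomial is a multiple of \<open>\<kappa>\<close>. A monomial that is not a
  multiple of \<open>\<kappa>\<close> has some exponent below \<open>size \<kappa>\<close>; counting
  those of size below \<open>N\<close> for each of the \<open>d\<close> positions gives the
  bound.\<close>

lemma has_chain_bound:
  assumes inj: "\<And>\<mu> \<nu>. \<lbrakk>set_mset \<mu> \<subseteq> {..<d}; set_mset \<nu> \<subseteq> {..<d}; size \<mu> < N; size \<nu> < N; wt \<mu> = wt \<nu>\<rbrakk> \<Longrightarrow> \<mu> = \<nu>"
    and lead: "set_mset \<kappa> \<subseteq> {..<d}"
    and redundant: "\<And>\<nu>. set_mset \<nu> \<subseteq> {..<d} \<Longrightarrow> mon (\<kappa> + \<nu>) \<in> L (Suc (wt (\<kappa> + \<nu>)))"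
    and n: "has_chain (ideal_power R m N) n"
  shows "n \<le> d * (size \<kappa> * N ^ (d - 1))"
proof -
  define S where "S i = {\<mu>. set_mset \<mu> \<subseteq> {..<d} \<and> size \<mu> < N \<and> count \<mu> i < size \<kappa>}" for i
  define B where "B = wt ` (\<Union>i<d. S i)"
  \<comment> \<open>By \<open>inj\<close> at most one monomial of size below \<open>N\<close> has
    weight \<open>v\<close>; monomials of larger size lie in \<open>m^N\<close> and hence in every
    \<open>L v\<close>.\<close>
  define g where "g v = (if \<exists>\<mu>. set_mset \<mu> \<subseteq> {..<d} \<and> size \<mu> < N \<and> wt \<mu> = v
    then mon (SOME \<mu>. set_mset \<mu> \<subseteq> {..<d} \<and> size \<mu> < N \<and> wt \<mu> = v) else \<zero>)" for v
  have g_eq: "g (wt \<mu>) = mon \<mu>" if \<mu>: "set_mset \<mu> \<subseteq> {..<d}" "size \<mu> < N" for \<mu>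
  proof -
    let ?\<nu> = "SOME \<nu>. set_mset \<nu> \<subseteq> {..<d} \<and> size \<nu> < N \<and> wt \<nu> = wt \<mu>"
    have ex: "\<exists>\<nu>. set_mset \<nu> \<subseteq> {..<d} \<and> size \<nu> < N \<and> wt \<nu> = wt \<mu>" using \<mu> by blast
    have "set_mset ?\<nu> \<subseteq> {..<d} \<and> size ?\<nu> < N \<and> wt ?\<nu> = wt \<mu>" by (rule someI_ex[OF ex])
    hence "?\<nu> = \<mu>" using inj[of ?\<nu> \<mu>] \<mu> by blast
    thus ?thesis unfolding g_def using ex by simp
  qed
  have g_L: "g v \<in> L v" for v
  proof (cases "\<exists>\<mu>. set_mset \<mu> \<subseteq> {..<d} \<and> size \<mu> < N \<and> wt \<mu> = v")
    case True
    then obtain \<mu> where \<mu>: "set_mset \<mu> \<subseteq> {..<d}" "size \<mu> < N" "wt \<mu> = v" by blast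
    show ?thesis using g_eq[OF \<mu>(1,2)] L_mon[OF \<mu>(1), of v] \<mu>(3) by simp
  next
    case False
    hence "g v = \<zero>" unfolding g_def by (rule if_not_P)
    thus ?thesis using idealD(2)[OF L_ideal] by simp
  qed
  have gc: "g v \<in> carrier R" for v by (rule idealD(1)[OF L_ideal g_L])
  have finS: "finite (S i)" for i
  proof (rule finite_subset)
    show "S i \<subseteq> (\<Union>s<N. {\<mu>. set_mset \<mu> \<subseteq> {..<d} \<and> size \<mu> = s})" by (auto simp: S_def)
    show "finite (\<Union>s<N. {\<mu>. set_mset \<mu> \<subseteq> {..<d} \<and> size \<mu> = s})"
      by (intro finite_UN_I finite_lessThan finite_multisets_of_size)
  qed
  have finB: "finite B" unfolding B_def by (intro finite_imageI finite_UN_I finite_lessThan finS)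
  have L_gen: "L v \<subseteq> P" if P: "ideal P R" "L (Suc v) \<subseteq> P"
    and eq: "\<And>\<mu>. \<lbrakk>set_mset \<mu> \<subseteq> {..<d}; size \<mu> < N; wt \<mu> = v\<rbrakk> \<Longrightarrow> mon \<mu> \<in> P" for v P
    unfolding L_def
  proof (rule genideal_minimal[OF P(1)], rule subsetI)
    fix y assume "y \<in> Lgen v"
    then consider \<mu> where "y = mon \<mu>" "set_mset \<mu> \<subseteq> {..<d}" "v \<le> wt \<mu>" | "y \<in> ideal_power R m N"
      unfolding Lgen_def by blast
    thus "y \<in> P"
    proof cases
      case 1
      consider "size \<mu> < N" "wt \<mu> = v" | "Suc v \<le> wt \<mu>" | "N \<le> size \<mu>" using 1(3) by linarith
      thus ?thesis
      proof cases
        case 2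
        thus ?thesis using L_mon[OF 1(2)] 1(1) P(2) by blast
      next
        case 3
        thus ?thesis
          using mon_power[OF 1(2)] ideal_power_decreasing[OF m_ideal, of N "size \<mu>"] 1(1) L_pow[of "Suc v"] P(2) by blast
      qed (use eq 1 in blast)
    qed (use L_pow[of "Suc v"] P(2) in blast)
  qed
  have "n \<le> card B"
  proof (rule has_chain_card_bound[OF maximal m_power n, of L "N * Suc (\<Sum>i<d. w i)" g B])
    show "L (Suc v) \<subseteq> L v" for v by (rule L_antimono) simp
    show "\<exists>u\<in>carrier R. b \<ominus> u \<otimes> g v \<in> L (Suc v)" if b: "b \<in> L v" for v b
    proof -
      let ?J = "{b \<in> carrier R. \<exists>u\<in>carrier R. b \<ominus> u \<otimes> g v \<in> L (Suc v)}"
      have "L v \<subseteq> ?J"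
      proof (rule L_gen[OF ideal_modulo[OF L_ideal gc]], rule subsetI)
        fix y assume y: "y \<in> L (Suc v)"
        have yc: "y \<in> carrier R" by (rule idealD(1)[OF L_ideal y])
        hence "y \<ominus> \<zero> \<otimes> g v = y" using gc by (simp add: a_minus_def)
        thus "y \<in> ?J" using y yc by (intro CollectI conjI bexI[of _ \<zero>]) simp_all
      next
        fix \<mu> assume \<mu>: "set_mset \<mu> \<subseteq> {..<d}" "size \<mu> < N" "wt \<mu> = v"
        have "g v = mon \<mu>" using g_eq[OF \<mu>(1,2)] \<mu>(3) by simp
        hence "mon \<mu> \<ominus> \<one> \<otimes> g v = \<zero>" using mon_closed by (simp add: a_minus_def r_neg)
        thus "mon \<mu> \<in> ?J" using mon_closed idealD(2)[OF L_ideal] by (intro CollectI conjI bexI[of _ \<one>]) simp_all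
      qed
      thus ?thesis using b by blast
    qed
    show "y \<otimes> b \<in> L (Suc v)" if "y \<in> m" "b \<in> L v" for v y b
      using L_m_mult[OF that] L_antimono[of "Suc v" "v + W"] W by auto
    show "L v \<subseteq> L (Suc v)" if v: "v \<notin> B" for v
    proof (rule L_gen[OF L_ideal subset_refl])
      fix \<mu> assume \<mu>: "set_mset \<mu> \<subseteq> {..<d}" "size \<mu> < N" "wt \<mu> = v"
      have "\<kappa> \<subseteq># \<mu>"
      proof (rule ccontr)
        assume "\<not> \<kappa> \<subseteq># \<mu>"
        then obtain i where i: "count \<mu> i < count \<kappa> i" unfolding subseteq_mset_def by (auto simp: not_le)
        hence "i \<in># \<kappa>" by (metis count_greater_zero_iff gr_zeroI not_less0)
        hence "i < d" using lead by auto
        moreover have "count \<mu> i < size \<kappa>" using i count_le_size[of \<kappa> i] by linarith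
        ultimately have "\<mu> \<in> (\<Union>i<d. S i)" using \<mu> by (auto simp: S_def)
        thus False using v \<mu>(3) by (auto simp: B_def)
      qed
      then obtain \<nu> where \<nu>: "\<mu> = \<kappa> + \<nu>" by (auto simp: mset_subset_eq_exists_conv)
      show "mon \<mu> \<in> L (Suc v)" using redundant[of \<nu>] \<mu>(1,3) \<nu> by auto
    qed
  qed (use L_ideal L_0 L_eventually g_L finB in auto)
  also have "\<dots> \<le> card (\<Union>i<d. S i)" unfolding B_def
    by (rule card_image_le) (intro finite_UN_I finite_lessThan finS)
  also have "\<dots> \<le> (\<Sum>i<d. card (S i))" by (rule card_UN_le) simp
  also have "\<dots> \<le> (\<Sum>i<d. size \<kappa> * N ^ (d - 1))"
    by (rule sum_mono) (unfold S_def, rule card_bounded_multisets, simp)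
  also have "\<dots> = d * (size \<kappa> * N ^ (d - 1))" by simp
  finally show ?thesis .
qed

end

text \<open>For \<open>n = d * M\<close> the binomial coefficient is at least
  \<open>(n / d)^d = M^d\<close>, while the other side is \<open>C * M^(d-1)\<close> with
  \<open>C\<close> independent of \<open>M\<close>. Any \<open>M > C\<close> works, and the summand
  \<open>k\<close> in \<open>M\<close> makes \<open>n\<close> large.\<close>

lemma binomial_exceeds_power:
  fixes d c s k :: nat
  assumes d: "d \<ge> 1"
  shows "\<exists>n\<ge>k. n \<ge> 1 \<and> d * (c * (s * n) ^ (d - 1)) < n choose d"
proof -
  define C where "C = d * c * (s * d) ^ (d - 1)"
  define M where "M = C + k + 1"
  define n where "n = d * M"
  have M: "M \<ge> 1" "M > C" by (auto simp: M_def)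
  have dn: "d \<le> n" using M by (simp add: n_def)
  have "real (M ^ d) = (real n / real d) ^ d" using d by (simp add: n_def)
  also have "\<dots> \<le> real (n choose d)" using binomial_ge_n_over_k_pow_k[OF dn, where 'a = real] .
  finally have ge: "M ^ d \<le> n choose d" by (simp only: of_nat_le_iff)
  have "d * (c * (s * n) ^ (d - 1)) = C * M ^ (d - 1)"
    by (simp add: C_def n_def power_mult_distrib mult_ac)
  also have "\<dots> < M * M ^ (d - 1)" using M by (intro mult_strict_right_mono) auto
  also have "\<dots> = M ^ d" using d by (cases d) auto
  finally have "d * (c * (s * n) ^ (d - 1)) < n choose d" using ge by linarith
  moreover have "n \<ge> k" "n \<ge> 1" using d M mult_le_mono1[OF d, of M] by (auto simp: n_def M_def)
  ultimately show ?thesis by blast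
qed

section \<open>Leading monomials and colon ideals\<close>

context local_generators
begin

text \<open>Variables with index below \<open>t\<close> dominate, then comes the total degree in the remaining ones.\<close>

definition lex_weight :: "nat \<Rightarrow> nat \<Rightarrow> nat \<Rightarrow> nat"
  where "lex_weight t B i = (if i < t then B ^ (d + 2 + i) else B ^ d + B ^ i)"

text \<open>The base \<open>B\<close> digits of \<open>lex_weight t B i\<close>: position
  \<open>d\<close> counts the degree in the variables from \<open>t\<close> on, the positions below
  \<open>d\<close> identify these variables, and the positions from \<open>d + 2\<close> on identify
  the variables below \<open>t\<close>.\<close>

definition digit :: "nat \<Rightarrow> nat \<Rightarrow> nat \<Rightarrow> nat"
  where "digit t i k = (if i < t then (if k = d + 2 + i then 1 else 0)
    else (if k = d then 1 else 0) + (if k = i then 1 else 0))"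

lemma lex_weight_digits:
  assumes "i < d" "t \<le> d"
  shows "lex_weight t B i = (\<Sum>k<2 * d + 2. digit t i k * B ^ k)"
proof -
  have single: "(\<Sum>k<2 * d + 2. (if k = a then 1 else 0) * B ^ k) = B ^ a" if "a < 2 * d + 2" for a
  proof -
    have "(\<Sum>k<2 * d + 2. (if k = a then 1 else 0) * B ^ k) = (\<Sum>k<2 * d + 2. if k = a then B ^ k else 0)"
      by (rule sum.cong) auto
    thus ?thesis using that by simp
  qed
  show ?thesis
  proof (cases "i < t")
    case True
    show ?thesis unfolding lex_weight_def digit_def if_P[OF True] by (rule single[symmetric]) (use assms in simp)
  next
    case False
    have "B ^ d = (\<Sum>k<2 * d + 2. (if k = d then 1 else 0) * B ^ k)"
      "B ^ i = (\<Sum>k<2 * d + 2. (if k = i then 1 else 0) * B ^ k)"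
      by (rule single[symmetric], use assms in simp)+
    thus ?thesis unfolding lex_weight_def digit_def if_not_P[OF False] add_mult_distrib sum.distrib by (rule arg_cong2)
  qed
qed

text \<open>For a monomial of size below \<open>B\<close> all digit sums stay below
  \<open>B\<close>, so no carry occurs and the exponents can be read off from the weight.\<close>

lemma lex_weight_inj:
  assumes t: "t \<le> d" and \<mu>: "set_mset \<mu> \<subseteq> {..<d}" "size \<mu> < B" and \<nu>: "set_mset \<nu> \<subseteq> {..<d}" "size \<nu> < B"
    and eq: "sum_mset (image_mset (lex_weight t B) \<mu>) = sum_mset (image_mset (lex_weight t B) \<nu>)"
  shows "\<mu> = \<nu>"
proof -
  define dg where "dg \<mu> k = sum_mset (image_mset (\<lambda>i. digit t i k) \<mu>)" for \<mu> k
  have wt: "sum_mset (image_mset (lex_weight t B) \<mu>) = (\<Sum>k<2 * d + 2. dg \<mu> k * B ^ k)"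
    if "set_mset \<mu> \<subseteq> {..<d}" for \<mu>
    using that
  proof (induction \<mu>)
    case (add i \<mu>)
    thus ?case using lex_weight_digits[of i t B] t
      by (simp add: dg_def add_mult_distrib sum.distrib del: sum.lessThan_Suc)
  qed (simp add: dg_def)
  have le1: "digit t i k \<le> 1" if "i < d" for i k using that by (auto simp: digit_def)
  have dg_le: "dg \<mu> k \<le> size \<mu>" if "set_mset \<mu> \<subseteq> {..<d}" for \<mu> k
    using that
  proof (induction \<mu>)
    case (add i \<mu>)
    thus ?case using le1[of i k] by (simp add: dg_def)
  qed (simp add: dg_def)
  have dg_eq: "dg \<mu> k = dg \<nu> k" if "k < 2 * d + 2" for k
  proof (rule digits_unique[OF _ _ _ that, where B = B])
    show "(\<Sum>i<2 * d + 2. dg \<mu> i * B ^ i) = (\<Sum>i<2 * d + 2. dg \<nu> i * B ^ i)"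
      using eq wt[OF \<mu>(1)] wt[OF \<nu>(1)] by simp
  qed (use le_less_trans[OF dg_le[OF \<mu>(1)] \<mu>(2)] le_less_trans[OF dg_le[OF \<nu>(1)] \<nu>(2)] in auto)
  have count: "count \<mu> i = dg \<mu> (if i < t then d + 2 + i else i)" if "set_mset \<mu> \<subseteq> {..<d}" "i < d" for \<mu> i
    using that(1)
  proof (induction \<mu>)
    case (add a \<mu>)
    have "digit t a (if i < t then d + 2 + i else i) = (if a = i then 1 else 0)"
      using add.prems that(2) by (auto simp: digit_def)
    thus ?case using add by (simp add: dg_def)
  qed (simp add: dg_def)
  show ?thesis
  proof (rule multiset_eqI)
    fix i
    show "count \<mu> i = count \<nu> i"
    proof (cases "i < d")
      case True
      thus ?thesis using count[OF \<mu>(1) True] count[OF \<nu>(1) True] dg_eq[of "if i < t then d + 2 + i else i"] by simp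
    next
      case False
      hence "i \<notin># \<mu>" "i \<notin># \<nu>" using \<mu> \<nu> by auto
      thus ?thesis by (simp add: not_in_iff)
    qed
  qed
qed

text \<open>Suppose that \<open>b\<close> has a non-trivial initial form of degree \<open>n\<close>
  modulo \<open>I t\<close>. Its monomial \<open>\<mu>\<close> of least weight has a coefficient
  \<open>u\<close> outside \<open>m\<close>. Since \<open>x t\<close> times \<open>b\<close> lies in
  \<open>I t\<close>, the monomial \<open>\<kappa> = x t \<mu>\<close> is, up to the factor
  \<open>u\<close>, a combination of terms of larger weight, and the same holds for all its
  multiples. Then \<open>has_chain_bound\<close> limits the length of \<open>R / m^N\<close> by a
  constant times \<open>N^(d-1)\<close>, against the growth.\<close>

lemma colon_closed:
  assumes t: "t < d" and b: "b \<in> carrier R" "b \<otimes> x t \<in> I t" and n: "b \<in> I t <+>\<^bsub>R\<^esub> ideal_power R m n"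
    and s: "s \<ge> 1" and growth: "\<And>N. N \<ge> 1 \<Longrightarrow> has_chain (ideal_power R m (s * N)) (N choose d)"
  shows "b \<in> I t <+>\<^bsub>R\<^esub> ideal_power R m (Suc n)"
proof (rule ccontr)
  assume nb: "b \<notin> I t <+>\<^bsub>R\<^esub> ideal_power R m (Suc n)"
  have td: "t \<le> d" using t by simp
  have d1: "d \<ge> 1" using t by simp
  \<comment> \<open>\<open>n + 3\<close> makes \<open>N\<close> large enough for the weights to
    separate the terms below; the strict inequality is the final contradiction, with
    \<open>Suc n\<close> as the size of \<open>\<kappa>\<close>.\<close>
  obtain N' where N': "N' \<ge> n + 3" "N' \<ge> 1" "d * (Suc n * (s * N') ^ (d - 1)) < N' choose d"
    using binomial_exceeds_power[OF d1, of "n + 3" "Suc n" s] by blast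
  define N where "N = s * N'"
  have "N' \<le> N" using s by (simp add: N_def)
  hence NN: "n + 3 \<le> N" using N'(1) by linarith
  define w where "w = lex_weight t N"
  have Nd: "N ^ i \<ge> 1" for i using NN by simp
  have w_ge: "N ^ d \<le> w i" if "i < d" for i
    using power_increasing[of d "d + 2 + i" N] NN by (simp add: w_def lex_weight_def)
  interpret weighted_generators R m x d w "N ^ d" N
    by unfold_locales (use Nd w_ge NN in auto)
  have wt_le: "wt \<mu> \<le> size \<mu> * (N ^ d + N ^ (d - 1))" if "set_mset \<mu> \<subseteq> {t..<d}" for \<mu>
    using that
  proof (induction \<mu>)
    case (add i \<mu>)
    have i: "i \<le> d - 1" "\<not> i < t" using add.prems by auto
    have "w i \<le> N ^ d + N ^ (d - 1)"
      using i(2) power_increasing[OF i(1), of N] NN by (simp add: w_def lex_weight_def)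
    thus ?case using add by simp
  qed simp
  have inj: "\<mu> = \<nu>" if "set_mset \<mu> \<subseteq> {..<d}" "set_mset \<nu> \<subseteq> {..<d}" "size \<mu> < N" "size \<nu> < N" "wt \<mu> = wt \<nu>" for \<mu> \<nu>
    by (rule lex_weight_inj[OF td that(1,3,2,4) that(5)[unfolded wt_def, unfolded w_def]])
  \<comment> \<open>The bound \<open>(n + 2) * N ^ d\<close> separates: possible leading monomials
    of degree \<open>n + 1\<close> stay below it, whereas by \<open>w_big\<close> and
    \<open>L_power_mult\<close> everything coming from \<open>I t\<close> or from
    \<open>m^(n+2)\<close> reaches it.\<close>
  have lead_bound: "wt \<mu> < (n + 2) * N ^ d" if "set_mset \<mu> \<subseteq> {t..<d}" "size \<mu> = Suc n" for \<mu>
  proof -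
    have "Suc n * N ^ (d - 1) < N * N ^ (d - 1)" using NN by (intro mult_strict_right_mono) auto
    also have "\<dots> = N ^ d" using d1 by (cases d) auto
    finally have "Suc n * (N ^ d + N ^ (d - 1)) < (n + 2) * N ^ d" by (simp add: algebra_simps)
    thus ?thesis using wt_le[OF that(1)] that(2) by simp
  qed
  have w_big: "(n + 2) * N ^ d \<le> w i" if "i < t" for i
  proof -
    have "(n + 2) * N ^ d \<le> N * N ^ d" using NN by (intro mult_le_mono1) simp
    also have "\<dots> = N ^ (Suc d)" by simp
    also have "\<dots> \<le> N ^ (d + 2 + i)" using NN by (intro power_increasing) auto
    finally show ?thesis using that by (simp add: w_def lex_weight_def)
  qed
  note It = I_ideal[OF td]
  \<comment> \<open>\<open>S v\<close> and \<open>Y v\<close> describe \<open>b\<close> modulo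
    \<open>I t + m^(n+1)\<close> by monomials of degree \<open>n\<close> in the variables from
    \<open>t\<close> on, keeping only those of weight at least \<open>v\<close>.\<close>
  define S where "S v = {mon \<mu> | \<mu>. set_mset \<mu> \<subseteq> {t..<d} \<and> size \<mu> = n \<and> v \<le> wt \<mu>}" for v
  define Y where "Y v = x ` {..<t} \<union> ideal_power R m (Suc n) \<union> S v" for v
  have Yc: "Y v \<subseteq> carrier R" for v
    unfolding Y_def S_def using xc t mon_closed ideal_subset[OF m_power] by auto
  note Yi = genideal_ideal[OF Yc] and Ys = genideal_self[OF Yc]
  have IY: "I t \<subseteq> Idl (Y v)" for v
    by (rule genideal_minimal[OF Yi order_trans[OF _ Ys]]) (auto simp: Y_def)
  have mY: "ideal_power R m (Suc n) \<subseteq> Idl (Y v)" for v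
    by (rule order_trans[OF _ Ys]) (auto simp: Y_def)
  have monI: "mon \<mu> \<in> I t" if \<mu>: "set_mset \<mu> \<subseteq> {..<d}" "i \<in># \<mu>" "i < t" for \<mu> i
  proof -
    obtain \<nu> where \<nu>: "\<mu> = add_mset i \<nu>" using mset_add[OF \<mu>(2)] by blast
    have "mon \<mu> = x i \<otimes> mon \<nu>" unfolding \<nu> by (rule monom_add_mset[OF xc]) (use \<mu>(3) td in auto)
    thus ?thesis using idealD(7)[OF It mon_closed I_mem[OF \<mu>(3) td]] by simp
  qed
  have bY0: "b \<in> Idl (Y 0)"
  proof -
    have "Idl {mon \<mu> | \<mu>. set_mset \<mu> \<subseteq> {..<d} \<and> size \<mu> = n} \<subseteq> Idl (Y 0)"
    proof (rule genideal_minimal[OF Yi], rule subsetI)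
      fix y assume "y \<in> {mon \<mu> | \<mu>. set_mset \<mu> \<subseteq> {..<d} \<and> size \<mu> = n}"
      then obtain \<mu> where \<mu>: "y = mon \<mu>" "set_mset \<mu> \<subseteq> {..<d}" "size \<mu> = n" by blast
      show "y \<in> Idl (Y 0)"
      proof (cases "set_mset \<mu> \<subseteq> {t..<d}")
        case True
        hence "y \<in> S 0" using \<mu> unfolding S_def by blast
        thus ?thesis using Ys[of 0] unfolding Y_def by blast
      next
        case False
        then obtain i where "i \<in># \<mu>" "i < t" using \<mu>(2) by (auto simp: subset_iff not_le)
        thus ?thesis using monI[OF \<mu>(2)] IY[of 0] \<mu>(1) by blast
      qed
    qed
    hence "ideal_power R m n \<subseteq> Idl (Y 0)"
      using power_subset_monomials[of n] set_add_least[OF Yi _ mY] by blast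
    thus ?thesis using set_add_least[OF Yi IY] n by blast
  qed
  \<comment> \<open>Beyond this weight no monomial of size \<open>n\<close> in the variables from
    \<open>t\<close> on is left.\<close>
  have bYV: "b \<notin> Idl (Y (Suc (n * (N ^ d + N ^ (d - 1)))))"
  proof
    let ?V = "Suc (n * (N ^ d + N ^ (d - 1)))"
    assume b: "b \<in> Idl (Y ?V)"
    have "\<not> ?V \<le> wt \<mu>" if "set_mset \<mu> \<subseteq> {t..<d}" "size \<mu> = n" for \<mu>
      using wt_le[OF that(1)] that(2) by simp
    hence "S ?V = {}" unfolding S_def by auto
    hence "Y ?V \<subseteq> I t <+>\<^bsub>R\<^esub> ideal_power R m (Suc n)"
      unfolding Y_def using subsetD[OF set_add_ge1[OF It m_power]] set_add_ge2[OF It m_power] I_mem[OF _ td] by auto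
    hence "Idl (Y ?V) \<subseteq> I t <+>\<^bsub>R\<^esub> ideal_power R m (Suc n)"
      by (rule genideal_minimal[OF add_ideals[OF It m_power]])
    thus False using b nb by blast
  qed
  \<comment> \<open>\<open>v\<close> is the weight of the initial term of \<open>b\<close>.\<close>
  obtain v where v: "b \<in> Idl (Y v)" "b \<notin> Idl (Y (Suc v))"
  proof -
    have "\<exists>v. b \<in> Idl (Y v) \<and> b \<notin> Idl (Y (Suc v))"
    proof (rule ccontr)
      assume "\<not> ?thesis"
      hence "b \<in> Idl (Y v)" for v using bY0 by (induction v) auto
      thus False using bYV by blast
    qed
    thus ?thesis using that by blast
  qed
  have YSuc: "Y v \<subseteq> P" if P: "Idl (Y (Suc v)) \<subseteq> P"
    "\<And>\<mu>. \<lbrakk>set_mset \<mu> \<subseteq> {t..<d}; size \<mu> = n; wt \<mu> = v\<rbrakk> \<Longrightarrow> mon \<mu> \<in> P" for P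
  proof
    fix y assume "y \<in> Y v"
    then consider "y \<in> Y (Suc v)" | \<mu> where "y = mon \<mu>" "set_mset \<mu> \<subseteq> {t..<d}" "size \<mu> = n" "v \<le> wt \<mu>"
      unfolding Y_def S_def by blast
    thus "y \<in> P"
    proof cases
      case 2
      show ?thesis
      proof (cases "wt \<mu> = v")
        case False
        hence "Suc v \<le> wt \<mu>" using 2(4) by simp
        hence "y \<in> S (Suc v)" using 2(1-3) unfolding S_def by blast
        thus ?thesis using Ys[of "Suc v"] P(1) unfolding Y_def by blast
      qed (use P(2) 2 in blast)
    qed (use Ys P(1) in blast)
  qed
  have "\<exists>\<mu>. set_mset \<mu> \<subseteq> {t..<d} \<and> size \<mu> = n \<and> wt \<mu> = v"
  proof (rule ccontr)
    assume "\<not> ?thesis"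
    hence "Y v \<subseteq> Idl (Y (Suc v))" by (intro YSuc) auto
    thus False using v genideal_minimal[OF Yi] by blast
  qed
  then obtain \<mu> where \<mu>: "set_mset \<mu> \<subseteq> {t..<d}" "size \<mu> = n" "wt \<mu> = v" by blast
  have \<mu>d: "set_mset \<mu> \<subseteq> {..<d}" using \<mu>(1) by auto
  let ?J = "{b \<in> carrier R. \<exists>u\<in>carrier R. b \<ominus> u \<otimes> mon \<mu> \<in> Idl (Y (Suc v))}"
  have "Idl (Y v) \<subseteq> ?J"
  proof (rule genideal_minimal[OF ideal_modulo[OF Yi mon_closed] YSuc])
    show "Idl (Y (Suc v)) \<subseteq> ?J"
    proof
      fix y assume y: "y \<in> Idl (Y (Suc v))"
      have yc: "y \<in> carrier R" by (rule idealD(1)[OF Yi y])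
      hence "y \<ominus> \<zero> \<otimes> mon \<mu> = y" using mon_closed by (simp add: a_minus_def)
      thus "y \<in> ?J" using y yc by (intro CollectI conjI bexI[of _ \<zero>]) simp_all
    qed
    fix \<nu> assume \<nu>: "set_mset \<nu> \<subseteq> {t..<d}" "size \<nu> = n" "wt \<nu> = v"
    have "\<nu> = \<mu>" by (rule inj) (use \<mu> \<nu> NN in auto)
    hence "mon \<nu> \<ominus> \<one> \<otimes> mon \<mu> = \<zero>" using mon_closed by (simp add: a_minus_def r_neg)
    thus "mon \<nu> \<in> ?J" using mon_closed idealD(2)[OF Yi]
      by (intro CollectI conjI bexI[of _ \<one>]) (simp_all add: a_minus_def r_neg)
  qed
  then obtain u where u: "u \<in> carrier R" "b \<ominus> u \<otimes> mon \<mu> \<in> Idl (Y (Suc v))" using v(1) by blast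
  define z where "z = b \<ominus> u \<otimes> mon \<mu>"
  have zc: "z \<in> carrier R" using b u mon_closed by (simp add: z_def)
  \<comment> \<open>Otherwise the initial term would lie in \<open>m^(n+1)\<close>, and
    \<open>b\<close> would already belong to the ideal for \<open>Suc v\<close>.\<close>
  have u_m: "u \<notin> m"
  proof
    assume "u \<in> m"
    hence "u \<otimes> mon \<mu> \<in> ideal_power R m (Suc n)"
      unfolding ideal_power_Suc'[OF m_ideal]
      by (rule ideal_prod.prod[OF _ mon_power[OF \<mu>d, unfolded \<mu>(2)]])
    hence "z \<oplus> u \<otimes> mon \<mu> \<in> Idl (Y (Suc v))"
      unfolding z_def by (rule idealD(3)[OF Yi u(2) subsetD[OF mY]])
    moreover have "z \<oplus> u \<otimes> mon \<mu> = b" using b u mon_closed by (simp add: z_def a_minus_def a_assoc l_neg)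
    ultimately show False using v(2) by simp
  qed
  define \<kappa> where "\<kappa> = add_mset t \<mu>"
  have \<kappa>: "set_mset \<kappa> \<subseteq> {t..<d}" "size \<kappa> = Suc n" "wt \<kappa> = w t + v" using \<mu> t by (auto simp: \<kappa>_def)
  have \<kappa>d: "set_mset \<kappa> \<subseteq> {..<d}" using \<kappa>(1) by auto
  have mon\<kappa>: "mon \<kappa> = x t \<otimes> mon \<mu>" unfolding \<kappa>_def by (rule monom_add_mset[OF xc t])
  \<comment> \<open>In \<open>u mon \<kappa> = x t b - x t z\<close> every term on the right is
    heavier than \<open>\<kappa>\<close>: those from \<open>I t\<close> and \<open>m^(n+2)\<close>
    by the separating bound, the monomials of \<open>z\<close> because they are heavier than
    \<open>\<mu>\<close>.\<close>
  have red: "mon (\<kappa> + \<nu>) \<in> L (Suc (wt (\<kappa> + \<nu>)))" if \<nu>: "set_mset \<nu> \<subseteq> {..<d}" for \<nu>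
  proof -
    let ?T = "L (Suc (wt \<kappa> + wt \<nu>))"
    have T: "ideal ?T R" by (rule L_ideal)
    let ?P = "{c \<in> carrier R. mon \<nu> \<otimes> c \<in> ?T}"
    have P: "ideal ?P R" by (rule ideal_colon[OF T mon_closed])
    have lb: "wt \<kappa> < (n + 2) * N ^ d" by (rule lead_bound[OF \<kappa>(1,2)])
    have xP: "x i \<in> ?P" if i: "i < t" for i
    proof -
      have "mon \<nu> \<otimes> x i = mon (add_mset i \<nu>)"
        using monom_add_mset[OF xc, where l = i and \<mu> = \<nu>] m_comm[OF mon_closed xc] i t by simp
      moreover have "mon (add_mset i \<nu>) \<in> ?T" by (rule L_mon) (use \<nu> i t w_big[OF i] lb in auto)
      ultimately show ?thesis using xc i t by simp
    qed
    have IP: "I t \<subseteq> ?P" by (rule genideal_minimal[OF P]) (use xP in auto)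
    have mP: "ideal_power R m (Suc (Suc n)) \<subseteq> ?P"
    proof
      fix h assume h: "h \<in> ideal_power R m (Suc (Suc n))"
      have hc: "h \<in> carrier R" by (rule idealD(1)[OF m_power h])
      have "h \<otimes> mon \<nu> \<in> L (wt \<nu> + Suc (Suc n) * N ^ d)" by (rule L_power_mult[OF h L_mon[OF \<nu> order_refl]])
      hence "h \<otimes> mon \<nu> \<in> ?T" using L_antimono[of "Suc (wt \<kappa> + wt \<nu>)" "wt \<nu> + Suc (Suc n) * N ^ d"] lb by auto
      thus "h \<in> ?P" using hc by (simp add: m_comm[OF mon_closed hc])
    qed
    have "x t \<otimes> z \<in> ?P"
    proof (rule genideal_colon[OF P xc[OF t] Yc _ u(2)[folded z_def]])
      fix y assume "y \<in> Y (Suc v)"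
      then consider i where "i < t" "y = x i" | "y \<in> ideal_power R m (Suc n)"
        | \<mu>' where "y = mon \<mu>'" "set_mset \<mu>' \<subseteq> {t..<d}" "Suc v \<le> wt \<mu>'"
        unfolding Y_def S_def by blast
      thus "x t \<otimes> y \<in> ?P"
      proof cases
        case 1
        show ?thesis unfolding 1(2) by (rule idealD(6)[OF P xc[OF t] xP[OF 1(1)]])
      next
        case 2
        have "x t \<otimes> y \<in> ideal_power R m (Suc (Suc n))"
          unfolding ideal_power_Suc'[OF m_ideal, of "Suc n"] by (rule ideal_prod.prod[OF x_m[OF t] 2])
        thus ?thesis using mP by blast
      next
        case 3
        have d': "set_mset \<mu>' \<subseteq> {..<d}" using 3(2) by auto
        have "x t \<otimes> y = mon (add_mset t \<mu>')" unfolding 3(1) by (rule monom_add_mset[OF xc t, symmetric])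
        moreover have "mon \<nu> \<otimes> mon (add_mset t \<mu>') \<in> ?T"
          unfolding mon_add[symmetric] by (rule L_mon) (use \<nu> d' t 3(3) \<kappa>(3) in auto)
        ultimately show ?thesis using mon_closed by simp
      qed
    qed
    moreover have "x t \<otimes> b \<in> ?P" using IP b m_comm[OF b(1) xc[OF t]] by auto
    ultimately have "x t \<otimes> b \<ominus> x t \<otimes> z \<in> ?P" using idealD(5)[OF P] by blast
    moreover have "x t \<otimes> b \<ominus> x t \<otimes> z = u \<otimes> mon \<kappa>"
      unfolding mon\<kappa> z_def using b(1) u(1) mon_closed[of \<mu>] xc[OF t] by algebra
    ultimately have uk: "mon \<nu> \<otimes> (u \<otimes> mon \<kappa>) \<in> ?T" by simp
    \<comment> \<open>\<open>u\<close> is inverted modulo \<open>m\<close>; the error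
      \<open>(1 - w' u) mon (\<kappa> + \<nu>)\<close> is heavier, since multiplication by
      \<open>m\<close> adds at least \<open>N ^ d\<close> to the weight.\<close>
    obtain w' where w': "w' \<in> carrier R" "\<one> \<ominus> w' \<otimes> u \<in> m" using maximal_inverse[OF maximal u(1) u_m] by blast
    have kn: "mon (\<kappa> + \<nu>) \<in> L (wt \<kappa> + wt \<nu>)" by (rule L_mon) (use \<kappa>d \<nu> in auto)
    have "(\<one> \<ominus> w' \<otimes> u) \<otimes> mon (\<kappa> + \<nu>) \<in> L (wt \<kappa> + wt \<nu> + N ^ d)" by (rule L_m_mult[OF w'(2) kn])
    hence "(\<one> \<ominus> w' \<otimes> u) \<otimes> mon (\<kappa> + \<nu>) \<in> ?T"
      using L_antimono[of "Suc (wt \<kappa> + wt \<nu>)" "wt \<kappa> + wt \<nu> + N ^ d"] Nd[of d] by auto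
    moreover have "w' \<otimes> (mon \<nu> \<otimes> (u \<otimes> mon \<kappa>)) \<in> ?T" by (rule idealD(6)[OF T w'(1) uk])
    ultimately have "(\<one> \<ominus> w' \<otimes> u) \<otimes> mon (\<kappa> + \<nu>) \<oplus> w' \<otimes> (mon \<nu> \<otimes> (u \<otimes> mon \<kappa>)) \<in> ?T"
      by (rule idealD(3)[OF T])
    moreover have "(\<one> \<ominus> w' \<otimes> u) \<otimes> mon (\<kappa> + \<nu>) \<oplus> w' \<otimes> (mon \<nu> \<otimes> (u \<otimes> mon \<kappa>)) = mon (\<kappa> + \<nu>)"
      unfolding mon_add using w'(1) u(1) mon_closed[of \<kappa>] mon_closed[of \<nu>] by algebra
    ultimately show ?thesis by simp
  qed
  have "N' choose d \<le> d * (size \<kappa> * N ^ (d - 1))"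
    by (rule has_chain_bound[OF inj \<kappa>d red]) (use growth[OF N'(2)] in \<open>simp_all add: N_def\<close>)
  thus False using N'(3) \<kappa>(2) by (simp add: N_def)
qed

text \<open>Krull's intersection theorem from Artin--Rees. For the ideal \<open>(b) + J\<close>, an
  element \<open>c = b - j\<close> of it in \<open>m^(1+r)\<close> lies in \<open>m\<close> times
  it. Hence \<open>b\<close> equals \<open>y b\<close> modulo \<open>J\<close> with \<open>y\<close>
  in \<open>m\<close>, and \<open>1 - y\<close> is the multiplier.\<close>

lemma krull_intersection:
  assumes J: "ideal J R" and b: "b \<in> carrier R" "\<And>n. b \<in> J <+>\<^bsub>R\<^esub> ideal_power R m n"
  shows "\<exists>s\<in>carrier R. s \<notin> m \<and> s \<otimes> b \<in> J"
proof -
  let ?N = "PIdl b <+>\<^bsub>R\<^esub> J"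
  have Pb: "ideal (PIdl b) R" by (rule cgenideal_ideal[OF b(1)])
  have N: "ideal ?N R" by (rule add_ideals[OF Pb J])
  obtain r where r: "\<And>j. ?N \<inter> ideal_power R m (j + r) \<subseteq> ideal_power R m j \<cdot> ?N"
    using artin_rees_ideal[OF noetherian_ring_axioms m_ideal N] by blast
  obtain j c where jc: "j \<in> J" "c \<in> ideal_power R m (1 + r)" "b = j \<oplus> c"
    using b(2)[of "1 + r"] unfolding mem_set_add by blast
  have c: "j \<in> carrier R" "c \<in> carrier R" using idealD(1)[OF J jc(1)] idealD(1)[OF m_power jc(2)] by auto
  have "c = b \<ominus> j" using c b(1) jc(3) by (simp add: a_minus_def a_ac r_neg r_neg1 r_neg2)
  moreover have "b \<in> ?N" using set_add_ge1[OF Pb J] cgenideal_self[OF b(1)] by blast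
  moreover have "j \<in> ?N" using set_add_ge2[OF Pb J] jc(1) by blast
  ultimately have "c \<in> ?N" using idealD(5)[OF N] by simp
  hence "c \<in> m \<cdot> ?N" using r[of 1] jc(2) by (auto simp: ideal_power_1[OF m_ideal])
  hence "\<exists>y\<in>m. \<exists>j'\<in>J. c = y \<otimes> b \<oplus> j'"
  proof (induction rule: ideal_prod.induct)
    case (prod i z)
    then obtain p j' where "p \<in> PIdl b" "j' \<in> J" "z = p \<oplus> j'" unfolding mem_set_add by blast
    moreover then obtain q where "q \<in> carrier R" "p = q \<otimes> b" unfolding cgenideal_def by blast
    ultimately have z: "z = q \<otimes> b \<oplus> j'" "q \<in> carrier R" "j' \<in> J" by auto
    have ic: "i \<in> carrier R" by (rule idealD(1)[OF m_ideal prod(1)])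
    have "i \<otimes> z = (i \<otimes> q) \<otimes> b \<oplus> i \<otimes> j'"
      unfolding z(1) using z(2) ic b(1) idealD(1)[OF J z(3)] by (simp add: r_distr m_assoc)
    thus ?case using idealD(7)[OF m_ideal z(2) prod(1)] idealD(6)[OF J ic z(3)] by blast
  next
    case (sum u v)
    then obtain y j1 y' j2 where h: "y \<in> m" "j1 \<in> J" "u = y \<otimes> b \<oplus> j1" "y' \<in> m" "j2 \<in> J" "v = y' \<otimes> b \<oplus> j2" by blast
    have "u \<oplus> v = (y \<oplus> y') \<otimes> b \<oplus> (j1 \<oplus> j2)"
      using h idealD(1)[OF m_ideal] idealD(1)[OF J] b(1) by (simp add: l_distr a_ac)
    thus ?case using idealD(3)[OF m_ideal h(1,4)] idealD(3)[OF J h(2,5)] by blast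
  qed
  then obtain y j' where y: "y \<in> m" "j' \<in> J" "c = y \<otimes> b \<oplus> j'" by blast
  have yc: "y \<in> carrier R" "j' \<in> carrier R" using idealD(1)[OF m_ideal y(1)] idealD(1)[OF J y(2)] by auto
  have "(\<one> \<ominus> y) \<otimes> b = b \<ominus> y \<otimes> b" using yc b(1) by algebra
  also have "\<dots> = (j \<oplus> (y \<otimes> b \<oplus> j')) \<ominus> y \<otimes> b" using jc(3) y(3) by simp
  also have "\<dots> = j \<oplus> j'" using c yc b(1) by algebra
  finally have "(\<one> \<ominus> y) \<otimes> b \<in> J" using idealD(3)[OF J jc(1) y(2)] by simp
  moreover have "\<one> \<ominus> y \<notin> m"
  proof
    assume "\<one> \<ominus> y \<in> m"
    hence "(\<one> \<ominus> y) \<oplus> y \<in> m" using idealD(3)[OF m_ideal] y(1) by blast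
    thus False using one_not_m yc by (simp add: a_minus_def a_assoc l_neg)
  qed
  ultimately show ?thesis using yc by (intro bexI[of _ "\<one> \<ominus> y"]) auto
qed

text \<open>\<open>colon_closed\<close> pushes \<open>b\<close> into \<open>I t + m^n\<close> for
  every \<open>n\<close>, and \<open>krull_intersection\<close> finishes.\<close>

theorem regular_sequence_locally:
  assumes P: "\<And>i. i \<le> d \<Longrightarrow> primeideal (P i) R" "\<And>i. i < d \<Longrightarrow> P i \<subset> P (Suc i)" "P d \<subseteq> m"
    and t: "t < d" and b: "b \<in> carrier R" "b \<otimes> x t \<in> I t"
  shows "\<exists>s\<in>carrier R. s \<notin> m \<and> s \<otimes> b \<in> I t"
proof -
  obtain s where s: "s \<ge> 1" "\<And>N. N \<ge> 1 \<Longrightarrow> has_chain (P 0 <+>\<^bsub>R\<^esub> ideal_power R m (s * N)) (N choose d)"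
    using prime_chain_growth[OF m_ideal one_not_m P] by blast
  have p0: "ideal (P 0) R" using P(1)[of 0] primeideal.axioms(1) by blast
  have growth: "has_chain (ideal_power R m (s * N)) (N choose d)" if "N \<ge> 1" for N
    by (rule has_chain_mono[OF s(2)[OF that] set_add_ge2[OF p0 m_power]]) simp
  have It: "ideal (I t) R" by (rule I_ideal) (use t in simp)
  have "b \<in> I t <+>\<^bsub>R\<^esub> ideal_power R m n" for n
  proof (induction n)
    case 0
    show ?case using set_add_ge2[OF It oneideal] b(1) by (auto simp: ideal_power_0)
  next
    case (Suc n)
    show ?case by (rule colon_closed[OF t b Suc s(1) growth])
  qed
  thus ?thesis by (rule krull_intersection[OF It b(1)])
qed

end

section \<open>The length of minimal free resolutions\<close>

lemma (in module) finsum_submodule: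
  assumes P: "submodule R P M" and f: "\<And>b. b \<in> B \<Longrightarrow> f b \<in> P"
  shows "(\<Oplus>\<^bsub>M\<^esub>b\<in>B. f b) \<in> P"
  using f
proof (induction B rule: infinite_finite_induct)
  case (insert b B)
  have "f \<in> insert b B \<rightarrow> carrier M" using insert.prems submoduleD(1)[OF P] by blast
  hence "(\<Oplus>\<^bsub>M\<^esub>b\<in>insert b B. f b) = f b \<oplus>\<^bsub>M\<^esub> (\<Oplus>\<^bsub>M\<^esub>b\<in>B. f b)"
    using insert.hyps by (intro M.finsum_insert) auto
  thus ?case using submoduleD(3)[OF P] insert by simp
qed (use submoduleD(2)[OF P] in simp_all)

text \<open>One direction applies the coordinate maps, the other expands \<open>x\<close> in the
  basis.\<close>

lemma (in module) ideal_smult_coordinates: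
  assumes \<pi>: "\<And>b. b \<in> B \<Longrightarrow> mod_hom R M Rmod (\<pi> b)" "\<And>x. x \<in> carrier M \<Longrightarrow> lincomb (\<lambda>b. \<pi> b x) B = x"
    and B: "B \<subseteq> carrier M" and J: "ideal J R" and x: "x \<in> carrier M"
  shows "x \<in> ideal_smult R M J (carrier M) \<longleftrightarrow> (\<forall>b\<in>B. \<pi> b x \<in> J)"
proof (intro iffI ballI)
  have Jc: "J \<subseteq> carrier R" by (rule R.ideal_subset[OF J])
  fix b assume x: "x \<in> ideal_smult R M J (carrier M)" and b: "b \<in> B"
  have "submodule R J Rmod" using R.submodule_ideal_module[OF R.oneideal] J Jc by simp
  thus "\<pi> b x \<in> J"
  proof (rule ideal_smult_hom[OF \<pi>(1)[OF b] Jc subset_refl x])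
    fix a y assume "a \<in> J" "y \<in> carrier M"
    thus "a \<odot>\<^bsub>Rmod\<^esub> \<pi> b y \<in> J" using mod_homD(1)[OF \<pi>(1)[OF b]] R.idealD(7)[OF J] by simp
  qed
next
  have Jc: "J \<subseteq> carrier R" by (rule R.ideal_subset[OF J])
  assume a: "\<forall>b\<in>B. \<pi> b x \<in> J"
  have "(\<Oplus>\<^bsub>M\<^esub>b\<in>B. \<pi> b x \<odot>\<^bsub>M\<^esub> b) \<in> ideal_smult R M J (carrier M)"
    by (rule finsum_submodule[OF ideal_smult_submodule[OF Jc subset_refl]])
      (rule ideal_smultI[OF Jc subset_refl], use a B in auto)
  thus "x \<in> ideal_smult R M J (carrier M)" using \<pi>(2)[OF x] by (simp add: lincomb_def)
qed

lemma (in module) ideal_smult_add_generator: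
  assumes Y: "Y \<subseteq> carrier R" and a: "a \<in> carrier R" and x: "x \<in> ideal_smult R M (Idl (insert a Y)) (carrier M)"
  shows "\<exists>u\<in>carrier M. \<exists>q\<in>ideal_smult R M (Idl Y) (carrier M). x = a \<odot>\<^bsub>M\<^esub> u \<oplus>\<^bsub>M\<^esub> q"
proof -
  have Yc: "Idl Y \<subseteq> carrier R" by (rule R.ideal_subset[OF R.genideal_ideal[OF Y]])
  let ?Q = "ideal_smult R M (Idl Y) (carrier M)"
  have Q: "submodule R ?Q M" by (rule ideal_smult_submodule[OF Yc subset_refl])
  note Qd = submoduleD[OF Q]
  let ?P = "{x. \<exists>u\<in>carrier M. \<exists>q\<in>?Q. x = a \<odot>\<^bsub>M\<^esub> u \<oplus>\<^bsub>M\<^esub> q}"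
  have PI: "y \<in> ?P" if "u \<in> carrier M" "q \<in> ?Q" "y = a \<odot>\<^bsub>M\<^esub> u \<oplus>\<^bsub>M\<^esub> q" for y u q using that by blast
  have P: "submodule R ?P M"
    unfolding submodule_iff
  proof (intro conjI ballI M.add_subI)
    show "?P \<subseteq> carrier M" using a Qd(1) by auto
    show "\<zero>\<^bsub>M\<^esub> \<in> ?P" by (rule PI[OF M.zero_closed Qd(2)]) (use a in simp)
    fix y assume "y \<in> ?P"
    then obtain u q where y: "u \<in> carrier M" "q \<in> ?Q" "y = a \<odot>\<^bsub>M\<^esub> u \<oplus>\<^bsub>M\<^esub> q" by blast
    show "\<ominus>\<^bsub>M\<^esub> y \<in> ?P"
      by (rule PI[OF M.a_inv_closed[OF y(1)] Qd(4)[OF y(2)]])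
        (use y a Qd(1)[OF y(2)] in \<open>simp add: smult_r_minus M.minus_add\<close>)
    { fix z assume "z \<in> ?P"
      then obtain v p where z: "v \<in> carrier M" "p \<in> ?Q" "z = a \<odot>\<^bsub>M\<^esub> v \<oplus>\<^bsub>M\<^esub> p" by blast
      show "y \<oplus>\<^bsub>M\<^esub> z \<in> ?P"
        by (rule PI[OF M.a_closed[OF y(1) z(1)] Qd(3)[OF y(2) z(2)]])
          (use y z a Qd(1)[OF y(2)] Qd(1)[OF z(2)] in \<open>simp add: smult_r_distr M.a_ac\<close>) }
    fix r assume r: "r \<in> carrier R"
    have "r \<odot>\<^bsub>M\<^esub> (a \<odot>\<^bsub>M\<^esub> u) = a \<odot>\<^bsub>M\<^esub> (r \<odot>\<^bsub>M\<^esub> u)"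
      using r a y(1) by (simp flip: smult_assoc1 add: R.m_comm)
    thus "r \<odot>\<^bsub>M\<^esub> y \<in> ?P"
      by (intro PI[OF smult_closed[OF r y(1)] Qd(6)[OF r y(2)]])
        (use y a r Qd(1)[OF y(2)] in \<open>simp add: smult_r_distr\<close>)
  qed
  have "ideal_smult R M (Idl (insert a Y)) (carrier M) \<subseteq> ?P"
  proof (rule ideal_smult_Idl[OF P subset_refl])
    show "insert a Y \<subseteq> carrier R" using a Y by simp
    fix y x assume y: "y \<in> insert a Y" and x: "x \<in> carrier M"
    show "y \<odot>\<^bsub>M\<^esub> x \<in> ?P"
    proof (cases "y = a")
      case True
      show ?thesis by (rule PI[OF x Qd(2)]) (use True x a in simp)
    next
      case False
      hence "y \<in> Idl Y" using y R.genideal_self[OF Y] by blast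
      hence yx: "y \<odot>\<^bsub>M\<^esub> x \<in> ?Q" by (rule ideal_smultI[OF Yc subset_refl _ x])
      show ?thesis by (rule PI[OF M.zero_closed yx]) (use a Qd(1)[OF yx] in simp)
    qed
  qed
  thus ?thesis using x by blast
qed

section \<open>Regular sequences acting on free resolutions\<close>

locale regular_generators = local_generators R m x d for R (structure) and m x d +
  fixes P :: "nat \<Rightarrow> 'a set"
  assumes P: "i \<le> d \<Longrightarrow> primeideal (P i) R" "i < d \<Longrightarrow> P i \<subset> P (Suc i)" "P d \<subseteq> m"
begin

lemma regular:
  assumes "t < d" "b \<in> carrier R" "x t \<otimes> b \<in> I t"
  shows "\<exists>s\<in>carrier R. s \<notin> m \<and> s \<otimes> b \<in> I t"
  using regular_sequence_locally[OF P assms(1,2)] assms(3) m_comm[OF assms(2) xc[OF assms(1)]] by simp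

lemma unit_mult:
  assumes "s \<in> carrier R" "s \<notin> m" "r \<in> carrier R" "r \<notin> m"
  shows "s \<otimes> r \<in> carrier R" "s \<otimes> r \<notin> m"
  using assms primeideal.I_prime[OF m_prime assms(1,3)] by auto

text \<open>The finitely many multipliers are multiplied together; primality of \<open>m\<close>
  keeps the product outside \<open>m\<close>.\<close>

lemma common_denominator:
  assumes J: "ideal J R" and "finite B" "\<And>b. b \<in> B \<Longrightarrow> a b \<in> carrier R"
    "\<And>b. b \<in> B \<Longrightarrow> \<exists>s\<in>carrier R. s \<notin> m \<and> s \<otimes> a b \<in> J"
  shows "\<exists>s\<in>carrier R. s \<notin> m \<and> (\<forall>b\<in>B. s \<otimes> a b \<in> J)"
  using assms(2-)
proof (induction B rule: finite_induct)
  case empty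
  show ?case using one_not_m by blast
next
  case (insert b B)
  have "\<exists>s\<in>carrier R. s \<notin> m \<and> (\<forall>b\<in>B. s \<otimes> a b \<in> J)"
    by (rule insert.IH) (rule insert.prems, simp)+
  then obtain s where s: "s \<in> carrier R" "s \<notin> m" "\<And>c. c \<in> B \<Longrightarrow> s \<otimes> a c \<in> J" by blast
  obtain r where r: "r \<in> carrier R" "r \<notin> m" "r \<otimes> a b \<in> J" using insert.prems(2)[of b] by blast
  have "(s \<otimes> r) \<otimes> a c \<in> J" if c: "c \<in> insert b B" for c
  proof (cases "c = b")
    case True
    thus ?thesis using idealD(6)[OF J s(1) r(3)] s(1) r(1) insert.prems(1)[of b] by (simp add: m_assoc)
  next
    case False
    hence "r \<otimes> (s \<otimes> a c) \<in> J" using idealD(6)[OF J r(1) s(3)] c by blast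
    thus ?thesis using s(1) r(1) insert.prems(1)[OF c] by (simp add: m_assoc m_lcomm)
  qed
  thus ?case using unit_mult[OF s(1,2) r(1,2)] by blast
qed

text \<open>Regularity of \<open>x t\<close> is applied to each coordinate, with a common multiplier
  at the end.\<close>

lemma regular_free_module:
  assumes M: "module R M" and B: "finite B" "module_basis R M B" and t: "t < d"
    and u: "u \<in> carrier M" "x t \<odot>\<^bsub>M\<^esub> u \<in> ideal_smult R M (I t) (carrier M)"
  shows "\<exists>s\<in>carrier R. s \<notin> m \<and> s \<odot>\<^bsub>M\<^esub> u \<in> ideal_smult R M (I t) (carrier M)"
proof -
  interpret M: module R M by fact
  obtain \<pi> where \<pi>: "\<And>b. b \<in> B \<Longrightarrow> mod_hom R M M.Rmod (\<pi> b)"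
    "\<And>x. x \<in> carrier M \<Longrightarrow> M.lincomb (\<lambda>b. \<pi> b x) B = x"
    using M.basis_coordinates[OF B] by metis
  have Bc: "B \<subseteq> carrier M" using B(2) by (simp add: module_basis_def)
  have J: "ideal (I t) R" by (rule I_ideal) (use t in simp)
  note coord = M.ideal_smult_coordinates[OF \<pi> Bc J]
  have \<pi>c: "\<pi> b u \<in> carrier R" if "b \<in> B" for b using mod_homD(1)[OF \<pi>(1)[OF that] u(1)] by simp
  have \<pi>s: "\<pi> b (r \<odot>\<^bsub>M\<^esub> u) = r \<otimes> \<pi> b u" if "b \<in> B" "r \<in> carrier R" for b r
    using mod_homD(3)[OF \<pi>(1)[OF that(1)] that(2) u(1)] by simp
  have "\<exists>s\<in>carrier R. s \<notin> m \<and> (\<forall>b\<in>B. s \<otimes> \<pi> b u \<in> I t)"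
  proof (rule common_denominator[OF J B(1) \<pi>c])
    fix b assume b: "b \<in> B"
    have "\<pi> b (x t \<odot>\<^bsub>M\<^esub> u) \<in> I t" using coord[of "x t \<odot>\<^bsub>M\<^esub> u"] u xc[OF t] b by simp
    hence "x t \<otimes> \<pi> b u \<in> I t" using \<pi>s[OF b xc[OF t]] by simp
    thus "\<exists>s\<in>carrier R. s \<notin> m \<and> s \<otimes> \<pi> b u \<in> I t" by (rule regular[OF t \<pi>c[OF b]])
  qed
  then obtain s where s: "s \<in> carrier R" "s \<notin> m" "\<And>b. b \<in> B \<Longrightarrow> s \<otimes> \<pi> b u \<in> I t" by blast
  have "s \<odot>\<^bsub>M\<^esub> u \<in> ideal_smult R M (I t) (carrier M)"
    using coord[of "s \<odot>\<^bsub>M\<^esub> u"] s \<pi>s u(1) by simp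
  thus ?thesis using s by blast
qed

text \<open>Up to multipliers outside \<open>m\<close>, this is the vanishing of \<open>Tor\<^sub>j(R / I t, M)\<close> for \<open>j > t\<close>.\<close>

lemma tor_vanishing:
  assumes F: "free_resolution R M F \<phi> \<epsilon>" and "t \<le> d" "t \<le> i" and "z \<in> carrier (F (Suc i))"
    "\<phi> (Suc i) z \<in> ideal_smult R (F i) (I t) (carrier (F i))"
  shows "\<exists>s\<in>carrier R. s \<notin> m \<and> (\<exists>w\<in>carrier (F (Suc (Suc i))).
    s \<odot>\<^bsub>F (Suc i)\<^esub> z \<ominus>\<^bsub>F (Suc i)\<^esub> \<phi> (Suc (Suc i)) w \<in> ideal_smult R (F (Suc i)) (I t) (carrier (F (Suc i))))"
  using assms(2-)
proof (induction t arbitrary: i z)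
  case 0
  note D = free_resolutionD[OF F]
  interpret Fi: module R "F i" by (rule D(1))
  interpret FS: module R "F (Suc i)" by (rule D(1))
  \<comment> \<open>For the zero ideal the hypothesis says that \<open>z\<close> is a cycle, and
    exactness supplies \<open>w\<close>.\<close>
  have I0: "I 0 = {\<zero>}" using genideal_minimal[OF zeroideal, of "{}"] idealD(2)[OF I_ideal[of 0]] by auto
  have "ideal_smult R (F i) (I 0) (carrier (F i)) \<subseteq> {\<zero>\<^bsub>F i\<^esub>}"
    by (rule Fi.ideal_smult_least[OF Fi.submodule_zero]) (use I0 in simp)
  hence "\<phi> (Suc i) z = \<zero>\<^bsub>F i\<^esub>" using 0 by blast
  then obtain w where w: "w \<in> carrier (F (Suc (Suc i)))" "z = \<phi> (Suc (Suc i)) w" using D(7)[of i] 0(3) by blast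
  have "submodule R (ideal_smult R (F (Suc i)) (I 0) (carrier (F (Suc i)))) (F (Suc i))"
    by (rule FS.ideal_smult_submodule) (use I0 in auto)
  moreover have "\<one> \<odot>\<^bsub>F (Suc i)\<^esub> z \<ominus>\<^bsub>F (Suc i)\<^esub> \<phi> (Suc (Suc i)) w = \<zero>\<^bsub>F (Suc i)\<^esub>"
    using w(2) 0(3) by (simp add: a_minus_def FS.M.r_neg)
  ultimately show ?case using FS.submoduleD(2) one_not_m w(1) by (intro bexI[of _ \<one>] conjI bexI[of _ w]) simp_all
next
  case (Suc t)
  note D = free_resolutionD[OF F]
  obtain k where k: "i = Suc k" "t \<le> k" using Suc.prems(2) by (cases i) auto
  have td: "t < d" using Suc.prems(1) by simp
  interpret Fk: module R "F k" by (rule D(1))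
  interpret Fi: module R "F i" by (rule D(1))
  interpret FS: module R "F (Suc i)" by (rule D(1))
  have It: "ideal (I t) R" "ideal (I (Suc t)) R" using I_ideal Suc.prems(1) td by auto
  have Ic: "I t \<subseteq> carrier R" "I (Suc t) \<subseteq> carrier R" using ideal_subset It by auto
  have Isub: "I t \<subseteq> I (Suc t)"
    by (rule genideal_minimal[OF It(2)]) (use I_mem[of _ "Suc t"] Suc.prems(1) in auto)
  let ?Qk = "ideal_smult R (F k) (I t) (carrier (F k))"
  let ?Qi = "ideal_smult R (F i) (I t) (carrier (F i))"
  let ?QS = "ideal_smult R (F (Suc i)) (I (Suc t)) (carrier (F (Suc i)))"
  have Qk: "submodule R ?Qk (F k)" by (rule Fk.ideal_smult_submodule[OF Ic(1) subset_refl])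
  have Qi: "submodule R ?Qi (F i)" by (rule Fi.ideal_smult_submodule[OF Ic(1) subset_refl])
  have QS: "submodule R ?QS (F (Suc i))" by (rule FS.ideal_smult_submodule[OF Ic(2) subset_refl])
  have xt: "x t \<in> carrier R" by (rule xc[OF td])
  have ins: "x ` {..<Suc t} = insert (x t) (x ` {..<t})" by (simp add: lessThan_Suc)
  note \<phi>S = mod_homD[OF D(4)[of i]]
  have D4k: "mod_hom R (F i) (F k) (\<phi> i)" using D(4)[of k] k(1) by simp
  note \<phi>i = mod_homD[OF D4k]
  have z: "z \<in> carrier (F (Suc i))" by (rule Suc.prems(3))
  have "x ` {..<t} \<subseteq> carrier R" using xc td by auto
  \<comment> \<open>Modulo \<open>I t\<close> the image of \<open>z\<close> is \<open>x t u\<close>.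
    Applying the differential once more shows that \<open>x t\<close> kills the image of
    \<open>u\<close> modulo \<open>I t\<close>.\<close>
  from Fi.ideal_smult_add_generator[OF this xt Suc.prems(4)[unfolded ins]]
  obtain u q where uq: "u \<in> carrier (F i)" "q \<in> ?Qi" "\<phi> (Suc i) z = x t \<odot>\<^bsub>F i\<^esub> u \<oplus>\<^bsub>F i\<^esub> q" by blast
  have qc: "q \<in> carrier (F i)" by (rule Fi.submoduleD(1)[OF Qi uq(2)])
  have "\<phi> i (\<phi> (Suc i) z) = \<zero>\<^bsub>F k\<^esub>" using D(7)[of k] z k(1) by blast
  hence "x t \<odot>\<^bsub>F k\<^esub> \<phi> i u \<oplus>\<^bsub>F k\<^esub> \<phi> i q = \<zero>\<^bsub>F k\<^esub>"
    unfolding uq(3) using \<phi>i(2,3) uq(1) qc xt by simp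
  hence "x t \<odot>\<^bsub>F k\<^esub> \<phi> i u = \<ominus>\<^bsub>F k\<^esub> \<phi> i q"
    using \<phi>i(1)[OF uq(1)] \<phi>i(1)[OF qc] xt by (intro Fk.M.minus_equality[symmetric]) auto
  moreover have "\<phi> i q \<in> ?Qk"
    by (rule ideal_smult_hom_mono[OF D4k Ic(1) uq(2)]) (use \<phi>i(1) in auto)
  ultimately have "x t \<odot>\<^bsub>F k\<^esub> \<phi> i u \<in> ?Qk" using Fk.submoduleD(4)[OF Qk] by simp
  moreover obtain B where "finite B" "module_basis R (F k) B" using D(2) by blast
  ultimately obtain s1 where s1: "s1 \<in> carrier R" "s1 \<notin> m" "s1 \<odot>\<^bsub>F k\<^esub> \<phi> i u \<in> ?Qk"
    using regular_free_module[OF D(1) _ _ td \<phi>i(1)[OF uq(1)]] by blast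
  have su: "s1 \<odot>\<^bsub>F i\<^esub> u \<in> carrier (F i)" using s1(1) uq(1) by simp
  have "\<phi> i (s1 \<odot>\<^bsub>F i\<^esub> u) \<in> ?Qk" using s1 \<phi>i(3) uq(1) by simp
  \<comment> \<open>By regularity of \<open>x t\<close>, the multiple \<open>s1 u\<close> is a cycle
    modulo \<open>I t\<close>, so by induction one degree lower a further multiple is a boundary
    modulo \<open>I t\<close>.\<close>
  then obtain s2 w' where s2: "s2 \<in> carrier R" "s2 \<notin> m" "w' \<in> carrier (F (Suc i))"
    "s2 \<odot>\<^bsub>F i\<^esub> (s1 \<odot>\<^bsub>F i\<^esub> u) \<ominus>\<^bsub>F i\<^esub> \<phi> (Suc i) w' \<in> ?Qi"
    using Suc.IH[of k "s1 \<odot>\<^bsub>F i\<^esub> u"] td k su by auto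
  let ?S = "s2 \<otimes> s1"
  note S = unit_mult[OF s2(1,2) s1(1,2)]
  \<comment> \<open>Subtracting \<open>x t w'\<close> removes the term with \<open>x t\<close>, so
    \<open>?y\<close> is a cycle modulo \<open>I t\<close>, while modulo \<open>I (Suc t)\<close> it
    is still a multiple of \<open>z\<close>.\<close>
  let ?y = "?S \<odot>\<^bsub>F (Suc i)\<^esub> z \<ominus>\<^bsub>F (Suc i)\<^esub> x t \<odot>\<^bsub>F (Suc i)\<^esub> w'"
  have yc: "?y \<in> carrier (F (Suc i))" using S(1) z xt s2(3) by simp
  have \<phi>w: "\<phi> (Suc i) w' \<in> carrier (F i)" by (rule \<phi>S(1)[OF s2(3)])
  have "\<phi> (Suc i) ?y = ?S \<odot>\<^bsub>F i\<^esub> \<phi> (Suc i) z \<ominus>\<^bsub>F i\<^esub> x t \<odot>\<^bsub>F i\<^esub> \<phi> (Suc i) w'"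
    using \<phi>S(3,5) S(1) z xt s2(3) by simp
  also have "\<dots> = x t \<odot>\<^bsub>F i\<^esub> (s2 \<odot>\<^bsub>F i\<^esub> (s1 \<odot>\<^bsub>F i\<^esub> u) \<ominus>\<^bsub>F i\<^esub> \<phi> (Suc i) w') \<oplus>\<^bsub>F i\<^esub> ?S \<odot>\<^bsub>F i\<^esub> q"
  proof -
    have "?S \<odot>\<^bsub>F i\<^esub> (x t \<odot>\<^bsub>F i\<^esub> u) = x t \<odot>\<^bsub>F i\<^esub> (s2 \<odot>\<^bsub>F i\<^esub> (s1 \<odot>\<^bsub>F i\<^esub> u))"
      using S(1) s1(1) s2(1) xt uq(1) by (simp flip: Fi.smult_assoc1 add: m_ac)
    thus ?thesis unfolding uq(3) a_minus_def using S(1) s1(1) s2(1) xt uq(1) qc \<phi>w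
      by (simp add: Fi.smult_r_distr Fi.smult_r_minus Fi.M.a_ac)
  qed
  also have "\<dots> \<in> ?Qi"
    by (rule Fi.submoduleD(3)[OF Qi Fi.submoduleD(6)[OF Qi xt s2(4)] Fi.submoduleD(6)[OF Qi S(1) uq(2)]])
  finally obtain s3 w where s3: "s3 \<in> carrier R" "s3 \<notin> m" "w \<in> carrier (F (Suc (Suc i)))"
    "s3 \<odot>\<^bsub>F (Suc i)\<^esub> ?y \<ominus>\<^bsub>F (Suc i)\<^esub> \<phi> (Suc (Suc i)) w \<in> ideal_smult R (F (Suc i)) (I t) (carrier (F (Suc i)))"
    using Suc.IH[OF _ _ yc] td k by auto
  have \<phi>w2: "\<phi> (Suc (Suc i)) w \<in> carrier (F (Suc i))" by (rule mod_homD(1)[OF D(4) s3(3)])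
  have 1: "s3 \<odot>\<^bsub>F (Suc i)\<^esub> ?y \<ominus>\<^bsub>F (Suc i)\<^esub> \<phi> (Suc (Suc i)) w \<in> ?QS"
    using FS.ideal_smult_mono[OF Isub Ic(2) subset_refl subset_refl] s3(4) by blast
  have "s3 \<otimes> x t \<in> I (Suc t)" using idealD(6)[OF It(2) s3(1) I_mem] Suc.prems(1) by simp
  hence 2: "(s3 \<otimes> x t) \<odot>\<^bsub>F (Suc i)\<^esub> w' \<in> ?QS" by (rule FS.ideal_smultI[OF Ic(2) subset_refl _ s2(3)])
  have "(s3 \<otimes> ?S) \<odot>\<^bsub>F (Suc i)\<^esub> z \<ominus>\<^bsub>F (Suc i)\<^esub> \<phi> (Suc (Suc i)) w
    = (s3 \<odot>\<^bsub>F (Suc i)\<^esub> ?y \<ominus>\<^bsub>F (Suc i)\<^esub> \<phi> (Suc (Suc i)) w) \<oplus>\<^bsub>F (Suc i)\<^esub> (s3 \<otimes> x t) \<odot>\<^bsub>F (Suc i)\<^esub> w'"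
  proof -
    have e: "s3 \<odot>\<^bsub>F (Suc i)\<^esub> ?y = (s3 \<otimes> ?S) \<odot>\<^bsub>F (Suc i)\<^esub> z \<oplus>\<^bsub>F (Suc i)\<^esub> \<ominus>\<^bsub>F (Suc i)\<^esub> ((s3 \<otimes> x t) \<odot>\<^bsub>F (Suc i)\<^esub> w')"
      unfolding a_minus_def using s3(1) S(1) z xt s2(3)
      by (simp add: FS.smult_r_distr FS.smult_r_minus FS.smult_assoc1)
    have cancel: "a \<oplus>\<^bsub>F (Suc i)\<^esub> \<ominus>\<^bsub>F (Suc i)\<^esub> c = a \<oplus>\<^bsub>F (Suc i)\<^esub> \<ominus>\<^bsub>F (Suc i)\<^esub> b \<oplus>\<^bsub>F (Suc i)\<^esub> \<ominus>\<^bsub>F (Suc i)\<^esub> c \<oplus>\<^bsub>F (Suc i)\<^esub> b"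
      if "a \<in> carrier (F (Suc i))" "b \<in> carrier (F (Suc i))" "c \<in> carrier (F (Suc i))" for a b c
    proof -
      have "a \<oplus>\<^bsub>F (Suc i)\<^esub> \<ominus>\<^bsub>F (Suc i)\<^esub> b \<oplus>\<^bsub>F (Suc i)\<^esub> \<ominus>\<^bsub>F (Suc i)\<^esub> c \<oplus>\<^bsub>F (Suc i)\<^esub> b
        = a \<oplus>\<^bsub>F (Suc i)\<^esub> \<ominus>\<^bsub>F (Suc i)\<^esub> c \<oplus>\<^bsub>F (Suc i)\<^esub> (\<ominus>\<^bsub>F (Suc i)\<^esub> b \<oplus>\<^bsub>F (Suc i)\<^esub> b)"
        using that by (simp add: FS.M.a_ac del: FS.M.l_neg)
      thus ?thesis using that by (simp add: FS.M.l_neg)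
    qed
    show ?thesis unfolding e unfolding a_minus_def
      by (rule cancel[OF _ _ \<phi>w2]) (use s3(1) S(1) z xt s2(3) in simp_all)
  qed
  hence "(s3 \<otimes> ?S) \<odot>\<^bsub>F (Suc i)\<^esub> z \<ominus>\<^bsub>F (Suc i)\<^esub> \<phi> (Suc (Suc i)) w \<in> ?QS"
    using FS.submoduleD(3)[OF QS 1 2] by simp
  thus ?case using unit_mult[OF s3(1,2) S] s3(3) by blast
qed

text \<open>For a basis element \<open>b\<close> of \<open>F j\<close>, minimality and a multiplier
  \<open>s\<close> put \<open>\<phi> (s b)\<close> into \<open>I d\<close> times the previous
  module. By \<open>tor_vanishing\<close> a multiple of \<open>b\<close> is then a boundary modulo
  \<open>I d\<close>. Boundaries lie in \<open>m F j\<close>, again by minimality, so a multiple of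
  \<open>b\<close> by an element outside \<open>m\<close> lies in \<open>m F j\<close>, which
  contradicts its coordinate at \<open>b\<close>.\<close>

theorem minimal_resolution_length:
  assumes F: "minimal_free_resolution R m M F \<phi> \<epsilon>" and j: "d < j"
  shows "carrier (F j) = {\<zero>\<^bsub>F j\<^esub>}"
proof -
  obtain i where i: "j = Suc i" "d \<le> i" using j by (cases j) auto
  have res: "free_resolution R M F \<phi> \<epsilon>" using F by (simp add: minimal_free_resolution_def)
  have min: "\<phi> (Suc k) ` carrier (F (Suc k)) \<subseteq> ideal_smult R (F k) m (carrier (F k))" for k
  proof -
    have "\<forall>j\<ge>1. \<phi> j ` carrier (F j) \<subseteq> ideal_smult R (F (j - 1)) m (carrier (F (j - 1)))"
      using F by (simp add: minimal_free_resolution_def)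
    from this[rule_format, of "Suc k"] show ?thesis by simp
  qed
  note D = free_resolutionD[OF res]
  interpret Fi: module R "F i" by (rule D(1))
  interpret FS: module R "F (Suc i)" by (rule D(1))
  obtain B where B: "finite B" "module_basis R (F (Suc i)) B" using D(2) by blast
  have Bc: "B \<subseteq> carrier (F (Suc i))" using B(2) by (simp add: module_basis_def)
  have mc: "m \<subseteq> carrier R" by (rule ideal_subset[OF m_ideal])
  have Id: "ideal (I d) R" by (rule I_ideal) simp
  have Idm: "I d \<subseteq> m" by (rule genideal_minimal[OF m_ideal]) (use x_m in auto)
  have "B = {}"
  proof (rule ccontr)
    assume "B \<noteq> {}"
    then obtain b where b: "b \<in> B" by blast
    have bc: "b \<in> carrier (F (Suc i))" using Bc b by blast
    obtain A where A: "A \<subseteq> carrier R" "finite A" "m = Idl A" using finetely_gen[OF m_ideal] by blast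
    \<comment> \<open>One multiplier for all of \<open>m\<close>, by finite generation.\<close>
    have "\<exists>s\<in>carrier R. s \<notin> m \<and> (\<forall>a\<in>A. s \<otimes> a \<in> I d)"
      by (rule common_denominator[OF Id A(2)]) (use A generate genideal_self[OF A(1)] in auto)
    then obtain s where s: "s \<in> carrier R" "s \<notin> m" "\<And>a. a \<in> A \<Longrightarrow> s \<otimes> a \<in> I d" by blast
    have sm: "s \<otimes> a \<in> I d" if "a \<in> m" for a
      by (rule genideal_colon[OF Id s(1) A(1) s(3)]) (use that A(3) in auto)
    let ?Q = "ideal_smult R (F i) (I d) (carrier (F i))"
    have Q: "submodule R ?Q (F i)" by (rule Fi.ideal_smult_submodule[OF ideal_subset[OF Id] subset_refl])
    have "ideal_smult R (F i) m (carrier (F i)) \<subseteq> {y \<in> carrier (F i). s \<odot>\<^bsub>F i\<^esub> y \<in> ?Q}"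
    proof (rule Fi.ideal_smult_least[OF Fi.submodule_preimage_smult[OF Q s(1)]])
      fix a y assume a: "a \<in> m" and y: "y \<in> carrier (F i)"
      have "(s \<otimes> a) \<odot>\<^bsub>F i\<^esub> y \<in> ?Q" by (rule Fi.ideal_smultI[OF ideal_subset[OF Id] subset_refl sm[OF a] y])
      moreover have "a \<in> carrier R" using a mc by blast
      ultimately show "a \<odot>\<^bsub>F i\<^esub> y \<in> {y \<in> carrier (F i). s \<odot>\<^bsub>F i\<^esub> y \<in> ?Q}"
        using y s(1) by (simp add: Fi.smult_assoc1)
    qed
    hence "s \<odot>\<^bsub>F i\<^esub> \<phi> (Suc i) b \<in> ?Q" using min[of i] bc by blast
    hence "\<phi> (Suc i) (s \<odot>\<^bsub>F (Suc i)\<^esub> b) \<in> ?Q" using mod_homD(3)[OF D(4) s(1) bc] by simp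
    then obtain s' w where w: "s' \<in> carrier R" "s' \<notin> m" "w \<in> carrier (F (Suc (Suc i)))"
      "s' \<odot>\<^bsub>F (Suc i)\<^esub> (s \<odot>\<^bsub>F (Suc i)\<^esub> b) \<ominus>\<^bsub>F (Suc i)\<^esub> \<phi> (Suc (Suc i)) w
        \<in> ideal_smult R (F (Suc i)) (I d) (carrier (F (Suc i)))"
      using tor_vanishing[OF res order_refl i(2)] s(1) bc by blast
    let ?mF = "ideal_smult R (F (Suc i)) m (carrier (F (Suc i)))"
    have mF: "submodule R ?mF (F (Suc i))" by (rule FS.ideal_smult_submodule[OF mc subset_refl])
    have \<phi>w: "\<phi> (Suc (Suc i)) w \<in> ?mF" using min[of "Suc i"] w(3) by blast
    let ?b = "s' \<odot>\<^bsub>F (Suc i)\<^esub> (s \<odot>\<^bsub>F (Suc i)\<^esub> b)"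
    have "?b \<ominus>\<^bsub>F (Suc i)\<^esub> \<phi> (Suc (Suc i)) w \<in> ?mF"
      using FS.ideal_smult_mono[OF Idm mc subset_refl subset_refl] w(4) by blast
    hence "(?b \<ominus>\<^bsub>F (Suc i)\<^esub> \<phi> (Suc (Suc i)) w) \<oplus>\<^bsub>F (Suc i)\<^esub> \<phi> (Suc (Suc i)) w \<in> ?mF"
      by (rule FS.submoduleD(3)[OF mF _ \<phi>w])
    moreover have "(?b \<ominus>\<^bsub>F (Suc i)\<^esub> \<phi> (Suc (Suc i)) w) \<oplus>\<^bsub>F (Suc i)\<^esub> \<phi> (Suc (Suc i)) w = ?b"
      using FS.submoduleD(1)[OF mF \<phi>w] w(1) s(1) bc by (simp add: a_minus_def FS.M.a_assoc FS.M.l_neg)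
    ultimately have bm: "(s' \<otimes> s) \<odot>\<^bsub>F (Suc i)\<^esub> b \<in> ?mF" using w(1) s(1) bc by (simp add: FS.smult_assoc1)
    obtain \<pi> where \<pi>: "\<And>b. b \<in> B \<Longrightarrow> mod_hom R (F (Suc i)) FS.Rmod (\<pi> b)"
      "\<And>x. x \<in> carrier (F (Suc i)) \<Longrightarrow> FS.lincomb (\<lambda>b. \<pi> b x) B = x"
      "\<And>b b'. b \<in> B \<Longrightarrow> b' \<in> B \<Longrightarrow> \<pi> b b' = (if b = b' then \<one> else \<zero>)"
      using FS.basis_coordinates[OF B] by metis
    have S: "s' \<otimes> s \<in> carrier R" "s' \<otimes> s \<notin> m" by (rule unit_mult[OF w(1,2) s(1,2)])+
    have "\<pi> b ((s' \<otimes> s) \<odot>\<^bsub>F (Suc i)\<^esub> b) \<in> m"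
      using FS.ideal_smult_coordinates[OF \<pi>(1,2) Bc m_ideal] bm b S(1) bc by simp
    moreover have "\<pi> b ((s' \<otimes> s) \<odot>\<^bsub>F (Suc i)\<^esub> b) = s' \<otimes> s"
      using mod_homD(3)[OF \<pi>(1)[OF b] S(1) bc] \<pi>(3)[OF b b] S(1) by simp
    ultimately show False using S(2) by simp
  qed
  hence "FS.span {} = carrier (F (Suc i))" using B(2) by (simp add: module_basis_def)
  thus ?thesis unfolding i(1) by (simp add: FS.span_def FS.lincomb_def)
qed

theorem syzygy_artin_rees_number_zero:
  assumes F: "minimal_free_resolution R m M F \<phi> \<epsilon>" and j: "d < j"
  shows "syzygy_artin_rees_number R m F \<phi> j = 0"
proof -
  obtain i where i: "j = Suc i" using j by (cases j) auto
  have res: "free_resolution R M F \<phi> \<epsilon>" using F by (simp add: minimal_free_resolution_def)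
  note D = free_resolutionD[OF res]
  interpret Fi: module R "F i" by (rule D(1))
  have N: "\<phi> (Suc i) ` carrier (F (Suc i)) = {\<zero>\<^bsub>F i\<^esub>}"
    using minimal_resolution_length[OF F j] mod_homD(4)[OF D(4)] i by simp
  have mc: "m \<subseteq> carrier R" by (rule ideal_subset[OF m_ideal])
  have "{\<zero>\<^bsub>F i\<^esub>} \<inter> Y \<subseteq> carrier (F i)" for Y by auto
  from Fi.submoduleD(2)[OF Fi.ideal_smult_submodule[OF mc this]]
  have "defects R m {\<zero>\<^bsub>F i\<^esub>} (F i) = {}" unfolding defects_def by auto
  hence "artin_rees_number R m {\<zero>\<^bsub>F i\<^esub>} (F i) = (LEAST r::nat. True)"
    using Fi.artin_rees_number_defects[OF m_ideal Fi.submodule_zero] by simp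
  thus ?thesis unfolding syzygy_artin_rees_number_def i using N by (simp add: Least_eq_0)
qed

end

section \<open>Standard graded algebras\<close>

context cring
begin

text \<open>A chain of ideals without a largest member yields a strictly increasing sequence by
  choice.\<close>

lemma noetherian_ring_from_acc:
  assumes acc: "\<And>J :: nat \<Rightarrow> 'a set. (\<And>p. ideal (J p) R) \<Longrightarrow> (\<And>p. J p \<subseteq> J (Suc p)) \<Longrightarrow> \<exists>p. J (Suc p) = J p"
  shows "noetherian_ring R"
proof (rule trivial_ideal_chain_imp_noetherian, rule ccontr)
  fix C assume C: "C \<noteq> {}" "subset.chain {I. ideal I R} C" "\<Union>C \<notin> C"
  have id: "ideal I R" if "I \<in> C" for I using C(2) that unfolding subset_chain_def by (elim conjE) (drule (1) subsetD, simp)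
  have lin: "I \<subseteq> I' \<or> I' \<subseteq> I" if "I \<in> C" "I' \<in> C" for I I'
    using C(2) that(1,2) unfolding subset_chain_def by (elim conjE) (drule (1) bspec, drule (1) bspec)
  have step: "\<exists>I'. I' \<in> C \<and> I \<subset> I'" if I: "I \<in> C" for I
  proof -
    have ne: "I \<noteq> \<Union>C" using C(3) I by (rule_tac notI) simp
    have "I \<subseteq> \<Union>C" by (rule Union_upper[OF I])
    hence "\<not> \<Union>C \<subseteq> I" using ne subset_antisym by (rule_tac notI) (drule (1) subset_antisym, simp)
    then obtain I' where I': "I' \<in> C" "\<not> I' \<subseteq> I" by (meson Union_least)
    hence "I \<subset> I'" using lin[OF I I'(1)] by (auto simp: psubset_eq)
    thus ?thesis using I'(1) by (intro exI conjI)
  qed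
  obtain I0 where I0: "I0 \<in> C" using C(1) by blast
  define nx where "nx I = (SOME I'. I' \<in> C \<and> I \<subset> I')" for I
  have nx: "nx I \<in> C \<and> I \<subset> nx I" if "I \<in> C" for I
    unfolding nx_def by (rule someI_ex[OF step[OF that]])
  define f where "f p = (nx ^^ p) I0" for p
  have f: "f p \<in> C" for p by (induction p) (simp_all add: f_def I0 nx)
  have f2: "f p \<subset> f (Suc p)" for p using nx[OF f[of p]] by (simp add: f_def)
  have "\<exists>p. f (Suc p) = f p"
  proof (rule acc)
    show "ideal (f p) R" for p by (rule id[OF f])
    show "f p \<subseteq> f (Suc p)" for p using f2[of p] by (rule psubset_imp_subset)
  qed
  then obtain p where "f (Suc p) = f p" ..
  thus False using f2[of p] by simp
qed

end

context noetherian_cring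
begin

lemma exists_maximal_ideal:
  assumes J: "ideal J R" "\<one> \<notin> J"
  obtains n where "maximalideal n R" "J \<subseteq> n"
proof -
  let ?A = "{I. ideal I R \<and> J \<subseteq> I \<and> \<one> \<notin> I}"
  have "\<exists>M\<in>?A. \<forall>X\<in>?A. M \<subseteq> X \<longrightarrow> X = M"
  proof (rule subset_Zorn_nonempty)
    show "?A \<noteq> {}" using J by blast
    fix C assume C: "C \<noteq> {}" "subset.chain ?A C"
    have sub: "C \<subseteq> ?A" using C(2) unfolding subset_chain_def by (rule conjunct1)
    have "subset.chain {I. ideal I R} C"
      unfolding subset_chain_def
    proof
      show "C \<subseteq> {I. ideal I R}" using sub by (rule subset_trans) (rule subsetI, simp)
      show "\<forall>X\<in>C. \<forall>Y\<in>C. X \<subseteq> Y \<or> Y \<subseteq> X" using C(2) unfolding subset_chain_def by (rule conjunct2)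
    qed
    hence "\<Union>C \<in> C" by (rule ideal_chain_is_trivial[OF C(1)])
    thus "\<Union>C \<in> ?A" by (rule subsetD[OF sub])
  qed
  then obtain M where M: "ideal M R" "J \<subseteq> M" "\<one> \<notin> M"
    "\<And>X. ideal X R \<Longrightarrow> J \<subseteq> X \<Longrightarrow> \<one> \<notin> X \<Longrightarrow> M \<subseteq> X \<Longrightarrow> X = M"
    by (elim bexE CollectE conjE) simp
  have "maximalideal M R"
  proof (rule maximalidealI[OF M(1)])
    show "carrier R \<noteq> M" using M(3) by auto
    fix X assume X: "ideal X R" "M \<subseteq> X" "X \<subseteq> carrier R"
    show "X = M \<or> X = carrier R"
    proof (cases "\<one> \<in> X")
      case True
      thus ?thesis using ideal.one_imp_carrier[OF X(1)] by simp
    next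
      case False
      thus ?thesis using M(4)[OF X(1) subset_trans[OF M(2) X(2)] False X(2)] by simp
    qed
  qed
  thus ?thesis by (rule that[OF _ M(2)])
qed

end

section \<open>The graded maximal ideal and noetherianity\<close>

context standard_graded_algebra
begin

lemma A_carrier: "A i \<subseteq> carrier R"
  using decomposition additive_subgroup.a_subset unfolding direct_sum_decomposition_def by blast

lemma A_subgroup: "additive_subgroup (A i) R"
  using decomposition unfolding direct_sum_decomposition_def by blast

lemma K_props: "K \<subseteq> carrier R" "\<one> \<in> K" "\<zero> \<in> K" "\<one> \<noteq> \<zero>"
  "a \<in> K \<Longrightarrow> b \<in> K \<Longrightarrow> a \<oplus> b \<in> K" "a \<in> K \<Longrightarrow> b \<in> K \<Longrightarrow> a \<otimes> b \<in> K" "a \<in> K \<Longrightarrow> \<ominus> a \<in> K"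
proof -
  note S = subringE[OF subfieldE(1)[OF ground_field]]
  show "K \<subseteq> carrier R" "\<one> \<in> K" "\<zero> \<in> K" using S(1,2,3) by auto
  show "\<one> \<noteq> \<zero>" by (rule subfieldE(6)[OF ground_field])
  show "a \<in> K \<Longrightarrow> b \<in> K \<Longrightarrow> a \<oplus> b \<in> K" "a \<in> K \<Longrightarrow> b \<in> K \<Longrightarrow> a \<otimes> b \<in> K" "a \<in> K \<Longrightarrow> \<ominus> a \<in> K"
    using S(5-7) by auto
qed



abbreviation \<mm> :: "'a set" where "\<mm> \<equiv> graded_maximal_ideal R A"

lemma mm_component: "a \<in> A i \<Longrightarrow> i \<ge> 1 \<Longrightarrow> a \<in> \<mm>"
proof -
  assume a: "a \<in> A i" "i \<ge> 1"
  have "a = finsum R (\<lambda>_. a) {i}" using a A_carrier by (simp add: subset_iff)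
  thus ?thesis unfolding graded_maximal_ideal_def using a by (intro CollectI exI[of _ "\<lambda>_. a"] exI[of _ "{i}"]) auto
qed

lemma mm_finsum_carrier: "f \<in> D \<rightarrow> carrier R" if "\<forall>i\<in>D. f i \<in> A i"
  using that A_carrier by blast

lemma mm_carrier: "\<mm> \<subseteq> carrier R"
proof
  fix x assume "x \<in> \<mm>"
  then obtain f D where f: "x = finsum R f D" "\<forall>i\<in>D. f i \<in> A i" unfolding graded_maximal_ideal_def by blast
  show "x \<in> carrier R" unfolding f(1) by (rule finsum_closed[OF mm_finsum_carrier[OF f(2)]])
qed

lemma mm_zero: "\<zero> \<in> \<mm>"
  unfolding graded_maximal_ideal_def by (intro CollectI exI[of _ "\<lambda>_. \<zero>"] exI[of _ "{}"]) simp

lemma mm_add: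
  assumes "x \<in> \<mm>" "y \<in> \<mm>"
  shows "x \<oplus> y \<in> \<mm>"
proof -
  obtain f D where x: "x = finsum R f D" "finite D" "D \<subseteq> {1..}" "\<forall>i\<in>D. f i \<in> A i"
    using assms(1) unfolding graded_maximal_ideal_def by blast
  obtain g E where y: "y = finsum R g E" "finite E" "E \<subseteq> {1..}" "\<forall>i\<in>E. g i \<in> A i"
    using assms(2) unfolding graded_maximal_ideal_def by blast
  define f' where "f' i = (if i \<in> D then f i else \<zero>)" for i
  define g' where "g' i = (if i \<in> E then g i else \<zero>)" for i
  have z: "\<zero> \<in> A i" for i by (rule additive_subgroup.zero_closed[OF A_subgroup])
  have f': "f' i \<in> A i" and g': "g' i \<in> A i" for i using x(4) y(4) z by (auto simp: f'_def g'_def)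
  have c: "f' \<in> B \<rightarrow> carrier R" "g' \<in> B \<rightarrow> carrier R" for B using f' g' A_carrier by blast+
  have "x = finsum R f' (D \<union> E)"
    unfolding x(1) using x(2) y(2) mm_finsum_carrier[OF x(4)]
    by (intro add.finprod_mono_neutral_cong_left) (auto simp: f'_def)
  moreover have "y = finsum R g' (D \<union> E)"
    unfolding y(1) using x(2) y(2) mm_finsum_carrier[OF y(4)]
    by (intro add.finprod_mono_neutral_cong_left) (auto simp: g'_def)
  ultimately have "x \<oplus> y = finsum R (\<lambda>i. f' i \<oplus> g' i) (D \<union> E)" using c by (simp add: finsum_addf)
  moreover have "f' i \<oplus> g' i \<in> A i" for i
    by (rule additive_subgroup.a_closed[OF A_subgroup f' g'])
  ultimately show ?thesis unfolding graded_maximal_ideal_def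
    using x(2,3) y(2,3) by (intro CollectI exI[of _ "\<lambda>i. f' i \<oplus> g' i"] exI[of _ "D \<union> E"]) auto
qed

lemma mm_finsum: "finite E \<Longrightarrow> (\<And>i. i \<in> E \<Longrightarrow> f i \<in> \<mm>) \<Longrightarrow> finsum R f E \<in> \<mm>"
proof (induction E rule: finite_induct)
  case (insert i E)
  have "finsum R f (insert i E) = f i \<oplus> finsum R f E"
    using insert.hyps insert.prems mm_carrier by (intro finsum_insert) auto
  thus ?case using insert mm_add by simp
qed (simp add: mm_zero)

lemma homogeneous_decomposition:
  assumes "x \<in> carrier R"
  obtains f D where "finite D" "\<And>i. f i \<in> A i" "x = finsum R f D"
  using assms decomposition unfolding direct_sum_decomposition_def by metis

lemma mm_mult:
  assumes r: "r \<in> carrier R" and x: "x \<in> \<mm>"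
  shows "r \<otimes> x \<in> \<mm>"
proof -
  obtain f D where f: "x = finsum R f D" "finite D" "D \<subseteq> {1..}" "\<forall>i\<in>D. f i \<in> A i"
    using x unfolding graded_maximal_ideal_def by blast
  obtain g E where g: "finite E" "\<And>i. g i \<in> A i" "r = finsum R g E" using homogeneous_decomposition[OF r] by metis
  have gc: "g \<in> E \<rightarrow> carrier R" using g(2) A_carrier by blast
  have xc: "x \<in> carrier R" using x mm_carrier by blast
  have "g j \<otimes> x \<in> \<mm>" if j: "j \<in> E" for j
  proof -
    have "g j \<otimes> x = finsum R (\<lambda>i. g j \<otimes> f i) D"
      unfolding f(1) by (rule finsum_rdistr[OF f(2) _ mm_finsum_carrier[OF f(4)]]) (use gc j in auto)
    also have "\<dots> \<in> \<mm>"
    proof (rule mm_finsum[OF f(2)])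
      fix i assume i: "i \<in> D"
      have "g j \<otimes> f i \<in> A (j + i)" using mult_graded[OF g(2)] f(4) i by blast
      thus "g j \<otimes> f i \<in> \<mm>" by (rule mm_component) (use f(3) i in auto)
    qed
    finally show ?thesis .
  qed
  moreover have "r \<otimes> x = finsum R (\<lambda>j. g j \<otimes> x) E"
    unfolding g(3) by (rule finsum_ldistr[OF g(1) xc gc])
  ultimately show ?thesis using mm_finsum[OF g(1)] by simp
qed

lemma mm_ideal: "ideal \<mm> R"
  by (rule idealI'[OF mm_carrier mm_zero mm_add mm_mult])

text \<open>By uniqueness of homogeneous components, the component of \<open>\<one>\<close> in
  degree \<open>0\<close> would be both \<open>\<zero>\<close> and \<open>\<one>\<close>.\<close>

lemma one_not_mm: "\<one> \<notin> \<mm>"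
proof
  assume "\<one> \<in> \<mm>"
  then obtain f D where f: "\<one> = finsum R f D" "finite D" "D \<subseteq> {1..}" "\<forall>i\<in>D. f i \<in> A i"
    unfolding graded_maximal_ideal_def by blast
  define g where "g i = (if i \<in> D then f i else \<zero>)" for i
  define h where "h i = (if i = (0::nat) then \<one> else \<zero>)" for i
  let ?dec = "\<lambda>f. (\<forall>i. f i \<in> A i) \<and> finite {i. f i \<noteq> \<zero>} \<and> \<one> = finsum R f {i. f i \<noteq> \<zero>}"
  have z: "\<zero> \<in> A i" for i by (rule additive_subgroup.zero_closed[OF A_subgroup])
  have "finsum R f D = finsum R g {i. g i \<noteq> \<zero>}"
    using f(2) mm_finsum_carrier[OF f(4)]
    by (intro add.finprod_mono_neutral_cong_right) (auto simp: g_def split: if_splits)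
  moreover have "finite {i. g i \<noteq> \<zero>}" by (rule finite_subset[OF _ f(2)]) (auto simp: g_def)
  ultimately have dg: "?dec g" using f(1,4) z by (auto simp: g_def)
  have "{i. h i \<noteq> \<zero>} = {0}" using K_props(4) by (auto simp: h_def)
  hence dh: "?dec h" using K_props(2) degree_zero z by (auto simp: h_def)
  have "\<exists>!f. ?dec f" using decomposition unfolding direct_sum_decomposition_def by auto
  hence "g = h" using dg dh by blast
  hence "g 0 = h 0" by simp
  moreover have "0 \<notin> D" using f(3) by auto
  ultimately show False using K_props(4) by (simp add: g_def h_def)
qed

text \<open>An element outside \<open>\<mm>\<close> has a non-zero component in degree
  \<open>0\<close>, an invertible element of the field \<open>K\<close>; the other components lie in
  \<open>\<mm>\<close>.\<close>

lemma mm_maximal: "maximalideal \<mm> R"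
proof (rule maximalidealI[OF mm_ideal])
  show "carrier R \<noteq> \<mm>" using one_not_mm by auto
  fix J assume J: "ideal J R" "\<mm> \<subseteq> J" "J \<subseteq> carrier R"
  show "J = \<mm> \<or> J = carrier R"
  proof (rule ccontr)
    assume a: "\<not> ?thesis"
    then obtain u where u: "u \<in> J" "u \<notin> \<mm>" using J(2) by blast
    have uc: "u \<in> carrier R" using u(1) J(3) by blast
    obtain g E where g: "finite E" "\<And>i. g i \<in> A i" "u = finsum R g E" using homogeneous_decomposition[OF uc] by metis
    have gc: "g \<in> B \<rightarrow> carrier R" for B using g(2) A_carrier by blast
    have y: "finsum R g (E - {0}) \<in> \<mm>" (is "?y \<in> _")
    proof (rule mm_finsum)
      show "finite (E - {0})" using g(1) by simp
      fix i assume "i \<in> E - {0}"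
      hence "1 \<le> i" by simp
      thus "g i \<in> \<mm>" by (rule mm_component[OF g(2)])
    qed
    have 0: "0 \<in> E"
    proof (rule ccontr)
      assume "0 \<notin> E"
      hence "E - {0} = E" by simp
      thus False using y u(2) g(3) by simp
    qed
    have "u = finsum R g (insert 0 (E - {0}))" using 0 g(3) by (simp add: insert_absorb)
    also have "\<dots> = g 0 \<oplus> ?y" by (rule finsum_insert) (use g(1) gc gc[of "{0}"] in auto)
    finally have ue: "u = g 0 \<oplus> ?y" .
    have yc: "?y \<in> carrier R" using y mm_carrier by blast
    have k: "g 0 \<in> K" using g(2)[of 0] degree_zero by simp
    have kc: "g 0 \<in> carrier R" using k K_props(1) by blast
    have "g 0 \<noteq> \<zero>" using ue u(2) y yc by auto
    hence kK: "g 0 \<in> K - {\<zero>}" using k by simp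
    note i = subfield_m_inv[OF ground_field kK]
    have ic: "inv (g 0) \<in> carrier R" using i(1) K_props(1) by blast
    have "g 0 = u \<ominus> ?y" unfolding ue using kc yc by (simp add: a_minus_def a_assoc r_neg)
    hence "g 0 \<in> J" using idealD(5)[OF J(1) u(1)] y J(2) by auto
    hence "inv (g 0) \<otimes> g 0 \<in> J" by (rule idealD(6)[OF J(1) ic])
    hence "\<one> \<in> J" using i(3) by simp
    thus False using ideal.one_imp_carrier[OF J(1)] a by blast
  qed
qed

text \<open>The basis theorem again, with the field \<open>K\<close> as base and multiplication by
  the finitely many elements of \<open>X\<close> as operations. All operations get degree
  \<open>0\<close>, and ideals are placed in component \<open>0\<close>, so that arbitrary ideals
  become subfamilies of \<open>M'\<close>.\<close>

lemma noetherian: "noetherian_ring R"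
proof -
  obtain X where X: "finite X" "X \<subseteq> A 1" "generate_ring R (K \<union> X) = carrier R"
    using generated_in_degree_one by blast
  have Xc: "X \<subseteq> carrier R" using X(2) A_carrier by blast
  define \<Omega> where "\<Omega> = (\<lambda>c. (0::nat, (\<otimes>) c)) ` K"
  define Os where "Os = (\<lambda>c. (0::nat, (\<otimes>) c)) ` X"
  define M where "M g = (if g = 0 then K else {\<zero>})" for g :: nat
  have Kadd: "add_sub K" using K_props by (intro add_subI) auto
  have op: "\<exists>c\<in>carrier R. \<delta> = 0 \<and> f = (\<otimes>) c" if "(\<delta>, f) \<in> Os \<union> \<Omega>" for \<delta> f
    using that Xc K_props(1) unfolding Os_def \<Omega>_def by blast
  have endo: "endo f" if "(\<delta>, f) \<in> Os \<union> \<Omega>" for \<delta> f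
    using op[OF that] by (auto simp: endo_def r_distr)
  have fM: "family \<Omega> M"
    unfolding family_def
  proof (intro conjI allI impI)
    show "add_sub (M g)" for g using Kadd by (simp add: M_def add_sub_def a_minus_def)
    fix \<delta> f g y assume f: "(\<delta>, f) \<in> \<Omega>" and y: "y \<in> M g"
    then obtain c where c: "c \<in> K" "\<delta> = 0" "f = (\<otimes>) c" unfolding \<Omega>_def by blast
    show "f y \<in> M (g + \<delta>)" using y K_props(1,6) c by (auto simp: M_def split: if_splits)
  qed
  have nM: "noeth \<Omega> M"
    unfolding noeth_def
  proof (intro allI impI)
    fix N assume N: "\<forall>p. family \<Omega> (N p) \<and> N p \<le> M \<and> N p \<le> N (Suc p)"
    have sub: "N p g \<subseteq> M g" "add_sub (N p g)" for p g using N by (auto simp: le_fun_def family_def)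
    have mono: "N p \<le> N q" if "p \<le> q" for p q using chain_mono[of N] N that by blast
    have pos: "N p g = {\<zero>}" if "g \<noteq> 0" for p g
      using sub(1)[of p g] add_subD(2)[OF sub(2)[of p g]] that by (auto simp: M_def)
    \<comment> \<open>A field has no proper non-zero subspace: \<open>y\<close> is multiplied by
      \<open>k \<otimes> inv y\<close> to reach \<open>k\<close>.\<close>
    have zero: "N p 0 = {\<zero>} \<or> N p 0 = K" for p
    proof (cases "N p 0 = {\<zero>}")
      case False
      then obtain y where y: "y \<in> N p 0" "y \<noteq> \<zero>" using add_subD(2)[OF sub(2)[of p 0]] by auto
      hence yK: "y \<in> K - {\<zero>}" using sub(1)[of p 0] by (auto simp: M_def)
      note i = subfield_m_inv[OF ground_field yK]
      have "k \<in> N p 0" if k: "k \<in> K" for k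
      proof -
        have "(0, (\<otimes>) (k \<otimes> inv y)) \<in> \<Omega>" unfolding \<Omega>_def using K_props(6)[OF k] i(1) by blast
        moreover have "family \<Omega> (N p)" using N by blast
        ultimately have "(k \<otimes> inv y) \<otimes> y \<in> N p (0 + 0)" using familyD(2) y(1) by blast
        moreover have "(k \<otimes> inv y) \<otimes> y = k"
        proof -
          have c: "k \<in> carrier R" "inv y \<in> carrier R" "y \<in> carrier R" using k i(1) yK K_props(1) by auto
          show ?thesis using m_assoc[OF c] i(3) c(1) by simp
        qed
        ultimately show ?thesis by simp
      qed
      thus ?thesis using sub(1)[of p 0] by (auto simp: M_def)
    qed simp
    show "\<exists>p0. \<forall>p\<ge>p0. N p = N p0"
    proof (cases "\<exists>p0. N p0 0 = K")
      case True
      then obtain p0 where p0: "N p0 0 = K" by blast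
      have "N p = N p0" if "p \<ge> p0" for p
      proof
        fix g show "N p g = N p0 g"
          using pos[of g p] pos[of g p0] p0 mono[OF that] sub(1)[of p 0] by (cases "g = 0") (auto simp: le_fun_def M_def)
      qed
      thus ?thesis by blast
    next
      case False
      hence z: "N p 0 = {\<zero>}" for p using zero[of p] by blast
      have "N p = N 0" for p
      proof
        fix g show "N p g = N 0 g" using pos[of g p] pos[of g 0] z[of p] z[of 0] by (cases "g = 0") simp_all
      qed
      hence "\<forall>p\<ge>0. N p = N 0" by simp
      thus ?thesis by (rule exI)
    qed
  qed
  have "\<exists>M'. family (Os \<union> \<Omega>) M' \<and> M \<le> M' \<and> noeth (Os \<union> \<Omega>) M'"
  proof (rule noeth_finite_ops[OF _ nM fM endo])
    show "finite Os" using X(1) by (simp add: Os_def)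
    fix \<delta> f \<delta>' f' y assume f: "(\<delta>, f) \<in> Os \<union> \<Omega>" and f': "(\<delta>', f') \<in> Os" and y: "y \<in> carrier R"
    obtain c where c: "c \<in> carrier R" "f = (\<otimes>) c" using op[OF f] by (elim bexE conjE)
    obtain c' where c': "c' \<in> carrier R" "f' = (\<otimes>) c'" using op[OF UnI1[OF f']] by (elim bexE conjE)
    show "f (f' y) = f' (f y)" unfolding c(2) c'(2) using c(1) c'(1) y by (rule m_lcomm)
  qed
  then obtain M' where M': "family (Os \<union> \<Omega>) M'" "M \<le> M'" "noeth (Os \<union> \<Omega>) M'" by (elim exE conjE)
  note M0 = add_subD[OF familyD(1)[OF M'(1), of 0]]
  have KX: "c \<otimes> z \<in> M' 0" if c: "c \<in> K \<union> X" and z: "z \<in> M' 0" for c z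
  proof -
    have "(0, (\<otimes>) c) \<in> Os \<union> \<Omega>" using c unfolding Os_def \<Omega>_def by blast
    from familyD(2)[OF M'(1) this z] show ?thesis by simp
  qed
  \<comment> \<open>\<open>K\<close> and \<open>X\<close> generate \<open>R\<close>, so
    \<open>M' 0\<close> is stable under all of \<open>R\<close>; containing \<open>\<one>\<close>,
    it is everything.\<close>
  have gen: "y \<in> carrier R \<and> (\<forall>z\<in>M' 0. y \<otimes> z \<in> M' 0)" if "y \<in> generate_ring R (K \<union> X)" for y
    using that
  proof (induction rule: generate_ring.induct)
    case one
    show ?case using M0(1) by simp
  next
    case (incl h)
    have "h \<in> carrier R" using incl Xc K_props(1) by blast
    thus ?case using KX[OF incl] by simp
  next
    case (a_inv h)
    thus ?case using M0(1,4) by (simp add: l_minus)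
  next
    case (eng_add h1 h2)
    thus ?case using M0(1,5) by (simp add: l_distr)
  next
    case (eng_mult h1 h2)
    thus ?case using M0(1) by (simp add: m_assoc)
  qed
  have o: "\<one> \<in> M' 0" using le_funD[OF M'(2), of 0] K_props(2) by (simp add: M_def subset_iff)
  have cM: "carrier R \<subseteq> M' 0"
  proof
    fix y assume y: "y \<in> carrier R"
    hence "y \<otimes> \<one> \<in> M' 0" by (rule conjunct2[OF gen[unfolded X(3)], THEN bspec, OF _ o])
    thus "y \<in> M' 0" using y by simp
  qed
  show ?thesis
  proof (rule noetherian_ring_from_acc)
    fix J :: "nat \<Rightarrow> 'a set" assume J: "\<And>p. ideal (J p) R" "\<And>p. J p \<subseteq> J (Suc p)"
    define N where "N p g = (if g = (0::nat) then J p else {\<zero>})" for p g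
    have "\<exists>p0. \<forall>p\<ge>p0. N p = N p0"
    proof (rule M'(3)[unfolded noeth_def, rule_format], intro conjI)
      fix p
      show "family (Os \<union> \<Omega>) (N p)"
        unfolding family_def
      proof (intro conjI allI impI)
        show "add_sub (N p g)" for g
          using J(1)[of p] by (simp add: N_def ideal_iff_submodule add_sub_def a_minus_def)
        fix \<delta> f g y assume f: "(\<delta>, f) \<in> Os \<union> \<Omega>" and y: "y \<in> N p g"
        obtain c where "c \<in> carrier R" "\<delta> = 0" "f = (\<otimes>) c" using op[OF f] by (elim bexE conjE)
        thus "f y \<in> N p (g + \<delta>)" using y idealD(6)[OF J(1)[of p]] by (auto simp: N_def split: if_splits)
      qed
      show "N p \<le> M'"
      proof (rule le_funI)
        fix g show "N p g \<subseteq> M' g"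
          using ideal_subset[OF J(1)[of p]] cM add_subD(2)[OF familyD(1)[OF M'(1), of g]] by (auto simp: N_def)
      qed
      show "N p \<le> N (Suc p)" using J(2)[of p] by (auto simp: le_fun_def N_def)
    qed
    then obtain p0 where p0: "\<forall>p\<ge>p0. N p = N p0" ..
    have "N (Suc p0) 0 = N p0 0" using spec[OF p0, of "Suc p0"] by simp
    hence "J (Suc p0) = J p0" by (simp add: N_def)
    thus "\<exists>p. J (Suc p) = J p" by (rule exI)
  qed
qed

end

section \<open>Localization at a maximal ideal\<close>

lemma UN_eq_const: "i \<in> I \<Longrightarrow> (\<And>j. j \<in> I \<Longrightarrow> f j = c) \<Longrightarrow> (\<Union>j\<in>I. f j) = c"
  by auto

text \<open>A finite supremum of natural numbers is attained; the prime \<open>p\<close> makes the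
  set of lengths non-empty.\<close>

lemma (in cring) prime_chain_of_krull_dim:
  assumes "krull_dim R = enat d" "primeideal p R"
  obtains P :: "nat \<Rightarrow> 'a set" where "\<And>i. i \<le> d \<Longrightarrow> primeideal (P i) R" "\<And>i. i < d \<Longrightarrow> P i \<subset> P (Suc i)"
proof -
  define N where "N = {n. \<exists>P :: nat \<Rightarrow> 'a set. (\<forall>i\<le>n. primeideal (P i) R) \<and> (\<forall>i<n. P i \<subset> P (Suc i))}"
  have dim: "Sup (enat ` N) = enat d"
    using assms(1) unfolding krull_dim_def N_def by (simp add: image_Collect)
  have N0: "0 \<in> N" unfolding N_def using assms(2) by (intro CollectI exI[of _ "\<lambda>_. p"]) simp
  have le: "n \<le> d" if "n \<in> N" for n
  proof -
    have "enat n \<le> Sup (enat ` N)" by (rule Sup_upper) (rule imageI[OF that])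
    thus ?thesis unfolding dim by simp
  qed
  have fin: "finite N" by (rule finite_subset[of _ "{..d}"]) (use le in auto)
  have "Sup (enat ` N) = enat (Max N)"
  proof (rule antisym)
    show "Sup (enat ` N) \<le> enat (Max N)" by (rule Sup_least) (use fin in auto)
    show "enat (Max N) \<le> Sup (enat ` N)" by (rule Sup_upper, rule imageI, rule Max_in) (use fin N0 in auto)
  qed
  hence "Max N = d" using dim by simp
  moreover have "Max N \<in> N" by (rule Max_in) (use fin N0 in auto)
  ultimately have "d \<in> N" by simp
  then obtain P :: "nat \<Rightarrow> 'a set" where "\<forall>i\<le>d. primeideal (P i) R" "\<forall>i<d. P i \<subset> P (Suc i)"
    unfolding N_def by (elim CollectE exE conjE)
  thus ?thesis by (intro that[of P]) simp_all
qed

section \<open>Arithmetic of fractions, extension and contraction of ideals\<close>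

locale localization = noetherian_cring R for R (structure) +
  fixes m :: "'a set"
  assumes maximal: "maximalideal m R"
begin

abbreviation S :: "'a set" where "S \<equiv> carrier R - m"

abbreviation fr :: "'a \<Rightarrow> 'a \<Rightarrow> ('a \<times> 'a) set" where "fr \<equiv> fraction R S"

abbreviation Q :: "('a \<times> 'a) set ring" where "Q \<equiv> ring_of_fractions R S"

lemma prime: "primeideal m R"
  by (rule maximalideal_prime[OF maximal])

lemma m_ideal: "ideal m R"
  using prime by (rule primeideal.axioms(1))

lemma S_carrier: "s \<in> S \<Longrightarrow> s \<in> carrier R"
  by simp

lemma S_one: "\<one> \<in> S"
  using ideal.one_imp_carrier[OF m_ideal] primeideal.I_notcarr[OF prime] by auto

lemma S_mult: "s \<in> S \<Longrightarrow> t \<in> S \<Longrightarrow> s \<otimes> t \<in> S"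
  using primeideal.I_prime[OF prime, of s t] by auto

lemma fr_mem: "(b, t) \<in> fr a s \<longleftrightarrow> b \<in> carrier R \<and> t \<in> S \<and> (\<exists>u\<in>S. u \<otimes> (a \<otimes> t) = u \<otimes> (b \<otimes> s))"
  by (simp add: fraction_def)

lemma fr_self: "a \<in> carrier R \<Longrightarrow> s \<in> S \<Longrightarrow> (a, s) \<in> fr a s"
  unfolding fr_mem using S_one by blast

lemma fr_trans:
  assumes c: "a \<in> carrier R" "s \<in> S" "b \<in> carrier R" "t \<in> S" "e \<in> carrier R" "r \<in> S"
    and u: "u \<in> S" "u \<otimes> (a \<otimes> t) = u \<otimes> (b \<otimes> s)" and v: "v \<in> S" "v \<otimes> (b \<otimes> r) = v \<otimes> (e \<otimes> t)"
  shows "\<exists>w\<in>S. w \<otimes> (a \<otimes> r) = w \<otimes> (e \<otimes> s)"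
proof
  note cc = c(1,3,5) c(2,4,6)[THEN S_carrier] u(1)[THEN S_carrier] v(1)[THEN S_carrier]
  show "u \<otimes> v \<otimes> t \<in> S" using u(1) v(1) c(4) S_mult by blast
  have "u \<otimes> v \<otimes> t \<otimes> (a \<otimes> r) = (v \<otimes> r) \<otimes> (u \<otimes> (a \<otimes> t))" using cc by (simp add: m_ac)
  also have "\<dots> = (u \<otimes> s) \<otimes> (v \<otimes> (b \<otimes> r))" unfolding u(2) using cc by (simp add: m_ac)
  also have "\<dots> = u \<otimes> v \<otimes> t \<otimes> (e \<otimes> s)" unfolding v(2) using cc by (simp add: m_ac)
  finally show "u \<otimes> v \<otimes> t \<otimes> (a \<otimes> r) = u \<otimes> v \<otimes> t \<otimes> (e \<otimes> s)" .
qed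

lemma fr_eqI:
  assumes c: "a \<in> carrier R" "s \<in> S" "b \<in> carrier R" "t \<in> S"
    and u: "u \<in> S" "u \<otimes> (a \<otimes> t) = u \<otimes> (b \<otimes> s)"
  shows "fr a s = fr b t"
proof (rule equalityI; rule subsetI)
  fix p assume "p \<in> fr b t"
  then obtain e r v where p: "p = (e, r)" "e \<in> carrier R" "r \<in> S" "v \<in> S" "v \<otimes> (b \<otimes> r) = v \<otimes> (e \<otimes> t)"
    by (cases p) (auto simp only: fr_mem)
  show "p \<in> fr a s"
    unfolding p(1) fr_mem using fr_trans[OF c p(2,3) u p(4,5)] p(2,3) by (intro conjI)
next
  fix p assume "p \<in> fr a s"
  then obtain e r v where p: "p = (e, r)" "e \<in> carrier R" "r \<in> S" "v \<in> S" "v \<otimes> (a \<otimes> r) = v \<otimes> (e \<otimes> s)"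
    by (cases p) (auto simp only: fr_mem)
  show "p \<in> fr b t"
    unfolding p(1) fr_mem using fr_trans[OF c(3,4,1,2) p(2,3) u(1) u(2)[symmetric] p(4,5)] p(2,3) by (intro conjI)
qed

lemma fr_eqD:
  assumes "b \<in> carrier R" "t \<in> S" "fr a s = fr b t"
  obtains u where "u \<in> S" "u \<otimes> (a \<otimes> t) = u \<otimes> (b \<otimes> s)"
  using fr_self[OF assms(1,2)] unfolding assms(3)[symmetric] fr_mem by (elim conjE bexE)

lemma Q_carrier: "a \<in> carrier R \<Longrightarrow> s \<in> S \<Longrightarrow> fr a s \<in> carrier Q"
  unfolding ring_of_fractions_def by auto

lemma Q_carrierE:
  assumes "y \<in> carrier Q"
  obtains a s where "a \<in> carrier R" "s \<in> S" "y = fr a s"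
  using assms unfolding ring_of_fractions_def by auto

lemma Q_one: "\<one>\<^bsub>Q\<^esub> = fr \<one> \<one>" and Q_zero: "\<zero>\<^bsub>Q\<^esub> = fr \<zero> \<one>"
  by (simp_all add: ring_of_fractions_def)

text \<open>The unions that define the operations on fractions collapse to a single class once all
  representatives give the same result.\<close>

lemma union_representatives:
  assumes "a \<in> carrier R" "s \<in> S" "b \<in> carrier R" "t \<in> S"
    and "\<And>a' s' b' t'. (a', s') \<in> fr a s \<Longrightarrow> (b', t') \<in> fr b t \<Longrightarrow> g a' s' b' t' = g a s b t"
  shows "(\<Union>(a, s)\<in>fr a s. \<Union>(b, t)\<in>fr b t. g a s b t) = g a s b t"
proof -
  have "(\<Union>(b, t)\<in>fr b t. g a' s' b t) = g a s b t" if "(a', s') \<in> fr a s" for a' s'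
    using fr_self[OF assms(3,4)] assms(5)[OF that] by (intro UN_eq_const) auto
  thus ?thesis using fr_self[OF assms(1,2)] by (intro UN_eq_const) auto
qed

lemma Q_mult:
  assumes c: "a \<in> carrier R" "s \<in> S" "b \<in> carrier R" "t \<in> S"
  shows "fr a s \<otimes>\<^bsub>Q\<^esub> fr b t = fr (a \<otimes> b) (s \<otimes> t)"
proof -
  have "(\<Union>(a, s)\<in>fr a s. \<Union>(b, t)\<in>fr b t. fr (a \<otimes> b) (s \<otimes> t)) = fr (a \<otimes> b) (s \<otimes> t)"
  proof (rule union_representatives[OF c])
    fix a' s' b' t' assume "(a', s') \<in> fr a s" "(b', t') \<in> fr b t"
    then obtain u v where p: "a' \<in> carrier R" "s' \<in> S" "b' \<in> carrier R" "t' \<in> S"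
      "u \<in> S" "u \<otimes> (a \<otimes> s') = u \<otimes> (a' \<otimes> s)" "v \<in> S" "v \<otimes> (b \<otimes> t') = v \<otimes> (b' \<otimes> t)"
      unfolding fr_mem by (elim conjE bexE)
    note cc = c(1,3) c(2,4)[THEN S_carrier] p(1,3) p(2,4,5,7)[THEN S_carrier]
    show "fr (a' \<otimes> b') (s' \<otimes> t') = fr (a \<otimes> b) (s \<otimes> t)"
    proof (rule fr_eqI)
      show "u \<otimes> v \<in> S" "s' \<otimes> t' \<in> S" "s \<otimes> t \<in> S" by (rule S_mult[OF p(5,7)] S_mult[OF p(2,4)] S_mult[OF c(2,4)])+
      have "u \<otimes> v \<otimes> ((a' \<otimes> b') \<otimes> (s \<otimes> t)) = (u \<otimes> (a' \<otimes> s)) \<otimes> (v \<otimes> (b' \<otimes> t))" using cc by (simp add: m_ac)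
      also have "\<dots> = u \<otimes> v \<otimes> ((a \<otimes> b) \<otimes> (s' \<otimes> t'))" unfolding p(6,8)[symmetric] using cc by (simp add: m_ac)
      finally show "u \<otimes> v \<otimes> ((a' \<otimes> b') \<otimes> (s \<otimes> t)) = u \<otimes> v \<otimes> ((a \<otimes> b) \<otimes> (s' \<otimes> t'))" .
    qed (use cc in simp_all)
  qed
  thus ?thesis by (simp add: ring_of_fractions_def)
qed

lemma Q_add:
  assumes c: "a \<in> carrier R" "s \<in> S" "b \<in> carrier R" "t \<in> S"
  shows "fr a s \<oplus>\<^bsub>Q\<^esub> fr b t = fr (a \<otimes> t \<oplus> b \<otimes> s) (s \<otimes> t)"
proof -
  have "(\<Union>(a, s)\<in>fr a s. \<Union>(b, t)\<in>fr b t. fr (a \<otimes> t \<oplus> b \<otimes> s) (s \<otimes> t)) = fr (a \<otimes> t \<oplus> b \<otimes> s) (s \<otimes> t)"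
  proof (rule union_representatives[OF c])
    fix a' s' b' t' assume "(a', s') \<in> fr a s" "(b', t') \<in> fr b t"
    then obtain u v where p: "a' \<in> carrier R" "s' \<in> S" "b' \<in> carrier R" "t' \<in> S"
      "u \<in> S" "u \<otimes> (a \<otimes> s') = u \<otimes> (a' \<otimes> s)" "v \<in> S" "v \<otimes> (b \<otimes> t') = v \<otimes> (b' \<otimes> t)"
      unfolding fr_mem by (elim conjE bexE)
    note cc = c(1,3) c(2,4)[THEN S_carrier] p(1,3) p(2,4,5,7)[THEN S_carrier]
    show "fr (a' \<otimes> t' \<oplus> b' \<otimes> s') (s' \<otimes> t') = fr (a \<otimes> t \<oplus> b \<otimes> s) (s \<otimes> t)"
    proof (rule fr_eqI)
      show "u \<otimes> v \<in> S" "s' \<otimes> t' \<in> S" "s \<otimes> t \<in> S" by (rule S_mult[OF p(5,7)] S_mult[OF p(2,4)] S_mult[OF c(2,4)])+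
      have "u \<otimes> v \<otimes> ((a' \<otimes> t' \<oplus> b' \<otimes> s') \<otimes> (s \<otimes> t))
          = (v \<otimes> t' \<otimes> t) \<otimes> (u \<otimes> (a' \<otimes> s)) \<oplus> (u \<otimes> s' \<otimes> s) \<otimes> (v \<otimes> (b' \<otimes> t))"
        using cc by (simp add: m_ac l_distr r_distr)
      also have "\<dots> = u \<otimes> v \<otimes> ((a \<otimes> t \<oplus> b \<otimes> s) \<otimes> (s' \<otimes> t'))"
        unfolding p(6,8)[symmetric] using cc by (simp add: m_ac l_distr r_distr)
      finally show "u \<otimes> v \<otimes> ((a' \<otimes> t' \<oplus> b' \<otimes> s') \<otimes> (s \<otimes> t))
          = u \<otimes> v \<otimes> ((a \<otimes> t \<oplus> b \<otimes> s) \<otimes> (s' \<otimes> t'))" .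
    qed (use cc in simp_all)
  qed
  thus ?thesis by (simp add: ring_of_fractions_def)
qed

lemma fr_unit:
  assumes "s \<in> S" "t \<in> S"
  shows "fr s t \<otimes>\<^bsub>Q\<^esub> fr t s = \<one>\<^bsub>Q\<^esub>"
  unfolding Q_mult[OF S_carrier[OF assms(1)] assms(2) S_carrier[OF assms(2)] assms(1)] Q_one
  by (rule fr_eqI[OF _ _ _ _ S_one]) (use assms S_mult S_one m_comm in auto)

lemma fr_split:
  assumes "a \<in> carrier R" "s \<in> S"
  shows "fr a s \<otimes>\<^bsub>Q\<^esub> fr s \<one> = fr a \<one>" "fr a \<one> \<otimes>\<^bsub>Q\<^esub> fr \<one> s = fr a s"
proof -
  note s = S_carrier[OF assms(2)]
  show "fr a s \<otimes>\<^bsub>Q\<^esub> fr s \<one> = fr a \<one>"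
    unfolding Q_mult[OF assms s S_one]
    by (rule fr_eqI[OF _ _ _ _ S_one]) (use assms s S_one in simp_all)
  show "fr a \<one> \<otimes>\<^bsub>Q\<^esub> fr \<one> s = fr a s"
    unfolding Q_mult[OF assms(1) S_one one_closed assms(2)] using assms(1) s by simp
qed

text \<open>That \<open>Q\<close> is a ring will come from its regularity and is not derived from
  the operations on fractions; hence the assumption \<open>cring Q\<close>.\<close>

lemma extension_ideal:
  assumes "cring Q" "ideal B R"
  shows "ideal {fr c s | c s. c \<in> B \<and> s \<in> S} Q" (is "ideal ?E Q")
proof -
  interpret Q: cring Q by fact
  note B = idealD[OF assms(2)]
  show ?thesis
  proof (rule Q.idealI')
    show "?E \<subseteq> carrier Q" using B(1) Q_carrier by blast
    show "\<zero>\<^bsub>Q\<^esub> \<in> ?E" unfolding Q_zero using B(2) S_one by blast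
  next
    fix y z assume "y \<in> ?E" "z \<in> ?E"
    then obtain a s b t where y: "y = fr a s" "a \<in> B" "s \<in> S" and z: "z = fr b t" "b \<in> B" "t \<in> S"
      by (elim CollectE exE conjE)
    have "y \<oplus>\<^bsub>Q\<^esub> z = fr (a \<otimes> t \<oplus> b \<otimes> s) (s \<otimes> t)" unfolding y(1) z(1) by (rule Q_add[OF B(1)[OF y(2)] y(3) B(1)[OF z(2)] z(3)])
    moreover have "a \<otimes> t \<oplus> b \<otimes> s \<in> B"
      by (rule B(3)[OF B(7)[OF S_carrier[OF z(3)] y(2)] B(7)[OF S_carrier[OF y(3)] z(2)]])
    ultimately show "y \<oplus>\<^bsub>Q\<^esub> z \<in> ?E" using S_mult[OF y(3) z(3)] by (intro CollectI exI conjI)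
  next
    fix r y assume r: "r \<in> carrier Q" and "y \<in> ?E"
    then obtain a s where y: "y = fr a s" "a \<in> B" "s \<in> S" by (elim CollectE exE conjE)
    obtain b t where b: "b \<in> carrier R" "t \<in> S" "r = fr b t" using r by (rule Q_carrierE)
    have "r \<otimes>\<^bsub>Q\<^esub> y = fr (b \<otimes> a) (t \<otimes> s)" unfolding y(1) b(3) by (rule Q_mult[OF b(1,2) B(1)[OF y(2)] y(3)])
    thus "r \<otimes>\<^bsub>Q\<^esub> y \<in> ?E" using S_mult[OF b(2) y(3)] B(6)[OF b(1) y(2)] by (intro CollectI exI conjI)
  qed
qed

lemma contraction_prime:
  assumes "cring Q" "primeideal P Q"
  shows "primeideal {a \<in> carrier R. fr a \<one> \<in> P} R" (is "primeideal ?P R")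
proof -
  interpret Q: cring Q by fact
  interpret P: primeideal P Q by fact
  note PD = Q.idealD[OF P.is_ideal]
  have mul: "fr (a \<otimes> b) \<one> = fr a \<one> \<otimes>\<^bsub>Q\<^esub> fr b \<one>" if "a \<in> carrier R" "b \<in> carrier R" for a b
    using Q_mult[OF that(1) S_one that(2) S_one] by simp
  have add: "fr (a \<oplus> b) \<one> = fr a \<one> \<oplus>\<^bsub>Q\<^esub> fr b \<one>" if "a \<in> carrier R" "b \<in> carrier R" for a b
    using Q_add[OF that(1) S_one that(2) S_one] that by simp
  show ?thesis
  proof (rule primeidealI)
    show "ideal ?P R"
    proof (rule idealI')
      show "\<zero> \<in> ?P" using PD(2) unfolding Q_zero by simp
      show "x \<oplus> y \<in> ?P" if "x \<in> ?P" "y \<in> ?P" for x y using that PD(3) by (simp add: add)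
      show "r \<otimes> x \<in> ?P" if "r \<in> carrier R" "x \<in> ?P" for r x
        using that PD(6)[OF Q_carrier[OF that(1) S_one]] by (simp add: mul)
    qed blast
    show "cring R" by (rule is_cring)
    have "\<one> \<notin> ?P" using P.one_imp_carrier P.I_notcarr unfolding Q_one by auto
    thus "carrier R \<noteq> ?P" using one_closed by blast
    fix a b assume ab: "a \<in> carrier R" "b \<in> carrier R" "a \<otimes> b \<in> ?P"
    have "fr a \<one> \<otimes>\<^bsub>Q\<^esub> fr b \<one> \<in> P" using ab(3) mul[OF ab(1,2)] by simp
    hence "fr a \<one> \<in> P \<or> fr b \<one> \<in> P" by (rule P.I_prime[OF Q_carrier[OF ab(1) S_one] Q_carrier[OF ab(2) S_one]])
    thus "a \<in> ?P \<or> b \<in> ?P" using ab(1,2) by blast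
  qed
qed

text \<open>The fractions \<open>a / s\<close> and \<open>a / 1\<close> generate the same ideal of
  \<open>Q\<close>, so an ideal is determined by its numerators.\<close>

lemma contraction_strict:
  assumes "cring Q" "ideal P Q" "ideal P' Q" "P \<subset> P'"
  shows "{a \<in> carrier R. fr a \<one> \<in> P} \<subset> {a \<in> carrier R. fr a \<one> \<in> P'}"
proof -
  interpret Q: cring Q by fact
  obtain y where y: "y \<in> P'" "y \<notin> P" using assms(4) by blast
  obtain a s where a: "a \<in> carrier R" "s \<in> S" "y = fr a s"
    by (rule Q_carrierE[OF Q.idealD(1)[OF assms(3) y(1)]])
  note s = S_carrier[OF a(2)]
  have "fr a \<one> \<in> P'" using Q.idealD(7)[OF assms(3) Q_carrier[OF s S_one] y(1)] unfolding a(3) fr_split(1)[OF a(1,2)] .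
  moreover have "fr a \<one> \<notin> P"
  proof
    assume "fr a \<one> \<in> P"
    from Q.idealD(7)[OF assms(2) Q_carrier[OF one_closed a(2)] this] show False
      using y(2) unfolding a(3) fr_split(2)[OF a(1,2)] by simp
  qed
  ultimately show ?thesis using assms(4) a(1) by blast
qed

end

section \<open>Regular generators from regularity\<close>

context localization
begin

text \<open>Numerators of generators of \<open>n\<close> generate \<open>m\<close> up to multipliers
  outside \<open>m\<close>, and a chain of primes of \<open>Q\<close> contracts to one inside
  \<open>m\<close>. This brings regularity down to \<open>R\<close>, where the resolutions
  live.\<close>

lemma regular_generators_of_localization:
  assumes "regular_local_ring Q n"
  obtains x d P where "regular_generators R m x d P"
proof -
  interpret Q: regular_local_ring Q n by fact
  have cQ: "cring Q" by (rule Q.is_cring)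
  note nD = Q.idealD[OF Q.is_ideal]
  obtain X where X: "X \<subseteq> carrier Q" "finite X" "Idl\<^bsub>Q\<^esub> X = n" "enat (card X) = krull_dim Q"
    using Q.regular by (elim exE conjE)
  let ?d = "card X"
  have prime_n: "primeideal n Q" by (rule Q.maximalideal_prime[OF Q.maximalideal_axioms])
  obtain P' where P': "\<And>i. i \<le> ?d \<Longrightarrow> primeideal (P' i) Q" "\<And>i. i < ?d \<Longrightarrow> P' i \<subset> P' (Suc i)"
    using Q.prime_chain_of_krull_dim[OF X(4)[symmetric] prime_n] by metis
  define P where "P i = {a \<in> carrier R. fr a \<one> \<in> P' i}" for i
  have unit: "\<one>\<^bsub>Q\<^esub> \<in> J" if "ideal J Q" "fr a s \<in> J" "a \<in> S" "s \<in> S" for J a s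
    using Q.idealD(7)[OF that(1) Q_carrier[OF S_carrier[OF that(4)] that(3)] that(2)]
    unfolding fr_unit[OF that(3,4)] .
  have notone: "\<one>\<^bsub>Q\<^esub> \<notin> J" if "primeideal J Q" for J
    using ideal.one_imp_carrier[OF primeideal.axioms(1)[OF that]] primeideal.I_notcarr[OF that] by auto
  let ?E = "\<lambda>B. {fr c s | c s. c \<in> B \<and> s \<in> S}"
  have nm: "n \<subseteq> ?E m"
  proof
    fix y assume y: "y \<in> n"
    obtain a s where a: "a \<in> carrier R" "s \<in> S" "y = fr a s" by (rule Q_carrierE[OF nD(1)[OF y]])
    have "a \<in> m"
    proof (rule ccontr)
      assume "a \<notin> m"
      hence "a \<in> S" using a(1) by simp
      from unit[OF Q.is_ideal y[unfolded a(3)] this a(2)] show False using notone[OF prime_n] by simp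
    qed
    thus "y \<in> ?E m" using a(2,3) by (intro CollectI exI conjI)
  qed
  have Em: "ideal (?E m) Q" by (rule extension_ideal[OF cQ m_ideal])
  have no: "\<one>\<^bsub>Q\<^esub> \<notin> ?E m"
  proof
    assume "\<one>\<^bsub>Q\<^esub> \<in> ?E m"
    then obtain c s where c: "fr \<one> \<one> = fr c s" "c \<in> m" "s \<in> S" unfolding Q_one by (elim CollectE exE conjE)
    note mD = idealD[OF m_ideal]
    obtain u where u: "u \<in> S" "u \<otimes> (\<one> \<otimes> s) = u \<otimes> (c \<otimes> \<one>)" by (rule fr_eqD[OF mD(1)[OF c(2)] c(3,1)])
    have "u \<otimes> s = u \<otimes> c" using u(2) mD(1)[OF c(2)] S_carrier[OF c(3)] by simp
    moreover have "u \<otimes> c \<in> m" by (rule mD(6)[OF S_carrier[OF u(1)] c(2)])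
    ultimately show False using S_mult[OF u(1) c(3)] by simp
  qed
  have "?E m \<noteq> carrier Q"
  proof
    assume eq: "?E m = carrier Q"
    show False using no Q.one_closed unfolding eq by (rule notE)
  qed
  moreover have "?E m = n \<or> ?E m = carrier Q" by (rule Q.I_maximal[OF Em nm Q.ideal_subset[OF Em]])
  \<comment> \<open>The extension of \<open>m\<close> contains \<open>n\<close> and is proper, so
    maximality of \<open>n\<close> gives equality.\<close>
  ultimately have nE: "n = ?E m" by (elim disjE) (erule sym, erule (1) notE)
  have "\<forall>y\<in>X. \<exists>c. c \<in> m \<and> (\<exists>s\<in>S. y = fr c s)"
  proof
    fix y assume "y \<in> X"
    hence "y \<in> n" using Q.genideal_self[OF X(1)] X(3) by blast
    hence "y \<in> ?E m" using nm by (rule rev_subsetD)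
    then obtain c s where "y = fr c s" "c \<in> m" "s \<in> S" by (elim CollectE exE conjE)
    thus "\<exists>c. c \<in> m \<and> (\<exists>s\<in>S. y = fr c s)" by (intro exI conjI bexI)
  qed
  from bchoice[OF this] obtain num where num: "\<forall>y\<in>X. num y \<in> m \<and> (\<exists>s\<in>S. y = fr (num y) s)" ..
  obtain h where h: "bij_betw h {0..<?d} X" using ex_bij_betw_nat_finite[OF X(2)] ..
  have hX: "h ` {..<?d} = X" using bij_betw_imp_surj_on[OF h] by (simp add: atLeast0LessThan)
  define x where "x i = num (h i)" for i
  have xm: "x i \<in> m" if "i < ?d" for i
  proof -
    have "h i \<in> X" using hX that by blast
    thus ?thesis using num unfolding x_def by simp
  qed
  have mc: "m \<subseteq> carrier R" by (rule ideal_subset[OF m_ideal])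
  let ?J = "Idl (x ` {..<?d})"
  have xc: "x ` {..<?d} \<subseteq> carrier R" using xm mc by auto
  have J: "ideal ?J R" by (rule genideal_ideal[OF xc])
  have nJ: "n \<subseteq> ?E ?J"
    unfolding X(3)[symmetric]
  proof (rule Q.genideal_minimal[OF extension_ideal[OF cQ J]], rule subsetI)
    fix y assume y: "y \<in> X"
    then obtain i where i: "i < ?d" "y = h i" using hX by blast
    have "x i \<in> ?J" using genideal_self[OF xc] i(1) by blast
    moreover obtain s where "s \<in> S" "y = fr (x i) s" using bspec[OF num y] unfolding x_def i(2) by (elim conjE bexE)
    ultimately show "y \<in> ?E ?J" by (intro CollectI exI conjI)
  qed
  \<comment> \<open>An equality \<open>a / 1 = c / s\<close> in \<open>Q\<close> means
    \<open>u s a = u c\<close> for some \<open>u\<close> outside \<open>m\<close>; then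
    \<open>u s\<close> is the multiplier.\<close>
  have gen: "\<exists>s\<in>carrier R. s \<notin> m \<and> s \<otimes> a \<in> ?J" if a: "a \<in> m" for a
  proof -
    have ac: "a \<in> carrier R" using a mc by (rule rev_subsetD)
    have "fr a \<one> \<in> ?E m" by (intro CollectI exI conjI, rule refl, rule a, rule S_one)
    hence "fr a \<one> \<in> ?E ?J" using nJ unfolding nE by (rule rev_subsetD)
    then obtain c s where c: "fr a \<one> = fr c s" "c \<in> ?J" "s \<in> S" by (elim CollectE exE conjE)
    have cc: "c \<in> carrier R" by (rule idealD(1)[OF J c(2)])
    obtain u where u: "u \<in> S" "u \<otimes> (a \<otimes> s) = u \<otimes> (c \<otimes> \<one>)" by (rule fr_eqD[OF cc c(3,1)])
    have "(u \<otimes> s) \<otimes> a = u \<otimes> c"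
      using u(2) ac cc S_carrier[OF u(1)] S_carrier[OF c(3)] by (simp add: m_assoc m_comm[of s a])
    also have "\<dots> \<in> ?J" by (rule idealD(6)[OF J S_carrier[OF u(1)] c(2)])
    finally have "u \<otimes> s \<otimes> a \<in> ?J" .
    thus ?thesis using S_mult[OF u(1) c(3)] by (elim DiffE) (rule bexI, rule conjI)
  qed
  have "regular_generators R m x ?d P"
  proof (intro regular_generators.intro local_generators.intro regular_generators_axioms.intro
      local_generators_axioms.intro)
    show "noetherian_cring R" by (rule noetherian_cring_axioms)
    show "primeideal (P i) R" if "i \<le> ?d" for i
      unfolding P_def by (rule contraction_prime[OF cQ P'(1)[OF that]])
    show "P i \<subset> P (Suc i)" if "i < ?d" for i
      unfolding P_def
      by (rule contraction_strict[OF cQ P'(1)[THEN primeideal.axioms(1)] P'(1)[THEN primeideal.axioms(1)] P'(2)[OF that]])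
        (use that in simp_all)
    show "P ?d \<subseteq> m"
    proof
      fix a assume "a \<in> P ?d"
      hence a: "a \<in> carrier R" "fr a \<one> \<in> P' ?d" unfolding P_def by simp_all
      show "a \<in> m"
      proof (rule ccontr)
        assume "a \<notin> m"
        hence "a \<in> S" using a(1) by simp
        from unit[OF primeideal.axioms(1)[OF P'(1)[OF order_refl]] a(2) this S_one] show False
          using notone[OF P'(1)[OF order_refl]] by simp
      qed
    qed
  qed (fact maximal xm gen)+
  thus ?thesis by (rule that)
qed

end

text \<open>Here \<open>\<one>\<close> is the multiplier, and the top prime lies in \<open>m\<close>
  because it lies in some maximal ideal, of which there is only one.\<close>

lemma (in regular_local_ring) regular_generators_of_local_ring:
  obtains x d P where "regular_generators R m x d P"
proof -
  interpret N: noetherian_cring R by (intro noetherian_cring.intro is_cring noetherian_ring_axioms)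
  obtain X where X: "X \<subseteq> carrier R" "finite X" "Idl X = m" "enat (card X) = krull_dim R"
    using regular by (elim exE conjE)
  let ?d = "card X"
  obtain P where P: "\<And>i. i \<le> ?d \<Longrightarrow> primeideal (P i) R" "\<And>i. i < ?d \<Longrightarrow> P i \<subset> P (Suc i)"
    using prime_chain_of_krull_dim[OF X(4)[symmetric] maximalideal_prime[OF maximalideal_axioms]] by metis
  obtain x where x: "bij_betw x {0..<?d} X" using ex_bij_betw_nat_finite[OF X(2)] ..
  have xX: "x ` {..<?d} = X" using bij_betw_imp_surj_on[OF x] by (simp add: atLeast0LessThan)
  have one: "\<one> \<notin> m" using one_imp_carrier I_notcarr by auto
  have "regular_generators R m x ?d P"
  proof (intro regular_generators.intro local_generators.intro regular_generators_axioms.intro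
      local_generators_axioms.intro)
    show "noetherian_cring R" by (rule N.noetherian_cring_axioms)
    show "maximalideal m R" by (rule maximalideal_axioms)
    show "x i \<in> m" if "i < ?d" for i
    proof -
      have "x i \<in> X" using xX that by blast
      thus ?thesis using genideal_self[OF X(1)] X(3) by blast
    qed
    show "\<exists>s\<in>carrier R. s \<notin> m \<and> s \<otimes> a \<in> Idl (x ` {..<?d})" if "a \<in> m" for a
      unfolding xX X(3) using that one a_subset by (intro bexI[of _ \<one>] conjI) auto
    show "P ?d \<subseteq> m"
    proof -
      have p: "primeideal (P ?d) R" by (rule P(1)[OF order_refl])
      have "\<one> \<notin> P ?d" using ideal.one_imp_carrier[OF primeideal.axioms(1)[OF p]] primeideal.I_notcarr[OF p] by auto
      then obtain n where "maximalideal n R" "P ?d \<subseteq> n"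
        by (rule N.exists_maximal_ideal[OF primeideal.axioms(1)[OF p]])
      thus ?thesis using maximal_unique by simp
    qed
  qed (fact P)+
  thus ?thesis by (rule that)
qed

section \<open>Artin--Rees numbers of the powers of an ideal\<close>

context noetherian_cring
begin

text \<open>For each \<open>j \<le> d\<close> the sequence \<open>\<rho> j\<close> is eventually
  constant, hence takes finitely many values; for \<open>j > d\<close> the number is
  \<open>0\<close>. The bound is a maximum over finitely many finite sets.\<close>

lemma syzygy_artin_rees_number_bounded:
  assumes I: "ideal I R" and gen: "regular_generators R m x d P"
  shows "\<exists>c. \<forall>j\<ge>1. \<forall>k. \<forall>(F :: nat \<Rightarrow> ('a, 'c) module) \<phi> \<epsilon>.
    minimal_free_resolution R m (ideal_module R (ideal_power R I k)) F \<phi> \<epsilon> \<longrightarrow>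
    syzygy_artin_rees_number R m F \<phi> j \<le> c"
proof -
  interpret G: regular_generators R m x d P by fact
  obtain \<rho> :: "nat \<Rightarrow> nat \<Rightarrow> nat" where \<rho>: "\<And>j. \<exists>c k0. \<forall>k\<ge>k0. \<rho> j k = c"
    "\<And>j k (F :: nat \<Rightarrow> ('a, 'c) module) \<phi> \<epsilon>. j \<ge> 1 \<Longrightarrow> free_resolution R (ideal_module R (ideal_power R I k)) F \<phi> \<epsilon> \<Longrightarrow>
      syzygy_artin_rees_number R m F \<phi> j = \<rho> j k"
    using syzygy_artin_rees_numbers_of_powers[OF I G.m_ideal] by metis
  have fin: "finite (range (\<rho> j))" for j
  proof -
    obtain c k0 where c: "\<forall>k\<ge>k0. \<rho> j k = c" using \<rho>(1)[of j] by (elim exE)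
    have "\<rho> j k \<in> insert c (\<rho> j ` {..<k0})" for k using c by (cases "k < k0") auto
    thus ?thesis by (intro finite_subset[of "range (\<rho> j)" "insert c (\<rho> j ` {..<k0})"]) auto
  qed
  let ?V = "\<Union>j\<le>d. range (\<rho> j)"
  have V: "finite ?V" using fin by simp
  have "syzygy_artin_rees_number R m F \<phi> j \<le> Max ?V"
    if j: "j \<ge> 1" and F: "minimal_free_resolution R m (ideal_module R (ideal_power R I k)) F \<phi> \<epsilon>"
    for j k and F :: "nat \<Rightarrow> ('a, 'c) module" and \<phi> \<epsilon>
  proof (cases "j \<le> d")
    case True
    have "free_resolution R (ideal_module R (ideal_power R I k)) F \<phi> \<epsilon>"
      using F unfolding minimal_free_resolution_def by (rule conjunct1)
    from \<rho>(2)[OF j this] show ?thesis using True by (intro Max_ge[OF V]) auto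
  next
    case False
    hence "d < j" by simp
    from G.syzygy_artin_rees_number_zero[OF F this] show ?thesis by simp
  qed
  thus ?thesis by (intro exI[of _ "Max ?V"] allI impI)
qed

lemma syzygy_artin_rees_number_stable:
  assumes I: "ideal I R" and m: "ideal m R" and j: "j \<ge> 1"
  shows "\<exists>c. \<exists>k0. \<forall>k\<ge>k0. \<forall>(F :: nat \<Rightarrow> ('a, 'c) module) \<phi> \<epsilon>.
    minimal_free_resolution R m (ideal_module R (ideal_power R I k)) F \<phi> \<epsilon> \<longrightarrow>
    syzygy_artin_rees_number R m F \<phi> j = c"
proof -
  obtain \<rho> :: "nat \<Rightarrow> nat \<Rightarrow> nat" where \<rho>: "\<And>j. \<exists>c k0. \<forall>k\<ge>k0. \<rho> j k = c"
    "\<And>j k (F :: nat \<Rightarrow> ('a, 'c) module) \<phi> \<epsilon>. j \<ge> 1 \<Longrightarrow> free_resolution R (ideal_module R (ideal_power R I k)) F \<phi> \<epsilon> \<Longrightarrow>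
      syzygy_artin_rees_number R m F \<phi> j = \<rho> j k"
    using syzygy_artin_rees_numbers_of_powers[OF I m] by metis
  obtain c k0 where c: "\<forall>k\<ge>k0. \<rho> j k = c" using \<rho>(1)[of j] by (elim exE)
  have "syzygy_artin_rees_number R m F \<phi> j = c"
    if k: "k \<ge> k0" and F: "minimal_free_resolution R m (ideal_module R (ideal_power R I k)) F \<phi> \<epsilon>"
    for k and F :: "nat \<Rightarrow> ('a, 'c) module" and \<phi> \<epsilon>
    using \<rho>(2)[OF j conjunct1[OF F[unfolded minimal_free_resolution_def]]] c k by simp
  thus ?thesis by (intro exI[of _ c] exI[of _ k0] allI impI)
qed

end

theorem theorem3p3:
  fixes R :: "('a, 'e) ring_scheme" and m I K :: "'a set" and A :: "nat \<Rightarrow> 'a set"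
  shows
    "(noetherian_local_ring R m \<and> ideal I R \<and> I \<subseteq> m \<longrightarrow>
       (\<forall>j\<ge>1. \<exists>c. \<exists>k0. \<forall>k\<ge>k0.
          \<forall>(F :: nat \<Rightarrow> ('a, 'b) module) \<phi> \<epsilon>.
            minimal_free_resolution R m (ideal_module R (ideal_power R I k)) F \<phi> \<epsilon> \<longrightarrow>
            syzygy_artin_rees_number R m F \<phi> j = c) \<and>
       (regular_local_ring R m \<longrightarrow>
          (\<exists>c. \<forall>j\<ge>1. \<forall>k.
             \<forall>(F :: nat \<Rightarrow> ('a, 'b) module) \<phi> \<epsilon>.
               minimal_free_resolution R m (ideal_module R (ideal_power R I k)) F \<phi> \<epsilon> \<longrightarrow>
               syzygy_artin_rees_number R m F \<phi> j \<le> c)))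
     \<and>
     (standard_graded_algebra R K A \<and> m = graded_maximal_ideal R A \<and>
        graded_ideal R A I \<and> I \<subseteq> m \<longrightarrow>
       (\<forall>j\<ge>1. \<exists>c. \<exists>k0. \<forall>k\<ge>k0.
          \<forall>(F :: nat \<Rightarrow> ('a, 'b) module) G \<phi> \<epsilon>.
            graded_minimal_free_resolution R A
              (ideal_module R (ideal_power R I k)) (ideal_grading R A (ideal_power R I k))
              F G \<phi> \<epsilon> \<longrightarrow>
            syzygy_artin_rees_number R m F \<phi> j = c) \<and>
       (regular_ring R \<longrightarrow>
          (\<exists>c. \<forall>j\<ge>1. \<forall>k.
             \<forall>(F :: nat \<Rightarrow> ('a, 'b) module) G \<phi> \<epsilon>.
               graded_minimal_free_resolution R A
                 (ideal_module R (ideal_power R I k)) (ideal_grading R A (ideal_power R I k))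
                 F G \<phi> \<epsilon> \<longrightarrow>
               syzygy_artin_rees_number R m F \<phi> j \<le> c)))"
    (is "(?loc \<longrightarrow> ?S \<and> (_ \<longrightarrow> ?B)) \<and> (?gr \<longrightarrow> ?GS \<and> (_ \<longrightarrow> ?GB))")
proof (intro conjI impI)
  assume a: ?loc
  interpret noetherian_local_ring R m using a by (rule conjunct1)
  interpret N: noetherian_cring R by (intro noetherian_cring.intro is_cring noetherian_ring_axioms)
  have I: "ideal I R" using a by (elim conjE)
  show ?S by (intro allI impI) (rule N.syzygy_artin_rees_number_stable[OF I is_ideal])
  assume "regular_local_ring R m"
  then obtain x d P where "regular_generators R m x d P" by (rule regular_local_ring.regular_generators_of_local_ring)
  thus ?B by (rule N.syzygy_artin_rees_number_bounded[OF I])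
next
  assume a: ?gr
  interpret standard_graded_algebra R K A using a by (rule conjunct1)
  interpret N: noetherian_cring R by (intro noetherian_cring.intro is_cring noetherian)
  have m: "m = graded_maximal_ideal R A" using a by (elim conjE)
  have I: "ideal I R" using a unfolding graded_ideal_def by (elim conjE)
  have mi: "ideal m R" unfolding m by (rule mm_ideal)
  \<comment> \<open>Forgetting the gradings reduces both graded claims to minimal resolutions with
    respect to \<open>m\<close>.\<close>
  have minimal: "minimal_free_resolution R m M F \<phi> \<epsilon>"
    if "graded_minimal_free_resolution R A M MG F G \<phi> \<epsilon>" for M :: "('a, 'a) module" and MG and F :: "nat \<Rightarrow> ('a, 'b) module" and G \<phi> \<epsilon>
    using that unfolding graded_minimal_free_resolution_def m by (rule conjunct1)
  show ?GS
  proof (intro allI impI)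
    fix j :: nat assume j: "1 \<le> j"
    obtain c k0 where c: "\<forall>k\<ge>k0. \<forall>(F :: nat \<Rightarrow> ('a, 'b) module) \<phi> \<epsilon>.
        minimal_free_resolution R m (ideal_module R (ideal_power R I k)) F \<phi> \<epsilon> \<longrightarrow>
        syzygy_artin_rees_number R m F \<phi> j = c"
      using N.syzygy_artin_rees_number_stable[OF I mi j] by (elim exE)
    show "\<exists>c. \<exists>k0. \<forall>k\<ge>k0. \<forall>(F :: nat \<Rightarrow> ('a, 'b) module) G \<phi> \<epsilon>.
        graded_minimal_free_resolution R A
          (ideal_module R (ideal_power R I k)) (ideal_grading R A (ideal_power R I k)) F G \<phi> \<epsilon> \<longrightarrow>
        syzygy_artin_rees_number R m F \<phi> j = c"
      by (intro exI[of _ c] exI[of _ k0] allI impI) (rule c[rule_format, OF _ minimal])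
  qed
  assume "regular_ring R"
  interpret L: localization R m
    by (intro localization.intro localization_axioms.intro N.noetherian_cring_axioms) (simp add: m mm_maximal)
  \<comment> \<open>Regularity is used at the single prime \<open>m\<close>, which contains all the
    information about resolutions that are minimal with respect to \<open>m\<close>.\<close>
  obtain n where "regular_local_ring L.Q n"
    using regular_ring.localizations_regular[OF \<open>regular_ring R\<close> L.prime] ..
  then obtain x d P where "regular_generators R m x d P" by (rule L.regular_generators_of_localization)
  from N.syzygy_artin_rees_number_bounded[OF I this]
  obtain c where c: "\<forall>j\<ge>1. \<forall>k. \<forall>(F :: nat \<Rightarrow> ('a, 'b) module) \<phi> \<epsilon>.
      minimal_free_resolution R m (ideal_module R (ideal_power R I k)) F \<phi> \<epsilon> \<longrightarrow>
      syzygy_artin_rees_number R m F \<phi> j \<le> c" ..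
  show ?GB by (intro exI[of _ c] allI impI) (rule c[rule_format, OF _ minimal])
qed

end
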